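(* Let $F\subset\mathbb{R}$ be a real quadratic field of discriminant $D$, $\Gamma_F=\operatorname{SL}_2(\mathcal{O}_F)$, $X(\Gamma_F)$ the Baily–Borel compactification of $\Gamma_F\backslash\mathbb{H}^2$, and $m$ a positive integer. Then the Hirzebruch–Zagier divisor $T_m$ on $X(\Gamma_F)$ is $\mathbb{Q}$-Cartier.
   Context: $\mathfrak d_F=\sqrt D\mathcal{O}_F$ is the different, $x\mapsto x'$ the conjugation. $T_m$ is the closure in $X(\Gamma_F)$ of the image of the $\Gamma_F$-invariant divisor $\sum\{(z_1,z_2)\in\mathbb{H}^2: az_1z_2+\lambda z_1+\lambda'z_2+b=0\}$ on $\mathbb{H}^2$, the sum running over $(a,b,\lambda)\in(\mathbb{Z}\oplus\mathbb{Z}\oplus\mathfrak d_F^{-1})/\{\pm1\}$ with $ab-\lambda\lambda'=m/D$. $X(\Gamma_F)=\Gamma_F\backslash(\mathbb{H}^2\cup\mathbb{P}^1(F))$ carries the Baily–Borel structure of a normal complex space. $\mathbb{Q}$-Cartier means some positive integer multiple of the divisor is locally the divisor of a holomorphic function. *)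

theory Defs
  imports "HOL-Analysis.Analysis"
begin

section \<open>Real quadratic fields\<close>

definition real_quadratic_field :: "real set \<Rightarrow> bool" where
  "real_quadratic_field F \<longleftrightarrow>
     1 \<in> F \<and> (\<forall>x\<in>F. \<forall>y\<in>F. x - y \<in> F \<and> x * y \<in> F) \<and> (\<forall>x\<in>F. inverse x \<in> F) \<and>
     vector_space.dim (\<lambda>(q::rat) (x::real). of_rat q * x) F = 2"

definition ring_of_integers :: "real set \<Rightarrow> real set" where
  "ring_of_integers F = {x \<in> F. algebraic_int x}"

text \<open>The nontrivial field automorphism of \<open>F\<close>; it is determined on \<open>F\<close> only, and it is only
  ever applied to elements of \<open>F\<close>.\<close>

definition conjugation :: "real set \<Rightarrow> real \<Rightarrow> real" where
  "conjugation F = (SOME \<sigma>. bij_betw \<sigma> F F \<and>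
     (\<forall>x\<in>F. \<forall>y\<in>F. \<sigma> (x + y) = \<sigma> x + \<sigma> y \<and> \<sigma> (x * y) = \<sigma> x * \<sigma> y) \<and>
     (\<exists>x\<in>F. \<sigma> x \<noteq> x))"

definition discriminant :: "real set \<Rightarrow> int" where
  "discriminant F = (THE d. \<exists>w1 w2.
     ring_of_integers F = {of_int p * w1 + of_int q * w2 | p q :: int. True} \<and>
     of_int d = (w1 * conjugation F w2 - w2 * conjugation F w1)\<^sup>2)"

definition different :: "real set \<Rightarrow> real set" where
  "different F = (\<lambda>x. sqrt (of_int (discriminant F)) * x) ` ring_of_integers F"

definition inverse_ideal :: "real set \<Rightarrow> real set \<Rightarrow> real set" where
  "inverse_ideal F I = {x \<in> F. \<forall>y\<in>I. x * y \<in> ring_of_integers F}"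

definition SL2 :: "real set \<Rightarrow> (real^2^2) set" where
  "SL2 R = {A. (\<forall>i j. A $ i $ j \<in> R) \<and> det A = 1}"

section \<open>The extended product of half planes and its quotient\<close>

definition H2 :: "(complex \<times> complex) set" where
  "H2 = {(z1, z2). Im z1 > 0 \<and> Im z2 > 0}"

text \<open>Points of the union of the product of two half planes and the projective line:
  \<open>Cusp x\<close> is the point \<open>(x : 1)\<close>, and \<open>CuspInf\<close> is \<open>(1 : 0)\<close>.\<close>

datatype ext_point = Interior "complex \<times> complex" | Cusp real | CuspInf

definition ext_H2 :: "real set \<Rightarrow> ext_point set" where
  "ext_H2 F = Interior ` H2 \<union> Cusp ` F \<union> {CuspInf}"

fun act :: "real set \<Rightarrow> real^2^2 \<Rightarrow> ext_point \<Rightarrow> ext_point" where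
  "act F A (Interior (z1, z2)) = Interior
     (moebius (of_real (A$1$1)) (of_real (A$1$2)) (of_real (A$2$1)) (of_real (A$2$2)) z1,
      moebius (of_real (conjugation F (A$1$1))) (of_real (conjugation F (A$1$2)))
              (of_real (conjugation F (A$2$1))) (of_real (conjugation F (A$2$2))) z2)"
| "act F A (Cusp x) =
     (if A$2$1 * x + A$2$2 = 0 then CuspInf
      else Cusp (moebius (A$1$1) (A$1$2) (A$2$1) (A$2$2) x))"
| "act F A CuspInf = (if A$2$1 = 0 then CuspInf else Cusp (A$1$1 / A$2$1))"

definition horoball :: "real \<Rightarrow> ext_point set" where
  "horoball C = Interior ` {(z1, z2) \<in> H2. Im z1 * Im z2 > C}"

text \<open>Every cusp is the image of \<open>CuspInf\<close> under some element of \<open>SL2 F\<close>; its basic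
  neighbourhoods consist of the cusp and the image of a horoball at \<open>CuspInf\<close>.\<close>

definition ext_open :: "real set \<Rightarrow> ext_point set \<Rightarrow> bool" where
  "ext_open F U \<longleftrightarrow> U \<subseteq> ext_H2 F \<and> open {z \<in> H2. Interior z \<in> U} \<and>
     (\<forall>A \<in> SL2 F. act F A CuspInf \<in> U \<longrightarrow> (\<exists>C>0. act F A ` horoball C \<subseteq> U))"

definition ext_topology :: "real set \<Rightarrow> ext_point topology" where
  "ext_topology F = topology (ext_open F)"

lemma istopology_ext_open: "istopology (ext_open F)"
  unfolding istopology_def
proof (intro conjI allI impI)
  fix S T assume S: "ext_open F S" and T: "ext_open F T"
  have "open ({z \<in> H2. Interior z \<in> S} \<inter> {z \<in> H2. Interior z \<in> T})"
    using S T by (intro open_Int) (auto simp: ext_open_def)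
  also have "{z \<in> H2. Interior z \<in> S} \<inter> {z \<in> H2. Interior z \<in> T} = {z \<in> H2. Interior z \<in> S \<inter> T}"
    by auto
  finally have 1: "open {z \<in> H2. Interior z \<in> S \<inter> T}" .
  have 2: "\<exists>C>0. act F A ` horoball C \<subseteq> S \<inter> T"
    if A: "A \<in> SL2 F" "act F A CuspInf \<in> S \<inter> T" for A
  proof -
    obtain C D where CD: "C > 0" "D > 0" "act F A ` horoball C \<subseteq> S" "act F A ` horoball D \<subseteq> T"
      using S T A unfolding ext_open_def by (metis IntD1 IntD2)
    have "horoball (max C D) \<subseteq> horoball C" "horoball (max C D) \<subseteq> horoball D"
      by (auto simp: horoball_def)
    with CD show ?thesis by (intro exI[of _ "max C D"]) (auto 4 4)
  qed
  show "ext_open F (S \<inter> T)"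
    unfolding ext_open_def using S 1 2 by (auto simp: ext_open_def)
next
  fix \<K> assume K: "\<forall>K\<in>\<K>. ext_open F K"
  have "{z \<in> H2. Interior z \<in> \<Union>\<K>} = (\<Union>K\<in>\<K>. {z \<in> H2. Interior z \<in> K})"
    by auto
  moreover have "open \<dots>"
    using K by (intro open_UN) (auto simp: ext_open_def)
  ultimately have 1: "open {z \<in> H2. Interior z \<in> \<Union>\<K>}" by simp
  have 2: "\<exists>C>0. act F A ` horoball C \<subseteq> \<Union>\<K>"
    if A: "A \<in> SL2 F" "act F A CuspInf \<in> \<Union>\<K>" for A
  proof -
    obtain K where k: "K \<in> \<K>" "act F A CuspInf \<in> K" using A by blast
    then obtain C where "C > 0" "act F A ` horoball C \<subseteq> K"
      using K A(1) unfolding ext_open_def by metis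
    with k show ?thesis by blast
  qed
  show "ext_open F (\<Union>\<K>)"
    unfolding ext_open_def using K 1 2 by (auto simp: ext_open_def)
qed

lemma openin_ext_topology: "openin (ext_topology F) = ext_open F"
  by (simp add: ext_topology_def istopology_ext_open)

text \<open>A point of \<open>X(\<Gamma>\<^sub>F)\<close> is an orbit of \<open>\<Gamma>\<^sub>F\<close>.\<close>

definition proj :: "real set \<Rightarrow> ext_point \<Rightarrow> ext_point set" where
  "proj F p = (\<lambda>A. act F A p) ` SL2 (ring_of_integers F)"

definition BB_topology :: "real set \<Rightarrow> ext_point set topology" where
  "BB_topology F = topology (\<lambda>V. V \<subseteq> proj F ` ext_H2 F \<and>
     openin (ext_topology F) {p \<in> ext_H2 F. proj F p \<in> V})"

lemma openin_BB_topology: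
  "openin (BB_topology F) V \<longleftrightarrow>
     V \<subseteq> proj F ` ext_H2 F \<and> openin (ext_topology F) {p \<in> ext_H2 F. proj F p \<in> V}"
proof -
  have "istopology (\<lambda>V. V \<subseteq> proj F ` ext_H2 F \<and>
          openin (ext_topology F) {p \<in> ext_H2 F. proj F p \<in> V})"
    unfolding istopology_def
  proof (intro conjI allI impI; (elim conjE)?)
    fix S T
    assume "openin (ext_topology F) {p \<in> ext_H2 F. proj F p \<in> S}"
      "openin (ext_topology F) {p \<in> ext_H2 F. proj F p \<in> T}"
    then have "openin (ext_topology F)
        ({p \<in> ext_H2 F. proj F p \<in> S} \<inter> {p \<in> ext_H2 F. proj F p \<in> T})" by blast
    also have "{p \<in> ext_H2 F. proj F p \<in> S} \<inter> {p \<in> ext_H2 F. proj F p \<in> T}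
        = {p \<in> ext_H2 F. proj F p \<in> S \<inter> T}" by auto
    finally show "openin (ext_topology F) {p \<in> ext_H2 F. proj F p \<in> S \<inter> T}" .
  next
    fix \<K>
    assume K: "\<forall>K\<in>\<K>. K \<subseteq> proj F ` ext_H2 F \<and>
      openin (ext_topology F) {p \<in> ext_H2 F. proj F p \<in> K}"
    have "{p \<in> ext_H2 F. proj F p \<in> \<Union>\<K>} = (\<Union>K\<in>\<K>. {p \<in> ext_H2 F. proj F p \<in> K})"
      by auto
    with K show "openin (ext_topology F) {p \<in> ext_H2 F. proj F p \<in> \<Union>\<K>}" by auto
  qed auto
  then show ?thesis by (simp add: BB_topology_def)
qed

definition holomorphic2_on :: "(complex \<times> complex \<Rightarrow> complex) \<Rightarrow> (complex \<times> complex) set \<Rightarrow> bool" where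
  "holomorphic2_on f W \<longleftrightarrow>
     (\<forall>z\<in>W. \<exists>a b. (f has_derivative (\<lambda>(v, w). a * v + b * w)) (at z within W))"

text \<open>The structure sheaf of a reduced complex space is given as a sheaf of functions. The
  Baily--Borel structure sheaf consists of the continuous functions which are holomorphic on the
  complement of the cusps, i.e. whose pullbacks to the product of half planes are holomorphic.
  Values of the functions outside the open set in question are irrelevant.\<close>

definition BB_sheaf :: "real set \<Rightarrow> ext_point set set \<Rightarrow> (ext_point set \<Rightarrow> complex) set" where
  "BB_sheaf F V = {f. continuous_map (subtopology (BB_topology F) V) euclidean f \<and>
     holomorphic2_on (\<lambda>z. f (proj F (Interior z))) {z \<in> H2. proj F (Interior z) \<in> V}}"

section \<open>Divisors on normal complex surfaces\<close>

text \<open>In this section \<open>X\<close> is the underlying topological space and \<open>\<O>\<close> the structure sheaf of a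
  normal complex space of pure dimension two. An open subspace \<open>U\<close> is represented by
  \<open>subtopology X U\<close> together with the same \<open>\<O>\<close>.\<close>

type_synonym 'a fun_sheaf = "'a set \<Rightarrow> ('a \<Rightarrow> complex) set"

definition analytic_subset :: "'a topology \<Rightarrow> 'a fun_sheaf \<Rightarrow> 'a set \<Rightarrow> bool" where
  "analytic_subset X \<O> Y \<longleftrightarrow> closedin X Y \<and>
     (\<forall>x \<in> topspace X. \<exists>V S. openin X V \<and> x \<in> V \<and> finite S \<and> S \<subseteq> \<O> V \<and>
        Y \<inter> V = {y \<in> V. \<forall>f\<in>S. f y = 0})"

definition irreducible_analytic :: "'a topology \<Rightarrow> 'a fun_sheaf \<Rightarrow> 'a set \<Rightarrow> bool" where
  "irreducible_analytic X \<O> Y \<longleftrightarrow> analytic_subset X \<O> Y \<and> Y \<noteq> {} \<and>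
     (\<forall>Y1 Y2. analytic_subset X \<O> Y1 \<and> analytic_subset X \<O> Y2 \<and> Y = Y1 \<union> Y2 \<longrightarrow> Y = Y1 \<or> Y = Y2)"

text \<open>The dimension of \<open>Y\<close> at \<open>y\<close>: the least number of holomorphic functions near \<open>y\<close> whose
  common zero set on \<open>Y\<close> is the point \<open>y\<close> alone.\<close>

definition local_dim :: "'a topology \<Rightarrow> 'a fun_sheaf \<Rightarrow> 'a set \<Rightarrow> 'a \<Rightarrow> nat" where
  "local_dim X \<O> Y y = (LEAST k. \<exists>V (f :: nat \<Rightarrow> 'a \<Rightarrow> complex). openin X V \<and> y \<in> V \<and>
     (\<forall>i<k. f i \<in> \<O> V) \<and> {x \<in> Y \<inter> V. \<forall>i<k. f i x = 0} = {y})"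

text \<open>On a surface, codimension one means dimension one.\<close>

definition prime_divisor :: "'a topology \<Rightarrow> 'a fun_sheaf \<Rightarrow> 'a set \<Rightarrow> bool" where
  "prime_divisor X \<O> Y \<longleftrightarrow> irreducible_analytic X \<O> Y \<and> (\<forall>y\<in>Y. local_dim X \<O> Y y = 1)"

text \<open>The germ of \<open>f\<close> at \<open>y\<close> lies in the \<open>k\<close>-th power of the ideal of germs vanishing on \<open>Y\<close>.\<close>

definition in_ideal_power ::
    "'a topology \<Rightarrow> 'a fun_sheaf \<Rightarrow> 'a set \<Rightarrow> nat \<Rightarrow> 'a \<Rightarrow> ('a \<Rightarrow> complex) \<Rightarrow> bool" where
  "in_ideal_power X \<O> Y k y f \<longleftrightarrow>
     (\<exists>V N (h :: nat \<Rightarrow> 'a \<Rightarrow> complex) (g :: nat \<Rightarrow> nat \<Rightarrow> 'a \<Rightarrow> complex).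
        openin X V \<and> y \<in> V \<and>
        (\<forall>i<N. h i \<in> \<O> V \<and> (\<forall>j<k. g i j \<in> \<O> V \<and> (\<forall>x \<in> Y \<inter> V. g i j x = 0))) \<and>
        (\<forall>x\<in>V. f x = (\<Sum>i<N. h i x * (\<Prod>j<k. g i j x))))"

text \<open>The order along the prime divisor \<open>Y\<close> of a function which does not vanish identically near
  any point of \<open>Y\<close>: the largest \<open>k\<close> such that, at a dense set of points of \<open>Y\<close>, the function lies
  in the \<open>k\<close>-th power of the ideal of \<open>Y\<close>. Density makes this the order at the generic point of
  \<open>Y\<close>, the singular points of \<open>X\<close> and of \<open>Y\<close> being nowhere dense in \<open>Y\<close>.\<close>

definition order_along :: "'a topology \<Rightarrow> 'a fun_sheaf \<Rightarrow> ('a \<Rightarrow> complex) \<Rightarrow> 'a set \<Rightarrow> nat" where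
  "order_along X \<O> f Y = (GREATEST k. Y \<subseteq> X closure_of {y \<in> Y. in_ideal_power X \<O> Y k y f})"

text \<open>A Weil divisor is given by its coefficients on the prime divisors (and 0 on all other sets).\<close>

type_synonym 'a divisor = "'a set \<Rightarrow> int"

text \<open>The irreducible components of \<open>Z \<inter> U\<close>, where \<open>Z\<close> is a prime divisor of \<open>X\<close>, are the prime
  divisors of \<open>U\<close> contained in \<open>Z\<close>; conversely a prime divisor of \<open>U\<close> is contained in at most one
  prime divisor of \<open>X\<close>, so the sum has at most one term.\<close>

definition restrict_divisor :: "'a divisor \<Rightarrow> 'a divisor" where
  "restrict_divisor \<Delta> Y = (\<Sum>Z | Y \<subseteq> Z \<and> \<Delta> Z \<noteq> 0. \<Delta> Z)"

text \<open>\<open>f\<close> is holomorphic on \<open>U\<close>, vanishes identically on no nonempty open set, and its divisor on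
  \<open>U\<close> is the restriction of \<open>n \<Delta>\<close>.\<close>

definition local_equation ::
    "'a topology \<Rightarrow> 'a fun_sheaf \<Rightarrow> 'a set \<Rightarrow> ('a \<Rightarrow> complex) \<Rightarrow> nat \<Rightarrow> 'a divisor \<Rightarrow> bool" where
  "local_equation X \<O> U f n \<Delta> \<longleftrightarrow> f \<in> \<O> U \<and> U \<subseteq> X closure_of {x \<in> U. f x \<noteq> 0} \<and>
     (\<forall>Y. prime_divisor (subtopology X U) \<O> Y \<longrightarrow>
        int (order_along (subtopology X U) \<O> f Y) = int n * restrict_divisor \<Delta> Y)"

definition Q_Cartier :: "'a topology \<Rightarrow> 'a fun_sheaf \<Rightarrow> 'a divisor \<Rightarrow> bool" where
  "Q_Cartier X \<O> \<Delta> \<longleftrightarrow>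
     (\<exists>n>0. \<forall>x \<in> topspace X. \<exists>U f. openin X U \<and> x \<in> U \<and> local_equation X \<O> U f n \<Delta>)"

section \<open>Hirzebruch--Zagier divisors\<close>

definition HZ_forms :: "real set \<Rightarrow> nat \<Rightarrow> (int \<times> int \<times> real) set" where
  "HZ_forms F m = {(a, b, l). l \<in> inverse_ideal F (different F) \<and>
     of_int (a * b) - l * conjugation F l = real m / of_int (discriminant F)}"

definition HZ_curve :: "real set \<Rightarrow> int \<times> int \<times> real \<Rightarrow> (complex \<times> complex) set" where
  "HZ_curve F = (\<lambda>(a, b, l). {(z1, z2) \<in> H2.
     of_int a * z1 * z2 + of_real l * z1 + of_real (conjugation F l) * z2 + of_int b = 0})"

text \<open>The invariant divisor on the product of half planes, as a formal sum of the (smooth and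
  irreducible) curves \<open>HZ_curve F v\<close>, where \<open>v\<close> runs over the forms up to sign.\<close>

definition HZ_upstairs :: "real set \<Rightarrow> nat \<Rightarrow> (complex \<times> complex) divisor" where
  "HZ_upstairs F m C =
     int (card {c \<in> (\<lambda>v. {v, - v}) ` HZ_forms F m. \<forall>v\<in>c. HZ_curve F v = C})"

definition closed_image :: "real set \<Rightarrow> (complex \<times> complex) set \<Rightarrow> ext_point set set" where
  "closed_image F C = BB_topology F closure_of ((\<lambda>z. proj F (Interior z)) ` C)"

text \<open>The closure of the image of the invariant divisor. The quotient map is unramified in
  codimension one, so the closure of the image of a component \<open>C\<close> has the multiplicity of \<open>C\<close>.
  The components with the same image form one orbit of \<open>\<Gamma>\<^sub>F\<close> and have the same multiplicity, so
  the choice of \<open>C\<close> does not matter.\<close>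

definition HZ_divisor :: "real set \<Rightarrow> nat \<Rightarrow> ext_point set divisor" where
  "HZ_divisor F m Z =
     (if \<exists>C. HZ_upstairs F m C \<noteq> 0 \<and> closed_image F C = Z
      then HZ_upstairs F m (SOME C. HZ_upstairs F m C \<noteq> 0 \<and> closed_image F C = Z)
      else 0)"

end

theory Submission
  imports Defs "HOL-Complex_Analysis.Complex_Analysis" "HOL-Computational_Algebra.Computational_Algebra"
begin

text \<open>Near every point of \<open>X(\<Gamma>\<^sub>F)\<close> some multiple of \<open>T\<^sub>m\<close>, bounded uniformly, is the divisor of an
  explicit function. At an interior point only finitely many of the curves matter, and the product
  of their equations over the finite stabilizer of the point is invariant. At a cusp, moved to
  infinity, only the forms \<open>\<lambda>z\<^sub>1 + \<lambda>'z\<^sub>2 + \<beta>\<close> vanish near the cusp. They fall into finitely many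
  orbits under \<open>(\<lambda>, \<beta>) \<mapsto> (\<epsilon>\<^sup>2\<^sup>k\<lambda>, \<beta> + s i)\<close>, with \<open>\<epsilon>\<close> the fundamental unit, and each orbit is
  the zero set of a local Borcherds product
  \<open>e(\<rho>(z)) \<Prod>\<^sub>k\<^sub>\<ge>\<^sub>0 (1 - e(l\<^sub>k(z))) \<Prod>\<^sub>k\<^sub><\<^sub>0 (1 - e(-l\<^sub>k(z)))\<close>, where \<open>l\<^sub>k(z) = (\<epsilon>\<^sup>2\<^sup>k\<lambda>z\<^sub>1 + \<epsilon>\<^sup>-\<^sup>2\<^sup>k\<lambda>'z\<^sub>2 + \<beta>)/s\<close>.
  The Weyl vector \<open>\<rho>\<close> makes it invariant under the stabilizer of the cusp up to roots of unity, and
  the product tends to 0 at the cusp.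

  The order along a prime divisor \<open>Y\<close> is determined at the points of \<open>Y\<close> that lie on a single curve
  and have trivial stabilizer. That \<open>Y\<close> lies in one component of \<open>T\<^sub>m\<close> follows from irreducibility:
  the same constructions applied to an orbit of forms and to its complement split \<open>Y\<close> into two
  analytic subsets.\<close>

section \<open>Real quadratic fields and their units\<close>

text \<open>Prime divisors and orders are given here through irreducibility of closed sets and a
  density condition on powers of an ideal, so a local splitting into branches has to be produced by
  explicit functions. This is why each chart carries, besides the equation of n T_m, a function with
  prescribed zero set for every \<Gamma>-closed set of forms. The exponents of these auxiliary
  functions are irrelevant; that of the equation must be the same number n at all points. The number
  n has two sources. At an interior point the exponent is twice the order of the stabilizer, which
  is bounded because a stabilizing matrix is determined by its trace and a sign, and the trace has
  both conjugates in [-2, 2]. At a cusp the unit multiplies a factor by the phase -e(-\<beta>/s),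
  and a translation changes the Weyl vector by a number whose denominators are cleared by
  (\<epsilon> - 1/\<epsilon>)^2, an integer that belongs to the field alone. The offsets \<beta> of
  all forms together have period 1/g and lie in (1/g)Z, with g the norm of the ideal of the cusp;
  taking s = 1/g makes the exponent independent of the cusp.\<close>

lemma rational_bounded_power_denominators:
  fixes r :: real
  assumes "r \<in> \<rat>" "d \<noteq> 0" and *: "\<And>k. of_int d * r ^ k \<in> \<int>"
  shows "r \<in> \<int>"
proof -
  from \<open>r \<in> \<rat>\<close> obtain p q :: int where r: "r = of_int p / of_int q" and q: "q > 0" and co: "coprime p q"
    by (metis Rats_cases')
  have "q ^ k dvd d" for k
  proof -
    from *[of k] obtain j where "of_int d * r ^ k = of_int j" by (auto elim: Ints_cases)
    then have "of_int d * of_int p ^ k = (of_int j * of_int q ^ k :: real)"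
      using q by (simp add: r power_divide field_simps)
    then have "d * p ^ k = j * q ^ k"
      by (metis of_int_mult of_int_power of_int_eq_iff)
    then have "q ^ k dvd d * p ^ k" by simp
    moreover have "coprime (q ^ k) (p ^ k)" using co by (simp add: coprime_commute)
    ultimately show ?thesis by (simp add: coprime_dvd_mult_left_iff)
  qed
  then have b: "q ^ k \<le> \<bar>d\<bar>" for k
    using \<open>d \<noteq> 0\<close> by (meson dvd_imp_le_int dvd_abs_iff abs_ge_self order_trans zdvd_imp_le abs_of_pos zero_less_abs_iff)
  have "q = 1"
  proof (rule ccontr)
    assume "q \<noteq> 1"
    then have "2 ^ nat \<bar>d\<bar> \<le> q ^ nat \<bar>d\<bar>" using q by (intro power_mono) auto
    moreover have "int (nat \<bar>d\<bar>) < 2 ^ nat \<bar>d\<bar>" using of_nat_less_two_power by blast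
    ultimately show False using b[of "nat \<bar>d\<bar>"] by linarith
  qed
  then show ?thesis by (simp add: r)
qed

lemma common_denominator:
  assumes "finite K" "\<And>k. k \<in> K \<Longrightarrow> (f k :: real) \<in> \<rat>"
  obtains d :: int where "d \<noteq> 0" "\<And>k. k \<in> K \<Longrightarrow> of_int d * f k \<in> \<int>"
proof -
  have "\<exists>d::int. d \<noteq> 0 \<and> (\<forall>k\<in>K. of_int d * f k \<in> \<int>)"
    using assms
  proof (induction K rule: finite_induct)
    case empty
    then show ?case by (intro exI[of _ 1]) auto
  next
    case (insert x K)
    then obtain d :: int where d: "d \<noteq> 0" "\<forall>k\<in>K. of_int d * f k \<in> \<int>" by auto
    obtain p q :: int where pq: "f x = of_int p / of_int q" "q > 0"
      using insert.prems[of x] by (metis Rats_cases' insertI1)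
    have "of_int (q * d) * f k \<in> \<int>" if k: "k \<in> insert x K" for k
    proof (cases "k = x")
      case True
      then have "of_int (q * d) * f k = of_int (d * p)" using pq by simp
      then show ?thesis by (metis Ints_of_int)
    next
      case False
      then have "of_int d * f k \<in> \<int>" using d k by blast
      then have "of_int q * (of_int d * f k) \<in> \<int>" by (rule Ints_mult[OF Ints_of_int])
      then show ?thesis by (simp only: of_int_mult mult.assoc)
    qed
    then show ?case using d pq by (intro exI[of _ "q * d"]) auto
  qed
  then show ?thesis using that by auto
qed

section \<open>Conjugation, trace, norm and integrality\<close>

locale quadratic =
  fixes F :: "real set"
  assumes rqf: "real_quadratic_field F"
begin

abbreviation cj :: "real \<Rightarrow> real" where "cj \<equiv> conjugation F"
abbreviation R :: "real set" where "R \<equiv> ring_of_integers F"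

lemma one_F [simp]: "1 \<in> F"
  and diff_F [simp]: "x \<in> F \<Longrightarrow> y \<in> F \<Longrightarrow> x - y \<in> F"
  and mult_F [simp]: "x \<in> F \<Longrightarrow> y \<in> F \<Longrightarrow> x * y \<in> F"
  and inverse_F [simp]: "x \<in> F \<Longrightarrow> inverse x \<in> F"
  using rqf by (auto simp: real_quadratic_field_def)

lemma zero_F [simp]: "0 \<in> F"
  using diff_F[of 1 1] by simp

lemma uminus_F [simp]: "x \<in> F \<Longrightarrow> - x \<in> F"
  using diff_F[of 0 x] by simp

lemma add_F [simp]: "x \<in> F \<Longrightarrow> y \<in> F \<Longrightarrow> x + y \<in> F"
  using diff_F[of x "- y"] by simp

lemma divide_F [simp]: "x \<in> F \<Longrightarrow> y \<in> F \<Longrightarrow> x / y \<in> F"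
  by (simp add: divide_inverse)

lemma power_F [simp]: "x \<in> F \<Longrightarrow> x ^ n \<in> F"
  by (induction n) auto

lemma of_nat_F [simp]: "of_nat n \<in> F"
  by (induction n) auto

lemma of_int_F [simp]: "of_int n \<in> F"
  by (cases n) auto

lemma Rats_F: "x \<in> \<rat> \<Longrightarrow> x \<in> F"
  by (elim Rats_cases') auto

lemma of_rat_F [simp]: "of_rat q \<in> F"
  by (rule Rats_F) simp

lemma ex_generator:
  obtains e :: int and \<delta> where "e > 0" "\<delta> > 0" "\<delta>\<^sup>2 = of_int e" "\<delta> \<notin> \<rat>" "\<delta> \<in> F"
    "F = {of_rat p + of_rat q * \<delta> |p q. True}"
proof -
  interpret rat_real: vector_space "\<lambda>(q::rat) (x::real). of_rat q * x"
    by unfold_locales (auto simp: algebra_simps of_rat_add of_rat_mult)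
  have dim: "rat_real.dim F = 2" using rqf by (auto simp: real_quadratic_field_def)
  have sub: "rat_real.subspace F"
    by (rule rat_real.subspaceI) auto
  have ind: "rat_real.independent {1::real}"
    using rat_real.dependent_single by simp
  obtain B where B: "{1} \<subseteq> B" "B \<subseteq> F" "rat_real.independent B" "F \<subseteq> rat_real.span B"
    using rat_real.maximal_independent_subset_extend[of "{1}" F] ind by auto
  have spanB: "rat_real.span B = F"
    using B(2,4) rat_real.span_minimal[OF _ sub] by (intro equalityI) blast+
  have "card B = 2"
    using rat_real.dim_eq_card[of B F] spanB dim B by (metis rat_real.span_eq_iff sub)
  then obtain \<theta> where \<theta>: "B = {1, \<theta>}" "\<theta> \<noteq> 1"
    using B(1) by (auto simp: card_2_iff doubleton_eq_iff)
  have F1: "F = {of_rat p + of_rat q * \<theta> |p q. True}"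
  proof -
    have "F = {x. \<exists>k l. x - of_rat k - of_rat l * \<theta> = 0}"
      unfolding spanB[symmetric] \<theta> rat_real.span_insert rat_real.span_empty
      by (auto simp: algebra_simps)
    then show ?thesis by (auto simp: algebra_simps)
  qed
  have irr: "\<theta> \<notin> \<rat>"
  proof
    assume "\<theta> \<in> \<rat>"
    then obtain q where "\<theta> = of_rat q" by (auto elim: Rats_cases)
    then have "\<theta> \<in> rat_real.span {1}" unfolding rat_real.span_singleton
      by (auto intro!: image_eqI[of _ _ q])
    then have "rat_real.dependent B"
      unfolding \<theta> rat_real.dependent_def using \<theta>(2)
      by (intro bexI[of _ \<theta>]) (auto simp: insert_Diff_if)
    then show False using B(3) by simp
  qed
  have \<theta>F: "\<theta> \<in> F" using B \<theta> by auto
  have "\<theta>\<^sup>2 \<in> F" using \<theta>F by simp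
  then obtain p0 q0 where pq: "\<theta>\<^sup>2 = of_rat p0 + of_rat q0 * \<theta>" using F1 by auto
  define c where "c = p0 + q0\<^sup>2 / 4"
  obtain a b where ab: "quotient_of c = (a, b)" by force
  have b: "b > 0" using quotient_of_denom_pos[OF ab] .
  have cab: "c = of_int a / of_int b" using quotient_of_div[OF ab] .
  \<comment> \<open>Completing the square: \<theta> - q0/2 has the rational square c = a/b, and
    multiplying by b makes the square the integer a b.\<close>
  define \<delta>0 where "\<delta>0 = of_int b * (\<theta> - of_rat (q0 / 2))"
  have "(\<theta> - of_rat (q0 / 2))\<^sup>2 = of_rat c"
    using pq by (simp add: c_def power2_eq_square algebra_simps of_rat_add of_rat_mult of_rat_divide)
  then have d2: "\<delta>0\<^sup>2 = of_int (a * b)"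
    using b by (simp add: \<delta>0_def power_mult_distrib cab of_rat_divide) (simp add: power2_eq_square)
  have \<theta>d: "\<theta> = of_rat (q0 / 2) + of_rat (1 / of_int b) * \<delta>0"
    using b by (simp add: \<delta>0_def of_rat_divide)
  have irr0: "\<delta>0 \<notin> \<rat>"
  proof
    assume "\<delta>0 \<in> \<rat>"
    then have "\<theta> \<in> \<rat>" unfolding \<theta>d by (intro Rats_add Rats_mult) auto
    then show False using irr by simp
  qed
  then have nz: "\<delta>0 \<noteq> 0" by auto
  define \<delta> where "\<delta> = \<bar>\<delta>0\<bar>"
  have irr1: "\<delta> \<notin> \<rat>" using irr0 unfolding \<delta>_def abs_if by auto
  have d\<delta>: "\<delta>\<^sup>2 = of_int (a * b)" using d2 by (simp add: \<delta>_def)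
  have pos: "a * b > 0"
  proof -
    have "\<delta>\<^sup>2 > 0" using nz by (simp add: \<delta>_def)
    then show ?thesis unfolding d\<delta> by (simp only: of_int_0_less_iff)
  qed
  have F2: "F = {of_rat p + of_rat q * \<delta> |p q. True}" (is "_ = ?S")
  proof (intro equalityI subsetI)
    fix x assume "x \<in> F"
    then have "x \<in> {of_rat p + of_rat q * \<theta> |p q. True}" using F1 by (simp only:)
    then obtain p q where x: "x = of_rat p + of_rat q * \<theta>" by (elim CollectE exE conjE)
    obtain s where s: "\<delta>0 = of_rat s * \<delta>"
    proof (cases "\<delta>0 \<ge> 0")
      case True
      then show ?thesis using that[of 1] by (simp add: \<delta>_def)
    next
      case False
      then show ?thesis using that[of "-1"] by (simp add: \<delta>_def)
    qed
    have "x = of_rat p + of_rat q * (of_rat (q0 / 2) + of_rat (1 / of_int b) * (of_rat s * \<delta>))"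
      by (simp only: x s[symmetric] \<theta>d[symmetric])
    also have "\<dots> = of_rat (p + q * (q0 / 2)) + of_rat (q * (1 / of_int b) * s) * \<delta>"
      by (simp only: of_rat_add of_rat_mult ring_distribs mult.assoc add.assoc)
    finally have "x = of_rat (p + q * (q0 / 2)) + of_rat (q * (1 / of_int b) * s) * \<delta>" .
    then show "x \<in> ?S" by (intro CollectI exI conjI TrueI)
  next
    fix x assume "x \<in> ?S"
    moreover have "\<delta> \<in> F" unfolding \<delta>_def \<delta>0_def abs_if using \<theta>F by auto
    ultimately show "x \<in> F" by auto
  qed
  show ?thesis
  proof (rule that[of "a * b" \<delta>])
    show "\<delta> > 0" using nz by (simp add: \<delta>_def)
    show "\<delta> \<in> F" unfolding \<delta>_def \<delta>0_def abs_if using \<theta>F by auto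
    show "a * b > 0" by (rule pos)
    show "\<delta>\<^sup>2 = of_int (a * b)" by (rule d\<delta>)
    show "\<delta> \<notin> \<rat>" by (rule irr1)
    show "F = {of_rat p + of_rat q * \<delta> |p q. True}" by (rule F2)
  qed
qed

text \<open>\<open>conjugation\<close> is a choice, so two things are needed. The map
  \<open>\<tau>\<close> with \<delta> |-> -\<delta> shows that there is something to choose; and
  whatever is chosen agrees with it, because an automorphism fixes the rationals, sends \<delta> to
  a square root of the same integer, and would be the identity if it fixed \<delta>.\<close>

lemma generator_conjugation:
  obtains e :: int and \<delta> where "e > 0" "\<delta> > 0" "\<delta>\<^sup>2 = of_int e" "\<delta> \<notin> \<rat>" "\<delta> \<in> F"
    "F = {of_rat p + of_rat q * \<delta> |p q. True}"
    "\<forall>p q. cj (of_rat p + of_rat q * \<delta>) = of_rat p - of_rat q * \<delta>"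
proof -
  obtain e :: int and \<delta> where e: "e > 0" "\<delta> > 0" "\<delta>\<^sup>2 = of_int e" "\<delta> \<notin> \<rat>" "\<delta> \<in> F"
    and F: "F = {of_rat p + of_rat q * \<delta> |p q. True}" by (rule ex_generator)
  have uniq: "p = p' \<and> q = q'" if "of_rat p + of_rat q * \<delta> = of_rat p' + of_rat q' * \<delta>" for p q p' q'
  proof -
    have "q = q'"
    proof (rule ccontr)
      assume "q \<noteq> q'"
      moreover have "of_rat (q - q') * \<delta> = of_rat (p' - p)" using that by (simp add: algebra_simps of_rat_diff)
      ultimately have "\<delta> = of_rat ((p' - p) / (q - q'))" by (simp add: of_rat_divide field_simps)
      then show False using e(4) by simp
    qed
    then show ?thesis using that by simp
  qed
  define P where "P = (\<lambda>\<sigma>. bij_betw \<sigma> F F \<and>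
     (\<forall>x\<in>F. \<forall>y\<in>F. \<sigma> (x + y) = \<sigma> x + \<sigma> y \<and> \<sigma> (x * y) = \<sigma> x * \<sigma> y) \<and>
     (\<exists>x\<in>F. \<sigma> x \<noteq> x))"
  define \<tau> where "\<tau> = (\<lambda>x. THE y. \<exists>p q. x = of_rat p + of_rat q * \<delta> \<and> y = of_rat p - of_rat q * \<delta>)"
  have \<tau>: "\<tau> (of_rat p + of_rat q * \<delta>) = of_rat p - of_rat q * \<delta>" for p q
    unfolding \<tau>_def by (rule the_equality) (auto dest: uniq)
  have \<tau>F: "\<tau> x \<in> F" if x: "x \<in> F" for x
  proof -
    from x obtain p q where "x = of_rat p + of_rat q * \<delta>" by (subst (asm) F) auto
    then show ?thesis using \<tau>[of p q] e(5) by simp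
  qed
  have \<tau>\<tau>: "\<tau> (\<tau> x) = x" if x: "x \<in> F" for x
  proof -
    from x obtain p q where "x = of_rat p + of_rat q * \<delta>" by (subst (asm) F) auto
    then show ?thesis using \<tau>[of p q] \<tau>[of p "-q"] by (simp add: of_rat_minus)
  qed
  have "P \<tau>" unfolding P_def
  proof (intro conjI ballI)
    show "bij_betw \<tau> F F"
      by (rule bij_betw_byWitness[where f' = \<tau>]) (use \<tau>F \<tau>\<tau> in auto)
    show "\<exists>x\<in>F. \<tau> x \<noteq> x"
      using \<tau>[of 0 1] e by (intro bexI[of _ \<delta>]) auto
    fix x y assume x: "x \<in> F" and y: "y \<in> F"
    from x obtain p q where x: "x = of_rat p + of_rat q * \<delta>" by (subst (asm) F) auto
    from y obtain p' q' where y: "y = of_rat p' + of_rat q' * \<delta>" by (subst (asm) F) auto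
    have "x + y = of_rat (p + p') + of_rat (q + q') * \<delta>" by (simp add: x y algebra_simps of_rat_add)
    then have "\<tau> (x + y) = of_rat (p + p') - of_rat (q + q') * \<delta>" by (simp only: \<tau>)
    then show "\<tau> (x + y) = \<tau> x + \<tau> y"
      unfolding x y \<tau> by (simp add: of_rat_add algebra_simps)
    have dd: "\<delta> * \<delta> = of_rat (of_int e)" using e(3) by (simp add: power2_eq_square)
    have "x * y = of_rat (p * p') + of_rat q * of_rat q' * (\<delta> * \<delta>) + of_rat (p * q' + q * p') * \<delta>"
      by (simp add: x y algebra_simps of_rat_add of_rat_mult)
    also have "\<dots> = of_rat (p * p' + q * q' * of_int e) + of_rat (p * q' + q * p') * \<delta>"
      unfolding dd by (simp add: algebra_simps of_rat_add of_rat_mult)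
    finally have "\<tau> (x * y) = of_rat (p * p' + q * q' * of_int e) - of_rat (p * q' + q * p') * \<delta>"
      by (simp add: \<tau>)
    also have "\<dots> = of_rat (p * p') + of_rat q * of_rat q' * (\<delta> * \<delta>) - of_rat (p * q' + q * p') * \<delta>"
      unfolding dd by (simp add: algebra_simps of_rat_add of_rat_mult)
    also have "\<dots> = \<tau> x * \<tau> y"
      unfolding x y \<tau> by (simp add: algebra_simps of_rat_add of_rat_mult)
    finally show "\<tau> (x * y) = \<tau> x * \<tau> y" .
  qed
  then have "P (SOME \<sigma>. P \<sigma>)" by (rule someI[of P])
  then have PC: "P cj" by (simp add: P_def conjugation_def)
  have add: "cj (x + y) = cj x + cj y" and mult: "cj (x * y) = cj x * cj y" if "x \<in> F" "y \<in> F" for x y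
    using PC that by (auto simp: P_def)
  have cj0: "cj 0 = 0" using add[of 0 0] by simp
  have cj1: "cj 1 = 1"
  proof -
    have "cj 1 \<noteq> cj 0" using PC unfolding P_def bij_betw_def by (metis inj_onD one_F zero_F zero_neq_one)
    moreover have "cj 1 * cj 1 = cj 1" using mult[of 1 1] by simp
    ultimately show ?thesis using cj0 by simp
  qed
  have cjm: "cj (- x) = - cj x" if "x \<in> F" for x using add[of x "- x"] that cj0 by auto
  have cjn: "cj (of_nat n) = of_nat n" for n
    by (induction n) (auto simp: cj0 cj1 add)
  have cji: "cj (of_int n) = of_int n" for n
    by (cases n rule: int_cases) (auto simp: cjn cjm add cj1 simp del: of_nat_Suc)
  have cjq: "cj (of_rat q) = of_rat q" for q
  proof -
    obtain a b where ab: "quotient_of q = (a, b)" by force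
    have b: "b > 0" using quotient_of_denom_pos[OF ab] .
    have q: "q = of_int a / of_int b" using quotient_of_div[OF ab] .
    have "of_rat q * of_int b = (of_int a :: real)" using b by (simp add: q of_rat_divide)
    then have "cj (of_rat q) * of_int b = of_int a"
      using mult[of "of_rat q" "of_int b"] by (simp add: cji)
    then show ?thesis using b by (simp add: q of_rat_divide field_simps)
  qed
  have cj\<delta>: "cj \<delta> = \<delta> \<or> cj \<delta> = - \<delta>"
  proof -
    have "cj \<delta> * cj \<delta> = cj (of_int e)" using mult[of \<delta> \<delta>] e by (simp add: power2_eq_square)
    then show ?thesis using e cji by (metis power2_eq_square square_eq_iff)
  qed
  have *: "cj (of_rat p + of_rat q * \<delta>) = of_rat p + of_rat q * cj \<delta>" for p q
    using e(5) by (simp add: add mult cjq)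
  have "cj \<delta> \<noteq> \<delta>"
  proof
    assume "cj \<delta> = \<delta>"
    then have "cj x = x" if "x \<in> F" for x using that * by (subst (asm) F) auto
    then show False using PC by (auto simp: P_def)
  qed
  then have "cj \<delta> = - \<delta>" using cj\<delta> by auto
  then have "\<forall>p q. cj (of_rat p + of_rat q * \<delta>) = of_rat p - of_rat q * \<delta>" using * by simp
  then show ?thesis by (rule that[OF e(1-5) F])
qed

lemma
  shows cj_F [simp]: "x \<in> F \<Longrightarrow> cj x \<in> F"
    and cj_cj [simp]: "x \<in> F \<Longrightarrow> cj (cj x) = x"
    and cj_add [simp]: "x \<in> F \<Longrightarrow> y \<in> F \<Longrightarrow> cj (x + y) = cj x + cj y"
    and cj_mult [simp]: "x \<in> F \<Longrightarrow> y \<in> F \<Longrightarrow> cj (x * y) = cj x * cj y"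
    and cj_of_rat [simp]: "cj (of_rat q) = of_rat q"
    and cj_fixed: "x \<in> F \<Longrightarrow> cj x = x \<Longrightarrow> x \<in> \<rat>"
    and trace_Rats: "x \<in> F \<Longrightarrow> x + cj x \<in> \<rat>"
    and norm_Rats: "x \<in> F \<Longrightarrow> x * cj x \<in> \<rat>"
proof -
  obtain e :: int and \<delta> where e: "e > 0" "\<delta> > 0" "\<delta>\<^sup>2 = of_int e" "\<delta> \<notin> \<rat>" "\<delta> \<in> F"
    and F: "F = {of_rat p + of_rat q * \<delta> |p q. True}"
    and c0: "\<forall>p q. cj (of_rat p + of_rat q * \<delta>) = of_rat p - of_rat q * \<delta>" by (rule generator_conjugation)
  have c: "cj (of_rat p + of_rat q * \<delta>) = of_rat p - of_rat q * \<delta>" for p q using c0 by blast 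
  have c': "cj (of_rat p - of_rat q * \<delta>) = of_rat p + of_rat q * \<delta>" for p q
    using c[of p "-q"] by (simp add: of_rat_minus)
  have dd: "\<delta> * \<delta> = of_rat (of_int e)" using e(3) by (simp add: power2_eq_square)
  show c3: "cj (of_rat q) = of_rat q" for q using c[of q 0] by simp
  {
    fix x assume x: "x \<in> F"
    then obtain p q where xpq: "x = of_rat p + of_rat q * \<delta>" by (subst (asm) F) auto
    show "cj x \<in> F" "cj (cj x) = x" by (auto simp: xpq c c' e)
    show "x \<in> \<rat>" if "cj x = x"
      using that e by (auto simp: xpq c)
    show "x + cj x \<in> \<rat>" by (simp add: xpq c)
    have "x * cj x = of_rat p * of_rat p - of_rat q * of_rat q * (\<delta> * \<delta>)"
      unfolding xpq c by (simp add: algebra_simps)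
    then show "x * cj x \<in> \<rat>" unfolding dd by simp
    fix y assume y: "y \<in> F"
    then obtain p' q' where y: "y = of_rat p' + of_rat q' * \<delta>" by (subst (asm) F) auto
    have "x + y = of_rat (p + p') + of_rat (q + q') * \<delta>" by (simp add: xpq y algebra_simps of_rat_add)
    then have "cj (x + y) = of_rat (p + p') - of_rat (q + q') * \<delta>" by (simp only: c)
    then show "cj (x + y) = cj x + cj y"
      unfolding xpq y c by (simp add: of_rat_add algebra_simps)
    have "x * y = of_rat (p * p') + of_rat q * of_rat q' * (\<delta> * \<delta>) + of_rat (p * q' + q * p') * \<delta>"
      by (simp add: xpq y algebra_simps of_rat_add of_rat_mult)
    also have "\<dots> = of_rat (p * p' + q * q' * of_int e) + of_rat (p * q' + q * p') * \<delta>"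
      unfolding dd by (simp add: algebra_simps of_rat_add of_rat_mult)
    finally have "cj (x * y) = of_rat (p * p' + q * q' * of_int e) - of_rat (p * q' + q * p') * \<delta>"
      by (simp add: c)
    also have "\<dots> = of_rat (p * p') + of_rat q * of_rat q' * (\<delta> * \<delta>) - of_rat (p * q' + q * p') * \<delta>"
      unfolding dd by (simp add: algebra_simps of_rat_add of_rat_mult)
    also have "\<dots> = cj x * cj y"
      unfolding xpq y c by (simp add: algebra_simps of_rat_add of_rat_mult)
    finally show "cj (x * y) = cj x * cj y" .
  }
qed

lemma cj_0 [simp]: "cj 0 = 0" and cj_1 [simp]: "cj 1 = 1"
  using cj_of_rat[of 0] cj_of_rat[of 1] by simp_all

lemma cj_of_int [simp]: "cj (of_int n) = of_int n" and cj_of_nat [simp]: "cj (of_nat k) = of_nat k"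
  and cj_numeral [simp]: "cj (numeral w) = numeral w"
  using cj_of_rat[of "of_int n"] cj_of_rat[of "of_nat k"] cj_of_rat[of "numeral w"] by simp_all

lemma cj_Rats: "x \<in> \<rat> \<Longrightarrow> cj x = x"
  by (auto elim!: Rats_cases)

lemma cj_minus [simp]: "x \<in> F \<Longrightarrow> cj (- x) = - cj x"
  using cj_add[of x "- x"] by auto

lemma cj_diff [simp]: "x \<in> F \<Longrightarrow> y \<in> F \<Longrightarrow> cj (x - y) = cj x - cj y"
  using cj_add[of x "- y"] by auto

lemma cj_eq_0_iff [simp]: "x \<in> F \<Longrightarrow> cj x = 0 \<longleftrightarrow> x = 0"
  by (metis cj_0 cj_cj)

lemma cj_inverse [simp]: "x \<in> F \<Longrightarrow> cj (inverse x) = inverse (cj x)"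
  by (cases "x = 0") (auto simp flip: cj_mult intro!: inverse_unique[symmetric])

lemma cj_divide [simp]: "x \<in> F \<Longrightarrow> y \<in> F \<Longrightarrow> cj (x / y) = cj x / cj y"
  by (simp add: divide_inverse)

lemma cj_power [simp]: "x \<in> F \<Longrightarrow> cj (x ^ n) = cj x ^ n"
  by (induction n) auto

text \<open>\<open>algebraic_int\<close> provides some monic integer polynomial, not the minimal
  one. It shows that one multiple \<open>d\<close> of all powers of \<open>x\<close> lies in the
  lattice \<open>L\<close> spanned by 1 and \<delta>, where norms are integers. So
  \<open>d * d\<close> clears the denominators of all powers of the rational number x x', which must
  then be an integer. The binomial recursion gives the same for x + 1, with the same
  \<open>d\<close>.\<close>

lemma integer_norm:
  assumes x: "x \<in> F" and ai: "algebraic_int x"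
  shows "x * cj x \<in> \<int>" "(x + 1) * cj (x + 1) \<in> \<int>"
proof -
  obtain e :: int and \<delta> where e: "e > 0" "\<delta> > 0" "\<delta>\<^sup>2 = of_int e" "\<delta> \<notin> \<rat>" "\<delta> \<in> F"
    and F: "F = {of_rat p + of_rat q * \<delta> |p q. True}"
    and c0: "\<forall>p q. cj (of_rat p + of_rat q * \<delta>) = of_rat p - of_rat q * \<delta>" by (rule generator_conjugation)
  have c: "cj (of_rat p + of_rat q * \<delta>) = of_rat p - of_rat q * \<delta>" for p q using c0 by blast
  define L where "L = {of_int i + of_int j * \<delta> |i j. True}"
  have L_add: "u + v \<in> L" if "u \<in> L" "v \<in> L" for u v
  proof -
    from that obtain i j i' j' where "u = of_int i + of_int j * \<delta>" "v = of_int i' + of_int j' * \<delta>"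
      by (auto simp: L_def)
    then have "u + v = of_int (i + i') + of_int (j + j') * \<delta>" by (simp add: algebra_simps)
    then show ?thesis unfolding L_def by blast
  qed
  have L_mult: "of_int n * u \<in> L" if "u \<in> L" for u n
  proof -
    from that obtain i j where "u = of_int i + of_int j * \<delta>" by (auto simp: L_def)
    then have "of_int n * u = of_int (n * i) + of_int (n * j) * \<delta>" by (simp add: algebra_simps)
    then show ?thesis unfolding L_def by blast
  qed
  have L0: "0 \<in> L" unfolding L_def by (intro CollectI exI[of _ 0]) auto
  have L_sum: "(\<Sum>i\<in>K. g i) \<in> L" if "\<And>i. i \<in> K \<Longrightarrow> g i \<in> L" for K :: "nat set" and g
    using that by (induction K rule: infinite_finite_induct) (auto intro: L0 L_add)
  obtain P where P: "lead_coeff P = 1" "\<And>i. coeff P i \<in> \<int>" "poly P x = 0"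
    using ai by (auto simp: algebraic_int.simps)
  define n where "n = degree P"
  have xn: "x ^ n = (\<Sum>i<n. - coeff P i * x ^ i)"
  proof -
    have "0 = (\<Sum>i\<le>n. coeff P i * x ^ i)" using P(3) by (simp add: poly_altdef n_def)
    also have "\<dots> = (\<Sum>i<n. coeff P i * x ^ i) + x ^ n"
      using P(1) by (simp add: n_def lessThan_Suc_atMost[symmetric])
    finally show ?thesis by (simp add: sum_negf)
  qed
  have "\<exists>p q. x ^ k = of_rat p + of_rat q * \<delta>" for k
  proof -
    have "x ^ k \<in> {of_rat p + of_rat q * \<delta> |p q. True}" using power_F[OF x, of k] F by (simp only:)
    then show ?thesis by blast
  qed
  then obtain p q where pq: "\<And>k. x ^ k = of_rat (p k) + of_rat (q k) * \<delta>" by metis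
  obtain d1 :: int where d1: "d1 \<noteq> 0" "\<And>k. k \<in> {..<n} \<Longrightarrow> of_int d1 * of_rat (p k) \<in> (\<int> :: real set)"
    by (rule common_denominator[of "{..<n}" "\<lambda>k. of_rat (p k)"]) auto
  obtain d2 :: int where d2: "d2 \<noteq> 0" "\<And>k. k \<in> {..<n} \<Longrightarrow> of_int d2 * of_rat (q k) \<in> (\<int> :: real set)"
    by (rule common_denominator[of "{..<n}" "\<lambda>k. of_rat (q k)"]) auto
  define d where "d = d1 * d2"
  have d0: "d \<noteq> 0" using d1 d2 by (simp add: d_def)
  have low: "of_int d * x ^ k \<in> L" if k: "k < n" for k
  proof -
    obtain i j where "of_int d1 * of_rat (p k) = (of_int i :: real)" "of_int d2 * of_rat (q k) = (of_int j :: real)"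
      using d1(2)[of k] d2(2)[of k] k by (auto elim!: Ints_cases)
    moreover have "of_int d * x ^ k = of_int d2 * (of_int d1 * of_rat (p k)) + of_int d1 * (of_int d2 * of_rat (q k)) * \<delta>"
      by (simp add: pq d_def algebra_simps)
    ultimately have "of_int d * x ^ k = of_int (d2 * i) + of_int (d1 * j) * \<delta>" by simp
    then show ?thesis unfolding L_def by blast
  qed
  have all: "of_int d * x ^ k \<in> L" for k
  proof (induction k rule: less_induct)
    case (less k)
    show ?case
    proof (cases "k < n")
      case False
      have "x ^ k = x ^ (k - n) * x ^ n" using False by (simp flip: power_add)
      then have "of_int d * x ^ k = (\<Sum>i<n. - coeff P i * (of_int d * x ^ (k - n + i)))"
        by (simp add: xn sum_distrib_left algebra_simps power_add)
      moreover have "- coeff P i * (of_int d * x ^ (k - n + i)) \<in> L" if "i < n" for i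
      proof -
        obtain z where "coeff P i = of_int z" using P(2)[of i] by (auto elim: Ints_cases)
        then show ?thesis using L_mult[OF less.IH[of "k - n + i"], of "- z"] that False by simp
      qed
      ultimately show ?thesis using L_sum[of "{..<n}"] by simp
    qed (use low in auto)
  qed
  have all1: "of_int d * (x + 1) ^ j * x ^ k \<in> L" for j k
  proof (induction j arbitrary: k)
    case (Suc j)
    have "of_int d * (x + 1) ^ Suc j * x ^ k = of_int d * (x + 1) ^ j * x ^ Suc k + of_int d * (x + 1) ^ j * x ^ k"
      by (simp add: algebra_simps)
    then show ?case using L_add Suc.IH by metis
  qed (use all in auto)
  have nl: "u * cj u \<in> \<int>" if "u \<in> L" for u
  proof -
    from that obtain i j where u: "u = of_int i + of_int j * \<delta>" by (auto simp: L_def)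
    have cu: "cj u = of_int i - of_int j * \<delta>" using c[of "of_int i" "of_int j"] by (simp add: u)
    have "u * cj u = of_int i * of_int i - of_int j * of_int j * \<delta>\<^sup>2"
      unfolding cu unfolding u by (simp add: power2_eq_square algebra_simps)
    then have "u * cj u = of_int (i * i - j * j * e)" by (simp add: e)
    then show ?thesis by (metis Ints_of_int)
  qed
  have key: "y * cj y \<in> \<int>" if y: "y \<in> F" "\<And>k. of_int d * y ^ k \<in> L" for y
  proof (rule rational_bounded_power_denominators[of _ "d * d"])
    show "y * cj y \<in> \<rat>" using y(1) by (rule norm_Rats)
    show "of_int (d * d) * (y * cj y) ^ k \<in> \<int>" for k
      using nl[OF y(2)[of k]] y(1) by (simp add: power_mult_distrib algebra_simps)
  qed (use d0 in auto)
  show "x * cj x \<in> \<int>" using key[OF x all] .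
  show "(x + 1) * cj (x + 1) \<in> \<int>" using key[of "x + 1"] x all1[of _ 0] by simp
qed

text \<open>The trace is N(x + 1) - N(x) - 1, so \<open>integer_norm\<close> yields both invariants;
  conversely \<open>x\<close> is a root of X^2 - (x + x') X + x x'. The ring structure of
  \<open>R\<close> is derived from this criterion.\<close>

lemma R_iff: "x \<in> R \<longleftrightarrow> x \<in> F \<and> x + cj x \<in> \<int> \<and> x * cj x \<in> \<int>"
proof (intro iffI conjI)
  assume x: "x \<in> R"
  then have xF: "x \<in> F" and ai: "algebraic_int x" by (auto simp: ring_of_integers_def)
  show "x \<in> F" "x * cj x \<in> \<int>" using xF integer_norm[OF xF ai] by auto
  have "(x + 1) * cj (x + 1) - x * cj x - 1 \<in> \<int>" using integer_norm[OF xF ai] by (intro Ints_diff) auto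
  moreover have "(x + 1) * cj (x + 1) - x * cj x - 1 = x + cj x" using xF by (simp add: algebra_simps)
  ultimately show "x + cj x \<in> \<int>" by simp
next
  assume *: "x \<in> F \<and> x + cj x \<in> \<int> \<and> x * cj x \<in> \<int>"
  have "algebraic_int x"
  proof (rule algebraic_int.intros[of "[:x * cj x, - (x + cj x), 1:]"]; (intro allI)?)
    fix i show "coeff [:x * cj x, - (x + cj x), 1:] i \<in> \<int>"
    proof -
      have "- (x + cj x) \<in> \<int>" using * by (intro Ints_minus) auto
      then show ?thesis using * by (auto simp: coeff_pCons split: nat.splits simp del: minus_add_distrib)
    qed
  qed (simp_all add: algebra_simps)
  then show "x \<in> R" using * by (auto simp: ring_of_integers_def)
qed

end

lemma rational_root_int:
  fixes r s :: real
  assumes "r \<in> \<rat>" "r + s \<in> \<int>" "r * s \<in> \<int>"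
  shows "r \<in> \<int>"
proof -
  have "algebraic_int r"
  proof (rule algebraic_int.intros[of "[:r * s, - (r + s), 1:]"]; (intro allI)?)
    fix i show "coeff [:r * s, - (r + s), 1:] i \<in> \<int>"
    proof -
      have "- (r + s) \<in> \<int>" using assms by (intro Ints_minus) auto
      then show ?thesis using assms by (auto simp: coeff_pCons split: nat.splits simp del: minus_add_distrib)
    qed
  qed (simp_all add: algebra_simps)
  then show ?thesis using assms(1) by (intro rational_algebraic_int_is_int)
qed

lemma Ints_bounded_finite: "finite {n :: int. \<bar>of_int n :: real\<bar> \<le> B}"
proof (rule finite_subset)
  show "{n :: int. \<bar>of_int n :: real\<bar> \<le> B} \<subseteq> {- \<lceil>B\<rceil>..\<lceil>B\<rceil>}"
  proof
    fix n :: int assume "n \<in> {n. \<bar>of_int n :: real\<bar> \<le> B}"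
    then have "\<bar>of_int n :: real\<bar> \<le> of_int \<lceil>B\<rceil>" by (auto intro: order_trans)
    then have "\<bar>n\<bar> \<le> \<lceil>B\<rceil>" by linarith
    then show "n \<in> {- \<lceil>B\<rceil>..\<lceil>B\<rceil>}" by auto
  qed
qed auto

section \<open>The ring of integers and its integral basis\<close>

context quadratic
begin

lemma R_F [simp]: "x \<in> R \<Longrightarrow> x \<in> F"
  by (simp add: ring_of_integers_def)

lemma R_trace: "x \<in> R \<Longrightarrow> x + cj x \<in> \<int>" and R_norm: "x \<in> R \<Longrightarrow> x * cj x \<in> \<int>"
  by (simp_all add: R_iff)

text \<open>The obstacle to closure of \<open>R\<close> under sums and products is this trace. It is
  rational and a root of an integral quadratic: its sum with the trace of x y' is the product of the
  traces of x and y, and its product with it is a polynomial in their traces and norms.\<close>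

lemma R_trace_mult:
  assumes "x \<in> R" "y \<in> R"
  shows "x * y + cj x * cj y \<in> \<int>"
proof (rule rational_root_int)
  have F: "x \<in> F" "y \<in> F" using assms by auto
  show "x * y + cj x * cj y \<in> \<rat>" using trace_Rats[of "x * y"] F by simp
  have "(x + cj x) * (y + cj y) \<in> \<int>" using assms by (intro Ints_mult R_trace)
  then show "(x * y + cj x * cj y) + (x * cj y + cj x * y) \<in> \<int>" by (simp add: algebra_simps)
  have "(y * cj y) * ((x + cj x) ^ 2 - 2 * (x * cj x)) + (x * cj x) * ((y + cj y) ^ 2 - 2 * (y * cj y)) \<in> \<int>"
    using assms by (intro Ints_add Ints_mult Ints_diff Ints_power R_trace R_norm) auto
  then show "(x * y + cj x * cj y) * (x * cj y + cj x * y) \<in> \<int>"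
    by (simp add: algebra_simps power2_eq_square)
qed

lemma R_cj [simp]: "x \<in> R \<Longrightarrow> cj x \<in> R"
  by (auto simp: R_iff algebra_simps)

lemma R_add [simp]:
  assumes "x \<in> R" "y \<in> R"
  shows "x + y \<in> R"
  unfolding R_iff
proof (intro conjI)
  have F: "x \<in> F" "y \<in> F" using assms by auto
  show "x + y \<in> F" using F by simp
  have "(x + cj x) + (y + cj y) \<in> \<int>" using assms by (intro Ints_add R_trace)
  then show "x + y + cj (x + y) \<in> \<int>" using F by (simp add: algebra_simps)
  have "x * cj x + y * cj y + (x * cj y + cj x * cj (cj y)) \<in> \<int>"
    using assms by (intro Ints_add R_norm R_trace_mult) auto
  then show "(x + y) * cj (x + y) \<in> \<int>" using F by (simp add: algebra_simps)
qed

lemma R_mult [simp]: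
  assumes "x \<in> R" "y \<in> R"
  shows "x * y \<in> R"
  unfolding R_iff
proof (intro conjI)
  have F: "x \<in> F" "y \<in> F" using assms by auto
  show "x * y \<in> F" using F by simp
  show "x * y + cj (x * y) \<in> \<int>" using R_trace_mult[OF assms] F by simp
  have "(x * cj x) * (y * cj y) \<in> \<int>" using assms by (intro Ints_mult R_norm)
  then show "(x * y) * cj (x * y) \<in> \<int>" using F by (simp add: algebra_simps)
qed

lemma of_int_R [simp]: "of_int n \<in> R"
  by (simp add: R_iff)

lemma Ints_R: "x \<in> \<int> \<Longrightarrow> x \<in> R"
  by (auto elim!: Ints_cases)

lemma zero_R [simp]: "0 \<in> R" and one_R [simp]: "1 \<in> R"
  and of_nat_R [simp]: "of_nat n \<in> R"
  by (intro Ints_R; simp)+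

lemma R_minus [simp]: "x \<in> R \<Longrightarrow> - x \<in> R"
  using R_mult[OF of_int_R[of "-1"], of x] by simp

lemma R_diff [simp]: "x \<in> R \<Longrightarrow> y \<in> R \<Longrightarrow> x - y \<in> R"
  using R_add[OF _ R_minus, of x y] by (simp only: diff_conv_add_uminus)

lemma R_power [simp]: "x \<in> R \<Longrightarrow> x ^ n \<in> R"
  by (induction n) simp_all

lemma R_Rats: "x \<in> R \<Longrightarrow> x \<in> \<rat> \<Longrightarrow> x \<in> \<int>"
  unfolding ring_of_integers_def by (blast intro: rational_algebraic_int_is_int)

lemma R_fixed: "x \<in> R \<Longrightarrow> cj x = x \<Longrightarrow> x \<in> \<int>"
  using cj_fixed R_Rats by auto

lemma R_denominator:
  assumes "x \<in> F"
  obtains k :: int where "k > 0" "of_int k * x \<in> R"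
proof -
  obtain a b where ab: "x + cj x = of_int a / of_int b" "b > (0::int)"
    using trace_Rats[OF assms] by (metis Rats_cases')
  obtain c d where cd: "x * cj x = of_int c / of_int d" "d > (0::int)"
    using norm_Rats[OF assms] by (metis Rats_cases')
  have "of_int (b * d) * x + cj (of_int (b * d) * x) = of_int (b * d) * (x + cj x)"
    using assms by (simp add: algebra_simps)
  also have "\<dots> = of_int (d * a)" using ab by simp
  finally have 1: "of_int (b * d) * x + cj (of_int (b * d) * x) = of_int (d * a)" .
  have "of_int (b * d) * x * cj (of_int (b * d) * x) = of_int (b * d) * of_int (b * d) * (x * cj x)"
    using assms by (simp add: algebra_simps)
  also have "\<dots> = of_int (b * b * d * c)" using cd by simp
  finally have 2: "of_int (b * d) * x * cj (of_int (b * d) * x) = of_int (b * b * d * c)" .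
  have "of_int (b * d) * x \<in> R"
    unfolding R_iff 1 2 using assms by (auto intro: Ints_of_int)
  then show ?thesis using ab cd by (intro that[of "b * d"]) auto
qed

text \<open>Division with remainder by the least positive difference x - x'. The squares of these
  differences are integers, so a least one exists, attained at \<open>w\<close>; subtracting a
  suitable multiple of \<open>w\<close> from an element of \<open>R\<close> leaves one equal to its
  conjugate, that is, an integer.\<close>

lemma integral_basis:
  obtains w where "w \<in> R" "w - cj w > 0" "R = {of_int p + of_int q * w |p q. True}"
proof -
  obtain e :: int and \<delta> where e: "e > 0" "\<delta> > 0" "\<delta>\<^sup>2 = of_int e" "\<delta> \<notin> \<rat>" "\<delta> \<in> F"
    and c: "\<forall>p q. cj (of_rat p + of_rat q * \<delta>) = of_rat p - of_rat q * \<delta>" by (rule generator_conjugation)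
  have c\<delta>: "cj \<delta> = - \<delta>" using c[rule_format, of 0 1] by simp
  have \<delta>R: "\<delta> \<in> R" unfolding R_iff c\<delta> using e by (simp add: power2_eq_square[symmetric])
  have sq: "(x - cj x)\<^sup>2 \<in> \<int>" if "x \<in> R" for x
  proof -
    have "(x + cj x)\<^sup>2 - 4 * (x * cj x) \<in> \<int>"
      using that by (intro Ints_diff Ints_power Ints_mult R_trace R_norm) auto
    then show ?thesis by (simp add: power2_eq_square algebra_simps)
  qed
  define Q where "Q = (\<lambda>x. x \<in> R \<and> x - cj x > 0)"
  have "Q \<delta>" using \<delta>R e c\<delta> by (simp add: Q_def)
  then obtain w where w: "Q w" "\<And>x. Q x \<Longrightarrow> nat \<lfloor>(w - cj w)\<^sup>2\<rfloor> \<le> nat \<lfloor>(x - cj x)\<^sup>2\<rfloor>"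
    using ex_has_least_nat[of Q \<delta> "\<lambda>x. nat \<lfloor>(x - cj x)\<^sup>2\<rfloor>"] by auto
  have wR: "w \<in> R" and wpos: "w - cj w > 0" using w by (auto simp: Q_def)
  have least: "w - cj w \<le> x - cj x" if "Q x" for x
  proof -
    have xR: "x \<in> R" using that by (simp add: Q_def)
    obtain i where i: "(w - cj w)\<^sup>2 = of_int i" using sq[OF wR] by (elim Ints_cases)
    obtain j where j: "(x - cj x)\<^sup>2 = of_int j" using sq[OF xR] by (elim Ints_cases)
    note ij = i j
    have "0 \<le> (of_int j :: real)" "0 \<le> (of_int i :: real)"
      unfolding ij[symmetric] by auto
    then have "i \<le> j" using w(2)[OF that] by (simp add: ij)
    then have "(w - cj w)\<^sup>2 \<le> (x - cj x)\<^sup>2" by (simp add: ij)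
    then show ?thesis using that by (simp add: Q_def power2_le_iff_abs_le)
  qed
  have "x \<in> {of_int p + of_int q * w |p q. True}" if x: "x \<in> R" for x
  proof -
    define q where "q = \<lfloor>(x - cj x) / (w - cj w)\<rfloor>"
    define y where "y = x - of_int q * w"
    have yR: "y \<in> R" using x wR by (simp add: y_def)
    have cy: "y - cj y = (x - cj x) - of_int q * (w - cj w)"
      using x wR by (simp add: y_def algebra_simps)
    have "of_int q \<le> (x - cj x) / (w - cj w)" "(x - cj x) / (w - cj w) < of_int q + 1"
      unfolding q_def by linarith+
    then have "of_int q * (w - cj w) \<le> x - cj x" "x - cj x < (of_int q + 1) * (w - cj w)"
      using wpos by (simp_all add: field_simps)
    then have "0 \<le> y - cj y" "y - cj y < w - cj w" unfolding cy by (simp_all add: algebra_simps)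
    then have "y = cj y" using least[of y] yR by (force simp: Q_def)
    then have "y \<in> \<int>" using R_fixed[OF yR] by simp
    then obtain p where "y = of_int p" by (auto elim: Ints_cases)
    then have "x = of_int p + of_int q * w" by (simp add: y_def)
    then show ?thesis by (intro CollectI exI conjI TrueI)
  qed
  then have "R = {of_int p + of_int q * w |p q. True}" using wR by auto
  then show ?thesis by (rule that[OF wR wpos])
qed

section \<open>Discriminant, codifferent and finiteness\<close>

abbreviation D :: int where "D \<equiv> discriminant F"
definition rD :: real where "rD = sqrt (of_int D)"

text \<open>\<open>discriminant\<close> is a definite description ranging over all bases, so
  independence of the basis has to be shown: the two changes of basis are integral, their
  determinants multiply to 1, and the square forgets the sign.\<close>

lemma discriminant_basis:
  assumes w: "w \<in> R" "w - cj w > 0" "R = {of_int p + of_int q * w |p q. True}"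
  shows "of_int D = (w - cj w)\<^sup>2"
proof -
  have coord: "\<exists>p q :: int. x = of_int p + of_int q * w" if "x \<in> R" for x
  proof -
    have "x \<in> {of_int p + of_int q * w |p q. True}" using that w(3) by (simp only:)
    then show ?thesis by (elim CollectE exE conjE) (intro exI)
  qed
  have sq: "(w - cj w)\<^sup>2 \<in> \<int>"
  proof -
    have "(w + cj w)\<^sup>2 - 4 * (w * cj w) \<in> \<int>"
      using w by (intro Ints_diff Ints_power Ints_mult R_trace R_norm) auto
    then show ?thesis by (simp add: power2_eq_square algebra_simps)
  qed
  then obtain d :: int where d: "of_int d = (w - cj w)\<^sup>2" by (metis Ints_cases)
  have uniq: "of_int d' = (w - cj w)\<^sup>2"
    if R: "R = {of_int p * w1 + of_int q * w2 | p q :: int. True}"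
     and d': "of_int d' = (w1 * cj w2 - w2 * cj w1)\<^sup>2" for d' w1 w2
  proof -
    have "w1 = of_int 1 * w1 + of_int 0 * w2" by simp
    then have w1: "w1 \<in> R" unfolding R by (intro CollectI exI conjI TrueI)
    have "w2 = of_int 0 * w1 + of_int 1 * w2" by simp
    then have w2: "w2 \<in> R" unfolding R by (intro CollectI exI conjI TrueI)
    note w12 = w1 w2
    obtain a b where ab1: "w1 = of_int a + of_int b * w" using coord[OF w1] by (elim exE)
    obtain c e where ab2: "w2 = of_int c + of_int e * w" using coord[OF w2] by (elim exE)
    note ab = ab1 ab2
    have "1 \<in> {of_int p * w1 + of_int q * w2 | p q :: int. True}" using one_R R by (simp only:)
    then obtain i j where ij: "1 = of_int i * w1 + of_int j * w2" by (elim CollectE exE conjE)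
    have "w \<in> {of_int p * w1 + of_int q * w2 | p q :: int. True}" using w(1) R by (simp only:)
    then obtain k l where kl: "w = of_int k * w1 + of_int l * w2" by (elim CollectE exE conjE)
    have F: "w \<in> F" "w1 \<in> F" "w2 \<in> F" using w w12 by auto
    have c12: "cj w1 = of_int a + of_int b * cj w" "cj w2 = of_int c + of_int e * cj w"
      using F by (simp_all add: ab)
    have 1: "w1 * cj w2 - w2 * cj w1 = of_int (b * c - a * e) * (w - cj w)"
      unfolding c12 unfolding ab by (simp add: algebra_simps)
    have cw: "cj w = of_int k * cj w1 + of_int l * cj w2" using F by (subst kl) simp
    have c1: "1 = of_int i * cj w1 + of_int j * cj w2"
      using arg_cong[OF ij, of cj] F by simp
    have "w * 1 - 1 * cj w = (of_int k * w1 + of_int l * w2) * (of_int i * cj w1 + of_int j * cj w2)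
       - (of_int i * w1 + of_int j * w2) * (of_int k * cj w1 + of_int l * cj w2)"
      by (simp only: kl[symmetric] ij[symmetric] cw[symmetric] c1[symmetric])
    then have "w - cj w = of_int (k * j - i * l) * (w1 * cj w2 - w2 * cj w1)"
      by (simp add: algebra_simps)
    then have "(w - cj w) * 1 = (w - cj w) * of_int ((k * j - i * l) * (b * c - a * e))" unfolding 1 by simp
    then have "(1::real) = of_int ((k * j - i * l) * (b * c - a * e))"
      using w(2) by (simp only: mult_cancel_left) auto
    then have "(k * j - i * l) * (b * c - a * e) = 1" by (metis of_int_1 of_int_eq_iff)
    then have "b * c - a * e = 1 \<or> b * c - a * e = -1"
      by (metis zmult_eq_1_iff)
    then have "(b * c - a * e)\<^sup>2 = 1" by auto
    then have "(of_int (b * c - a * e) :: real)\<^sup>2 = 1" by (metis of_int_1 of_int_power)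
    then show ?thesis unfolding d' 1 power_mult_distrib by simp
  qed
  have ex: "\<exists>w1 w2. R = {of_int p * w1 + of_int q * w2 | p q :: int. True} \<and>
     of_int d = (w1 * cj w2 - w2 * cj w1)\<^sup>2"
    using w d by (intro exI[of _ 1] exI[of _ w]) (auto simp: power2_eq_square algebra_simps)
  have "D = d"
    unfolding discriminant_def
  proof (rule the_equality)
    show "\<exists>w1 w2. R = {of_int p * w1 + of_int q * w2 | p q :: int. True} \<and>
     of_int d = (w1 * cj w2 - w2 * cj w1)\<^sup>2" by (rule ex)
    fix d' assume "\<exists>w1 w2. R = {of_int p * w1 + of_int q * w2 | p q :: int. True} \<and>
     of_int d' = (w1 * cj w2 - w2 * cj w1)\<^sup>2"
    then have "of_int d' = (w - cj w)\<^sup>2" by (elim exE conjE) (rule uniq)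
    then show "d' = d" using d by (metis of_int_eq_iff)
  qed
  then show ?thesis using d by simp
qed

lemma standard_basis:
  obtains w where "w \<in> R" "w - cj w = rD" "R = {of_int p + of_int q * w |p q. True}" "rD > 0"
proof -
  obtain w where w: "w \<in> R" "w - cj w > 0" "R = {of_int p + of_int q * w |p q. True}"
    by (rule integral_basis)
  have "w - cj w = rD" using discriminant_basis[OF w] w(2) by (simp add: rD_def real_sqrt_unique)
  then show ?thesis using w by (intro that[of w]) auto
qed

lemma R_coordinates:
  obtains w :: real and p q :: "real \<Rightarrow> int" where "w \<in> R" "w - cj w = rD"
    "\<forall>x\<in>R. x = of_int (p x) + of_int (q x) * w"
proof -
  obtain w where w: "w \<in> R" "w - cj w = rD" "R = {of_int p + of_int q * w |p q. True}" by (rule standard_basis)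
  have "\<forall>x\<in>R. \<exists>p q :: int. x = of_int p + of_int q * w"
  proof
    fix x assume "x \<in> R"
    then have "x \<in> {of_int p + of_int q * w |p q. True}" using w(3) by (simp only:)
    then show "\<exists>p q :: int. x = of_int p + of_int q * w" by (elim CollectE exE conjE) (intro exI)
  qed
  then have "\<exists>p q. \<forall>x\<in>R. x = of_int (p x :: int) + of_int (q x :: int) * w" unfolding bchoice_iff by simp
  then obtain p q where "\<forall>x\<in>R. x = of_int (p x :: int) + of_int (q x :: int) * w" by (elim exE)
  then show ?thesis by (rule that[OF w(1,2)])
qed

lemma rD_pos [simp]: "rD > 0" and D_pos [simp]: "D > 0" and rD_R [simp]: "rD \<in> R"
  and cj_rD [simp]: "cj rD = - rD"
proof -
  obtain w where w: "w \<in> R" "w - cj w = rD" "rD > 0" by (rule standard_basis)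
  then show "rD > 0" by simp
  then show "D > 0" by (simp add: rD_def)
  have "w - cj w \<in> R" using w(1) by (intro R_diff R_cj)
  then show "rD \<in> R" using w by (simp only:)
  have "cj (w - cj w) = - (w - cj w)" using w(1) by simp
  then show "cj rD = - rD" by (simp only: w(2))
qed

lemma rD_nonneg [simp]: "rD \<ge> 0" and rD_nonzero [simp]: "rD \<noteq> 0"
  using less_imp_le[OF rD_pos] less_imp_neq[OF rD_pos] by auto

lemma rD_sq: "rD * rD = of_int D"
proof -
  have "(0::real) \<le> of_int D" using D_pos by (simp only: of_int_0_le_iff)
  then show ?thesis by (simp add: rD_def)
qed

lemma D_ge_1: "(1::real) \<le> of_int D"
proof -
  have "1 \<le> D" using D_pos by linarith
  then show ?thesis by (simp only: of_int_1_le_iff)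
qed

abbreviation Di :: "real set" where "Di \<equiv> inverse_ideal F (different F)"

lemma Di_iff: "l \<in> Di \<longleftrightarrow> l \<in> F \<and> rD * l \<in> R"
proof -
  have D: "l \<in> Di \<longleftrightarrow> l \<in> F \<and> (\<forall>y\<in>R. l * (rD * y) \<in> R)"
    by (simp add: inverse_ideal_def different_def rD_def)
  show ?thesis
    unfolding D
  proof (intro conj_cong refl iffI ballI)
    assume "\<forall>y\<in>R. l * (rD * y) \<in> R"
    from bspec[OF this one_R] show "rD * l \<in> R" by (simp add: mult.commute)
  next
    fix y assume "rD * l \<in> R" "y \<in> R"
    then have "rD * l * y \<in> R" by (rule R_mult)
    then show "l * (rD * y) \<in> R" by (simp add: mult_ac)
  qed
qed

lemma Di_F [simp]: "l \<in> Di \<Longrightarrow> l \<in> F"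
  by (simp add: Di_iff)

lemma Di_add [simp]: "k \<in> Di \<Longrightarrow> l \<in> Di \<Longrightarrow> k + l \<in> Di"
  by (simp add: Di_iff algebra_simps)

lemma Di_mult [simp]: "l \<in> Di \<Longrightarrow> x \<in> R \<Longrightarrow> l * x \<in> Di"
  using R_mult[of "rD * l" x] by (auto simp: Di_iff mult.assoc)

lemma R_Di [simp]: "x \<in> R \<Longrightarrow> x \<in> Di"
  by (simp add: Di_iff)

lemma Di_cj [simp]: "l \<in> Di \<Longrightarrow> cj l \<in> Di"
  using R_minus[OF R_cj[of "rD * l"]] by (simp add: Di_iff del: R_minus R_cj)

text \<open>The codifferent is the trace dual of \<open>R\<close>: if rD l x = P + Q w in the
  standard basis with w - w' = rD, then subtracting the conjugate shows that the trace of l x is the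
  coordinate Q.\<close>

lemma Di_trace:
  assumes "l \<in> Di" "x \<in> R"
  shows "l * x + cj l * cj x \<in> \<int>"
proof -
  obtain w :: real and p q :: "real \<Rightarrow> int" where w: "w \<in> R" "w - cj w = rD"
    "\<forall>x\<in>R. x = of_int (p x) + of_int (q x) * w" by (rule R_coordinates)
  define y where "y = rD * (l * x)"
  have lx: "l * x \<in> Di" "l * x \<in> F" using assms Di_mult by auto
  have y: "y \<in> R" using lx by (simp add: y_def Di_iff)
  have cy: "cj y = - rD * (cj l * cj x)"
  proof -
    have "cj y = cj rD * cj (l * x)" unfolding y_def by (rule cj_mult) (simp_all add: lx)
    also have "cj (l * x) = cj l * cj x" by (rule cj_mult) (simp_all add: assms)
    finally show ?thesis by simp
  qed
  define P Q where "P = p y" and "Q = q y"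
  have yPQ: "y = of_int P + of_int Q * w" using w(3) y by (simp add: P_def Q_def)
  have "cj y = of_int P + of_int Q * cj w" by (subst yPQ) (use w(1) in simp)
  then have "y - cj y = of_int Q * rD" unfolding w(2)[symmetric] by (subst yPQ) (simp add: algebra_simps)
  moreover have "y - cj y = rD * (l * x + cj l * cj x)" unfolding cy by (simp add: y_def algebra_simps)
  ultimately have "rD * (l * x + cj l * cj x) = rD * of_int Q" by simp
  then have "l * x + cj l * cj x = of_int Q" using rD_pos by (metis less_irrefl mult_cancel_left)
  then show ?thesis by simp
qed

lemma R_bounded_finite: "finite {x \<in> R. \<bar>x\<bar> \<le> B \<and> \<bar>cj x\<bar> \<le> B}"
proof -
  obtain w :: real and p q :: "real \<Rightarrow> int" where w: "w \<in> R" "w - cj w = rD"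
    "\<forall>x\<in>R. x = of_int (p x) + of_int (q x) * w" by (rule R_coordinates)
  let ?A = "{n :: int. \<bar>of_int n :: real\<bar> \<le> 2 * B / rD}"
  let ?C = "{n :: int. \<bar>of_int n :: real\<bar> \<le> B + 2 * B / rD * \<bar>w\<bar>}"
  have "finite ((\<lambda>(i, j). of_int i + of_int j * w) ` (?C \<times> ?A))"
    by (intro finite_imageI finite_cartesian_product Ints_bounded_finite)
  moreover have "{x \<in> R. \<bar>x\<bar> \<le> B \<and> \<bar>cj x\<bar> \<le> B} \<subseteq> (\<lambda>(i, j). of_int i + of_int j * w) ` (?C \<times> ?A)"
  proof
    fix x assume x: "x \<in> {x \<in> R. \<bar>x\<bar> \<le> B \<and> \<bar>cj x\<bar> \<le> B}"
    define P Q where "P = p x" and "Q = q x"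
    have xPQ: "x = of_int P + of_int Q * w" using w(3) x by (simp add: P_def Q_def)
    have "cj x = of_int P + of_int Q * cj w" by (subst xPQ) (use w(1) in simp)
    then have d: "x - cj x = of_int Q * rD" unfolding w(2)[symmetric] by (subst xPQ) (simp add: algebra_simps)
    have "\<bar>x - cj x\<bar> \<le> 2 * B" using x by auto
    then have "\<bar>of_int Q\<bar> * rD \<le> 2 * B" unfolding d abs_mult using rD_pos by (simp only: abs_of_pos)
    then have Q: "\<bar>of_int Q\<bar> \<le> 2 * B / rD" using rD_pos by (simp only: pos_le_divide_eq)
    have "\<bar>of_int P\<bar> = \<bar>x - of_int Q * w\<bar>" by (subst xPQ) simp
    also have "\<dots> \<le> \<bar>x\<bar> + \<bar>of_int Q\<bar> * \<bar>w\<bar>" by (metis abs_mult abs_triangle_ineq4)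
    also have "\<dots> \<le> B + 2 * B / rD * \<bar>w\<bar>" using x Q by (intro add_mono mult_right_mono) auto
    finally have "(P, Q) \<in> ?C \<times> ?A" using Q by simp
    then show "x \<in> (\<lambda>(i, j). of_int i + of_int j * w) ` (?C \<times> ?A)" using xPQ by (intro image_eqI[of _ _ "(P, Q)"]) auto
  qed
  ultimately show ?thesis by (rule rev_finite_subset)
qed

lemma scaled_R_bounded_finite:
  assumes c: "c \<in> F" "c \<noteq> 0"
  shows "finite {x \<in> F. c * x \<in> R \<and> \<bar>x\<bar> \<le> B \<and> \<bar>cj x\<bar> \<le> B}"
proof -
  let ?B = "max (\<bar>c\<bar> * B) (\<bar>cj c\<bar> * B)"
  have "(\<lambda>x. c * x) ` {x \<in> F. c * x \<in> R \<and> \<bar>x\<bar> \<le> B \<and> \<bar>cj x\<bar> \<le> B} \<subseteq> {x \<in> R. \<bar>x\<bar> \<le> ?B \<and> \<bar>cj x\<bar> \<le> ?B}"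
  proof (intro image_subsetI CollectI conjI)
    fix x assume x: "x \<in> {x \<in> F. c * x \<in> R \<and> \<bar>x\<bar> \<le> B \<and> \<bar>cj x\<bar> \<le> B}"
    then show "c * x \<in> R" by simp
    have "\<bar>c * x\<bar> \<le> \<bar>c\<bar> * B" "\<bar>cj (c * x)\<bar> \<le> \<bar>cj c\<bar> * B"
      using x c by (auto simp: abs_mult intro!: mult_left_mono)
    then show "\<bar>c * x\<bar> \<le> ?B" "\<bar>cj (c * x)\<bar> \<le> ?B" by linarith+
  qed
  then have "finite ((\<lambda>x. c * x) ` {x \<in> F. c * x \<in> R \<and> \<bar>x\<bar> \<le> B \<and> \<bar>cj x\<bar> \<le> B})"
    using R_bounded_finite finite_subset by blast
  then show ?thesis
    by (rule finite_imageD) (use c in \<open>auto intro!: inj_onI\<close>)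
qed

section \<open>Units\<close>

definition unitR :: "real \<Rightarrow> bool" where
  "unitR u \<longleftrightarrow> u \<in> R \<and> inverse u \<in> R \<and> u \<noteq> 0"

lemma unitR_norm:
  assumes "unitR u"
  shows "\<bar>u * cj u\<bar> = 1"
proof -
  obtain i j where i: "u * cj u = of_int i" and j: "inverse u * cj (inverse u) = of_int j"
    using assms R_norm by (metis Ints_cases unitR_def)
  have "of_int (i * j) = (u * cj u) * (inverse u * cj (inverse u))" using i j by simp
  also have "\<dots> = 1"
  proof -
    have "u \<in> F" "u \<noteq> 0" "cj u \<noteq> 0" using assms by (auto simp: unitR_def)
    then show ?thesis by (simp add: field_simps)
  qed
  finally have "i * j = 1" by (metis of_int_1 of_int_eq_iff)
  then have "\<bar>i\<bar> = 1" by (metis abs_1 abs_minus_cancel zmult_eq_1_iff)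
  then show ?thesis using i by (metis of_int_1 of_int_abs)
qed

lemma unitR_cj: "unitR u \<Longrightarrow> \<bar>cj u\<bar> = 1 / \<bar>u\<bar>"
  using unitR_norm[of u] by (auto simp: abs_mult unitR_def field_simps)

lemma unitR_mult: "unitR u \<Longrightarrow> unitR v \<Longrightarrow> unitR (u * v)"
  by (simp add: unitR_def)

lemma unitR_inverse: "unitR u \<Longrightarrow> unitR (inverse u)"
  by (simp add: unitR_def)

lemma unitR_minus: "unitR u \<Longrightarrow> unitR (- u)"
  by (simp add: unitR_def)

lemma unitR_powi: "unitR u \<Longrightarrow> unitR (u powi k)"
  by (auto simp: unitR_def power_int_def simp flip: power_inverse)

text \<open>The classical argument for Pell's equation. Dirichlet approximations to \<open>w\<close>
  give infinitely many integers of norm at most \<open>B\<close>; by the pigeonhole principle two of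
  them, different up to sign, have the same norm n and the same coordinates modulo n, and then both
  of their quotients are integral.\<close>

lemma ex_unit_gt_1: "\<exists>u. unitR u \<and> u > 1"
proof -
  obtain w :: real and p q :: "real \<Rightarrow> int" where w: "w \<in> R" "w - cj w = rD"
    and pq: "\<forall>x\<in>R. x = of_int (p x) + of_int (q x) * w" by (rule R_coordinates)
  have wirr: "w \<notin> \<rat>" using w(2) rD_pos cj_Rats[of w] by force
  \<comment> \<open>For x = k w - h with |x| < 1/N and k at most N, the conjugate is at most 1 + N
    rD, so the norm is at most 1/N + rD.\<close>
  define B where "B = 1 + rD"
  define X where "X = {x \<in> R. x \<noteq> 0 \<and> \<bar>x * cj x\<bar> \<le> B}"
  have small: "\<exists>x\<in>X. \<bar>x\<bar> < 1 / real N" if N: "N > 0" for N :: nat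
  proof -
    obtain h k where hk: "0 < k" "k \<le> int N" "\<bar>of_int k * w - of_int h\<bar> < 1 / real N"
      by (rule Dirichlet_approx[OF N])
    define x where "x = of_int k * w - of_int h"
    have xR: "x \<in> R" using w by (simp add: x_def)
    have x0: "x \<noteq> 0"
    proof
      assume "x = 0"
      then have "w = of_int h / of_int k" using hk by (simp add: x_def field_simps)
      then show False using wirr by simp
    qed
    have xl: "\<bar>x\<bar> < 1 / real N" using hk by (simp add: x_def)
    have "cj x = of_int k * cj w - of_int h" using w by (simp add: x_def)
    also have "\<dots> = x - of_int k * rD" by (simp add: x_def w(2)[symmetric] algebra_simps)
    finally have "\<bar>cj x\<bar> \<le> \<bar>x\<bar> + \<bar>of_int k * rD\<bar>" by linarith
    also have "\<bar>of_int k * rD\<bar> = of_int k * rD" using hk rD_pos by (intro abs_of_nonneg mult_nonneg_nonneg less_imp_le) auto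
    also have "\<dots> \<le> real N * rD" using hk rD_pos by (intro mult_right_mono) auto
    also have "\<bar>x\<bar> \<le> 1" using xl N by (rule_tac order_trans[OF less_imp_le[OF xl]]) simp
    finally have cx: "\<bar>cj x\<bar> \<le> 1 + real N * rD" by simp
    have "\<bar>x * cj x\<bar> \<le> 1 / real N * (1 + real N * rD)"
      unfolding abs_mult using xl cx by (intro mult_mono) auto
    also have "\<dots> = 1 / real N + rD" using N by (simp add: field_simps)
    also have "\<dots> \<le> B" using N by (simp add: B_def)
    finally have "x \<in> X" using xR x0 by (simp add: X_def)
    then show ?thesis using xl by blast
  qed
  have infX: "infinite X"
  proof
    assume fin: "finite X"
    have ne: "X \<noteq> {}" using small[of 1] by auto
    define \<mu> where "\<mu> = Min (abs ` X)"
    have "\<mu> \<in> abs ` X" unfolding \<mu>_def using fin ne by (intro Min_in) auto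
    then have "\<mu> > 0" by (auto simp: X_def)
    then obtain N where N: "N > 0" "1 / real N < \<mu>"
      by (metis ex_inverse_of_nat_less inverse_eq_divide)
    obtain x where "x \<in> X" "\<bar>x\<bar> < 1 / real N" using small[OF N(1)] by blast
    moreover from this have "\<mu> \<le> \<bar>x\<bar>" unfolding \<mu>_def using fin by (intro Min_le) auto
    ultimately show False using N by simp
  qed
  define nn where "nn x = \<lfloor>x * cj x\<rfloor>" for x
  have nn: "of_int (nn x) = x * cj x" if "x \<in> R" for x
    using R_norm[OF that] by (auto simp: nn_def elim!: Ints_cases)
  have nn0: "nn x \<noteq> 0" if "x \<in> X" for x
    using nn[of x] that by (auto simp: X_def)
  define f where "f x = (nn x, p x mod nn x, q x mod nn x)" for x
  have "finite (f ` X)"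
  proof (rule finite_subset)
    let ?N = "{n :: int. \<bar>of_int n :: real\<bar> \<le> B}"
    let ?M = "{- \<lceil>B\<rceil> .. \<lceil>B\<rceil>}"
    show "f ` X \<subseteq> ?N \<times> ?M \<times> ?M"
    proof
      fix y assume "y \<in> f ` X"
      then obtain x where x: "x \<in> X" "y = f x" by blast
      have n: "\<bar>of_int (nn x) :: real\<bar> \<le> B" using nn[of x] x by (simp add: X_def)
      then have n': "\<bar>nn x\<bar> \<le> \<lceil>B\<rceil>" by linarith
      have "\<bar>r mod nn x\<bar> \<le> \<lceil>B\<rceil>" for r
        using abs_mod_less[OF nn0[OF x(1)], of r] n' by linarith
      then have "r mod nn x \<in> ?M" for r by (smt (verit) atLeastAtMost_iff)
      then show "y \<in> ?N \<times> ?M \<times> ?M" using n x by (auto simp: f_def)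
    qed
  qed (intro finite_cartesian_product Ints_bounded_finite finite_atLeastAtMost_int)
  then obtain a where a: "a \<in> X" "infinite {b \<in> X. f b = f a}"
    using pigeonhole_infinite[OF infX] by blast
  then obtain b where b: "b \<in> X" "f b = f a" "b \<noteq> a" "b \<noteq> - a"
  proof -
    have "infinite ({b \<in> X. f b = f a} - {a, - a})" using a(2) by (intro Diff_infinite_finite) auto
    then obtain b where "b \<in> {b \<in> X. f b = f a} - {a, - a}" by (metis infinite_imp_nonempty ex_in_conv)
    then show ?thesis using that by auto
  qed
  have aR: "a \<in> R" "a \<noteq> 0" and bR: "b \<in> R" "b \<noteq> 0" using a b by (auto simp: X_def)
  define n where "n = nn a"
  have nb: "nn b = n" and pm: "p b mod n = p a mod n" and qm: "q b mod n = q a mod n"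
    using b(2) unfolding f_def n_def prod.inject by (elim conjE; metis)+
  have n0: "n \<noteq> 0" using nn0[OF a(1)] by (simp add: n_def)
  from pm have "n dvd p b - p a" by (simp add: mod_eq_dvd_iff)
  then obtain i where i: "p b - p a = n * i" ..
  from qm have "n dvd q b - q a" by (simp add: mod_eq_dvd_iff)
  then obtain j where j: "q b - q a = n * j" ..
  define z where "z = of_int i + of_int j * w"
  have zR: "z \<in> R" using w by (simp add: z_def)
  have "b - a = of_int (p b - p a) + of_int (q b - q a) * w"
    using pq aR bR by (metis (no_types) add_diff_add left_diff_distrib of_int_diff)
  then have bz: "b = a + of_int n * z" unfolding i j by (simp add: z_def algebra_simps)
  have na: "a * cj a = of_int n" and nbb: "b * cj b = of_int n"
    using nn[OF aR(1)] nn[OF bR(1)] nb by (simp_all add: n_def)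
  \<comment> \<open>b = a + n z and n = a a', so dividing by a leaves 1 + z a'. For the inverse
    quotient the same n is written as b b'.\<close>
  have ba: "b / a = 1 + z * cj a"
  proof -
    have "b * cj a = of_int n * (1 + z * cj a)" by (subst bz) (simp add: algebra_simps na)
    then have "b * cj a = (a * (1 + z * cj a)) * cj a" by (simp add: na[symmetric] mult_ac)
    moreover have "cj a \<noteq> 0" using aR by simp
    ultimately have "b = a * (1 + z * cj a)" by (metis mult_right_cancel)
    then show ?thesis using aR by simp
  qed
  have ab: "a / b = 1 - z * cj b"
  proof -
    have a': "a = b - of_int n * z" using bz by simp
    have "a * cj b = of_int n * (1 - z * cj b)" by (subst a') (simp add: algebra_simps nbb)
    then have "a * cj b = (b * (1 - z * cj b)) * cj b" by (simp add: nbb[symmetric] mult_ac)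
    moreover have "cj b \<noteq> 0" using bR by simp
    ultimately have "a = b * (1 - z * cj b)" by (metis mult_right_cancel)
    then show ?thesis using bR by simp
  qed
  define u where "u = b / a"
  have "u \<in> R" using ba zR aR by (simp add: u_def)
  moreover have "inverse u \<in> R" using ab zR bR by (simp add: u_def)
  ultimately have u: "unitR u" using aR bR by (simp add: unitR_def u_def)
  have u1: "\<bar>u\<bar> \<noteq> 1"
  proof
    assume "\<bar>u\<bar> = 1"
    then have "\<bar>b\<bar> = \<bar>a\<bar>" using aR by (simp add: u_def)
    then show False using b by (auto simp: abs_eq_iff)
  qed
  have "unitR \<bar>u\<bar>" using u unitR_minus by (auto simp: abs_if)
  moreover have "unitR (inverse \<bar>u\<bar>)" by (rule unitR_inverse) fact
  moreover have "\<bar>u\<bar> > 1 \<or> inverse \<bar>u\<bar> > 1"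
    using u1 u by (auto simp: unitR_def one_less_inverse_iff)
  ultimately show ?thesis by blast
qed

text \<open>Units in (1, u0] have conjugates of absolute value less than 1, so they are finite in
  number and one of them is least. Dividing a positive unit by the largest power of \<epsilon> not
  exceeding it leaves a unit in [1, \<epsilon>), which can only be 1.\<close>

lemma fundamental_unit:
  obtains \<epsilon> where "unitR \<epsilon>" "\<epsilon> > 1" "\<forall>u. unitR u \<longrightarrow> (\<exists>k. u = \<epsilon> powi k \<or> u = - (\<epsilon> powi k))"
proof -
  obtain u0 where u0: "unitR u0" "u0 > 1" using ex_unit_gt_1 by blast
  define U where "U = {u. unitR u \<and> 1 < u \<and> u \<le> u0}"
  have "U \<subseteq> {x \<in> R. \<bar>x\<bar> \<le> u0 \<and> \<bar>cj x\<bar> \<le> u0}"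
  proof
    fix u assume u: "u \<in> U"
    then have "\<bar>cj u\<bar> = 1 / \<bar>u\<bar>" by (intro unitR_cj) (simp add: U_def)
    also have "\<dots> \<le> 1" using u by (simp add: U_def)
    also have "1 \<le> u0" using u0 by simp
    finally show "u \<in> {x \<in> R. \<bar>x\<bar> \<le> u0 \<and> \<bar>cj x\<bar> \<le> u0}" using u by (auto simp: U_def unitR_def)
  qed
  then have finU: "finite U" using R_bounded_finite finite_subset by blast
  have "u0 \<in> U" using u0 by (simp add: U_def)
  define \<epsilon> where "\<epsilon> = Min U"
  have "\<epsilon> \<in> U" unfolding \<epsilon>_def using finU \<open>u0 \<in> U\<close> by (intro Min_in) auto
  then have \<epsilon>: "unitR \<epsilon>" "\<epsilon> > 1" "\<epsilon> \<le> u0" by (auto simp: U_def)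
  have least: "\<epsilon> \<le> u" if "unitR u" "u > 1" for u
  proof (cases "u \<le> u0")
    case True
    then show ?thesis unfolding \<epsilon>_def using finU that by (intro Min_le) (auto simp: U_def)
  qed (use \<epsilon> in simp)
  have pos: "\<exists>k. u = \<epsilon> powi k" if u: "unitR u" "u > 0" for u
  proof -
    define k where "k = \<lfloor>log \<epsilon> u\<rfloor>"
    have pw: "\<epsilon> powr of_int j = \<epsilon> powi j" for j using \<epsilon> by (intro powr_real_of_int') auto
    have "of_int k \<le> log \<epsilon> u" "log \<epsilon> u < of_int (k + 1)" unfolding k_def by linarith+
    then have "\<epsilon> powr of_int k \<le> u" "u < \<epsilon> powr of_int (k + 1)"
      using \<epsilon> u by (simp_all add: le_log_iff log_less_iff)
    then have k: "\<epsilon> powi k \<le> u" "u < \<epsilon> powi (k + 1)" unfolding pw by auto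
    define v where "v = u * inverse (\<epsilon> powi k)"
    have p: "\<epsilon> powi k > 0" using \<epsilon> by simp
    have v: "unitR v" unfolding v_def using u \<epsilon> by (intro unitR_mult unitR_inverse unitR_powi)
    have "v \<ge> 1" using k p by (simp add: v_def field_simps)
    moreover have "v < \<epsilon>"
    proof -
      have "u < \<epsilon> powi k * \<epsilon>" using k(2) \<epsilon> by (simp add: power_int_add_1)
      then show ?thesis using p by (simp add: v_def field_simps)
    qed
    ultimately have "v = 1" using least[OF v] by force
    then show ?thesis using p by (auto simp: v_def field_simps)
  qed
  have "\<forall>u. unitR u \<longrightarrow> (\<exists>k. u = \<epsilon> powi k \<or> u = - (\<epsilon> powi k))"
  proof (intro allI impI)
    fix u assume u: "unitR u"
    show "\<exists>k. u = \<epsilon> powi k \<or> u = - (\<epsilon> powi k)"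
    proof (cases "u > 0")
      case False
      then have "- u > 0" using u by (simp add: unitR_def)
      then obtain k where "- u = \<epsilon> powi k" using pos[OF unitR_minus[OF u]] by blast
      then show ?thesis by (intro exI[of _ k]) auto
    qed (use pos u in blast)
  qed
  then show ?thesis by (rule that[OF \<epsilon>(1,2)])
qed

end

section \<open>Holomorphic functions of two variables\<close>

lemma holomorphic2_on_open:
  "open W \<Longrightarrow> holomorphic2_on f W \<longleftrightarrow>
     (\<forall>z\<in>W. \<exists>a b. (f has_derivative (\<lambda>(v, w). a * v + b * w)) (at z))"
  unfolding holomorphic2_on_def by (rule ball_cong) (simp_all only: at_within_open)

lemma holomorphic2_on_subset:
  "holomorphic2_on f W \<Longrightarrow> V \<subseteq> W \<Longrightarrow> holomorphic2_on f V"
  unfolding holomorphic2_on_def by (meson has_derivative_subset subsetD)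

lemma holomorphic2_on_transform:
  assumes "holomorphic2_on f W" "\<And>z. z \<in> W \<Longrightarrow> g z = f z"
  shows "holomorphic2_on g W"
  unfolding holomorphic2_on_def
proof
  fix z assume z: "z \<in> W"
  then obtain a b where d: "(f has_derivative (\<lambda>(v, w). a * v + b * w)) (at z within W)"
    using assms(1) unfolding holomorphic2_on_def by blast
  have "(g has_derivative (\<lambda>(v, w). a * v + b * w)) (at z within W)"
    by (rule has_derivative_transform[OF z assms(2) d])
  then show "\<exists>a b. (g has_derivative (\<lambda>(v, w). a * v + b * w)) (at z within W)" by blast
qed

lemma holomorphic2_on_local:
  assumes "\<And>z. z \<in> W \<Longrightarrow> \<exists>V. open V \<and> z \<in> V \<and> holomorphic2_on f (W \<inter> V)"
  shows "holomorphic2_on f W"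
  unfolding holomorphic2_on_def
proof
  fix z assume z: "z \<in> W"
  then obtain V where V: "open V" "z \<in> V" "holomorphic2_on f (W \<inter> V)" using assms by blast
  have "z \<in> W \<inter> V" using z V by simp
  then obtain a b where "(f has_derivative (\<lambda>(v, w). a * v + b * w)) (at z within W \<inter> V)"
    using V(3) unfolding holomorphic2_on_def by blast
  then have "(f has_derivative (\<lambda>(v, w). a * v + b * w)) (at z within W)"
    using at_within_nhd[OF V(2,1), of W "W \<inter> V"] by (simp add: Int_assoc)
  then show "\<exists>a b. (f has_derivative (\<lambda>(v, w). a * v + b * w)) (at z within W)" by blast
qed

lemma holomorphic2_on_imp_continuous_on: "holomorphic2_on f W \<Longrightarrow> continuous_on W f"
  unfolding holomorphic2_on_def continuous_on_eq_continuous_within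
  using has_derivative_continuous by blast

lemma holomorphic2_onI:
  "(\<And>z. z \<in> W \<Longrightarrow> (f has_derivative (\<lambda>(v, w). a z * v + b z * w)) (at z within W)) \<Longrightarrow> holomorphic2_on f W"
  unfolding holomorphic2_on_def by blast

lemma holomorphic2_onE:
  assumes "holomorphic2_on f W"
  obtains a b where "\<And>z. z \<in> W \<Longrightarrow> (f has_derivative (\<lambda>(v, w). a z * v + b z * w)) (at z within W)"
proof -
  have "\<forall>z\<in>W. \<exists>a b. (f has_derivative (\<lambda>(v, w). a * v + b * w)) (at z within W)"
    using assms by (simp add: holomorphic2_on_def)
  then have "\<exists>a b. \<forall>z\<in>W. (f has_derivative (\<lambda>(v, w). a z * v + b z * w)) (at z within W)"
    unfolding bchoice_iff by simp
  then show ?thesis using that by blast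
qed

lemma holomorphic2_on_const: "holomorphic2_on (\<lambda>_. c) W"
  by (rule holomorphic2_onI[of W _ "\<lambda>_. 0" "\<lambda>_. 0"]) (simp add: case_prod_unfold)

lemma holomorphic2_on_fst: "holomorphic2_on fst W"
  by (rule holomorphic2_onI[of W _ "\<lambda>_. 1" "\<lambda>_. 0"])
     (auto simp: case_prod_unfold intro!: derivative_eq_intros)

lemma holomorphic2_on_snd: "holomorphic2_on snd W"
  by (rule holomorphic2_onI[of W _ "\<lambda>_. 0" "\<lambda>_. 1"])
     (auto simp: case_prod_unfold intro!: derivative_eq_intros)

lemma holomorphic2_on_add:
  assumes "holomorphic2_on f W" "holomorphic2_on g W"
  shows "holomorphic2_on (\<lambda>z. f z + g z) W"
proof -
  obtain a b where f: "\<And>z. z \<in> W \<Longrightarrow> (f has_derivative (\<lambda>(v, w). a z * v + b z * w)) (at z within W)"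
    using holomorphic2_onE[OF assms(1)] by metis
  obtain c d where g: "\<And>z. z \<in> W \<Longrightarrow> (g has_derivative (\<lambda>(v, w). c z * v + d z * w)) (at z within W)"
    using holomorphic2_onE[OF assms(2)] by metis
  show ?thesis
  proof (rule holomorphic2_onI[of W _ "\<lambda>z. a z + c z" "\<lambda>z. b z + d z"])
    fix z assume z: "z \<in> W"
    show "((\<lambda>z. f z + g z) has_derivative (\<lambda>(v, w). (a z + c z) * v + (b z + d z) * w)) (at z within W)"
      by (rule has_derivative_eq_rhs[OF has_derivative_add[OF f[OF z] g[OF z]]])
         (auto simp: fun_eq_iff algebra_simps)
  qed
qed

lemma holomorphic2_on_mult:
  assumes "holomorphic2_on f W" "holomorphic2_on g W"
  shows "holomorphic2_on (\<lambda>z. f z * g z) W"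
proof -
  obtain a b where f: "\<And>z. z \<in> W \<Longrightarrow> (f has_derivative (\<lambda>(v, w). a z * v + b z * w)) (at z within W)"
    using holomorphic2_onE[OF assms(1)] by metis
  obtain c d where g: "\<And>z. z \<in> W \<Longrightarrow> (g has_derivative (\<lambda>(v, w). c z * v + d z * w)) (at z within W)"
    using holomorphic2_onE[OF assms(2)] by metis
  show ?thesis
  proof (rule holomorphic2_onI[of W _ "\<lambda>z. f z * c z + a z * g z" "\<lambda>z. f z * d z + b z * g z"])
    fix z assume z: "z \<in> W"
    show "((\<lambda>z. f z * g z) has_derivative (\<lambda>(v, w). (f z * c z + a z * g z) * v + (f z * d z + b z * g z) * w)) (at z within W)"
      by (rule has_derivative_eq_rhs[OF has_derivative_mult[OF f[OF z] g[OF z]]])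
         (auto simp: fun_eq_iff algebra_simps)
  qed
qed

lemma holomorphic2_on_comp:
  assumes "holomorphic2_on f W" "g holomorphic_on S" "open S" "f ` W \<subseteq> S"
  shows "holomorphic2_on (\<lambda>z. g (f z)) W"
proof -
  obtain a b where f: "\<And>z. z \<in> W \<Longrightarrow> (f has_derivative (\<lambda>(v, w). a z * v + b z * w)) (at z within W)"
    using holomorphic2_onE[OF assms(1)] by metis
  show ?thesis
  proof (rule holomorphic2_onI[of W _ "\<lambda>z. deriv g (f z) * a z" "\<lambda>z. deriv g (f z) * b z"])
    fix z assume z: "z \<in> W"
    have "(g has_field_derivative deriv g (f z)) (at (f z))"
      using assms z by (intro holomorphic_derivI[of g S]) auto
    then have "(g has_derivative (\<lambda>h. deriv g (f z) * h)) (at (f z))"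
      by (simp add: has_field_derivative_def)
    from has_derivative_compose[OF f[OF z] this]
    show "((\<lambda>z. g (f z)) has_derivative (\<lambda>(v, w). deriv g (f z) * a z * v + deriv g (f z) * b z * w)) (at z within W)"
      by (rule has_derivative_eq_rhs) (auto simp: fun_eq_iff algebra_simps)
  qed
qed

lemma holomorphic2_on_inverse:
  assumes "holomorphic2_on f W" "\<And>z. z \<in> W \<Longrightarrow> f z \<noteq> 0"
  shows "holomorphic2_on (\<lambda>z. inverse (f z)) W"
  by (rule holomorphic2_on_comp[OF assms(1), of inverse "- {0}"])
     (use assms(2) in \<open>auto intro!: holomorphic_intros\<close>)

lemma holomorphic2_on_divide:
  assumes "holomorphic2_on f W" "holomorphic2_on g W" "\<And>z. z \<in> W \<Longrightarrow> g z \<noteq> 0"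
  shows "holomorphic2_on (\<lambda>z. f z / g z) W"
  unfolding divide_inverse
  using assms by (intro holomorphic2_on_mult holomorphic2_on_inverse)

lemma holomorphic2_on_power: "holomorphic2_on f W \<Longrightarrow> holomorphic2_on (\<lambda>z. f z ^ n) W"
  by (induction n) (auto intro: holomorphic2_on_const holomorphic2_on_mult)

lemma holomorphic2_on_prod:
  "(\<And>i. i \<in> I \<Longrightarrow> holomorphic2_on (f i) W) \<Longrightarrow> holomorphic2_on (\<lambda>z. \<Prod>i\<in>I. f i z) W"
  by (induction I rule: infinite_finite_induct)
     (auto intro: holomorphic2_on_const holomorphic2_on_mult)

lemma holomorphic2_on_uminus: "holomorphic2_on f W \<Longrightarrow> holomorphic2_on (\<lambda>z. - f z) W"
  using holomorphic2_on_mult[OF holomorphic2_on_const[of "-1"]] by simp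

lemma holomorphic2_on_diff:
  "holomorphic2_on f W \<Longrightarrow> holomorphic2_on g W \<Longrightarrow> holomorphic2_on (\<lambda>z. f z - g z) W"
  using holomorphic2_on_add[OF _ holomorphic2_on_uminus, of f W g] by simp

lemma holomorphic2_on_map:
  assumes "holomorphic2_on p W" "holomorphic2_on q W" "holomorphic2_on f V"
    "\<And>z. z \<in> W \<Longrightarrow> (p z, q z) \<in> V"
  shows "holomorphic2_on (\<lambda>z. f (p z, q z)) W"
proof -
  obtain a b where p: "\<And>z. z \<in> W \<Longrightarrow> (p has_derivative (\<lambda>(v, w). a z * v + b z * w)) (at z within W)"
    using holomorphic2_onE[OF assms(1)] by metis
  obtain c d where q: "\<And>z. z \<in> W \<Longrightarrow> (q has_derivative (\<lambda>(v, w). c z * v + d z * w)) (at z within W)"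
    using holomorphic2_onE[OF assms(2)] by metis
  obtain r s where f: "\<And>z. z \<in> V \<Longrightarrow> (f has_derivative (\<lambda>(v, w). r z * v + s z * w)) (at z within V)"
    using holomorphic2_onE[OF assms(3)] by metis
  show ?thesis
  proof (rule holomorphic2_onI[of W _ "\<lambda>z. r (p z, q z) * a z + s (p z, q z) * c z"
        "\<lambda>z. r (p z, q z) * b z + s (p z, q z) * d z"])
    fix z assume z: "z \<in> W"
    have "(f has_derivative (\<lambda>(v, w). r (p z, q z) * v + s (p z, q z) * w))
        (at (p z, q z) within (\<lambda>z. (p z, q z)) ` W)"
      using f[OF assms(4)[OF z]] by (rule has_derivative_subset) (use assms(4) in auto)
    from has_derivative_in_compose[OF has_derivative_Pair[OF p[OF z] q[OF z]] this]
    show "((\<lambda>z. f (p z, q z)) has_derivative (\<lambda>(v, w). (r (p z, q z) * a z + s (p z, q z) * c z) * v +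
        (r (p z, q z) * b z + s (p z, q z) * d z) * w)) (at z within W)"
      by (rule has_derivative_eq_rhs) (auto simp: fun_eq_iff algebra_simps)
  qed
qed

lemma holomorphic2_on_curve:
  assumes "holomorphic2_on f W" "open W" "p holomorphic_on S" "q holomorphic_on S" "open S"
    "\<And>t. t \<in> S \<Longrightarrow> (p t, q t) \<in> W"
  shows "(\<lambda>t. f (p t, q t)) holomorphic_on S"
proof -
  have "\<exists>d. ((\<lambda>t. f (p t, q t)) has_field_derivative d) (at t)" if t: "t \<in> S" for t
  proof -
    have p: "(p has_derivative (\<lambda>h. deriv p t * h)) (at t)" and q: "(q has_derivative (\<lambda>h. deriv q t * h)) (at t)"
      using holomorphic_derivI[OF assms(3,5) t] holomorphic_derivI[OF assms(4,5) t]
      by (simp_all add: has_field_derivative_def)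
    obtain a b where f: "(f has_derivative (\<lambda>(v, w). a * v + b * w)) (at (p t, q t))"
      using assms(1) assms(6)[OF t] unfolding holomorphic2_on_open[OF assms(2)] by blast
    have "((\<lambda>t. f (p t, q t)) has_derivative (\<lambda>h. (a * deriv p t + b * deriv q t) * h)) (at t)"
      by (rule has_derivative_eq_rhs[OF has_derivative_compose[OF has_derivative_Pair[OF p q] f]])
         (auto simp: fun_eq_iff algebra_simps)
    then show ?thesis unfolding has_field_derivative_def by blast
  qed
  then show ?thesis using assms(5) by (simp add: holomorphic_on_open)
qed

text \<open>Osgood's lemma: the partial derivative is jointly continuous by Cauchy's estimate.\<close>

lemma osgood:
  fixes f :: "complex \<times> complex \<Rightarrow> complex"
  assumes W: "open W" and cont: "continuous_on W f"
    and hol1: "\<And>a b. (a, b) \<in> W \<Longrightarrow> (\<lambda>x. f (x, b)) field_differentiable (at a)"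
    and hol2: "\<And>a b. (a, b) \<in> W \<Longrightarrow> (\<lambda>y. f (a, y)) field_differentiable (at b)"
  shows "holomorphic2_on f W"
  unfolding holomorphic2_on_open[OF W]
proof (clarify)
  fix a b assume ab: "(a, b) \<in> W"
  obtain A B where AB: "open A" "open B" "(a, b) \<in> A \<times> B" "A \<times> B \<subseteq> W"
    using W ab open_prod_elim by blast
  obtain r1 where r1: "r1 > 0" "cball a r1 \<subseteq> A" using AB open_contains_cball by (metis mem_Sigma_iff)
  obtain r2 where r2: "r2 > 0" "cball b r2 \<subseteq> B" using AB open_contains_cball by (metis mem_Sigma_iff)
  define r where "r = min r1 r2"
  have r: "r > 0" "cball a r \<times> cball b r \<subseteq> W"
  proof -
    show "r > 0" using r1 r2 by (simp add: r_def)
    have "cball a r \<subseteq> A" "cball b r \<subseteq> B" using r1 r2 by (auto simp: r_def)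
    then show "cball a r \<times> cball b r \<subseteq> W" using AB(4) by blast
  qed
  let ?K = "cball a r \<times> cball b r"
  have ucont: "uniformly_continuous_on ?K f"
    using cont r(2) by (intro compact_uniformly_continuous compact_Times compact_cball) (rule continuous_on_subset)
  define g where "g x y = deriv (\<lambda>y. f (x, y)) y" for x y
  have inW: "(x, y) \<in> W" if "x \<in> cball a r" "y \<in> cball b r" for x y using r that by blast
  have dy: "((\<lambda>y. f (x, y)) has_field_derivative g x y) (at y)" if "x \<in> cball a r" "y \<in> cball b r" for x y
    using hol2[OF inW[OF that]] by (simp add: g_def DERIV_deriv_iff_field_differentiable)
  have holy: "(\<lambda>y. f (x, y)) holomorphic_on ball b r" if "x \<in> cball a r" for x
    using dy[OF that] unfolding holomorphic_on_open[OF open_ball] by (meson ball_subset_cball subsetD)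
  have gcont: "continuous (at (a, b) within ball a r \<times> ball b (r/2)) (\<lambda>(x, y). g x y)"
    unfolding continuous_within_eps_delta
  proof (intro allI impI)
    fix e :: real assume e: "e > 0"
    have "continuous_on (ball b r) (deriv (\<lambda>y. f (a, y)))"
      using holy[of a] r by (intro holomorphic_on_imp_continuous_on holomorphic_deriv) auto
    then have "isCont (\<lambda>y. g a y) b" unfolding g_def using r by (simp add: continuous_on_eq_continuous_at)
    then obtain d1 where d1: "d1 > 0" "\<And>y. dist y b < d1 \<Longrightarrow> dist (g a y) (g a b) < e / 2"
      unfolding continuous_at_eps_delta using e by (metis half_gt_zero)
    \<comment> \<open>Cauchy's estimate on a circle of radius r/4 turns the bound e r/8 for f(x, w)
      - f(a, w) into e/2 for the difference of the derivatives.\<close>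
    obtain d2 where d2: "d2 > 0" "\<And>p p'. p \<in> ?K \<Longrightarrow> p' \<in> ?K \<Longrightarrow> dist p' p < d2 \<Longrightarrow> dist (f p') (f p) < e * r / 8"
      using ucont e r unfolding uniformly_continuous_on_def by (metis divide_pos_pos mult_pos_pos zero_less_numeral)
    have "dist (g x y) (g a b) < e" if x: "x \<in> ball a r" and y: "y \<in> ball b (r/2)" and d: "dist (x, y) (a, b) < min d1 d2" for x y
    proof -
      have dx: "dist x a < d2" using d dist_fst_le[of "(x, y)" "(a, b)"] by simp
      have dyb: "dist y b < d1" using d dist_snd_le[of "(x, y)" "(a, b)"] by simp
      have sub: "cball y (r/4) \<subseteq> ball b r"
      proof
        fix w assume "w \<in> cball y (r/4)"
        then show "w \<in> ball b r" using y r dist_triangle[of b w y] by simp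
      qed
      let ?h = "\<lambda>w. f (x, w) - f (a, w)"
      have hh: "?h holomorphic_on ball b r" using x r by (intro holomorphic_intros holy) auto
      have "cmod ((deriv ^^ 1) ?h y) \<le> fact 1 * (e * r / 8) / (r/4) ^ 1"
      proof (rule Cauchy_inequality)
        show "?h holomorphic_on ball y (r/4)" using hh sub ball_subset_cball holomorphic_on_subset by blast
        show "continuous_on (cball y (r/4)) ?h" using hh sub holomorphic_on_imp_continuous_on holomorphic_on_subset by blast
        fix w assume "cmod (y - w) = r/4"
        then have "w \<in> cball y (r/4)" by (simp add: dist_norm)
        then have w: "w \<in> cball b r" using sub ball_subset_cball by blast
        have "dist (f (x, w)) (f (a, w)) < e * r / 8"
        proof (rule d2(2))
          show "dist (x, w) (a, w) < d2" using dx by (simp add: dist_Pair_Pair)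
        qed (use w x r in auto)
        then show "cmod (?h w) \<le> e * r / 8" by (simp add: dist_norm)
      qed (use r in auto)
      then have "cmod (deriv ?h y) \<le> e / 2" using r by simp
      moreover have "deriv ?h y = g x y - g a y"
        using x y r by (intro DERIV_imp_deriv DERIV_diff dy) auto
      ultimately have "dist (g x y) (g a y) \<le> e / 2" by (simp add: dist_norm)
      then show ?thesis using d1(2)[OF dyb] dist_triangle[of "g x y" "g a b" "g a y"] by linarith
    qed
    then show "\<exists>d>0. \<forall>p\<in>ball a r \<times> ball b (r/2). dist p (a, b) < d \<longrightarrow>
        dist (case p of (x, y) \<Rightarrow> g x y) (case (a, b) of (x, y) \<Rightarrow> g x y) < e"
      using d1 d2 by (intro exI[of _ "min d1 d2"]) auto
  qed
  have "((\<lambda>(x, y). f (x, y)) has_derivative (\<lambda>(tx, ty). deriv (\<lambda>x. f (x, b)) a * tx + blinfun_mult_right (g a b) ty))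
      (at (a, b) within ball a r \<times> ball b (r/2))"
  proof (rule has_derivative_partialsI)
    have "((\<lambda>x. f (x, b)) has_derivative (\<lambda>h. deriv (\<lambda>x. f (x, b)) a * h)) (at a)"
      using hol1[OF ab] by (simp add: has_field_derivative_def[symmetric] DERIV_deriv_iff_field_differentiable)
    then show "((\<lambda>x. f (x, b)) has_derivative (\<lambda>h. deriv (\<lambda>x. f (x, b)) a * h)) (at a within ball a r)"
      by (rule has_derivative_at_withinI)
    show "((\<lambda>y. f (x, y)) has_derivative blinfun_apply (blinfun_mult_right (g x y))) (at y within ball b (r/2))"
      if "x \<in> ball a r" "y \<in> ball b (r/2)" for x y
      using dy[of x y] that r by (auto simp: has_field_derivative_def intro!: has_derivative_at_withinI)
    show "continuous (at (a, b) within ball a r \<times> ball b (r/2)) (\<lambda>(x, y). blinfun_mult_right (g x y))"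
      using bounded_linear.continuous[OF bounded_linear_blinfun_mult_right gcont]
      by (simp add: case_prod_unfold)
  qed (use r in auto)
  moreover have "at (a, b) within ball a r \<times> ball b (r/2) = at (a, b)"
    using r by (intro at_within_open) (auto intro: open_Times)
  ultimately have "(f has_derivative (\<lambda>(v, w). deriv (\<lambda>x. f (x, b)) a * v + g a b * w)) (at (a, b))"
    by (simp add: case_prod_unfold)
  then show "\<exists>c d. (f has_derivative (\<lambda>(v, w). c * v + d * w)) (at (a, b))" by blast
qed

lemma holomorphic2_slices:
  assumes W: "open W" and hol: "holomorphic2_on f W" and ab: "(a, b) \<in> W"
  shows "(\<lambda>x. f (x, b)) field_differentiable (at a)" "(\<lambda>y. f (a, y)) field_differentiable (at b)"
proof -
  obtain A B where AB: "open A" "open B" "(a, b) \<in> A \<times> B" "A \<times> B \<subseteq> W"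
    using W ab open_prod_elim by blast
  have "(\<lambda>x. f (x, b)) holomorphic_on A"
    using AB by (intro holomorphic2_on_curve[OF hol W]) (auto intro!: holomorphic_intros)
  then show "(\<lambda>x. f (x, b)) field_differentiable (at a)"
    using AB by (auto simp: holomorphic_on_imp_differentiable_at)
  have "(\<lambda>y. f (a, y)) holomorphic_on B"
    using AB by (intro holomorphic2_on_curve[OF hol W]) (auto intro!: holomorphic_intros)
  then show "(\<lambda>y. f (a, y)) field_differentiable (at b)"
    using AB by (auto simp: holomorphic_on_imp_differentiable_at)
qed

text \<open>Continuity and holomorphy in each variable separately pass to the limit by the theorems
  in one variable; \<open>osgood\<close> puts them together.\<close>

lemma holomorphic2_uniform_limit:
  fixes f :: "nat \<Rightarrow> complex \<times> complex \<Rightarrow> complex"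
  assumes W: "open W" and hol: "\<And>n. holomorphic2_on (f n) W"
    and lim: "\<And>z. z \<in> W \<Longrightarrow> \<exists>r>0. cball z r \<subseteq> W \<and> uniform_limit (cball z r) f g sequentially"
  shows "holomorphic2_on g W"
proof (rule osgood[OF W])
  have "isCont g z" if z: "z \<in> W" for z
  proof -
    obtain r where r: "r > 0" "cball z r \<subseteq> W" "uniform_limit (cball z r) f g sequentially" using lim[OF z] by blast
    have "continuous_on (cball z r) g"
    proof (rule uniform_limit_theorem[OF _ r(3)])
      show "\<forall>\<^sub>F n in sequentially. continuous_on (cball z r) (f n)"
        using holomorphic2_on_imp_continuous_on[OF hol] r(2) by (intro always_eventually allI) (rule continuous_on_subset)
    qed auto
    then have "continuous_on (ball z r) g" by (rule continuous_on_subset) auto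
    then show ?thesis using r(1) by (simp add: continuous_on_eq_continuous_at)
  qed
  then show "continuous_on W g" by (simp add: continuous_on_eq_continuous_at W)
next
  fix a b assume ab: "(a, b) \<in> W"
  obtain r where r: "r > 0" "cball (a, b) r \<subseteq> W" "uniform_limit (cball (a, b) r) f g sequentially" using lim[OF ab] by blast
  have s1: "(x, b) \<in> cball (a, b) r" if "x \<in> cball a r" for x using that by (simp add: dist_Pair_Pair)
  have s2: "(a, y) \<in> cball (a, b) r" if "y \<in> cball b r" for y using that by (simp add: dist_Pair_Pair)
  have u1: "uniform_limit (cball a r) (\<lambda>n x. f n (x, b)) (\<lambda>x. g (x, b)) sequentially"
  proof (rule uniform_limitI)
    fix e :: real assume "e > 0"
    from uniform_limitD[OF r(3) this]
    have "\<forall>\<^sub>F n in sequentially. \<forall>z\<in>cball (a, b) r. dist (f n z) (g z) < e" .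
    then show "\<forall>\<^sub>F n in sequentially. \<forall>x\<in>cball a r. dist (f n (x, b)) (g (x, b)) < e"
      by (rule eventually_mono) (use s1 in blast)
  qed
  have u2: "uniform_limit (cball b r) (\<lambda>n y. f n (a, y)) (\<lambda>y. g (a, y)) sequentially"
  proof (rule uniform_limitI)
    fix e :: real assume "e > 0"
    from uniform_limitD[OF r(3) this]
    have "\<forall>\<^sub>F n in sequentially. \<forall>z\<in>cball (a, b) r. dist (f n z) (g z) < e" .
    then show "\<forall>\<^sub>F n in sequentially. \<forall>y\<in>cball b r. dist (f n (a, y)) (g (a, y)) < e"
      by (rule eventually_mono) (use s2 in blast)
  qed
  have c1: "(\<lambda>x. f n (x, b)) field_differentiable (at x)" if "x \<in> cball a r" for x n
    using holomorphic2_slices(1)[OF W hol, of x b n] s1[OF that] r(2) by blast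
  have c2: "(\<lambda>y. f n (a, y)) field_differentiable (at y)" if "y \<in> cball b r" for y n
    using holomorphic2_slices(2)[OF W hol, of a y n] s2[OF that] r(2) by blast
  have "(\<lambda>x. g (x, b)) holomorphic_on ball a r"
  proof (rule holomorphic_uniform_limit[OF _ u1])
    show "\<forall>\<^sub>F n in sequentially. continuous_on (cball a r) (\<lambda>x. f n (x, b)) \<and> (\<lambda>x. f n (x, b)) holomorphic_on ball a r"
    proof (intro always_eventually allI conjI)
      fix n
      have h: "(\<lambda>x. f n (x, b)) holomorphic_on cball a r"
        unfolding holomorphic_on_def using c1 field_differentiable_at_within by blast
      show "continuous_on (cball a r) (\<lambda>x. f n (x, b))" by (rule holomorphic_on_imp_continuous_on[OF h])
      show "(\<lambda>x. f n (x, b)) holomorphic_on ball a r" by (rule holomorphic_on_subset[OF h ball_subset_cball])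
    qed
  qed auto
  then show "(\<lambda>x. g (x, b)) field_differentiable (at a)"
    using r by (auto simp: holomorphic_on_imp_differentiable_at)
  have "(\<lambda>y. g (a, y)) holomorphic_on ball b r"
  proof (rule holomorphic_uniform_limit[OF _ u2])
    show "\<forall>\<^sub>F n in sequentially. continuous_on (cball b r) (\<lambda>y. f n (a, y)) \<and> (\<lambda>y. f n (a, y)) holomorphic_on ball b r"
    proof (intro always_eventually allI conjI)
      fix n
      have h: "(\<lambda>y. f n (a, y)) holomorphic_on cball b r"
        unfolding holomorphic_on_def using c2 field_differentiable_at_within by blast
      show "continuous_on (cball b r) (\<lambda>y. f n (a, y))" by (rule holomorphic_on_imp_continuous_on[OF h])
      show "(\<lambda>y. f n (a, y)) holomorphic_on ball b r" by (rule holomorphic_on_subset[OF h ball_subset_cball])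
    qed
  qed auto
  then show "(\<lambda>y. g (a, y)) field_differentiable (at b)"
    using r by (auto simp: holomorphic_on_imp_differentiable_at)
qed

section \<open>Infinite products of holomorphic functions\<close>

lemma convergent_prod_1_minus:
  fixes q :: "nat \<Rightarrow> complex"
  assumes "summable M" "\<And>k. norm (q k) \<le> M k"
  shows "convergent_prod (\<lambda>k. 1 - q k)" "(\<lambda>n. \<Prod>k<n. 1 - q k) \<longlonglongrightarrow> prodinf (\<lambda>k. 1 - q k)"
    "prodinf (\<lambda>k. 1 - q k) = 0 \<longleftrightarrow> (\<exists>k. q k = 1)"
proof -
  have "summable (\<lambda>k. norm (q k))"
    using assms by (intro summable_comparison_test'[OF assms(1), of 0]) auto
  then have "summable (\<lambda>k. norm ((1 - q k) - 1))" by simp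
  then have "abs_convergent_prod (\<lambda>k. 1 - q k)" by (rule summable_imp_abs_convergent_prod)
  then show c: "convergent_prod (\<lambda>k. 1 - q k)" by (rule abs_convergent_prod_imp_convergent_prod)
  show "(\<lambda>n. \<Prod>k<n. 1 - q k) \<longlonglongrightarrow> prodinf (\<lambda>k. 1 - q k)"
    using convergent_prod_LIMSEQ[OF c] by (subst LIMSEQ_lessThan_iff_atMost)
  show "prodinf (\<lambda>k. 1 - q k) = 0 \<longleftrightarrow> (\<exists>k. q k = 1)"
  proof
    assume "prodinf (\<lambda>k. 1 - q k) = 0"
    then show "\<exists>k. q k = 1" using prodinf_nonzero[OF c] by force
  next
    assume "\<exists>k. q k = 1"
    then obtain k where k: "1 - q k = 0" by auto
    then have "eventually (\<lambda>n. (\<Prod>k<n. 1 - q k) = 0) sequentially"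
      unfolding eventually_sequentially by (intro exI[of _ "Suc k"]) auto
    then have "(\<lambda>n. \<Prod>k<n. 1 - q k) \<longlonglongrightarrow> 0" by (rule tendsto_eventually)
    then show "prodinf (\<lambda>k. 1 - q k) = 0"
      using \<open>(\<lambda>n. \<Prod>k<n. 1 - q k) \<longlonglongrightarrow> prodinf (\<lambda>k. 1 - q k)\<close> LIMSEQ_unique by blast
  qed
qed

text \<open>Normal convergence, stated with a summable majorant on a closed ball around each point.
  It makes the product of the 1 - q k holomorphic and lets it vanish exactly where some factor
  does.\<close>

definition loc_summable :: "(nat \<Rightarrow> complex \<times> complex \<Rightarrow> complex) \<Rightarrow> (complex \<times> complex) set \<Rightarrow> bool" where
  "loc_summable q W \<longleftrightarrow> (\<forall>z\<in>W. \<exists>r>0. \<exists>M. cball z r \<subseteq> W \<and> summable M \<and> (\<forall>k. \<forall>w\<in>cball z r. norm (q k w) \<le> M k))"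

lemma loc_summableD:
  assumes "loc_summable q W" "z \<in> W"
  shows "convergent_prod (\<lambda>k. 1 - q k z)" "(\<lambda>n. \<Prod>k<n. 1 - q k z) \<longlonglongrightarrow> prodinf (\<lambda>k. 1 - q k z)"
    "prodinf (\<lambda>k. 1 - q k z) = 0 \<longleftrightarrow> (\<exists>k. q k z = 1)"
proof -
  obtain r M where M: "r > 0" "summable M" "\<forall>k. \<forall>w\<in>cball z r. norm (q k w) \<le> M k"
    using assms by (auto simp: loc_summable_def)
  have le: "norm (q k z) \<le> M k" for k using M by simp
  show "convergent_prod (\<lambda>k. 1 - q k z)" "(\<lambda>n. \<Prod>k<n. 1 - q k z) \<longlonglongrightarrow> prodinf (\<lambda>k. 1 - q k z)"
    "prodinf (\<lambda>k. 1 - q k z) = 0 \<longleftrightarrow> (\<exists>k. q k z = 1)"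
    using convergent_prod_1_minus[OF M(2), of "\<lambda>k. q k z"] le by blast+
qed

lemma holomorphic2_on_prodinf:
  assumes W: "open W" and hol: "\<And>k. holomorphic2_on (q k) W" and ls: "loc_summable q W"
  shows "holomorphic2_on (\<lambda>z. prodinf (\<lambda>k. 1 - q k z)) W"
proof (rule holomorphic2_uniform_limit[OF W, of "\<lambda>n z. \<Prod>k<n. 1 - q k z"])
  show "holomorphic2_on (\<lambda>z. \<Prod>k<n. 1 - q k z) W" for n
    by (intro holomorphic2_on_prod holomorphic2_on_diff holomorphic2_on_const hol)
  fix z assume z: "z \<in> W"
  obtain r M where M: "r > 0" "cball z r \<subseteq> W" "summable M" "\<forall>k. \<forall>w\<in>cball z r. norm (q k w) \<le> M k"
    using ls z unfolding loc_summable_def by meson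
  have sums: "uniformly_convergent_on (cball z r) (\<lambda>N w. \<Sum>k<N. norm (- q k w))"
    by (rule Weierstrass_m_test'[OF _ M(3)]) (use M in auto)
  have "uniformly_convergent_on (cball z r) (\<lambda>N w. \<Prod>k<N. 1 + (\<lambda>k w. - q k w) k w)"
  proof (rule Infinite_Products.uniformly_convergent_on_prod)
    fix k show "continuous_on (cball z r) (\<lambda>w. - q k w)"
      by (rule continuous_on_minus[OF continuous_on_subset[OF holomorphic2_on_imp_continuous_on[OF hol] M(2)]])
  qed (use sums in auto)
  then have "uniformly_convergent_on (cball z r) (\<lambda>N w. \<Prod>k<N. 1 - q k w)" by simp
  then obtain l where l: "uniform_limit (cball z r) (\<lambda>N w. \<Prod>k<N. 1 - q k w) l sequentially"
    by (auto simp: uniformly_convergent_on_def)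
  have lw: "l w = prodinf (\<lambda>k. 1 - q k w)" if w: "w \<in> cball z r" for w
  proof (rule LIMSEQ_unique)
    show "(\<lambda>N. \<Prod>k<N. 1 - q k w) \<longlonglongrightarrow> l w" using tendsto_uniform_limitI[OF l w] .
    show "(\<lambda>N. \<Prod>k<N. 1 - q k w) \<longlonglongrightarrow> prodinf (\<lambda>k. 1 - q k w)"
      by (rule loc_summableD(2)[OF ls subsetD[OF M(2) w]])
  qed
  have ul: "uniform_limit (cball z r) (\<lambda>N w. \<Prod>k<N. 1 - q k w) (\<lambda>w. prodinf (\<lambda>k. 1 - q k w)) sequentially"
  proof (rule uniform_limitI)
    fix e :: real assume "e > 0"
    from uniform_limitD[OF l this]
    show "\<forall>\<^sub>F N in sequentially. \<forall>w\<in>cball z r. dist (\<Prod>k<N. 1 - q k w) (prodinf (\<lambda>k. 1 - q k w)) < e"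
      by (rule eventually_mono) (simp add: lw)
  qed
  from conjI[OF M(1) conjI[OF M(2) ul]]
  show "\<exists>r>0. cball z r \<subseteq> W \<and> uniform_limit (cball z r) (\<lambda>N w. \<Prod>k<N. 1 - q k w) (\<lambda>w. prodinf (\<lambda>k. 1 - q k w)) sequentially"
    by (rule exI)
qed

text \<open>Replacing \<open>q j\<close> by 0 turns the j-th factor into 1, which splits a factor
  off without renumbering the others.\<close>

lemma loc_summable_remove: "loc_summable q W \<Longrightarrow> loc_summable (q(j := (\<lambda>_. 0))) W"
  unfolding loc_summable_def
proof
  fix z assume *: "\<forall>z\<in>W. \<exists>r>0. \<exists>M. cball z r \<subseteq> W \<and> summable M \<and> (\<forall>k. \<forall>w\<in>cball z r. norm (q k w) \<le> M k)" and "z \<in> W"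
  from bspec[OF this] obtain r M where M: "r > 0" "cball z r \<subseteq> W" "summable M" "\<forall>k. \<forall>w\<in>cball z r. norm (q k w) \<le> M k"
    by (elim exE conjE)
  have "0 \<le> M k" for k
  proof -
    have "z \<in> cball z r" using M(1) by simp
    then have "norm (q k z) \<le> M k" using M(4) by simp
    then show ?thesis using norm_ge_zero order_trans by blast
  qed
  then show "\<exists>r>0. \<exists>M. cball z r \<subseteq> W \<and> summable M \<and> (\<forall>k. \<forall>w\<in>cball z r. norm ((q(j := (\<lambda>_. 0))) k w) \<le> M k)"
    using M by (intro exI[of _ r] conjI exI[of _ M]) auto
qed

lemma prodinf_extract:
  assumes "loc_summable q W" "z \<in> W"
  shows "prodinf (\<lambda>k. 1 - q k z) = (1 - q j z) * prodinf (\<lambda>k. 1 - (q(j := (\<lambda>_. 0))) k z)"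
proof (rule LIMSEQ_unique)
  show "(\<lambda>n. \<Prod>k<n. 1 - q k z) \<longlonglongrightarrow> prodinf (\<lambda>k. 1 - q k z)" by (rule loc_summableD(2)[OF assms])
  have "(\<lambda>n. (1 - q j z) * (\<Prod>k<n. 1 - (q(j := (\<lambda>_. 0))) k z)) \<longlonglongrightarrow>
      (1 - q j z) * prodinf (\<lambda>k. 1 - (q(j := (\<lambda>_. 0))) k z)"
    by (intro tendsto_mult_left loc_summableD(2)[OF loc_summable_remove[OF assms(1)] assms(2)])
  moreover have "eventually (\<lambda>n. (1 - q j z) * (\<Prod>k<n. 1 - (q(j := (\<lambda>_. 0))) k z) = (\<Prod>k<n. 1 - q k z)) sequentially"
    unfolding eventually_sequentially
  proof (intro exI[of _ "Suc j"] allI impI)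
    fix n assume n: "Suc j \<le> n"
    have "(\<Prod>k<n. 1 - q k z) = (1 - q j z) * (\<Prod>k\<in>{..<n} - {j}. 1 - q k z)"
      using n by (intro prod.remove) auto
    also have "(\<Prod>k\<in>{..<n} - {j}. 1 - q k z) = (\<Prod>k\<in>{..<n} - {j}. 1 - (q(j := (\<lambda>_. 0))) k z)"
      by (intro prod.cong) auto
    also have "\<dots> = (\<Prod>k<n. 1 - (q(j := (\<lambda>_. 0))) k z)"
      using n by (subst (2) prod.remove[of _ j]) auto
    finally show "(1 - q j z) * (\<Prod>k<n. 1 - (q(j := (\<lambda>_. 0))) k z) = (\<Prod>k<n. 1 - q k z)" by simp
  qed
  ultimately show "(\<lambda>n. \<Prod>k<n. 1 - q k z) \<longlonglongrightarrow> (1 - q j z) * prodinf (\<lambda>k. 1 - (q(j := (\<lambda>_. 0))) k z)"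
    by (rule Lim_transform_eventually)
qed

lemma norm_prodinf_le:
  fixes q :: "nat \<Rightarrow> complex"
  assumes "summable M" "\<And>k. norm (q k) \<le> M k"
  shows "norm (prodinf (\<lambda>k. 1 - q k)) \<le> exp (suminf M)"
proof -
  have M0: "0 \<le> M k" for k using assms(2) norm_ge_zero order_trans by blast
  have "(\<lambda>n. norm (\<Prod>k<n. 1 - q k)) \<longlonglongrightarrow> norm (prodinf (\<lambda>k. 1 - q k))"
    by (intro tendsto_norm convergent_prod_1_minus(2)[OF assms])
  moreover have "norm (\<Prod>k<n. 1 - q k) \<le> exp (suminf M)" for n
  proof -
    have "norm (\<Prod>k<n. 1 - q k) \<le> (\<Prod>k<n. exp (M k))"
      unfolding prod_norm[symmetric]
    proof (intro prod_mono conjI norm_ge_zero)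
      fix k
      have "norm (1 - q k) \<le> 1 + norm (q k)" by (metis norm_one norm_triangle_ineq4)
      also have "\<dots> \<le> 1 + M k" using assms(2) by simp
      also have "\<dots> \<le> exp (M k)" by simp
      finally show "norm (1 - q k) \<le> exp (M k)" .
    qed
    also have "\<dots> = exp (\<Sum>k<n. M k)" by (simp add: exp_sum)
    also have "\<dots> \<le> exp (suminf M)" using sum_le_suminf[OF assms(1)] M0 by simp
    finally show ?thesis .
  qed
  ultimately show ?thesis by (intro LIMSEQ_le_const2) auto
qed

text \<open>A quantitative form of divisibility by y - \<phi> x. Cauchy's estimate bounds the
  derivative in y near the point, and the mean value inequality on the vertical segment from (x,
  \<phi> x) to (x, y) does the rest. Orders are bounded from above by means of it.\<close>

lemma vanishing_on_graph_bound:
  assumes W: "open W" "(a, \<phi> a) \<in> W" and g: "holomorphic2_on g W"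
    and \<phi>: "isCont \<phi> a" and S: "open S" "a \<in> S" and van: "\<And>x. x \<in> S \<Longrightarrow> g (x, \<phi> x) = 0"
  obtains K V where "open V" "(a, \<phi> a) \<in> V" "\<And>x y. (x, y) \<in> V \<Longrightarrow> norm (g (x, y)) \<le> K * norm (y - \<phi> x)"
proof -
  define b where "b = \<phi> a"
  obtain A B where AB: "open A" "open B" "(a, b) \<in> A \<times> B" "A \<times> B \<subseteq> W"
    using W open_prod_elim unfolding b_def by blast
  obtain r where r: "r > 0" "cball b r \<subseteq> B" using AB open_contains_cball by (metis mem_Sigma_iff)
  obtain r1 where r1: "r1 > 0" "cball a r1 \<subseteq> A" using AB open_contains_cball by (metis mem_Sigma_iff)
  have "compact (g ` (cball a r1 \<times> cball b r))"
    using r r1 AB(4) by (intro compact_continuous_image continuous_on_subset[OF holomorphic2_on_imp_continuous_on[OF g]] compact_Times) auto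
  then obtain C where C: "\<And>x y. x \<in> cball a r1 \<Longrightarrow> y \<in> cball b r \<Longrightarrow> norm (g (x, y)) \<le> C"
    using compact_imp_bounded bounded_iff by (metis SigmaI imageI)
  obtain d where d: "d > 0" "\<And>x. dist x a < d \<Longrightarrow> dist (\<phi> x) b < r / 2"
    using \<phi> r unfolding continuous_at_eps_delta b_def by (metis half_gt_zero)
  define V where "V = (S \<inter> ball a (min d r1)) \<times> ball b (r/2)"
  show ?thesis
  proof (rule that)
    show "open V" unfolding V_def using S by (intro open_Times open_Int) auto
    show "(a, \<phi> a) \<in> V" using S d r r1 by (simp add: V_def b_def)
    fix x y assume "(x, y) \<in> V"
    then have x: "x \<in> S" "x \<in> cball a r1" "dist x a < d" and y: "y \<in> ball b (r/2)" by (auto simp: V_def dist_commute)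
    have \<phi>x: "\<phi> x \<in> ball b (r/2)" using d(2)[OF x(3)] by (simp add: dist_commute)
    have holy: "(\<lambda>y. g (x, y)) holomorphic_on B"
      using AB x r1 by (intro holomorphic2_on_curve[OF g W(1)]) (auto intro!: holomorphic_intros)
    have bd: "norm (deriv (\<lambda>y. g (x, y)) w) \<le> C / (r/2)" if w: "w \<in> ball b (r/2)" for w
    proof -
      have sub: "cball w (r/2) \<subseteq> cball b r"
      proof
        fix u assume "u \<in> cball w (r/2)"
        then show "u \<in> cball b r" using w dist_triangle[of b u w] by simp
      qed
      have "cmod ((deriv ^^ 1) (\<lambda>y. g (x, y)) w) \<le> fact 1 * C / (r/2) ^ 1"
      proof (rule Cauchy_inequality)
        show "(\<lambda>y. g (x, y)) holomorphic_on ball w (r/2)"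
          by (rule holomorphic_on_subset[OF holy]) (use sub r ball_subset_cball in blast)
        show "continuous_on (cball w (r/2)) (\<lambda>y. g (x, y))"
          by (rule continuous_on_subset[OF holomorphic_on_imp_continuous_on[OF holy]]) (use sub r in blast)
        fix u assume "cmod (w - u) = r/2"
        then have "u \<in> cball w (r/2)" by (simp add: dist_norm)
        then show "cmod (g (x, u)) \<le> C" using C[OF x(2)] sub by blast
      qed (use r in auto)
      then show ?thesis by simp
    qed
    have "norm (g (x, y) - g (x, \<phi> x)) \<le> C / (r/2) * norm (y - \<phi> x)"
    proof (rule field_differentiable_bound[of "ball b (r/2)"])
      show "((\<lambda>y. g (x, y)) has_field_derivative deriv (\<lambda>y. g (x, y)) w) (at w within ball b (r/2))"
        if "w \<in> ball b (r/2)" for w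
      proof (rule has_field_derivative_at_within[OF holomorphic_derivI[OF holy AB(2)]])
        have "ball b (r/2) \<subseteq> cball b r" using r(1) by auto
        then show "w \<in> B" using that r(2) by blast
      qed
    qed (use bd y \<phi>x in auto)
    then show "norm (g (x, y)) \<le> (C / (r/2)) * norm (y - \<phi> x)" using van[OF x(1)] by simp
  qed
qed

section \<open>The Hilbert modular group and its forms\<close>

no_notation fps_nth (infixl "$" 75)

definition mk2 :: "real \<Rightarrow> real \<Rightarrow> real \<Rightarrow> real \<Rightarrow> real^2^2" where
  "mk2 a b c d = vector [vector [a, b], vector [c, d]]"

lemma mk2_nth [simp]:
  "mk2 a b c d $ 1 $ 1 = a" "mk2 a b c d $ 1 $ 2 = b" "mk2 a b c d $ 2 $ 1 = c" "mk2 a b c d $ 2 $ 2 = d"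
  unfolding mk2_def by (simp_all only: vector_2)

lemma mat2_eq_iff:
  fixes A B :: "real^2^2"
  shows "A = B \<longleftrightarrow> A$1$1 = B$1$1 \<and> A$1$2 = B$1$2 \<and> A$2$1 = B$2$1 \<and> A$2$2 = B$2$2"
  unfolding vec_eq_iff forall_2 by (simp only: conj_assoc)

lemma mk2_eta: "mk2 (A$1$1) (A$1$2) (A$2$1) (A$2$2) = A"
  by (simp add: mat2_eq_iff)

lemma mat2_mult_nth:
  fixes A B :: "real^2^2"
  shows "(A ** B)$i$j = A$i$1 * B$1$j + A$i$2 * B$2$j"
  by (simp add: matrix_matrix_mult_def sum_2)

lemma mat2_one_nth [simp]:
  "(mat 1 :: real^2^2)$1$1 = 1" "(mat 1 :: real^2^2)$1$2 = 0" "(mat 1 :: real^2^2)$2$1 = 0" "(mat 1 :: real^2^2)$2$2 = 1"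
  by (simp_all add: mat_def)

lemma SL2_iff:
  "A \<in> SL2 K \<longleftrightarrow> A$1$1 \<in> K \<and> A$1$2 \<in> K \<and> A$2$1 \<in> K \<and> A$2$2 \<in> K \<and> A$1$1 * A$2$2 - A$1$2 * A$2$1 = 1"
  by (auto simp: SL2_def forall_2 det_2)

section \<open>Moebius transformations of the upper half plane\<close>

definition aut :: "real^2^2 \<Rightarrow> complex \<Rightarrow> complex" where
  "aut A z = of_real (A$2$1) * z + of_real (A$2$2)"

definition mob :: "real^2^2 \<Rightarrow> complex \<Rightarrow> complex" where
  "mob A z = (of_real (A$1$1) * z + of_real (A$1$2)) / aut A z"

lemma det_one_nonzero_row:
  fixes A :: "real^2^2"
  assumes "A$1$1 * A$2$2 - A$1$2 * A$2$1 = 1" "Im z > 0"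
  shows "aut A z \<noteq> 0"
proof
  assume "aut A z = 0"
  then have "Im (aut A z) = 0" "Re (aut A z) = 0" by simp_all
  then have "A$2$1 = 0" "A$2$2 = 0" using assms(2) by (auto simp: aut_def)
  then show False using assms(1) by simp
qed

lemma mob_aut: "aut A z \<noteq> 0 \<Longrightarrow> mob A z * aut A z = of_real (A$1$1) * z + of_real (A$1$2)"
  by (simp add: mob_def)

lemma Im_mob:
  fixes A :: "real^2^2"
  assumes "A$1$1 * A$2$2 - A$1$2 * A$2$1 = 1"
  shows "Im (mob A z) = Im z / (cmod (aut A z))\<^sup>2"
proof -
  have "Im (mob A z) = (Im (of_real (A$1$1) * z + of_real (A$1$2)) * Re (aut A z) -
      Re (of_real (A$1$1) * z + of_real (A$1$2)) * Im (aut A z)) / (cmod (aut A z))\<^sup>2"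
    unfolding mob_def Im_divide cmod_power2 ..
  also have "Im (of_real (A$1$1) * z + of_real (A$1$2)) * Re (aut A z) -
      Re (of_real (A$1$1) * z + of_real (A$1$2)) * Im (aut A z) = (A$1$1 * A$2$2 - A$1$2 * A$2$1) * Im z"
    by (simp add: aut_def algebra_simps)
  finally show ?thesis using assms by simp
qed

lemma Im_mob_pos:
  fixes A :: "real^2^2"
  assumes "A$1$1 * A$2$2 - A$1$2 * A$2$1 = 1" "Im z > 0"
  shows "Im (mob A z) > 0"
  using det_one_nonzero_row[OF assms] assms by (simp add: Im_mob)

lemma aut_mult:
  fixes A B :: "real^2^2"
  assumes "aut B z \<noteq> 0"
  shows "aut (A ** B) z = aut A (mob B z) * aut B z"
proof -
  have "aut A (mob B z) * aut B z = of_real (A$2$1) * (mob B z * aut B z) + of_real (A$2$2) * aut B z"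
    by (simp add: aut_def algebra_simps)
  also have "\<dots> = aut (A ** B) z"
    unfolding mob_aut[OF assms] by (simp add: aut_def mat2_mult_nth algebra_simps)
  finally show ?thesis by simp
qed

lemma mob_mult:
  fixes A B :: "real^2^2"
  assumes "aut B z \<noteq> 0" "aut A (mob B z) \<noteq> 0"
  shows "mob (A ** B) z = mob A (mob B z)"
proof -
  have nz: "aut (A ** B) z \<noteq> 0" using assms by (simp add: aut_mult)
  have "mob A (mob B z) * aut (A ** B) z = (mob A (mob B z) * aut A (mob B z)) * aut B z"
    using assms by (simp add: aut_mult)
  also have "\<dots> = of_real (A$1$1) * (mob B z * aut B z) + of_real (A$1$2) * aut B z"
    unfolding mob_aut[OF assms(2)] by (simp add: algebra_simps)
  also have "\<dots> = of_real ((A ** B)$1$1) * z + of_real ((A ** B)$1$2)"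
    unfolding mob_aut[OF assms(1)] by (simp add: aut_def mat2_mult_nth algebra_simps)
  also have "\<dots> = mob (A ** B) z * aut (A ** B) z" using mob_aut[OF nz] by simp
  finally show ?thesis using nz by simp
qed

lemma mob_one [simp]: "mob (mat 1) z = z" and aut_one [simp]: "aut (mat 1) z = 1"
  by (simp_all add: mob_def aut_def)

lemma moebius_mob: "moebius (of_real (A$1$1)) (of_real (A$1$2)) (of_real (A$2$1)) (of_real (A$2$2)) z = mob A z"
  by (simp add: moebius_def mob_def aut_def)

text \<open>Subtracting the equations and dividing by z - w gives p (z + w) + q = 0, whose imaginary
  part forces p = 0. This one fact limits both the fixed points of a group element and the
  intersection of two curves to a single point.\<close>

lemma real_quadratic_two_roots:
  fixes p q r :: real
  assumes "of_real p * z\<^sup>2 + of_real q * z + of_real r = 0" "of_real p * w\<^sup>2 + of_real q * w + of_real r = 0"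
    and "Im z > 0" "Im w > 0" "z \<noteq> w"
  shows "p = 0" "q = 0" "r = 0"
proof -
  have "(z - w) * (of_real p * (z + w) + of_real q) =
      (of_real p * z\<^sup>2 + of_real q * z + of_real r) - (of_real p * w\<^sup>2 + of_real q * w + of_real r)"
    by (simp add: algebra_simps power2_eq_square)
  then have *: "of_real p * (z + w) + of_real q = 0" using assms by simp
  then have "Im (of_real p * (z + w) + of_real q) = 0" by simp
  then have "p * (Im z + Im w) = 0" by simp
  then show p: "p = 0" using assms by simp
  show q: "q = 0" using * p by simp
  show "r = 0" using assms(1) p q by simp
qed

lemma open_H2: "open H2"
proof -
  have "H2 = {z. Im z > 0} \<times> {z. Im z > 0}" by (auto simp: H2_def)
  moreover have "open \<dots>" by (intro open_Times open_halfspace_Im_gt)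
  ultimately show ?thesis by simp
qed

lemma H2_iff: "z \<in> H2 \<longleftrightarrow> Im (fst z) > 0 \<and> Im (snd z) > 0"
  by (cases z) (simp add: H2_def)

lemma compact_H2_bound:
  assumes "compact K" "K \<subseteq> H2"
  obtains B where "B \<ge> 1" "\<And>z. z \<in> K \<Longrightarrow> cmod (fst z) \<le> B \<and> cmod (snd z) \<le> B \<and> Im (fst z) \<ge> 1 / B \<and> Im (snd z) \<ge> 1 / B"
proof -
  have c: "continuous_on K (\<lambda>z. cmod (fst z) + cmod (snd z) + 1 / Im (fst z) + 1 / Im (snd z))"
    using assms(2) by (intro continuous_intros) (auto simp: H2_def)
  have "bounded ((\<lambda>z. cmod (fst z) + cmod (snd z) + 1 / Im (fst z) + 1 / Im (snd z)) ` K)"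
    by (intro compact_imp_bounded compact_continuous_image c assms(1))
  then obtain C where C: "\<forall>z\<in>K. norm (cmod (fst z) + cmod (snd z) + 1 / Im (fst z) + 1 / Im (snd z)) \<le> C"
    unfolding bounded_iff by auto
  define B where "B = max C 1"
  have "cmod (fst z) \<le> B \<and> cmod (snd z) \<le> B \<and> Im (fst z) \<ge> 1 / B \<and> Im (snd z) \<ge> 1 / B" if z: "z \<in> K" for z
  proof -
    have im: "Im (fst z) > 0" "Im (snd z) > 0" using assms(2) z by (auto simp: H2_def)
    have "cmod (fst z) + cmod (snd z) + 1 / Im (fst z) + 1 / Im (snd z) \<le> C"
      using bspec[OF C z] by simp
    moreover have "0 \<le> cmod (fst z)" "0 \<le> cmod (snd z)" "0 < 1 / Im (fst z)" "0 < 1 / Im (snd z)" using im by auto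
    ultimately have "cmod (fst z) \<le> B" "cmod (snd z) \<le> B" and *: "1 / Im (fst z) \<le> B" "1 / Im (snd z) \<le> B"
      unfolding B_def by linarith+
    moreover have "B > 0" by (simp add: B_def)
    moreover have "Im (fst z) \<ge> 1 / B" "Im (snd z) \<ge> 1 / B"
      using * im \<open>B > 0\<close> by (simp_all add: field_simps)
    ultimately show ?thesis by simp
  qed
  then show ?thesis by (intro that[of B]) (auto simp: B_def)
qed

text \<open>The quotient of the imaginary parts bounds |c z + d| by B, and then a z + b = w (c z +
  d) is at most B^2. The imaginary parts of these two numbers control a and c, and after that b and
  d follow from the triangle inequality.\<close>

lemma entries_bounded:
  fixes A :: "real^2^2"
  assumes det: "A$1$1 * A$2$2 - A$1$2 * A$2$1 = 1" and B: "B \<ge> 1"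
    and z: "cmod z \<le> B" "Im z \<ge> 1 / B" and w: "cmod (mob A z) \<le> B" "Im (mob A z) \<ge> 1 / B"
  shows "\<bar>A$i$j\<bar> \<le> B\<^sup>2 + B ^ 4"
proof -
  have B0: "B > 0" "1 / B > 0" using B by auto
  have imz: "Im z > 0" and imw: "Im (mob A z) > 0" using z w B0 by linarith+
  have nz: "aut A z \<noteq> 0" by (rule det_one_nonzero_row[OF det imz])
  have "(cmod (aut A z))\<^sup>2 = Im z / Im (mob A z)" using Im_mob[OF det, of z] imw imz nz by (simp add: field_simps)
  also have "\<dots> \<le> B / (1 / B)"
    using w z imz B0 abs_Im_le_cmod[of z] by (intro frac_le) auto
  also have "\<dots> = B\<^sup>2" by (simp add: power2_eq_square)
  finally have J: "cmod (aut A z) \<le> B" using B0 by (simp add: power2_le_iff_abs_le)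
  have imp: "\<bar>x\<bar> \<le> C * B" if "cmod (of_real x * z + of_real y) \<le> C" for x y C :: real
  proof -
    have "\<bar>x\<bar> * (1 / B) \<le> \<bar>x\<bar> * Im z" using z by (intro mult_left_mono) auto
    also have "\<dots> = \<bar>Im (of_real x * z + of_real y)\<bar>" using imz by (simp add: abs_mult)
    also have "\<dots> \<le> C" using abs_Im_le_cmod that order_trans by blast
    finally show ?thesis using B0 by (simp add: field_simps)
  qed
  have imp2: "\<bar>y\<bar> \<le> C + C * B\<^sup>2" if *: "cmod (of_real x * z + of_real y) \<le> C" for x y C :: real
  proof -
    have "cmod (of_real y) = cmod ((of_real x * z + of_real y) - of_real x * z)" by simp
    also have "\<dots> \<le> cmod (of_real x * z + of_real y) + cmod (of_real x * z)" by (rule norm_triangle_ineq4)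
    also have "cmod (of_real x * z) = \<bar>x\<bar> * cmod z" by (simp add: norm_mult)
    also have "\<bar>x\<bar> * cmod z \<le> (C * B) * B" using imp[OF *] z B0 by (intro mult_mono) auto
    finally show ?thesis using * by (simp add: power2_eq_square)
  qed
  have num: "cmod (of_real (A$1$1) * z + of_real (A$1$2)) \<le> B * B"
    unfolding mob_aut[OF nz, symmetric] norm_mult using w J B0 by (intro mult_mono) auto
  have J': "cmod (of_real (A$2$1) * z + of_real (A$2$2)) \<le> B * B"
  proof -
    have "B * 1 \<le> B * B" using B B0 by (intro mult_left_mono) auto
    then show ?thesis using J unfolding aut_def by linarith
  qed
  have p1: "B * B * B \<le> B\<^sup>2 + B ^ 4"
  proof -
    have "B * B * B * 1 \<le> B * B * B * B" using B B0 by (intro mult_left_mono) auto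
    moreover have "0 \<le> B * B" by simp
    ultimately show ?thesis unfolding power2_eq_square power4_eq_xxxx by linarith
  qed
  have p2: "B * B + B * B * B\<^sup>2 \<le> B\<^sup>2 + B ^ 4" by (simp add: power2_eq_square power4_eq_xxxx)
  have "\<bar>A$1$1\<bar> \<le> B\<^sup>2 + B ^ 4" "\<bar>A$2$1\<bar> \<le> B\<^sup>2 + B ^ 4"
    using imp[OF num] imp[OF J'] p1 by linarith+
  moreover have "\<bar>A$1$2\<bar> \<le> B\<^sup>2 + B ^ 4" "\<bar>A$2$2\<bar> \<le> B\<^sup>2 + B ^ 4"
    using imp2[OF num] imp2[OF J'] p2 by linarith+
  ultimately have "\<forall>i j. \<bar>A$i$j\<bar> \<le> B\<^sup>2 + B ^ 4" by (simp add: forall_2)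
  then show ?thesis by blast
qed

section \<open>The action on the product of half planes\<close>

context quadratic
begin

definition cjm :: "real^2^2 \<Rightarrow> real^2^2" where
  "cjm A = mk2 (cj (A$1$1)) (cj (A$1$2)) (cj (A$2$1)) (cj (A$2$2))"

lemma cjm_nth [simp]:
  "cjm A $ 1 $ 1 = cj (A$1$1)" "cjm A $ 1 $ 2 = cj (A$1$2)" "cjm A $ 2 $ 1 = cj (A$2$1)" "cjm A $ 2 $ 2 = cj (A$2$2)"
  by (simp_all add: cjm_def)

abbreviation \<Gamma> :: "(real^2^2) set" where "\<Gamma> \<equiv> SL2 R"
abbreviation G :: "(real^2^2) set" where "G \<equiv> SL2 F"

lemma G_det: "A \<in> G \<Longrightarrow> A$1$1 * A$2$2 - A$1$2 * A$2$1 = 1"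
  and G_F [simp]: "A \<in> G \<Longrightarrow> A$1$1 \<in> F" "A \<in> G \<Longrightarrow> A$1$2 \<in> F" "A \<in> G \<Longrightarrow> A$2$1 \<in> F" "A \<in> G \<Longrightarrow> A$2$2 \<in> F"
  by (auto simp: SL2_iff)

lemma \<Gamma>_G [simp]: "A \<in> \<Gamma> \<Longrightarrow> A \<in> G"
  by (simp add: SL2_iff)

lemma G_det_cjm:
  assumes "A \<in> G" shows "cjm A$1$1 * cjm A$2$2 - cjm A$1$2 * cjm A$2$1 = 1"
proof -
  have "cjm A$1$1 * cjm A$2$2 - cjm A$1$2 * cjm A$2$1 = cj (A$1$1 * A$2$2 - A$1$2 * A$2$1)"
    using assms by simp
  then show ?thesis using G_det[OF assms] by simp
qed

lemma det_mult2:
  fixes A B :: "real^2^2"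
  shows "(A ** B)$1$1 * (A ** B)$2$2 - (A ** B)$1$2 * (A ** B)$2$1 =
     (A$1$1 * A$2$2 - A$1$2 * A$2$1) * (B$1$1 * B$2$2 - B$1$2 * B$2$1)"
  unfolding mat2_mult_nth by algebra

lemma SL2_mult: "A \<in> G \<Longrightarrow> B \<in> G \<Longrightarrow> A ** B \<in> G"
  unfolding SL2_iff det_mult2 by (simp add: mat2_mult_nth)

lemma \<Gamma>_mult: "A \<in> \<Gamma> \<Longrightarrow> B \<in> \<Gamma> \<Longrightarrow> A ** B \<in> \<Gamma>"
  unfolding SL2_iff det_mult2 by (simp add: mat2_mult_nth)

definition inv2 :: "real^2^2 \<Rightarrow> real^2^2" where
  "inv2 A = mk2 (A$2$2) (- (A$1$2)) (- (A$2$1)) (A$1$1)"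

lemma inv2_G: "A \<in> G \<Longrightarrow> inv2 A \<in> G" and inv2_\<Gamma>: "A \<in> \<Gamma> \<Longrightarrow> inv2 A \<in> \<Gamma>"
  unfolding SL2_iff inv2_def by (simp_all add: algebra_simps)

lemma inv2_right: "A \<in> G \<Longrightarrow> A ** inv2 A = mat 1" and inv2_left: "A \<in> G \<Longrightarrow> inv2 A ** A = mat 1"
  using G_det[of A] by (simp_all add: mat2_eq_iff mat2_mult_nth inv2_def algebra_simps)

lemma one_\<Gamma> [simp]: "mat 1 \<in> \<Gamma>"
  unfolding SL2_iff by simp

lemma cjm_mult: "A \<in> G \<Longrightarrow> B \<in> G \<Longrightarrow> cjm (A ** B) = cjm A ** cjm B"
  by (simp add: mat2_eq_iff mat2_mult_nth)

lemma cjm_one [simp]: "cjm (mat 1) = mat 1"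
  by (simp add: mat2_eq_iff)

definition act2 :: "real^2^2 \<Rightarrow> complex \<times> complex \<Rightarrow> complex \<times> complex" where
  "act2 A z = (mob A (fst z), mob (cjm A) (snd z))"

lemma act_Interior: "act F A (Interior z) = Interior (act2 A z)"
  by (cases z) (simp add: act2_def moebius_mob[symmetric])

lemma act2_H2: "A \<in> G \<Longrightarrow> z \<in> H2 \<Longrightarrow> act2 A z \<in> H2"
  by (simp add: H2_iff act2_def Im_mob_pos[OF G_det] Im_mob_pos[OF G_det_cjm])

lemma aut_nz: "A \<in> G \<Longrightarrow> z \<in> H2 \<Longrightarrow> aut A (fst z) \<noteq> 0" "A \<in> G \<Longrightarrow> z \<in> H2 \<Longrightarrow> aut (cjm A) (snd z) \<noteq> 0"
  using det_one_nonzero_row[OF G_det] det_one_nonzero_row[OF G_det_cjm] by (auto simp: H2_iff)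

lemma act2_mult:
  assumes "A \<in> G" "B \<in> G" "z \<in> H2"
  shows "act2 (A ** B) z = act2 A (act2 B z)"
  using aut_nz[OF assms(2,3)] aut_nz[OF assms(1) act2_H2[OF assms(2,3)]]
  unfolding act2_def cjm_mult[OF assms(1,2)] by (simp add: mob_mult)

lemma act2_one [simp]: "act2 (mat 1) z = z"
  by (simp add: act2_def)

lemma act2_inv2 [simp]: "A \<in> G \<Longrightarrow> z \<in> H2 \<Longrightarrow> act2 (inv2 A) (act2 A z) = z"
  "A \<in> G \<Longrightarrow> z \<in> H2 \<Longrightarrow> act2 A (act2 (inv2 A) z) = z"
  using act2_mult[of "inv2 A" A z] act2_mult[of A "inv2 A" z] inv2_left inv2_right inv2_G by auto

section \<open>Forms, their transformation and their curves\<close>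

definition ell :: "real \<times> real \<times> real \<Rightarrow> complex \<times> complex \<Rightarrow> complex" where
  "ell v z = (case v of (a, l, b) \<Rightarrow> of_real a * fst z * snd z + of_real l * fst z + of_real (cj l) * snd z + of_real b)"

definition nrm :: "real \<times> real \<times> real \<Rightarrow> real" where
  "nrm v = (case v of (a, l, b) \<Rightarrow> a * b - l * cj l)"

definition VF :: "(real \<times> real \<times> real) set" where "VF = \<rat> \<times> F \<times> \<rat>"

text \<open>With M the matrix with rows (a, l) and (l', b), \<open>ell v z\<close> is the bilinear
  expression (z1, 1) M (z2, 1)^T, \<open>nrm v\<close> is det M, and \<open>pull A\<close> is M |->
  A^T M A'. It is therefore a right action that preserves the norm.\<close>

definition pull :: "real^2^2 \<Rightarrow> real \<times> real \<times> real \<Rightarrow> real \<times> real \<times> real" where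
  "pull A v = (case v of (a, l, b) \<Rightarrow>
     (a * A$1$1 * cj (A$1$1) + l * A$1$1 * cj (A$2$1) + cj l * A$2$1 * cj (A$1$1) + b * A$2$1 * cj (A$2$1),
      a * A$1$1 * cj (A$1$2) + l * A$1$1 * cj (A$2$2) + cj l * A$2$1 * cj (A$1$2) + b * A$2$1 * cj (A$2$2),
      a * A$1$2 * cj (A$1$2) + l * A$1$2 * cj (A$2$2) + cj l * A$2$2 * cj (A$1$2) + b * A$2$2 * cj (A$2$2)))"

lemma VF_cases:
  assumes "v \<in> VF"
  obtains a l b where "v = (a, l, b)" "a \<in> F" "b \<in> F" "l \<in> F" "cj a = a" "cj b = b"
  using assms by (auto simp: VF_def Rats_F cj_Rats)

lemma cj_fixed_Rats: "x \<in> F \<Longrightarrow> cj x = x \<longleftrightarrow> x \<in> \<rat>"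
  using cj_fixed cj_Rats by blast

lemma pull_VF:
  assumes "v \<in> VF" "A \<in> G"
  shows "pull A v \<in> VF"
proof -
  obtain a l b where v: "v = (a, l, b)" "a \<in> F" "b \<in> F" "l \<in> F" "cj a = a" "cj b = b"
    using assms(1) by (rule VF_cases)
  show ?thesis unfolding VF_def pull_def v(1) using assms(2) v
    by (simp add: cj_fixed_Rats[symmetric] algebra_simps)
qed

lemma ell_pull:
  assumes v: "v \<in> VF" and A: "A \<in> G" and z: "z \<in> H2"
  shows "ell (pull A v) z = ell v (act2 A z) * aut A (fst z) * aut (cjm A) (snd z)"
proof -
  obtain a l b where v: "v = (a, l, b)" "a \<in> F" "b \<in> F" "l \<in> F" "cj a = a" "cj b = b"
    using v by (rule VF_cases)
  define x y where "x = fst z" and "y = snd z"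
  define P Q where "P = aut A x" and "Q = aut (cjm A) y"
  have nz: "P \<noteq> 0" "Q \<noteq> 0" using aut_nz[OF A z] by (simp_all add: P_def Q_def x_def y_def)
  have mA: "mob A x * P = of_real (A$1$1) * x + of_real (A$1$2)"
    and mB: "mob (cjm A) y * Q = of_real (cj (A$1$1)) * y + of_real (cj (A$1$2))"
    using mob_aut[of A x] mob_aut[of "cjm A" y] nz by (simp_all add: P_def Q_def)
  have "ell v (act2 A z) * P * Q = of_real a * (mob A x * P) * (mob (cjm A) y * Q)
     + of_real l * (mob A x * P) * Q + of_real (cj l) * P * (mob (cjm A) y * Q) + of_real b * P * Q"
    by (simp add: v(1) ell_def act2_def x_def y_def algebra_simps)
  also have "\<dots> = ell (pull A v) z"
    unfolding mA mB unfolding P_def Q_def aut_def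
    using v A by (simp add: ell_def pull_def x_def[symmetric] y_def[symmetric] algebra_simps)
  finally show ?thesis by (simp add: P_def Q_def x_def y_def)
qed

lemma nrm_pull:
  assumes "v \<in> VF" "A \<in> G"
  shows "nrm (pull A v) = nrm v"
proof -
  obtain a l b where v: "v = (a, l, b)" "a \<in> F" "b \<in> F" "l \<in> F" "cj a = a" "cj b = b"
    using assms(1) by (rule VF_cases)
  have "nrm (pull A v) = (A$1$1 * A$2$2 - A$1$2 * A$2$1) * (cjm A$1$1 * cjm A$2$2 - cjm A$1$2 * cjm A$2$1) * nrm v"
    using v assms(2) by (simp add: nrm_def pull_def algebra_simps)
  then show ?thesis using G_det[OF assms(2)] G_det_cjm[OF assms(2)] by simp
qed

lemma pull_mult:
  assumes "v \<in> VF" "A \<in> G" "B \<in> G"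
  shows "pull (A ** B) v = pull B (pull A v)"
proof -
  obtain a l b where v: "v = (a, l, b)" "a \<in> F" "b \<in> F" "l \<in> F" "cj a = a" "cj b = b"
    using assms(1) by (rule VF_cases)
  show ?thesis using v assms(2,3) by (simp add: pull_def mat2_mult_nth algebra_simps)
qed

lemma pull_one: "v \<in> VF \<Longrightarrow> pull (mat 1) v = v"
  by (cases v) (simp add: pull_def)

definition curve :: "real \<times> real \<times> real \<Rightarrow> (complex \<times> complex) set" where
  "curve v = {z \<in> H2. ell v z = 0}"

lemma curve_pull:
  assumes "v \<in> VF" "A \<in> G" "z \<in> H2"
  shows "z \<in> curve (pull A v) \<longleftrightarrow> act2 A z \<in> curve v"
  using ell_pull[OF assms] aut_nz[OF assms(2,3)] act2_H2[OF assms(2,3)] assms(3) by (simp add: curve_def)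

lemma ell_uminus: "v \<in> VF \<Longrightarrow> ell (- v) z = - ell v z"
  by (cases v) (simp add: ell_def VF_def)

lemma pull_uminus: "v \<in> VF \<Longrightarrow> pull A (- v) = - pull A v"
  by (cases v) (simp add: pull_def VF_def)

lemma curve_uminus: "v \<in> VF \<Longrightarrow> curve (- v) = curve v"
  by (simp add: curve_def ell_uminus)

lemma nrm_uminus: "v \<in> VF \<Longrightarrow> nrm (- v) = nrm v"
  by (cases v) (simp add: nrm_def VF_def)

lemma holomorphic2_ell: "holomorphic2_on (ell v) W"
  unfolding ell_def split_beta
  by (intro holomorphic2_on_add holomorphic2_on_mult holomorphic2_on_const holomorphic2_on_fst holomorphic2_on_snd)

lemma holomorphic2_aut:
  "holomorphic2_on (\<lambda>z. aut A (fst z)) W" "holomorphic2_on (\<lambda>z. aut A (snd z)) W"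
  unfolding aut_def
  by (intro holomorphic2_on_add holomorphic2_on_mult holomorphic2_on_const holomorphic2_on_fst holomorphic2_on_snd)+

lemma holomorphic2_act2:
  assumes "A \<in> G" "W \<subseteq> H2"
  shows "holomorphic2_on (\<lambda>z. fst (act2 A z)) W" "holomorphic2_on (\<lambda>z. snd (act2 A z)) W"
  unfolding act2_def fst_conv snd_conv mob_def using aut_nz[OF assms(1) subsetD[OF assms(2)]]
  by (intro holomorphic2_on_divide holomorphic2_aut holomorphic2_on_add holomorphic2_on_mult
      holomorphic2_on_const holomorphic2_on_fst holomorphic2_on_snd; simp)+

lemma holomorphic2_comp_act2:
  assumes "A \<in> G" "W \<subseteq> H2" "holomorphic2_on f V" "\<And>z. z \<in> W \<Longrightarrow> act2 A z \<in> V"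
  shows "holomorphic2_on (\<lambda>z. f (act2 A z)) W"
  using holomorphic2_on_map[OF holomorphic2_act2[OF assms(1,2)] assms(3)] assms(4) by simp

lemma continuous_on_act2: "A \<in> G \<Longrightarrow> W \<subseteq> H2 \<Longrightarrow> continuous_on W (act2 A)"
proof -
  assume A: "A \<in> G" and W: "W \<subseteq> H2"
  have "continuous_on W (\<lambda>z. (fst (act2 A z), snd (act2 A z)))"
    by (intro continuous_on_Pair holomorphic2_on_imp_continuous_on holomorphic2_act2[OF A W])
  then show ?thesis by simp
qed

lemma open_act2_image:
  assumes "A \<in> G" "open W" "W \<subseteq> H2"
  shows "open (act2 A ` W)"
proof -
  have "act2 A ` W = {z \<in> H2. act2 (inv2 A) z \<in> W}"
  proof (intro equalityI subsetI)
    fix w assume "w \<in> act2 A ` W"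
    then obtain z where z: "z \<in> W" "w = act2 A z" by blast
    then have "z \<in> H2" using assms(3) by blast
    then show "w \<in> {z \<in> H2. act2 (inv2 A) z \<in> W}" using z act2_H2[OF assms(1)] assms(1) by simp
  next
    fix w assume w: "w \<in> {z \<in> H2. act2 (inv2 A) z \<in> W}"
    then have "w = act2 A (act2 (inv2 A) w)" using assms(1) by simp
    then show "w \<in> act2 A ` W" using w by blast
  qed
  also have "\<dots> = H2 \<inter> act2 (inv2 A) -` W" by auto
  also have "open \<dots>"
    using continuous_open_preimage[OF continuous_on_act2[OF inv2_G[OF assms(1)] order_refl] open_H2 assms(2)]
    by (simp add: Int_commute)
  finally show ?thesis .
qed

lemma curve_linear_nz:
  assumes v: "v \<in> VF" "v = (a, l, b)" "nrm v > 0" and z: "Im z > 0"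
  shows "of_real a * z + of_real (cj l) \<noteq> 0" "of_real a * z + of_real l \<noteq> 0"
proof -
  have l: "l \<in> F" using v by (auto simp: VF_def)
  have ne: "a \<noteq> 0 \<or> l \<noteq> 0" using v by (auto simp: nrm_def)
  have *: "a = 0 \<and> x = 0" if "of_real a * z + of_real x = 0" for x :: real
  proof -
    have "Im (of_real a * z + of_real x) = 0" "Re (of_real a * z + of_real x) = 0" unfolding that by simp_all
    then show ?thesis using z by auto
  qed
  have cl: "cj l = 0 \<Longrightarrow> l = 0" using l by simp
  show "of_real a * z + of_real (cj l) \<noteq> 0" using *[of "cj l"] ne cl by blast
  show "of_real a * z + of_real l \<noteq> 0" using *[of l] ne by blast
qed

text \<open>On the curve (a x + l') y = -(l x + b). Multiplying by the complex conjugate of a x + l'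
  and taking imaginary parts leaves the determinant of the form. For positive norm this ties the two
  imaginary parts together, which is behind the graph description, local finiteness and the
  behaviour near a cusp.\<close>

lemma ell_zero_Im:
  assumes v: "v = (a, l, b)" and z: "ell v (x, y) = 0"
  shows "Im y * (cmod (of_real a * x + of_real (cj l)))\<^sup>2 = nrm v * Im x"
    "Im x * (cmod (of_real a * y + of_real l))\<^sup>2 = nrm v * Im y"
proof -
  have main: "Im q * (cmod (of_real a * p + of_real k'))\<^sup>2 = (a * b - k * k') * Im p"
    if "of_real a * p * q + of_real k * p + of_real k' * q + of_real b = 0" for p q :: complex and k k' :: real
  proof -
    have e: "(of_real a * p + of_real k') * q = - (of_real k * p + of_real b)"
      using that by (simp add: algebra_simps eq_neg_iff_add_eq_0)
    let ?w = "of_real a * p + of_real k'"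
    have "q * of_real ((cmod ?w)\<^sup>2) = q * (?w * cnj ?w)" by (simp only: complex_norm_square)
    also have "\<dots> = (?w * q) * cnj ?w" by (simp add: mult_ac)
    also have "\<dots> = - (of_real k * p + of_real b) * cnj ?w" unfolding e ..
    finally have "Im (q * of_real ((cmod ?w)\<^sup>2)) = Im (- (of_real k * p + of_real b) * cnj ?w)" by simp
    then show ?thesis by (simp add: algebra_simps)
  qed
  show "Im y * (cmod (of_real a * x + of_real (cj l)))\<^sup>2 = nrm v * Im x"
    using main[of x y l "cj l"] z v by (simp add: ell_def nrm_def)
  show "Im x * (cmod (of_real a * y + of_real l))\<^sup>2 = nrm v * Im y"
    using main[of y x "cj l" l] z v by (simp add: ell_def nrm_def algebra_simps)
qed

text \<open>Solving the equation for the second coordinate. For positive norm the denominator has no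
  zero in the upper half plane and the value lies there again, so the curve is a graph over the
  whole first factor and meets each slice exactly once.\<close>

definition graph2 :: "real \<times> real \<times> real \<Rightarrow> complex \<Rightarrow> complex" where
  "graph2 v x = (case v of (a, l, b) \<Rightarrow> - (of_real l * x + of_real b) / (of_real a * x + of_real (cj l)))"

definition den2 :: "real \<times> real \<times> real \<Rightarrow> complex \<Rightarrow> complex" where
  "den2 v x = (case v of (a, l, b) \<Rightarrow> of_real a * x + of_real (cj l))"

lemma den2_nz: "v \<in> VF \<Longrightarrow> nrm v > 0 \<Longrightarrow> Im x > 0 \<Longrightarrow> den2 v x \<noteq> 0"
  using curve_linear_nz(1)[of v] by (cases v) (auto simp: den2_def)

lemma ell_graph2:
  assumes "v \<in> VF" "nrm v > 0" "Im x > 0"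
  shows "ell v (x, y) = den2 v x * (y - graph2 v x)"
proof -
  have "den2 v x \<noteq> 0" by (rule den2_nz[OF assms])
  then show ?thesis by (cases v) (simp add: ell_def graph2_def den2_def field_simps)
qed

lemma graph2_curve:
  assumes "v \<in> VF" "nrm v > 0" "Im x > 0"
  shows "(x, graph2 v x) \<in> curve v"
proof -
  have e: "ell v (x, graph2 v x) = 0" using ell_graph2[OF assms] by simp
  obtain a l b where v: "v = (a, l, b)" by (cases v) auto
  have "den2 v x \<noteq> 0" by (rule den2_nz[OF assms])
  then have p: "(cmod (of_real a * x + of_real (cj l)))\<^sup>2 > 0" by (simp add: v den2_def)
  have "Im (graph2 v x) * (cmod (of_real a * x + of_real (cj l)))\<^sup>2 > 0"
    using ell_zero_Im(1)[OF v e] assms by simp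
  then have "Im (graph2 v x) > 0" using p by (simp add: zero_less_mult_iff)
  then show ?thesis using e assms by (simp add: curve_def H2_iff)
qed

lemma curve_iff_graph2:
  assumes "v \<in> VF" "nrm v > 0" "(x, y) \<in> H2"
  shows "(x, y) \<in> curve v \<longleftrightarrow> y = graph2 v x"
proof -
  have x: "Im x > 0" using assms by (simp add: H2_iff)
  show ?thesis using ell_graph2[OF assms(1,2) x] den2_nz[OF assms(1,2) x] assms(3) by (simp add: curve_def)
qed

lemma graph2_holomorphic:
  assumes "v \<in> VF" "nrm v > 0"
  shows "graph2 v holomorphic_on {x. Im x > 0}"
proof -
  obtain a l b where v: "v = (a, l, b)" by (cases v) auto
  show ?thesis unfolding graph2_def v prod.case
    using curve_linear_nz(1)[OF assms(1) v assms(2)] by (intro holomorphic_intros) auto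
qed

text \<open>The equations \<open>m\<close> say that (a, b, l, l') and (c, d, k, k') are
  proportional; conjugation supplies the minors involving l' or k' that are not listed. The norm is
  quadratic, so equal nonzero norms leave only the factors 1 and -1.\<close>

lemma proportional_forms:
  assumes u: "u = (a, l, b)" "u \<in> VF" and v: "v = (c, k, d)" "v \<in> VF"
    and n: "nrm u = nrm v" "nrm u \<noteq> 0"
    and m: "a * k = l * c" "b * k = l * d" "a * d = b * c" "l * cj k = cj l * k"
  shows "u = v \<or> u = - v"
proof -
  have F: "a \<in> F" "b \<in> F" "l \<in> F" "c \<in> F" "d \<in> F" "k \<in> F" "cj a = a" "cj b = b" "cj c = c" "cj d = d"
    using u v by (auto simp: VF_def Rats_F cj_Rats)
  have "a * cj k = cj (a * k)" using F by simp
  also have "\<dots> = cj l * c" unfolding m(1) using F by simp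
  finally have m1: "a * cj k = cj l * c" .
  have "b * cj k = cj (b * k)" using F by simp
  also have "\<dots> = cj l * d" unfolding m(2) using F by simp
  finally have m2: "b * cj k = cj l * d" .
  note m' = m1 m2
  have nu: "a * b - l * cj l = c * d - k * cj k" "a * b - l * cj l \<noteq> 0" using n by (simp_all add: nrm_def u v)
  have "(c * d - k * cj k) * a\<^sup>2 = (a * b - l * cj l) * c\<^sup>2"
    using m m' by algebra
  then have a2: "a\<^sup>2 = c\<^sup>2" using nu by simp
  have "(c * d - k * cj k) * b\<^sup>2 = (a * b - l * cj l) * d\<^sup>2"
    using m m' by algebra
  then have b2: "b\<^sup>2 = d\<^sup>2" using nu by simp
  have "(c * d - k * cj k) * l\<^sup>2 = (a * b - l * cj l) * k\<^sup>2"
    using m m' by algebra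
  then have l2: "l\<^sup>2 = k\<^sup>2" using nu by simp
  show ?thesis
  proof (cases "l = 0")
    case True
    then have k: "k = 0" using l2 by simp
    then have "a \<noteq> 0" "c \<noteq> 0" using nu True by auto
    moreover have "a = c \<or> a = - c" using a2 by (simp only: power2_eq_iff)
    ultimately have "a = c \<and> b = d \<or> a = - c \<and> b = - d" using m(3)
    proof (elim disjE)
      assume "a = c" "c \<noteq> 0"
      then show ?thesis using m(3) by simp
    next
      assume "a = - c" "c \<noteq> 0"
      then have "c * (b + d) = 0" using m(3) by (simp add: algebra_simps)
      then have "b = - d" using \<open>c \<noteq> 0\<close> by simp
      then show ?thesis using \<open>a = - c\<close> by simp
    qed
    then show ?thesis using True k by (auto simp: u v)
  next
    case False
    have "l = k \<or> l = - k" using l2 by (simp only: power2_eq_iff)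
    then show ?thesis
    proof
      assume lk: "l = k"
      then have "a * l = c * l" "b * l = d * l" using m by (simp_all add: mult_ac)
      then show ?thesis using False lk by (simp add: u v)
    next
      assume lk: "l = - k"
      then have "a * l = (- c) * l" "b * l = (- d) * l" using m by (simp_all add: mult_ac)
      then have "a = - c" "b = - d" using mult_right_cancel[OF False] by blast+
      then show ?thesis using lk by (simp add: u v)
    qed
  qed
qed

lemma curve_unique:
  assumes u: "u \<in> VF" and v: "v \<in> VF" and n: "nrm u = nrm v" "nrm u > 0"
    and zw: "z \<in> curve u" "z \<in> curve v" "w \<in> curve u" "w \<in> curve v" "z \<noteq> w"
  shows "u = v \<or> u = - v"
proof -
  obtain a l b where u': "u = (a, l, b)" by (cases u) auto
  obtain c k d where v': "v = (c, k, d)" by (cases v) auto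
  obtain x y where z: "z = (x, y)" by (cases z) auto
  obtain x' y' where w: "w = (x', y')" by (cases w) auto
  have F: "a \<in> F" "b \<in> F" "l \<in> F" "c \<in> F" "d \<in> F" "k \<in> F" "cj a = a" "cj b = b" "cj c = c" "cj d = d"
    using u v by (auto simp: VF_def Rats_F cj_Rats u' v')
  have h: "(x, y) \<in> H2" "(x', y') \<in> H2" using zw by (auto simp: curve_def z w)
  have nv: "nrm v > 0" using n by simp
  have xx: "x \<noteq> x'"
    using zw curve_iff_graph2[OF u n(2) h(1)] curve_iff_graph2[OF u n(2) h(2)] by (auto simp: z w)
  \<comment> \<open>Eliminating the second coordinate from the two equations leaves a real quadratic
    in the first. The two common points give it two distinct roots in the upper half plane, so its
    coefficients vanish.\<close>
  have quad: "of_real (l * c - a * k) * p\<^sup>2 + of_real (l * cj k + b * c - k * cj l - d * a) * p + of_real (b * cj k - d * cj l) = 0"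
    if "ell u (p, q) = 0" "ell v (p, q) = 0" for p q
  proof -
    have "of_real (l * c - a * k) * p\<^sup>2 + of_real (l * cj k + b * c - k * cj l - d * a) * p + of_real (b * cj k - d * cj l)
      = (of_real c * p + of_real (cj k)) * ell u (p, q) - (of_real a * p + of_real (cj l)) * ell v (p, q)"
      by (simp add: ell_def u' v' algebra_simps power2_eq_square)
    then show ?thesis using that by simp
  qed
  have e: "ell u (x, y) = 0" "ell v (x, y) = 0" "ell u (x', y') = 0" "ell v (x', y') = 0"
    using zw by (simp_all add: curve_def z w)
  have im: "Im x > 0" "Im x' > 0" using h by (simp_all add: H2_iff)
  note q = real_quadratic_two_roots[OF quad[OF e(1,2)] quad[OF e(3,4)] im xx]
  have t: "l * cj k - k * cj l = d * a - b * c" using q(2) by simp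
  \<comment> \<open>The left side of \<open>t\<close> changes sign under conjugation and the right
    side is fixed by it, so both are zero.\<close>
  have "cj (l * cj k - k * cj l) = cj (d * a - b * c)" using t by simp
  then have "cj l * k - cj k * l = d * a - b * c" using F by simp
  then have m: "l * cj k = cj l * k" "a * d = b * c" using t by (simp_all add: algebra_simps)
  have "cj (b * cj k) = cj (d * cj l)" using q(3) by simp
  then have "b * k = l * d" using F by (simp add: mult.commute)
  moreover have "a * k = l * c" using q(1) by simp
  ultimately show ?thesis
    using proportional_forms[OF u' u v' v n(1)] n(2) m by simp
qed

section \<open>The lattice of forms, local finiteness and stabilizers\<close>

definition LL :: "(real \<times> real \<times> real) set" where "LL = \<int> \<times> Di \<times> \<int>"

definition HF :: "nat \<Rightarrow> (real \<times> real \<times> real) set" where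
  "HF m = {v \<in> LL. nrm v = real m / of_int D}"

lemma LL_VF: "v \<in> LL \<Longrightarrow> v \<in> VF"
  by (auto simp: LL_def VF_def elim!: Ints_cases)

lemma HF_VF [simp]: "v \<in> HF m \<Longrightarrow> v \<in> VF"
  by (simp add: HF_def LL_VF)

lemma HF_nrm: "v \<in> HF m \<Longrightarrow> nrm v = real m / of_int D"
  by (simp add: HF_def)

lemma HF_nrm_pos: "v \<in> HF m \<Longrightarrow> m > 0 \<Longrightarrow> nrm v > 0"
  by (simp add: HF_def)

lemma Di_tr: "l \<in> Di \<Longrightarrow> x \<in> R \<Longrightarrow> y \<in> R \<Longrightarrow> l * x * cj y + cj l * cj x * y \<in> \<int>"
  using Di_trace[of l "x * cj y"] by (simp add: mult_ac)

lemma pull_LL: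
  assumes "v \<in> LL" "A \<in> \<Gamma>"
  shows "pull A v \<in> LL"
proof -
  obtain a l b where v: "v = (a, l, b)" "a \<in> \<int>" "b \<in> \<int>" "l \<in> Di" using assms(1) by (auto simp: LL_def)
  have A: "A$1$1 \<in> R" "A$1$2 \<in> R" "A$2$1 \<in> R" "A$2$2 \<in> R" using assms(2) unfolding SL2_iff by blast+
  have 1: "a * (p * cj p) + (l * p * cj q + cj l * cj p * q) + b * (q * cj q) \<in> \<int>" if "p \<in> R" "q \<in> R" for p q
    by (intro Ints_add Ints_mult[OF v(2) R_norm[OF that(1)]] Ints_mult[OF v(3) R_norm[OF that(2)]] Di_tr[OF v(4) that])
  have 2: "a * p * cj q + l * (p * cj s) + cj l * (r * cj q) + b * r * cj s \<in> Di"
    if "p \<in> R" "q \<in> R" "r \<in> R" "s \<in> R" for p q r s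
  proof -
    have "a * p * cj q \<in> R" "b * r * cj s \<in> R" using that Ints_R[OF v(2)] Ints_R[OF v(3)] by simp_all
    moreover have "l * (p * cj s) \<in> Di" "cj l * (r * cj q) \<in> Di" using that v(4) by simp_all
    ultimately show ?thesis by simp
  qed
  show ?thesis
    unfolding LL_def pull_def v(1)
    using 1[of "A$1$1" "A$2$1"] 1[of "A$1$2" "A$2$2"] 2[of "A$1$1" "A$1$2" "A$2$1" "A$2$2"] A
    by (simp add: algebra_simps)
qed

lemma pull_HF: "v \<in> HF m \<Longrightarrow> A \<in> \<Gamma> \<Longrightarrow> pull A v \<in> HF m"
  by (simp add: HF_def pull_LL nrm_pull LL_VF)

lemma LL_uminus [simp]: "v \<in> LL \<Longrightarrow> - v \<in> LL"
proof -
  assume "v \<in> LL"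
  moreover have "- l \<in> Di" if "l \<in> Di" for l using Di_mult[OF that, of "-1"] by simp
  ultimately show "- v \<in> LL" by (auto simp: LL_def)
qed

lemma HF_uminus: "v \<in> HF m \<Longrightarrow> - v \<in> HF m"
  by (simp add: HF_def nrm_uminus LL_VF)

text \<open>For points of \<open>K\<close>, \<open>ell_zero_Im\<close> bounds |a z1 + l'| and |a z2
  + l|. This bounds a, l and l', and the equation then bounds b; only finitely many lattice vectors
  remain.\<close>

lemma curves_locally_finite:
  assumes "compact K" "K \<subseteq> H2"
  shows "finite {v \<in> HF m. curve v \<inter> K \<noteq> {}}"
proof -
  obtain B where B: "B \<ge> 1" and bd: "\<And>z. z \<in> K \<Longrightarrow> cmod (fst z) \<le> B \<and> cmod (snd z) \<le> B \<and> Im (fst z) \<ge> 1 / B \<and> Im (snd z) \<ge> 1 / B"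
    using compact_H2_bound[OF assms] by metis
  have B0: "B > 0" "1 / B > 0" using B by auto
  \<comment> \<open>The norm m/D is at most m and the quotient of the imaginary parts at most
    B^2.\<close>
  define M where "M = sqrt (real m) * B"
  have M0: "M \<ge> 0" using B0 by (simp add: M_def)
  define C where "C = M * B + M + M * B * B"
  have bound: "\<bar>a\<bar> \<le> M * B \<and> \<bar>k\<bar> \<le> M + M * B * B"
    if "cmod (of_real a * p + of_real k) \<le> M" "cmod p \<le> B" "Im p \<ge> 1 / B" for a k :: real and p
  proof
    have imp: "Im p > 0" using that(3) B0 by linarith
    have "\<bar>a\<bar> * (1 / B) \<le> \<bar>a\<bar> * Im p" using that by (intro mult_left_mono) auto
    also have "\<dots> = \<bar>Im (of_real a * p + of_real k)\<bar>" using imp by (simp add: abs_mult)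
    also have "\<dots> \<le> M" using abs_Im_le_cmod that(1) order_trans by blast
    finally show a: "\<bar>a\<bar> \<le> M * B" using B0 by (simp add: field_simps)
    have "cmod (of_real k) = cmod ((of_real a * p + of_real k) - of_real a * p)" by simp
    also have "\<dots> \<le> cmod (of_real a * p + of_real k) + cmod (of_real a * p)" by (rule norm_triangle_ineq4)
    also have "cmod (of_real a * p) = \<bar>a\<bar> * cmod p" by (simp add: norm_mult)
    also have "\<bar>a\<bar> * cmod p \<le> (M * B) * B" using a that B0 M0 by (intro mult_mono) auto
    finally show "\<bar>k\<bar> \<le> M + M * B * B" using that(1) by simp
  qed
  define E where "E = M * B * B * B + (M + M * B * B) * B + (M + M * B * B) * B"
  let ?S = "{n :: int. \<bar>of_int n :: real\<bar> \<le> M * B}"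
  let ?T = "{x \<in> F. rD * x \<in> R \<and> \<bar>x\<bar> \<le> M + M * B * B \<and> \<bar>cj x\<bar> \<le> M + M * B * B}"
  let ?U = "{n :: int. \<bar>of_int n :: real\<bar> \<le> E}"
  have fin: "finite ((\<lambda>(i, l, j). (of_int i, l, of_int j) :: real \<times> real \<times> real) ` (?S \<times> ?T \<times> ?U))"
    by (intro finite_imageI finite_cartesian_product Ints_bounded_finite scaled_R_bounded_finite) auto
  have "{v \<in> HF m. curve v \<inter> K \<noteq> {}} \<subseteq> (\<lambda>(i, l, j). (of_int i, l, of_int j)) ` (?S \<times> ?T \<times> ?U)"
  proof
    fix v assume "v \<in> {v \<in> HF m. curve v \<inter> K \<noteq> {}}"
    then obtain x y where vH: "v \<in> HF m" and z: "(x, y) \<in> curve v" "(x, y) \<in> K" by auto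
    obtain a l b where v: "v = (a, l, b)" by (cases v) auto
    have "a \<in> \<int>" "b \<in> \<int>" and lD: "l \<in> Di" using vH by (auto simp: HF_def LL_def v)
    then obtain i j where ij: "a = of_int i" "b = of_int j" by (metis Ints_cases)
    have e: "ell v (x, y) = 0" using z by (simp add: curve_def)
    have xy: "cmod x \<le> B" "cmod y \<le> B" "Im x \<ge> 1 / B" "Im y \<ge> 1 / B" using bd[OF z(2)] by simp_all
    have im: "Im x > 0" "Im y > 0" using xy B0 by linarith+
    have nm: "nrm v \<le> real m" "nrm v \<ge> 0"
      using HF_nrm[OF vH] D_ge_1 divide_left_mono[of 1 "real_of_int D" "real m"] by auto
    have M2: "nrm v * (p / q) \<le> M\<^sup>2" if "p \<le> B" "q \<ge> 1 / B" "p > 0" for p q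
    proof -
      have "0 < q" using that B0 by linarith
      then have pq: "0 \<le> p / q" using that by simp
      have "p / q \<le> B / (1 / B)" using that B0 by (intro frac_le) auto
      then have "nrm v * (p / q) \<le> real m * (B / (1 / B))" using nm pq by (intro mult_mono) auto
      moreover have "real m * (B / (1 / B)) = M\<^sup>2"
        by (simp add: M_def power_mult_distrib) (simp add: power2_eq_square)
      ultimately show ?thesis by simp
    qed
    have "(cmod (of_real a * x + of_real (cj l)))\<^sup>2 = nrm v * (Im x / Im y)"
      using ell_zero_Im(1)[OF v e] im by (simp add: field_simps)
    also have "\<dots> \<le> M\<^sup>2" using xy im abs_Im_le_cmod[of x] by (intro M2) auto
    finally have c1: "cmod (of_real a * x + of_real (cj l)) \<le> M" using M0 by (simp add: power2_le_iff_abs_le)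
    have "(cmod (of_real a * y + of_real l))\<^sup>2 = nrm v * (Im y / Im x)"
      using ell_zero_Im(2)[OF v e] im by (simp add: field_simps)
    also have "\<dots> \<le> M\<^sup>2" using xy im abs_Im_le_cmod[of y] by (intro M2) auto
    finally have c2: "cmod (of_real a * y + of_real l) \<le> M" using M0 by (simp add: power2_le_iff_abs_le)
    have b1: "\<bar>a\<bar> \<le> M * B" "\<bar>cj l\<bar> \<le> M + M * B * B" using bound[OF c1 xy(1,3)] by simp_all
    have b2: "\<bar>l\<bar> \<le> M + M * B * B" using bound[OF c2 xy(2,4)] by simp
    have M1: "0 \<le> M * B" "0 \<le> M + M * B * B" using M0 B0 by auto
    have be: "of_real b = - (of_real a * x * y + of_real l * x + of_real (cj l) * y)"
      using e by (simp add: ell_def v eq_neg_iff_add_eq_0 algebra_simps)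
    have "\<bar>b\<bar> = cmod (of_real a * x * y + of_real l * x + of_real (cj l) * y)"
      using arg_cong[OF be, of cmod] by (simp only: norm_minus_cancel norm_of_real)
    also have "\<dots> \<le> cmod (of_real a * x * y) + cmod (of_real l * x) + cmod (of_real (cj l) * y)"
      by (meson norm_triangle_ineq norm_triangle_le add_right_mono)
    also have "\<dots> = \<bar>a\<bar> * cmod x * cmod y + \<bar>l\<bar> * cmod x + \<bar>cj l\<bar> * cmod y" by (simp add: norm_mult)
    also have "\<dots> \<le> E" unfolding E_def using b1 b2 xy B0 M1 by (intro add_mono mult_mono) auto
    finally have b3: "\<bar>b\<bar> \<le> E" .
    have "l \<in> ?T" using lD b1 b2 by (simp add: Di_iff)
    then show "v \<in> (\<lambda>(i, l, j). (of_int i, l, of_int j)) ` (?S \<times> ?T \<times> ?U)"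
      using b1 b3 by (intro image_eqI[of _ _ "(i, l, j)"]) (auto simp: v ij)
  qed
  then show ?thesis using fin finite_subset by blast
qed

text \<open>\<open>entries_bounded\<close> applies to the matrix in the first coordinate and to its
  conjugate in the second, and \<open>R\<close> is discrete under the two embeddings
  together.\<close>

lemma properly_discontinuous:
  assumes "compact K" "K \<subseteq> H2"
  shows "finite {A \<in> \<Gamma>. act2 A ` K \<inter> K \<noteq> {}}"
proof -
  obtain B where B: "B \<ge> 1" and bd: "\<And>z. z \<in> K \<Longrightarrow> cmod (fst z) \<le> B \<and> cmod (snd z) \<le> B \<and> Im (fst z) \<ge> 1 / B \<and> Im (snd z) \<ge> 1 / B"
    using compact_H2_bound[OF assms] by metis
  define M where "M = B\<^sup>2 + B ^ 4"
  let ?T = "{x \<in> R. \<bar>x\<bar> \<le> M \<and> \<bar>cj x\<bar> \<le> M}"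
  have fin: "finite ((\<lambda>(a, b, c, d). mk2 a b c d) ` (?T \<times> ?T \<times> ?T \<times> ?T))"
    by (intro finite_imageI finite_cartesian_product R_bounded_finite)
  have "{A \<in> \<Gamma>. act2 A ` K \<inter> K \<noteq> {}} \<subseteq> (\<lambda>(a, b, c, d). mk2 a b c d) ` (?T \<times> ?T \<times> ?T \<times> ?T)"
  proof
    fix A assume "A \<in> {A \<in> \<Gamma>. act2 A ` K \<inter> K \<noteq> {}}"
    then obtain z where A: "A \<in> \<Gamma>" and z: "z \<in> K" "act2 A z \<in> K" by auto
    have G: "A \<in> G" using A by simp
    note bz = bd[OF z(1)] and bw = bd[OF z(2), unfolded act2_def fst_conv snd_conv]
    have 1: "\<bar>A$i$j\<bar> \<le> M" for i j
      unfolding M_def using bz bw by (intro entries_bounded[OF G_det[OF G] B, of "fst z"]) simp_all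
    have 2: "\<bar>cjm A$i$j\<bar> \<le> M" for i j
      unfolding M_def using bz bw by (intro entries_bounded[OF G_det_cjm[OF G] B, of "snd z"]) simp_all
    have "(A$1$1, A$1$2, A$2$1, A$2$2) \<in> ?T \<times> ?T \<times> ?T \<times> ?T"
      using A 1 2[of 1 1] 2[of 1 2] 2[of 2 1] 2[of 2 2] unfolding SL2_iff by simp
    then show "A \<in> (\<lambda>(a, b, c, d). mk2 a b c d) ` (?T \<times> ?T \<times> ?T \<times> ?T)"
      by (rule rev_image_eqI) (simp add: mk2_eta)
  qed
  then show ?thesis using fin finite_subset by blast
qed

text \<open>The fixed point equation c z^2 + (d - a) z - b = 0 expresses a - d and b through c and
  z. Combined with the determinant, its discriminant becomes the trace identity, the familiar bound
  |a + d| <= 2 for elliptic elements in a form that also recovers c up to sign.\<close>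

lemma mob_fixed:
  fixes A :: "real^2^2"
  assumes det: "A$1$1 * A$2$2 - A$1$2 * A$2$1 = 1" and z: "Im z > 0" "mob A z = z"
  shows "of_real (A$2$1) * z\<^sup>2 + of_real (A$2$2 - A$1$1) * z + of_real (- (A$1$2)) = 0"
    and "A$1$1 - A$2$2 = 2 * A$2$1 * Re z" "A$1$2 = - A$2$1 * (cmod z)\<^sup>2"
    and "(A$1$1 + A$2$2)\<^sup>2 + 4 * (A$2$1)\<^sup>2 * (Im z)\<^sup>2 = 4"
proof -
  have nz: "aut A z \<noteq> 0" by (rule det_one_nonzero_row[OF det z(1)])
  have "z * aut A z = of_real (A$1$1) * z + of_real (A$1$2)" using mob_aut[OF nz] z(2) by simp
  then show q: "of_real (A$2$1) * z\<^sup>2 + of_real (A$2$2 - A$1$1) * z + of_real (- (A$1$2)) = 0"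
    by (simp add: aut_def algebra_simps power2_eq_square)
  have "Im (of_real (A$2$1) * z\<^sup>2 + of_real (A$2$2 - A$1$1) * z + of_real (- (A$1$2))) = 0" unfolding q by simp
  then have "(2 * A$2$1 * Re z + (A$2$2 - A$1$1)) * Im z = 0" by (simp add: power2_eq_square algebra_simps)
  then show 1: "A$1$1 - A$2$2 = 2 * A$2$1 * Re z" using z by simp
  have "Re (of_real (A$2$1) * z\<^sup>2 + of_real (A$2$2 - A$1$1) * z + of_real (- (A$1$2))) = 0" unfolding q by simp
  then have "A$2$1 * ((Re z)\<^sup>2 - (Im z)\<^sup>2) - (A$1$1 - A$2$2) * Re z - A$1$2 = 0" by (simp add: power2_eq_square algebra_simps)
  then show 2: "A$1$2 = - A$2$1 * (cmod z)\<^sup>2" unfolding 1 cmod_power2 by (simp add: power2_eq_square algebra_simps)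
  have "(A$1$1 + A$2$2)\<^sup>2 = (A$1$1 - A$2$2)\<^sup>2 + 4 * (1 + A$1$2 * A$2$1)"
    using det by (simp add: power2_eq_square algebra_simps)
  then show "(A$1$1 + A$2$2)\<^sup>2 + 4 * (A$2$1)\<^sup>2 * (Im z)\<^sup>2 = 4"
    unfolding 1 2 cmod_power2 by (simp add: power2_eq_square algebra_simps)
qed

text \<open>Two different fixed points differ in some coordinate, and there the quadratic fixed
  point equation has two roots in the upper half plane and vanishes identically. If it is the second
  coordinate, this concerns the conjugate matrix, and injectivity of conjugation carries it
  back.\<close>

lemma one_fixed_point:
  assumes A: "A \<in> G" and z: "z \<in> H2" "act2 A z = z" and w: "w \<in> H2" "act2 A w = w" and ne: "z \<noteq> w"
  shows "A = mat 1 \<or> A = - mat 1"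
proof -
  have fz: "mob A (fst z) = fst z" "mob (cjm A) (snd z) = snd z" and fw: "mob A (fst w) = fst w" "mob (cjm A) (snd w) = snd w"
    using z w unfolding act2_def by (metis fst_conv snd_conv)+
  have im: "Im (fst z) > 0" "Im (snd z) > 0" "Im (fst w) > 0" "Im (snd w) > 0" using z w by (simp_all add: H2_iff)
  have *: "A$2$1 = 0 \<and> A$2$2 = A$1$1 \<and> A$1$2 = 0"
  proof (cases "fst z = fst w")
    case False
    note q = real_quadratic_two_roots[OF mob_fixed(1)[OF G_det[OF A] im(1) fz(1)] mob_fixed(1)[OF G_det[OF A] im(3) fw(1)] im(1,3) False]
    then show ?thesis by simp
  next
    case True
    then have False': "snd z \<noteq> snd w" using ne by (simp add: prod_eq_iff)
    note q = real_quadratic_two_roots[OF mob_fixed(1)[OF G_det_cjm[OF A] im(2) fz(2)] mob_fixed(1)[OF G_det_cjm[OF A] im(4) fw(2)] im(2,4) False']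
    have "cj (A$2$2 - A$1$1) = 0" using q(2) A by simp
    then have "A$2$2 - A$1$1 = 0" using A cj_eq_0_iff diff_F by (metis G_F(1,4))
    then show ?thesis using q A by simp
  qed
  then have "A$1$1 * A$1$1 = 1" using G_det[OF A] by simp
  then have "A$1$1 = 1 \<or> A$1$1 = -1" by (metis mult_minus1 mult_cancel_left2 square_eq_1_iff)
  then show ?thesis using * by (auto simp: mat2_eq_iff)
qed

definition stab :: "complex \<times> complex \<Rightarrow> (real^2^2) set" where
  "stab z = {A \<in> \<Gamma>. act2 A z = z}"

text \<open>An element fixing a point is determined by its trace and by whether its lower left entry
  is nonnegative, which accounts for the factor 2; the trace and its conjugate are at most 2 in
  absolute value. The bound does not depend on the point.\<close>

definition stab_bound :: nat where
  "stab_bound = 2 * card {t \<in> R. \<bar>t\<bar> \<le> 2 \<and> \<bar>cj t\<bar> \<le> 2}"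

lemma finite_stab: "z \<in> H2 \<Longrightarrow> finite (stab z)"
  using properly_discontinuous[of "{z}"] by (auto simp: stab_def elim: rev_finite_subset)

lemma card_stab:
  assumes z: "z \<in> H2"
  shows "card (stab z) \<le> stab_bound" "card (stab z) > 0"
proof -
  let ?T = "{t \<in> R. \<bar>t\<bar> \<le> 2 \<and> \<bar>cj t\<bar> \<le> 2}"
  let ?f = "\<lambda>A :: real^2^2. (A$1$1 + A$2$2, A$2$1 \<ge> 0)"
  have im: "Im (fst z) > 0" "Im (snd z) > 0" using z by (simp_all add: H2_iff)
  have fx: "A \<in> G" "mob A (fst z) = fst z" "mob (cjm A) (snd z) = snd z" if "A \<in> stab z" for A
    using that unfolding stab_def act2_def by (auto simp: prod_eq_iff)
  have "?f ` stab z \<subseteq> ?T \<times> UNIV"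
  proof
    fix y assume "y \<in> ?f ` stab z"
    then obtain A where A: "A \<in> stab z" "y = ?f A" by blast
    have AR: "A$1$1 \<in> R" "A$2$2 \<in> R" using A unfolding stab_def SL2_iff by blast+
    have sq: "\<bar>t\<bar> \<le> 2" if "t\<^sup>2 + 4 * s\<^sup>2 * r\<^sup>2 = 4" for t s r :: real
    proof -
      have "0 \<le> 4 * s\<^sup>2 * r\<^sup>2" by simp
      then have "t\<^sup>2 \<le> 4" using that by linarith
      then show ?thesis using abs_le_square_iff[of t 2] by simp
    qed
    have "\<bar>A$1$1 + A$2$2\<bar> \<le> 2"
      by (rule sq[OF mob_fixed(4)[OF G_det[OF fx(1)[OF A(1)]] im(1) fx(2)[OF A(1)]]])
    moreover have "\<bar>cjm A$1$1 + cjm A$2$2\<bar> \<le> 2"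
      by (rule sq[OF mob_fixed(4)[OF G_det_cjm[OF fx(1)[OF A(1)]] im(2) fx(3)[OF A(1)]]])
    ultimately show "y \<in> ?T \<times> UNIV" using AR A(2) by simp
  qed
  moreover have "inj_on ?f (stab z)"
  proof (rule inj_onI)
    fix A B assume A: "A \<in> stab z" and B: "B \<in> stab z" and eq: "?f A = ?f B"
    note a = mob_fixed(2-4)[OF G_det[OF fx(1)[OF A]] im(1) fx(2)[OF A]]
    note b = mob_fixed(2-4)[OF G_det[OF fx(1)[OF B]] im(1) fx(2)[OF B]]
    have t: "A$1$1 + A$2$2 = B$1$1 + B$2$2" and s: "A$2$1 \<ge> 0 \<longleftrightarrow> B$2$1 \<ge> 0" using eq by auto
    have "4 * (A$2$1)\<^sup>2 * (Im (fst z))\<^sup>2 = 4 * (B$2$1)\<^sup>2 * (Im (fst z))\<^sup>2" using a(3) b(3) unfolding t by linarith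
    then have "(A$2$1)\<^sup>2 = (B$2$1)\<^sup>2" using im by simp
    then have c: "A$2$1 = B$2$1" using s by (auto simp: power2_eq_iff)
    have "A$1$1 - A$2$2 = B$1$1 - B$2$2" using a(1) b(1) c by simp
    then have "A$1$1 = B$1$1" "A$2$2 = B$2$2" using t by linarith+
    then show "A = B" using a(2) b(2) c by (simp add: mat2_eq_iff)
  qed
  moreover have fin: "finite (?T \<times> (UNIV :: bool set))" by (intro finite_cartesian_product R_bounded_finite finite)
  ultimately have "card (stab z) \<le> card (?T \<times> (UNIV :: bool set))" using card_inj_on_le by blast
  also have "\<dots> = stab_bound" by (simp add: card_cartesian_product stab_bound_def)
  finally show "card (stab z) \<le> stab_bound" .
  have "mat 1 \<in> stab z" by (simp add: stab_def)
  then show "card (stab z) > 0" using finite_stab[OF z] by (auto simp: card_gt_0_iff)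
qed

end

section \<open>The Baily--Borel space\<close>

context quadratic
begin

abbreviation X :: "ext_point set topology" where "X \<equiv> BB_topology F"
abbreviation Ox :: "ext_point set set \<Rightarrow> (ext_point set \<Rightarrow> complex) set" where "Ox \<equiv> BB_sheaf F"

text \<open>Homogeneous coordinates (x : y) of a cusp. With them the action is linear, and the case
  distinctions in \<open>act\<close> disappear from composition and inversion.\<close>

definition cu :: "real \<Rightarrow> real \<Rightarrow> ext_point" where
  "cu x y = (if y = 0 then CuspInf else Cusp (x / y))"

definition qpt :: "complex \<times> complex \<Rightarrow> ext_point set" where
  "qpt z = proj F (Interior z)"

lemma cu_ne_Interior [simp]: "cu x y \<noteq> Interior z" "Interior z \<noteq> cu x y"
  by (simp_all add: cu_def)

lemma act_cu:
  assumes A: "A \<in> G" and xy: "x \<noteq> 0 \<or> y \<noteq> 0"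
  shows "act F A (cu x y) = cu (A$1$1 * x + A$1$2 * y) (A$2$1 * x + A$2$2 * y)"
    "A$1$1 * x + A$1$2 * y \<noteq> 0 \<or> A$2$1 * x + A$2$2 * y \<noteq> 0"
proof -
  show nz: "A$1$1 * x + A$1$2 * y \<noteq> 0 \<or> A$2$1 * x + A$2$2 * y \<noteq> 0"
  proof (rule ccontr)
    assume "\<not> ?thesis"
    then have e: "A$1$1 * x + A$1$2 * y = 0" "A$2$1 * x + A$2$2 * y = 0" by auto
    have "(A$1$1 * A$2$2 - A$1$2 * A$2$1) * x = 0" "(A$1$1 * A$2$2 - A$1$2 * A$2$1) * y = 0"
      using e by algebra+
    then show False using G_det[OF A] xy by simp
  qed
  show "act F A (cu x y) = cu (A$1$1 * x + A$1$2 * y) (A$2$1 * x + A$2$2 * y)"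
  proof (cases "y = 0")
    case True
    then show ?thesis using xy by (simp add: cu_def)
  next
    case False
    have e: "A$2$1 * x / y + A$2$2 = (A$2$1 * x + A$2$2 * y) / y" using False by (simp add: field_simps)
    have e': "A$1$1 * x / y + A$1$2 = (A$1$1 * x + A$1$2 * y) / y" using False by (simp add: field_simps)
    show ?thesis using False by (simp add: cu_def moebius_def e e')
  qed
qed

lemma ext_H2_cases:
  assumes "p \<in> ext_H2 F"
  obtains z where "z \<in> H2" "p = Interior z" | x y where "x \<in> F" "y \<in> F" "x \<noteq> 0 \<or> y \<noteq> 0" "p = cu x y"
proof -
  consider z where "z \<in> H2" "p = Interior z" | x where "x \<in> F" "p = Cusp x" | "p = CuspInf"
    using assms unfolding ext_H2_def by blast
  then show ?thesis
  proof cases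
    case 2
    then show ?thesis using that(2)[of x 1] by (simp add: cu_def)
  next
    case 3
    then show ?thesis using that(2)[of 1 0] by (simp add: cu_def)
  qed (use that(1) in blast)
qed

lemma cu_ext_H2: "x \<in> F \<Longrightarrow> y \<in> F \<Longrightarrow> cu x y \<in> ext_H2 F"
  by (simp add: cu_def ext_H2_def)

lemma Interior_ext_H2: "Interior z \<in> ext_H2 F \<longleftrightarrow> z \<in> H2"
  by (auto simp: ext_H2_def)

lemma act_ext_H2:
  assumes A: "A \<in> G" and p: "p \<in> ext_H2 F"
  shows "act F A p \<in> ext_H2 F"
  using p
proof (cases rule: ext_H2_cases)
  case (1 z)
  then show ?thesis using act2_H2[OF A] by (simp add: act_Interior Interior_ext_H2)
next
  case (2 x y)
  then show ?thesis unfolding 2(4) act_cu(1)[OF A 2(3)] using A by (intro cu_ext_H2) simp_all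
qed

lemma act_mult:
  assumes A: "A \<in> G" and B: "B \<in> G" and p: "p \<in> ext_H2 F"
  shows "act F (A ** B) p = act F A (act F B p)"
  using p
proof (cases rule: ext_H2_cases)
  case (1 z)
  then show ?thesis using act2_mult[OF A B] by (simp add: act_Interior)
next
  case (2 x y)
  show ?thesis
    unfolding 2(4) act_cu(1)[OF B 2(3)] act_cu(1)[OF A act_cu(2)[OF B 2(3)]] act_cu(1)[OF SL2_mult[OF A B] 2(3)]
    by (simp add: mat2_mult_nth algebra_simps)
qed

lemma act_one:
  assumes p: "p \<in> ext_H2 F"
  shows "act F (mat 1) p = p"
  using p
proof (cases rule: ext_H2_cases)
  case (1 z)
  then show ?thesis by (simp add: act_Interior)
next
  case (2 x y)
  have "mat 1 \<in> G" by simp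
  from act_cu(1)[OF this 2(3)] show ?thesis using 2(4) by simp
qed

lemma act_inv:
  assumes A: "A \<in> G" and p: "p \<in> ext_H2 F"
  shows "act F (inv2 A) (act F A p) = p" "act F A (act F (inv2 A) p) = p"
  using act_mult[OF inv2_G[OF A] A p] act_mult[OF A inv2_G[OF A] p] act_one[OF p] inv2_left[OF A] inv2_right[OF A] by simp_all

lemma proj_eq_iff:
  assumes p: "p \<in> ext_H2 F" and q: "q \<in> ext_H2 F"
  shows "proj F p = proj F q \<longleftrightarrow> (\<exists>A\<in>\<Gamma>. q = act F A p)"
proof
  assume "proj F p = proj F q"
  moreover have "q \<in> proj F q" unfolding proj_def using act_one[OF q] by (intro image_eqI[of _ _ "mat 1"]) auto
  ultimately have "q \<in> proj F p" by simp
  then show "\<exists>A\<in>\<Gamma>. q = act F A p" by (auto simp: proj_def)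
next
  assume "\<exists>A\<in>\<Gamma>. q = act F A p"
  then obtain A where A: "A \<in> \<Gamma>" "q = act F A p" by blast
  have AG: "A \<in> G" using A by simp
  have p': "p = act F (inv2 A) q" using act_inv[OF AG p] A by simp
  have "proj F q \<subseteq> proj F p"
  proof
    fix r assume "r \<in> proj F q"
    then obtain B where B: "B \<in> \<Gamma>" "r = act F B q" by (auto simp: proj_def)
    then have "r = act F (B ** A) p" using act_mult[of B A p] AG p A by simp
    then show "r \<in> proj F p" unfolding proj_def using \<Gamma>_mult[OF B(1) A(1)] by blast
  qed
  moreover have "proj F p \<subseteq> proj F q"
  proof
    fix r assume "r \<in> proj F p"
    then obtain B where B: "B \<in> \<Gamma>" "r = act F B p" by (auto simp: proj_def)
    then have "r = act F (B ** inv2 A) q" using act_mult[of B "inv2 A" q] inv2_G[OF AG] q p' by simp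
    then show "r \<in> proj F q" unfolding proj_def using \<Gamma>_mult[OF B(1) inv2_\<Gamma>[OF A(1)]] by blast
  qed
  ultimately show "proj F p = proj F q" by blast
qed

lemma qpt_eq_iff:
  assumes "z \<in> H2" "w \<in> H2"
  shows "qpt z = qpt w \<longleftrightarrow> (\<exists>A\<in>\<Gamma>. w = act2 A z)"
  unfolding qpt_def using assms by (subst proj_eq_iff) (simp_all add: Interior_ext_H2 act_Interior)

lemma qpt_act2: "A \<in> \<Gamma> \<Longrightarrow> z \<in> H2 \<Longrightarrow> qpt (act2 A z) = qpt z"
  using qpt_eq_iff[of z "act2 A z"] act2_H2[of A z] by auto

lemma qpt_ne_cusp: "x \<in> F \<Longrightarrow> y \<in> F \<Longrightarrow> x \<noteq> 0 \<or> y \<noteq> 0 \<Longrightarrow> z \<in> H2 \<Longrightarrow> qpt z \<noteq> proj F (cu x y)"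
  unfolding qpt_def by (subst proj_eq_iff) (auto simp: Interior_ext_H2 cu_ext_H2 act_Interior)

lemma G_CuspInf: "A \<in> G \<Longrightarrow> act F A CuspInf = cu (A$1$1) (A$2$1)" "A \<in> G \<Longrightarrow> A$1$1 \<noteq> 0 \<or> A$2$1 \<noteq> 0"
  using act_cu[of A 1 0] by (simp_all add: cu_def)

lemma topspace_X: "topspace X = proj F ` ext_H2 F"
proof -
  have "openin X (proj F ` ext_H2 F)"
    unfolding openin_BB_topology openin_ext_topology
  proof (intro conjI order_refl)
    have e: "{p \<in> ext_H2 F. proj F p \<in> proj F ` ext_H2 F} = ext_H2 F" by auto
    show "ext_open F {p \<in> ext_H2 F. proj F p \<in> proj F ` ext_H2 F}"
      unfolding e ext_open_def
    proof (intro conjI ballI impI order_refl)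
      show "open {z \<in> H2. Interior z \<in> ext_H2 F}" using open_H2 by (simp add: Interior_ext_H2)
      fix A assume "A \<in> G"
      moreover have "horoball 1 \<subseteq> ext_H2 F" by (auto simp: horoball_def Interior_ext_H2)
      ultimately have "act F A ` horoball 1 \<subseteq> ext_H2 F" using act_ext_H2 by blast
      then show "\<exists>C>0. act F A ` horoball C \<subseteq> ext_H2 F" by (intro exI[of _ 1]) simp
    qed
  qed
  moreover have "topspace X \<subseteq> proj F ` ext_H2 F"
    using openin_topspace[of X] unfolding openin_BB_topology by blast
  ultimately show ?thesis by (meson openin_subset subset_antisym)
qed

lemma X_cases:
  assumes "x \<in> topspace X"
  obtains z where "z \<in> H2" "x = qpt z" | a c where "a \<in> F" "c \<in> F" "a \<noteq> 0 \<or> c \<noteq> 0" "x = proj F (cu a c)"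
proof -
  obtain p where "p \<in> ext_H2 F" "x = proj F p" using assms topspace_X by auto
  then show ?thesis using that by (cases p rule: ext_H2_cases) (auto simp: qpt_def)
qed

lemma qpt_topspace [simp]: "z \<in> H2 \<Longrightarrow> qpt z \<in> topspace X"
  by (auto simp: topspace_X qpt_def Interior_ext_H2)

lemma act2_image_H2: "A \<in> G \<Longrightarrow> W \<subseteq> H2 \<Longrightarrow> act2 A ` W \<subseteq> H2"
  using act2_H2 by blast

lemma openin_qpt_image:
  assumes W: "open W" "W \<subseteq> H2"
  shows "openin X (qpt ` W)"
  unfolding openin_BB_topology openin_ext_topology
proof
  show "qpt ` W \<subseteq> proj F ` ext_H2 F" using W by (auto simp: qpt_def Interior_ext_H2)
  let ?W = "\<Union>A\<in>\<Gamma>. act2 A ` W"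
  have oW: "open ?W" using W by (intro open_UN ballI open_act2_image) auto
  have WH: "?W \<subseteq> H2" using act2_image_H2[OF \<Gamma>_G W(2)] by (intro UN_least)
  have e: "{p \<in> ext_H2 F. proj F p \<in> qpt ` W} = Interior ` ?W"
  proof (intro equalityI subsetI)
    fix p assume p: "p \<in> {p \<in> ext_H2 F. proj F p \<in> qpt ` W}"
    then obtain w where w: "w \<in> W" "proj F (Interior w) = proj F p" by (auto simp: qpt_def)
    then have "\<exists>A\<in>\<Gamma>. p = act F A (Interior w)"
      using proj_eq_iff[of "Interior w" p] p W by (auto simp: Interior_ext_H2)
    then show "p \<in> Interior ` ?W" using w by (auto simp: act_Interior)
  next
    fix p assume "p \<in> Interior ` ?W"
    then obtain A w where A: "A \<in> \<Gamma>" "w \<in> W" "p = Interior (act2 A w)" by auto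
    have wH: "w \<in> H2" using A W by auto
    then have "proj F p = qpt w" using qpt_act2[OF A(1) wH] by (simp add: A qpt_def)
    then show "p \<in> {p \<in> ext_H2 F. proj F p \<in> qpt ` W}"
      using A wH act2_H2[of A w] by (auto simp: Interior_ext_H2)
  qed
  show "ext_open F {p \<in> ext_H2 F. proj F p \<in> qpt ` W}"
    unfolding e ext_open_def
  proof (intro conjI ballI impI)
    show "Interior ` ?W \<subseteq> ext_H2 F"
    proof
      fix p assume "p \<in> Interior ` ?W"
      then obtain w where "w \<in> ?W" "p = Interior w" by blast
      then show "p \<in> ext_H2 F" using subsetD[OF WH] by (simp only: Interior_ext_H2)
    qed
    have "{z \<in> H2. Interior z \<in> Interior ` ?W} = H2 \<inter> ?W" by auto
    also have "\<dots> = ?W" using WH by (rule Int_absorb1)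
    finally have "{z \<in> H2. Interior z \<in> Interior ` ?W} = ?W" .
    then show "open {z \<in> H2. Interior z \<in> Interior ` ?W}" using oW by (simp only:)
  next
    fix A assume "A \<in> G" "act F A CuspInf \<in> Interior ` ?W"
    then have False using G_CuspInf(1)[of A] by auto
    then show "\<exists>C>0. act F A ` horoball C \<subseteq> Interior ` ?W" ..
  qed
qed

section \<open>Horoballs and neighbourhoods of cusps\<close>

definition HB :: "real \<Rightarrow> (complex \<times> complex) set" where
  "HB C = {z \<in> H2. Im (fst z) * Im (snd z) > C}"

lemma HB_H2: "HB C \<subseteq> H2"
  by (auto simp: HB_def)

lemma horoball_HB: "horoball C = Interior ` HB C"
  by (auto simp: horoball_def HB_def)

lemma open_HB: "open (HB C)"
proof -
  have "HB C = H2 \<inter> {z. Im (fst z) * Im (snd z) > C}" by (auto simp: HB_def)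
  also have "open \<dots>"
    by (intro open_Int open_H2 open_Collect_less continuous_intros)
  finally show ?thesis .
qed

definition cusp_nbhd :: "real^2^2 \<Rightarrow> real \<Rightarrow> ext_point set set" where
  "cusp_nbhd \<alpha> C = insert (proj F (act F \<alpha> CuspInf)) (qpt ` act2 \<alpha> ` HB C)"

lemma Im_act2_upper:
  assumes "A \<in> G" "A$2$1 = 0" "z \<in> H2"
  shows "Im (fst (act2 A z)) * Im (snd (act2 A z)) = Im (fst z) * Im (snd z) / (A$2$2 * cj (A$2$2))\<^sup>2"
  using Im_mob[OF G_det[OF assms(1)], of "fst z"] Im_mob[OF G_det_cjm[OF assms(1)], of "snd z"] assms(2)
  by (simp add: act2_def aut_def power_mult_distrib)

text \<open>Openness has to be tested with every A in \<open>SL2 F\<close> that carries infinity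
  into the set, not just with \<alpha>. Such an A equals \<gamma> \<alpha> B with \<gamma> in
  \<Gamma> and B fixing infinity, and B only rescales the product of the imaginary parts.\<close>

lemma openin_cusp_nbhd:
  assumes \<alpha>: "\<alpha> \<in> G" and C: "C > 0"
  shows "openin X (cusp_nbhd \<alpha> C)"
  unfolding openin_BB_topology openin_ext_topology
proof
  have oH: "open (act2 \<alpha> ` HB C)" by (intro open_act2_image \<alpha> open_HB HB_H2)
  have sH: "act2 \<alpha> ` HB C \<subseteq> H2" by (intro act2_image_H2 \<alpha> HB_H2)
  have inf: "CuspInf \<in> ext_H2 F" by (simp add: ext_H2_def)
  have a: "act F \<alpha> CuspInf \<in> ext_H2 F" by (intro act_ext_H2 \<alpha> inf)
  show "cusp_nbhd \<alpha> C \<subseteq> proj F ` ext_H2 F"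
    using sH a by (auto simp: cusp_nbhd_def qpt_def Interior_ext_H2)
  have e1: "{p \<in> ext_H2 F. proj F p \<in> qpt ` act2 \<alpha> ` HB C} \<subseteq> {p \<in> ext_H2 F. proj F p \<in> cusp_nbhd \<alpha> C}"
    by (auto simp: cusp_nbhd_def)
  have eo: "ext_open F {p \<in> ext_H2 F. proj F p \<in> qpt ` act2 \<alpha> ` HB C}"
    using openin_qpt_image[OF oH sH] unfolding openin_BB_topology openin_ext_topology by blast
  have int: "{z \<in> H2. Interior z \<in> {p \<in> ext_H2 F. proj F p \<in> cusp_nbhd \<alpha> C}} =
     {z \<in> H2. Interior z \<in> {p \<in> ext_H2 F. proj F p \<in> qpt ` act2 \<alpha> ` HB C}}"
  proof -
    have "proj F (Interior z) \<noteq> proj F (act F \<alpha> CuspInf)" if "z \<in> H2" for z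
      using qpt_ne_cusp[of "\<alpha>$1$1" "\<alpha>$2$1" z] G_CuspInf[OF \<alpha>] \<alpha> that by (simp add: qpt_def)
    then show ?thesis by (auto simp: cusp_nbhd_def)
  qed
  show "ext_open F {p \<in> ext_H2 F. proj F p \<in> cusp_nbhd \<alpha> C}"
    unfolding ext_open_def
  proof (intro conjI ballI impI)
    show "open {z \<in> H2. Interior z \<in> {p \<in> ext_H2 F. proj F p \<in> cusp_nbhd \<alpha> C}}"
      unfolding int using eo unfolding ext_open_def by blast
  next
    fix A assume A: "A \<in> G" "act F A CuspInf \<in> {p \<in> ext_H2 F. proj F p \<in> cusp_nbhd \<alpha> C}"
    have "proj F (act F A CuspInf) \<notin> qpt ` act2 \<alpha> ` HB C"
    proof
      assume "proj F (act F A CuspInf) \<in> qpt ` act2 \<alpha> ` HB C"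
      then obtain w where w: "w \<in> H2" "proj F (act F A CuspInf) = qpt w" using sH by auto
      then show False using qpt_ne_cusp[of "A$1$1" "A$2$1" w] G_CuspInf[OF A(1)] A(1) by simp
    qed
    then have "proj F (act F \<alpha> CuspInf) = proj F (act F A CuspInf)" using A by (auto simp: cusp_nbhd_def)
    then obtain \<gamma> where \<gamma>: "\<gamma> \<in> \<Gamma>" "act F A CuspInf = act F \<gamma> (act F \<alpha> CuspInf)"
      using proj_eq_iff[OF a act_ext_H2[OF A(1) inf]] by blast
    have \<gamma>G: "\<gamma> \<in> G" using \<gamma> by simp
    define M where "M = \<gamma> ** \<alpha>"
    have M: "M \<in> G" unfolding M_def by (intro SL2_mult \<gamma>G \<alpha>)
    define B where "B = inv2 M ** A"
    have B: "B \<in> G" unfolding B_def by (intro SL2_mult inv2_G M A)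
    have "act F A CuspInf = act F M CuspInf"
      unfolding M_def act_mult[OF \<gamma>G \<alpha> inf] by (rule \<gamma>(2))
    moreover have "act F B CuspInf = act F (inv2 M) (act F A CuspInf)"
      unfolding B_def by (rule act_mult[OF inv2_G[OF M] A(1) inf])
    ultimately have "act F B CuspInf = act F (inv2 M) (act F M CuspInf)" by simp
    then have "act F B CuspInf = CuspInf" using act_inv(1)[OF M inf] by simp
    then have B21: "B$2$1 = 0" using G_CuspInf[OF B] by (simp add: cu_def split: if_splits)
    \<comment> \<open>The upper triangular B divides the product of the imaginary parts by k, so
      height C k is needed to land in height C.\<close>
    define k where "k = (B$2$2 * cj (B$2$2))\<^sup>2"
    have "B$2$2 \<noteq> 0" using G_det[OF B] B21 by auto
    then have k: "k > 0" using B by (simp add: k_def)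
    have "act F A ` horoball (C * k) \<subseteq> {p \<in> ext_H2 F. proj F p \<in> cusp_nbhd \<alpha> C}"
    proof
      fix p assume "p \<in> act F A ` horoball (C * k)"
      then obtain z where z0: "z \<in> HB (C * k)" "p = act F A (Interior z)" unfolding horoball_HB by blast
      then have z: "z \<in> HB (C * k)" "p = Interior (act2 A z)" by (simp_all only: act_Interior)
      have zH: "z \<in> H2" using z by (simp add: HB_def)
      have BH: "act2 B z \<in> H2" by (intro act2_H2 B zH)
      have "Im (fst (act2 B z)) * Im (snd (act2 B z)) = Im (fst z) * Im (snd z) / k"
        unfolding k_def by (intro Im_act2_upper B B21 zH)
      moreover have "C < Im (fst z) * Im (snd z) / k" using z k by (simp add: HB_def pos_less_divide_eq)
      ultimately have BC: "act2 B z \<in> HB C" using BH by (simp add: HB_def)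
      have "M ** B = A" unfolding B_def using inv2_right[OF M] by (simp add: matrix_mul_assoc)
      then have "act2 A z = act2 M (act2 B z)" using act2_mult[OF M B zH] by simp
      also have "\<dots> = act2 \<gamma> (act2 \<alpha> (act2 B z))" unfolding M_def by (intro act2_mult \<gamma>G \<alpha> BH)
      finally have "qpt (act2 A z) = qpt (act2 \<alpha> (act2 B z))"
        using qpt_act2[OF \<gamma>(1) act2_H2[OF \<alpha> BH]] by simp
      then show "p \<in> {p \<in> ext_H2 F. proj F p \<in> cusp_nbhd \<alpha> C}"
        using BC act2_H2[OF A(1) zH] z(2) unfolding cusp_nbhd_def qpt_def by (auto simp: Interior_ext_H2)
    qed
    then show "\<exists>C'>0. act F A ` horoball C' \<subseteq> {p \<in> ext_H2 F. proj F p \<in> cusp_nbhd \<alpha> C}"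
      using C k by (intro exI[of _ "C * k"]) simp
  qed simp
qed

text \<open>Descends a function from representatives in \<open>W\<close> to the quotient. The
  constant \<open>c\<close> is the value at classes without a representative in \<open>W\<close>; in
  the applications this is the value at the cusp.\<close>

definition push :: "(complex \<times> complex) set \<Rightarrow> (complex \<times> complex \<Rightarrow> complex) \<Rightarrow> complex \<Rightarrow> ext_point set \<Rightarrow> complex" where
  "push W \<phi> c x = (if \<exists>z\<in>W. x = qpt z then \<phi> (SOME z. z \<in> W \<and> x = qpt z) else c)"

definition \<Gamma>_inv_on :: "(complex \<times> complex) set \<Rightarrow> (complex \<times> complex \<Rightarrow> complex) \<Rightarrow> bool" where
  "\<Gamma>_inv_on W \<phi> \<longleftrightarrow> (\<forall>A\<in>\<Gamma>. \<forall>z\<in>W. act2 A z \<in> W \<longrightarrow> \<phi> (act2 A z) = \<phi> z)"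

lemma push_qpt:
  assumes "W \<subseteq> H2" "\<Gamma>_inv_on W \<phi>" "z \<in> W"
  shows "push W \<phi> c (qpt z) = \<phi> z"
proof -
  define w where "w = (SOME w. w \<in> W \<and> qpt z = qpt w)"
  have "w \<in> W \<and> qpt z = qpt w" unfolding w_def by (rule someI[of _ z]) (use assms in simp)
  then have w: "w \<in> W" "qpt z = qpt w" by auto
  obtain A where "A \<in> \<Gamma>" "w = act2 A z" using qpt_eq_iff[of z w] w assms by blast
  then have "\<phi> w = \<phi> z" using assms(2,3) w(1) unfolding \<Gamma>_inv_on_def by blast
  then show ?thesis using assms(3) unfolding push_def w_def by auto
qed

lemma push_cusp:
  assumes "W \<subseteq> H2" "\<alpha> \<in> G"
  shows "push W \<phi> c (proj F (act F \<alpha> CuspInf)) = c"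
proof -
  have "\<not> (\<exists>z\<in>W. proj F (act F \<alpha> CuspInf) = qpt z)"
    using qpt_ne_cusp[of "\<alpha>$1$1" "\<alpha>$2$1"] G_CuspInf[OF assms(2)] assms by (metis G_F(1,3) subsetD)
  then show ?thesis by (simp add: push_def)
qed

lemma push_holomorphic:
  assumes W: "open W" "W \<subseteq> H2" and hol: "holomorphic2_on \<phi> W" and inv: "\<Gamma>_inv_on W \<phi>"
  shows "holomorphic2_on (\<lambda>z. push W \<phi> c (qpt z)) {z \<in> H2. qpt z \<in> qpt ` W}"
proof (rule holomorphic2_on_local)
  fix z assume z: "z \<in> {z \<in> H2. qpt z \<in> qpt ` W}"
  then obtain w where w: "w \<in> W" "qpt z = qpt w" by auto
  obtain A where A: "A \<in> \<Gamma>" "z = act2 A w" using qpt_eq_iff[of w z] w z W by auto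
  have AG: "A \<in> G" using A by simp
  let ?V = "act2 A ` W"
  have oV: "open ?V" by (intro open_act2_image AG W)
  have VH: "?V \<subseteq> H2" by (intro act2_image_H2 AG W)
  have "holomorphic2_on (\<lambda>z. \<phi> (act2 (inv2 A) z)) ?V"
    by (rule holomorphic2_comp_act2[OF inv2_G[OF AG] VH hol]) (use AG W in auto)
  then have "holomorphic2_on (\<lambda>z. push W \<phi> c (qpt z)) ?V"
  proof (rule holomorphic2_on_transform)
    fix u assume "u \<in> ?V"
    then obtain v where v: "v \<in> W" "u = act2 A v" by auto
    then have "v \<in> H2" using W by auto
    then show "push W \<phi> c (qpt u) = \<phi> (act2 (inv2 A) u)"
      using v qpt_act2[OF A(1)] push_qpt[OF W(2) inv v(1)] AG by simp
  qed
  then have "holomorphic2_on (\<lambda>z. push W \<phi> c (qpt z)) ({z \<in> H2. qpt z \<in> qpt ` W} \<inter> ?V)"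
    by (rule holomorphic2_on_subset) auto
  then show "\<exists>V. open V \<and> z \<in> V \<and> holomorphic2_on (\<lambda>z. push W \<phi> c (qpt z)) ({z \<in> H2. qpt z \<in> qpt ` W} \<inter> V)"
    using oV w(1) A(2) by (intro exI[of _ ?V]) auto
qed

lemma push_level_open:
  assumes W: "open W" "W \<subseteq> H2" and hol: "holomorphic2_on \<phi> W" and U: "open U"
  shows "openin X (qpt ` {z \<in> W. \<phi> z \<in> U})"
proof -
  have "open (W \<inter> \<phi> -` U)"
    using continuous_open_preimage[OF holomorphic2_on_imp_continuous_on[OF hol] W(1) U] .
  moreover have "W \<inter> \<phi> -` U = {z \<in> W. \<phi> z \<in> U}" by auto
  ultimately show ?thesis using W by (intro openin_qpt_image) auto
qed

lemma push_sheaf: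
  assumes W: "open W" "W \<subseteq> H2" and hol: "holomorphic2_on \<phi> W" and inv: "\<Gamma>_inv_on W \<phi>"
  shows "push W \<phi> c \<in> Ox (qpt ` W)"
proof -
  have oV: "openin X (qpt ` W)" by (intro openin_qpt_image W)
  have "continuous_map (subtopology X (qpt ` W)) euclidean (push W \<phi> c)"
    unfolding continuous_map openin_open_subtopology[OF oV]
  proof (intro conjI allI impI)
    fix U :: "complex set" assume "openin euclidean U"
    then have U: "open U" by simp
    have e: "{x \<in> topspace (subtopology X (qpt ` W)). push W \<phi> c x \<in> U} = qpt ` {z \<in> W. \<phi> z \<in> U}"
      using push_qpt[OF W(2) inv] W(2) by (auto simp: topspace_subtopology)
    show "openin X {x \<in> topspace (subtopology X (qpt ` W)). push W \<phi> c x \<in> U}"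
      unfolding e by (rule push_level_open[OF W hol U])
    show "{x \<in> topspace (subtopology X (qpt ` W)). push W \<phi> c x \<in> U} \<subseteq> qpt ` W" by auto
  qed auto
  then show ?thesis using push_holomorphic[OF assms] by (simp add: BB_sheaf_def qpt_def)
qed

text \<open>Compared with \<open>push_sheaf\<close>, only continuity at the cusp is new: by the
  limit hypothesis, the preimage of an open set containing \<open>c\<close> is a smaller cusp
  neighbourhood together with the image of an open part of \<open>W\<close>.\<close>

lemma push_sheaf_cusp:
  assumes \<alpha>: "\<alpha> \<in> G" and C: "C > 0" and W: "W = act2 \<alpha> ` HB C"
    and hol: "holomorphic2_on \<phi> W" and inv: "\<Gamma>_inv_on W \<phi>"
    and lim: "\<And>e. e > 0 \<Longrightarrow> \<exists>C'\<ge>C. \<forall>z\<in>HB C'. cmod (\<phi> (act2 \<alpha> z) - c) < e"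
  shows "push W \<phi> c \<in> Ox (cusp_nbhd \<alpha> C)"
proof -
  have oW: "open W" unfolding W by (intro open_act2_image \<alpha> open_HB HB_H2)
  have WH: "W \<subseteq> H2" unfolding W by (intro act2_image_H2 \<alpha> HB_H2)
  let ?N = "cusp_nbhd \<alpha> C" and ?k = "proj F (act F \<alpha> CuspInf)"
  have oN: "openin X ?N" by (intro openin_cusp_nbhd \<alpha> C)
  have N: "?N = insert ?k (qpt ` W)" by (simp add: cusp_nbhd_def W)
  have pik: "qpt z \<noteq> ?k" if "z \<in> H2" for z
    using qpt_ne_cusp[of "\<alpha>$1$1" "\<alpha>$2$1" z] G_CuspInf[OF \<alpha>] \<alpha> that by simp
  have pk: "push W \<phi> c ?k = c" by (rule push_cusp[OF WH \<alpha>])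
  have "continuous_map (subtopology X ?N) euclidean (push W \<phi> c)"
    unfolding continuous_map openin_open_subtopology[OF oN]
  proof (intro conjI allI impI)
    fix U :: "complex set" assume "openin euclidean U"
    then have U: "open U" by simp
    let ?S = "{x \<in> topspace (subtopology X ?N). push W \<phi> c x \<in> U}"
    have top: "topspace (subtopology X ?N) = ?N" using openin_subset[OF oN] by (simp add: topspace_subtopology Int_absorb1)
    have o1: "openin X (qpt ` {z \<in> W. \<phi> z \<in> U})" by (rule push_level_open[OF oW WH hol U])
    show "openin X ?S"
    proof (cases "c \<in> U")
      case False
      then have "?S = qpt ` {z \<in> W. \<phi> z \<in> U}"
        unfolding top unfolding N using push_qpt[OF WH inv] pk by auto
      then show ?thesis using o1 by simp
    next
      case True
      then obtain e where e: "e > 0" "ball c e \<subseteq> U" using U open_contains_ball by blast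
      obtain C' where C': "C' \<ge> C" "\<forall>z\<in>HB C'. cmod (\<phi> (act2 \<alpha> z) - c) < e" using lim[OF e(1)] by blast
      have sub: "HB C' \<subseteq> HB C" using C' by (auto simp: HB_def)
      have o2: "openin X (cusp_nbhd \<alpha> C')" using C C' by (intro openin_cusp_nbhd \<alpha>) simp
      have "?S = cusp_nbhd \<alpha> C' \<union> qpt ` {z \<in> W. \<phi> z \<in> U}"
      proof (intro equalityI subsetI)
        fix x assume "x \<in> ?S"
        then have x: "x = ?k \<or> x \<in> qpt ` W" "push W \<phi> c x \<in> U" unfolding top unfolding N by auto
        then show "x \<in> cusp_nbhd \<alpha> C' \<union> qpt ` {z \<in> W. \<phi> z \<in> U}"
          using push_qpt[OF WH inv] by (auto simp: cusp_nbhd_def)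
      next
        fix x assume "x \<in> cusp_nbhd \<alpha> C' \<union> qpt ` {z \<in> W. \<phi> z \<in> U}"
        then consider "x = ?k" | z where "z \<in> HB C'" "x = qpt (act2 \<alpha> z)" | z where "z \<in> W" "\<phi> z \<in> U" "x = qpt z"
          unfolding cusp_nbhd_def by blast
        then show "x \<in> ?S"
        proof cases
          case 1
          then show ?thesis unfolding top unfolding N using pk True by simp
        next
          case 2
          have w: "act2 \<alpha> z \<in> W" unfolding W using 2 sub by blast
          have "dist c (\<phi> (act2 \<alpha> z)) < e" using C'(2) 2(1) by (simp add: dist_norm norm_minus_commute)
          then have "\<phi> (act2 \<alpha> z) \<in> U" using e(2) by auto
          then show ?thesis unfolding top unfolding N using push_qpt[OF WH inv w] w 2(2) by auto
        next
          case 3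
          then show ?thesis unfolding top unfolding N using push_qpt[OF WH inv 3(1)] by auto
        qed
      qed
      then show ?thesis using o1 o2 by (simp add: openin_Un)
    qed
    show "?S \<subseteq> ?N" unfolding top by auto
  qed auto
  moreover have "{z \<in> H2. qpt z \<in> ?N} = {z \<in> H2. qpt z \<in> qpt ` W}" unfolding N using pik by auto
  ultimately show ?thesis using push_holomorphic[OF oW WH hol inv, of c] by (simp add: BB_sheaf_def qpt_def)
qed

lemma open_qpt_preimage:
  assumes "openin X V"
  shows "open {z \<in> H2. qpt z \<in> V}"
proof -
  have "ext_open F {p \<in> ext_H2 F. proj F p \<in> V}"
    using assms unfolding openin_BB_topology openin_ext_topology by blast
  then have "open {z \<in> H2. Interior z \<in> {p \<in> ext_H2 F. proj F p \<in> V}}" unfolding ext_open_def by blast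
  moreover have "{z \<in> H2. Interior z \<in> {p \<in> ext_H2 F. proj F p \<in> V}} = {z \<in> H2. qpt z \<in> V}"
    by (auto simp: qpt_def Interior_ext_H2)
  ultimately show ?thesis by simp
qed

lemma sheaf_holomorphic: "f \<in> Ox V \<Longrightarrow> holomorphic2_on (\<lambda>z. f (qpt z)) {z \<in> H2. qpt z \<in> V}"
  by (simp add: BB_sheaf_def qpt_def)

lemma sheaf_continuous: "f \<in> Ox V \<Longrightarrow> continuous_map (subtopology X V) euclidean f"
  by (simp add: BB_sheaf_def)

lemma sheaf_restrict:
  assumes "f \<in> Ox V" "V' \<subseteq> V"
  shows "f \<in> Ox V'"
proof -
  have "continuous_map (subtopology X V') euclidean f"
    using sheaf_continuous[OF assms(1)] assms(2) by (rule continuous_map_from_subtopology_mono)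
  moreover have "holomorphic2_on (\<lambda>z. f (qpt z)) {z \<in> H2. qpt z \<in> V'}"
    by (rule holomorphic2_on_subset[OF sheaf_holomorphic[OF assms(1)]]) (use assms(2) in auto)
  ultimately show ?thesis by (simp add: BB_sheaf_def qpt_def)
qed

text \<open>Of the finitely many elements that move a compact ball onto something meeting it, those
  that do not fix the centre are excluded by shrinking the ball. The intersection of the translates
  of the small ball under the finite stabilizer is then invariant. The compact \<open>K\<close> is
  kept because finiteness of the curves is available on compact sets.\<close>

lemma invariant_nbhd:
  assumes z: "z0 \<in> H2" and W0: "open W0" "z0 \<in> W0"
  obtains W K where "open W" "z0 \<in> W" "W \<subseteq> W0" "W \<subseteq> K" "compact K" "K \<subseteq> H2"
    "\<And>A. A \<in> stab z0 \<Longrightarrow> act2 A ` W = W" "\<And>A w. A \<in> \<Gamma> \<Longrightarrow> w \<in> W \<Longrightarrow> act2 A w \<in> W \<Longrightarrow> A \<in> stab z0"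
proof -
  have "open (H2 \<inter> W0)" using open_H2 W0 by (intro open_Int)
  then obtain r where r: "r > 0" "cball z0 r \<subseteq> H2 \<inter> W0" using z W0 open_contains_cball by (metis IntI)
  define K where "K = cball z0 r"
  have K: "compact K" "K \<subseteq> H2" using r by (auto simp: K_def)
  define S where "S = {A \<in> \<Gamma>. act2 A ` K \<inter> K \<noteq> {}} - stab z0"
  have finS: "finite S" unfolding S_def using properly_discontinuous[OF K] by simp
  have ex: "\<exists>d>0. \<forall>w\<in>ball z0 d. w \<in> H2 \<longrightarrow> act2 A w \<notin> ball z0 d" if A: "A \<in> S" for A
  proof -
    have AG: "A \<in> G" and ne: "act2 A z0 \<noteq> z0" using A by (auto simp: S_def stab_def)
    define e where "e = dist (act2 A z0) z0 / 2"
    have e: "e > 0" using ne by (simp add: e_def)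
    have "isCont (act2 A) z0"
      using continuous_on_act2[OF AG order_refl] open_H2 z by (simp add: continuous_on_eq_continuous_at)
    then obtain d where d: "d > 0" "\<And>w. dist w z0 < d \<Longrightarrow> dist (act2 A w) (act2 A z0) < e"
      unfolding continuous_at_eps_delta using e by metis
    have "act2 A w \<notin> ball z0 (min d e)" if w: "w \<in> ball z0 (min d e)" for w
    proof
      assume "act2 A w \<in> ball z0 (min d e)"
      then have "dist (act2 A w) z0 < e" by (simp add: dist_commute)
      moreover have "dist (act2 A w) (act2 A z0) < e" using d(2)[of w] w by (simp add: dist_commute)
      ultimately have "dist (act2 A z0) z0 < 2 * e" using dist_triangle3[of "act2 A z0" z0 "act2 A w"] by (simp add: dist_commute)
      then show False by (simp add: e_def)
    qed
    then show ?thesis using d(1) e by (intro exI[of _ "min d e"]) simp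
  qed
  have "\<exists>d>0. d \<le> r \<and> (\<forall>A\<in>S. \<forall>w\<in>ball z0 d. w \<in> H2 \<longrightarrow> act2 A w \<notin> ball z0 d)"
    using finS ex
  proof (induction S rule: finite_induct)
    case empty
    then show ?case using r by (intro exI[of _ r]) auto
  next
    case (insert A S)
    then obtain d where d: "d > 0" "d \<le> r" "\<forall>A\<in>S. \<forall>w\<in>ball z0 d. w \<in> H2 \<longrightarrow> act2 A w \<notin> ball z0 d" by auto
    obtain d' where d': "d' > 0" "\<forall>w\<in>ball z0 d'. w \<in> H2 \<longrightarrow> act2 A w \<notin> ball z0 d'" using insert.prems by auto
    show ?case using d d' by (intro exI[of _ "min d d'"]) auto
  qed
  then obtain d where d: "d > 0" "d \<le> r" "\<And>A w. A \<in> S \<Longrightarrow> w \<in> ball z0 d \<Longrightarrow> w \<in> H2 \<Longrightarrow> act2 A w \<notin> ball z0 d" by blast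
  have bK: "ball z0 d \<subseteq> K" using d by (auto simp: K_def)
  then have bH: "ball z0 d \<subseteq> H2" using K by auto
  have sG: "A \<in> G" "A \<in> \<Gamma>" "act2 A z0 = z0" if "A \<in> stab z0" for A using that by (auto simp: stab_def)
  define W where "W = (\<Inter>A\<in>stab z0. act2 A ` ball z0 d)"
  have one: "mat 1 \<in> stab z0" by (simp add: stab_def)
  have "open W" unfolding W_def using finite_stab[OF z] sG bH by (intro open_INT ballI open_act2_image) auto
  moreover have "z0 \<in> W"
  proof -
    have "z0 \<in> act2 A ` ball z0 d" if "A \<in> stab z0" for A
      using sG(3)[OF that] d(1) by (intro image_eqI[of _ _ z0]) auto
    then show ?thesis by (simp add: W_def)
  qed
  moreover have Wb: "W \<subseteq> ball z0 d"
  proof -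
    have "W \<subseteq> act2 (mat 1) ` ball z0 d" unfolding W_def using one by (rule INT_lower)
    then show ?thesis by simp
  qed
  moreover have "W \<subseteq> K" "W \<subseteq> W0" using Wb bK r by (auto simp: K_def)
  moreover have sub: "act2 A ` W \<subseteq> W" if A: "A \<in> stab z0" for A
  proof
    fix y assume "y \<in> act2 A ` W"
    then obtain w where w: "w \<in> W" "y = act2 A w" by auto
    have wH: "w \<in> H2" using w Wb bH by auto
    have "y \<in> act2 B ` ball z0 d" if B: "B \<in> stab z0" for B
    proof -
      let ?C = "inv2 A ** B"
      have CG: "?C \<in> \<Gamma>" using sG(2)[OF A] sG(2)[OF B] by (intro \<Gamma>_mult inv2_\<Gamma>)
      have "act2 ?C z0 = act2 (inv2 A) (act2 B z0)" using sG(1)[OF A] sG(1)[OF B] z by (intro act2_mult inv2_G)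
      also have "\<dots> = z0" using act2_inv2(1)[OF sG(1)[OF A] z] sG(3)[OF A] sG(3)[OF B] by simp
      finally have "?C \<in> stab z0" using CG by (simp add: stab_def)
      then have "w \<in> act2 ?C ` ball z0 d" using w by (auto simp: W_def)
      then obtain u where u: "u \<in> ball z0 d" "w = act2 ?C u" by auto
      have uH: "u \<in> H2" using u bH by auto
      have "w = act2 (inv2 A) (act2 B u)" using u act2_mult[OF inv2_G[OF sG(1)[OF A]] sG(1)[OF B] uH] by simp
      then have "y = act2 B u" using w act2_inv2(2)[OF sG(1)[OF A] act2_H2[OF sG(1)[OF B] uH]] by simp
      then show ?thesis using u by blast
    qed
    then show "y \<in> W" by (simp add: W_def)
  qed
  moreover have "act2 A ` W = W" if A: "A \<in> stab z0" for A
  proof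
    have "inv2 A \<in> stab z0" using A sG[OF A] act2_inv2(1)[OF sG(1)[OF A] z] inv2_\<Gamma>[of A] by (simp add: stab_def)
    show "W \<subseteq> act2 A ` W"
    proof
      fix w assume w: "w \<in> W"
      have wH: "w \<in> H2" using w Wb bH by auto
      have "act2 (inv2 A) w \<in> W" using sub[OF \<open>inv2 A \<in> stab z0\<close>] w by auto
      moreover have "w = act2 A (act2 (inv2 A) w)" using sG(1)[OF A] wH by simp
      ultimately show "w \<in> act2 A ` W" by blast
    qed
  qed (rule sub[OF A])
  moreover have "A \<in> stab z0" if A: "A \<in> \<Gamma>" "w \<in> W" "act2 A w \<in> W" for A w
  proof (rule ccontr)
    assume "A \<notin> stab z0"
    then have "A \<in> S" using A \<open>W \<subseteq> K\<close> by (auto simp: S_def)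
    then show False using d(3)[OF _ subsetD[OF Wb A(2)] subsetD[OF bH subsetD[OF Wb A(2)]]] subsetD[OF Wb A(3)] by blast
  qed
  ultimately show ?thesis using that[of W K] K by blast
qed

end

section \<open>Divisors from local data\<close>

context quadratic
begin

text \<open>Treats both kinds of neighbourhoods alike: \<open>W\<close> represents every point of
  \<open>U\<close> with at most one exception, which is the cusp when there is one. Statements about
  zeros and orders are made on \<open>W\<close>, and the exceptional point is reached by
  continuity.\<close>

definition chart :: "ext_point set set \<Rightarrow> (complex \<times> complex) set \<Rightarrow> bool" where
  "chart U W \<longleftrightarrow> openin X U \<and> open W \<and> W \<subseteq> H2 \<and> qpt ` W \<subseteq> U \<and>
     (\<forall>z\<in>H2. qpt z \<in> U \<longrightarrow> qpt z \<in> qpt ` W) \<and> (\<exists>k. U - qpt ` W \<subseteq> {k})"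

lemma chartD:
  assumes "chart U W"
  shows "openin X U" "open W" "W \<subseteq> H2" "qpt ` W \<subseteq> U"
  using assms unfolding chart_def by simp_all

lemma chart_rep:
  assumes "chart U W" "z \<in> H2" "qpt z \<in> U"
  obtains w where "w \<in> W" "w \<in> H2" "qpt z = qpt w"
proof -
  have "\<forall>z\<in>H2. qpt z \<in> U \<longrightarrow> qpt z \<in> qpt ` W" using assms(1) unfolding chart_def by (elim conjE)
  from bspec[OF this assms(2)] assms(3) have "qpt z \<in> qpt ` W" by (rule mp)
  then obtain w where "w \<in> W" "qpt z = qpt w" by (elim imageE)
  then show ?thesis using that subsetD[OF chartD(3)[OF assms(1)]] by simp
qed

lemma chart_extra:
  assumes "chart U W"
  obtains \<kappa> where "U - qpt ` W \<subseteq> {\<kappa>}"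
  using assms unfolding chart_def by (elim conjE exE)

definition zero_on :: "(real \<times> real \<times> real) set \<Rightarrow> (complex \<times> complex) set \<Rightarrow> (ext_point set \<Rightarrow> complex) \<Rightarrow> bool" where
  "zero_on S W f \<longleftrightarrow> (\<forall>z\<in>W. f (qpt z) = 0 \<longleftrightarrow> (\<exists>v\<in>S. z \<in> curve v))"

text \<open>Crossings of curves are left out. At a point on a single curve the function is to be a
  unit times the n-th power of the equation of that curve, and orders along prime divisors are read
  off at such points.\<close>

definition order_on :: "nat \<Rightarrow> nat \<Rightarrow> (complex \<times> complex) set \<Rightarrow> (ext_point set \<Rightarrow> complex) \<Rightarrow> bool" where
  "order_on n m W f \<longleftrightarrow> (\<forall>z\<in>W. \<forall>v\<in>HF m. z \<in> curve v \<longrightarrow> (\<forall>u\<in>HF m. z \<in> curve u \<longrightarrow> u = v \<or> u = - v) \<longrightarrow>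
     (\<exists>W' h. open W' \<and> z \<in> W' \<and> W' \<subseteq> W \<and> holomorphic2_on h W' \<and>
        (\<forall>w\<in>W'. h w \<noteq> 0 \<and> f (qpt w) = h w * ell v w ^ n)))"

definition \<Gamma>_closed :: "nat \<Rightarrow> (real \<times> real \<times> real) set \<Rightarrow> bool" where
  "\<Gamma>_closed m S \<longleftrightarrow> S \<subseteq> HF m \<and> (\<forall>v\<in>S. - v \<in> S) \<and> (\<forall>v\<in>S. \<forall>A\<in>\<Gamma>. pull A v \<in> S)"

text \<open>For an arbitrary \<Gamma>-closed set only the zero set is recorded, so powers taken to
  achieve invariance do no harm. The exact exponent \<open>n\<close> is demanded for the set of all
  forms.\<close>

definition local_data :: "nat \<Rightarrow> nat \<Rightarrow> ext_point set \<Rightarrow> bool" where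
  "local_data m n x \<longleftrightarrow> (\<exists>U W. chart U W \<and> x \<in> U \<and>
     (\<forall>S. \<Gamma>_closed m S \<longrightarrow> (\<exists>f\<in>Ox U. zero_on S W f)) \<and>
     (\<exists>f\<in>Ox U. zero_on (HF m) W f \<and> order_on n m W f))"

definition generic :: "nat \<Rightarrow> complex \<times> complex \<Rightarrow> bool" where
  "generic m z \<longleftrightarrow> stab z \<subseteq> {mat 1, - mat 1} \<and>
     (\<forall>u\<in>HF m. \<forall>v\<in>HF m. z \<in> curve u \<longrightarrow> z \<in> curve v \<longrightarrow> u = v \<or> u = - v)"

lemma finite_at_most_one: "(\<And>x y. x \<in> S \<Longrightarrow> y \<in> S \<Longrightarrow> x = y) \<Longrightarrow> finite S"
  by (metis finite.emptyI finite_insert insertCI is_singletonI' is_singleton_def)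

text \<open>Only finitely many group elements and curves matter near a point. An element other than
  the two scalar ones fixes at most one point, and curves of forms that differ by more than a sign
  meet at most once.\<close>

lemma nongeneric_discrete:
  assumes m: "m > 0" and z: "z0 \<in> H2"
  obtains T where "open T" "z0 \<in> T" "T \<subseteq> H2" "finite {z \<in> T. \<not> generic m z}"
proof -
  obtain r where r: "r > 0" "cball z0 r \<subseteq> H2" using z open_H2 open_contains_cball by metis
  define K where "K = cball z0 r"
  have K: "compact K" "K \<subseteq> H2" using r by (auto simp: K_def)
  define \<A> where "\<A> = {A \<in> \<Gamma>. act2 A ` K \<inter> K \<noteq> {}} - {mat 1, - mat 1}"
  define \<V> where "\<V> = {v \<in> HF m. curve v \<inter> K \<noteq> {}}"
  have f1: "finite \<A>" unfolding \<A>_def using properly_discontinuous[OF K] by simp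
  have f2: "finite \<V>" unfolding \<V>_def by (rule curves_locally_finite[OF K])
  have fA: "finite {z \<in> H2. act2 A z = z}" if "A \<in> \<A>" for A
  proof (rule finite_at_most_one)
    fix x y assume "x \<in> {z \<in> H2. act2 A z = z}" "y \<in> {z \<in> H2. act2 A z = z}"
    then show "x = y" using one_fixed_point[of A x y] that by (auto simp: \<A>_def)
  qed
  have fV: "finite (curve (fst p) \<inter> curve (snd p))" if "p \<in> {p \<in> \<V> \<times> \<V>. fst p \<noteq> snd p \<and> fst p \<noteq> - snd p}" for p
  proof (rule finite_at_most_one)
    fix x y assume xy: "x \<in> curve (fst p) \<inter> curve (snd p)" "y \<in> curve (fst p) \<inter> curve (snd p)"
    have p: "fst p \<in> HF m" "snd p \<in> HF m" "fst p \<noteq> snd p" "fst p \<noteq> - snd p" using that by (auto simp: \<V>_def)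
    show "x = y"
      using curve_unique[OF HF_VF[OF p(1)] HF_VF[OF p(2)] _ HF_nrm_pos[OF p(1) m], of x y] xy p(3,4)
        HF_nrm[OF p(1)] HF_nrm[OF p(2)] by auto
  qed
  have fin: "finite ((\<Union>A\<in>\<A>. {z \<in> H2. act2 A z = z}) \<union>
      (\<Union>p\<in>{p \<in> \<V> \<times> \<V>. fst p \<noteq> snd p \<and> fst p \<noteq> - snd p}. curve (fst p) \<inter> curve (snd p)))"
    using f1 f2 fA fV by (intro finite_UnI finite_UN_I) auto
  have "{z \<in> ball z0 r. \<not> generic m z} \<subseteq> (\<Union>A\<in>\<A>. {z \<in> H2. act2 A z = z}) \<union>
      (\<Union>p\<in>{p \<in> \<V> \<times> \<V>. fst p \<noteq> snd p \<and> fst p \<noteq> - snd p}. curve (fst p) \<inter> curve (snd p))"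
  proof
    fix z assume zz: "z \<in> {z \<in> ball z0 r. \<not> generic m z}"
    then have zK: "z \<in> K" and zH: "z \<in> H2" using K by (auto simp: K_def)
    consider A where "A \<in> stab z" "A \<notin> {mat 1, - mat 1}"
      | u v where "u \<in> HF m" "v \<in> HF m" "z \<in> curve u" "z \<in> curve v" "u \<noteq> v" "u \<noteq> - v"
      using zz unfolding generic_def by blast
    then show "z \<in> (\<Union>A\<in>\<A>. {z \<in> H2. act2 A z = z}) \<union>
      (\<Union>p\<in>{p \<in> \<V> \<times> \<V>. fst p \<noteq> snd p \<and> fst p \<noteq> - snd p}. curve (fst p) \<inter> curve (snd p))"
    proof cases
      case 1
      then have A: "A \<in> \<Gamma>" "act2 A z = z" by (auto simp: stab_def)
      have "z \<in> act2 A ` K \<inter> K" using zK A(2) by (metis IntI imageI)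
      then have "A \<in> \<A>" using 1(2) A(1) unfolding \<A>_def by blast
      then show ?thesis using A zH by blast
    next
      case 2
      then have "u \<in> \<V>" "v \<in> \<V>" using zK unfolding \<V>_def by blast+
      then have "(u, v) \<in> {p \<in> \<V> \<times> \<V>. fst p \<noteq> snd p \<and> fst p \<noteq> - snd p}" using 2 by simp
      moreover have "z \<in> curve (fst (u, v)) \<inter> curve (snd (u, v))" using 2 by simp
      ultimately show ?thesis by blast
    qed
  qed
  then have "finite {z \<in> ball z0 r. \<not> generic m z}" using fin finite_subset by blast
  then show ?thesis using r ball_subset_cball by (intro that[of "ball z0 r"]) auto
qed

text \<open>In a disc with fixed first coordinate only finitely many curves occur. Each is a graph
  and meets the disc at most once, whereas the disc is infinite.\<close>

lemma off_curves:
  assumes m: "m > 0" and T: "open T" "T \<subseteq> H2" "T \<noteq> {}"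
  obtains z where "z \<in> T" "\<And>v. v \<in> HF m \<Longrightarrow> z \<notin> curve v"
proof -
  obtain x y where xy: "(x, y) \<in> T" using T by auto
  obtain A B where AB: "open A" "open B" "(x, y) \<in> A \<times> B" "A \<times> B \<subseteq> T" using T(1) xy open_prod_elim by blast
  obtain r where r: "r > 0" "cball y r \<subseteq> B" using AB open_contains_cball by (metis mem_Sigma_iff)
  define K where "K = {x} \<times> cball y r"
  have K: "compact K" "K \<subseteq> T" using AB r by (auto simp: K_def intro!: compact_Times)
  have fin: "finite ((\<lambda>v. graph2 v x) ` {v \<in> HF m. curve v \<inter> K \<noteq> {}})"
    using curves_locally_finite[OF K(1)] K(2) T(2) by (intro finite_imageI) blast
  have "infinite (cball y r)" using uncountable_cball[OF r(1), of y] countable_finite by blast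
  then have "infinite (cball y r - (\<lambda>v. graph2 v x) ` {v \<in> HF m. curve v \<inter> K \<noteq> {}})"
    by (rule Diff_infinite_finite[OF fin])
  then have "cball y r - (\<lambda>v. graph2 v x) ` {v \<in> HF m. curve v \<inter> K \<noteq> {}} \<noteq> {}"
    by (rule infinite_imp_nonempty)
  then obtain y' where y': "y' \<in> cball y r" "y' \<notin> (\<lambda>v. graph2 v x) ` {v \<in> HF m. curve v \<inter> K \<noteq> {}}" by blast
  have zK: "(x, y') \<in> K" using y' by (simp add: K_def)
  then have zT: "(x, y') \<in> T" using K by blast
  have "(x, y') \<notin> curve v" if v: "v \<in> HF m" for v
  proof
    assume c: "(x, y') \<in> curve v"
    then have "y' = graph2 v x" using curve_iff_graph2[OF HF_VF[OF v] HF_nrm_pos[OF v m]] zT T(2) by blast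
    moreover have "v \<in> {v \<in> HF m. curve v \<inter> K \<noteq> {}}" using v c zK by blast
    ultimately show False using y'(2) by blast
  qed
  then show ?thesis using that zT by blast
qed

lemma interior_dense:
  assumes V: "openin X V" "x \<in> V"
  shows "\<exists>z\<in>H2. qpt z \<in> V"
proof -
  have "x \<in> topspace X" using V openin_subset by blast
  then show ?thesis
  proof (cases rule: X_cases)
    case (2 a c)
    obtain A where A: "A \<in> G" "A$1$1 = a" "A$2$1 = c"
    proof (cases "a = 0")
      case True
      have "mk2 a (- 1 / c) c 0 \<in> G" unfolding SL2_iff using 2 True by simp
      then show ?thesis using that[of "mk2 a (- 1 / c) c 0"] by simp
    next
      case False
      have "mk2 a 0 c (1 / a) \<in> G" unfolding SL2_iff using 2 False by simp
      then show ?thesis using that[of "mk2 a 0 c (1 / a)"] by simp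
    qed
    have e: "act F A CuspInf = cu a c" using G_CuspInf(1)[OF A(1)] A by simp
    have "ext_open F {p \<in> ext_H2 F. proj F p \<in> V}"
      using V(1) unfolding openin_BB_topology openin_ext_topology by blast
    moreover have "act F A CuspInf \<in> {p \<in> ext_H2 F. proj F p \<in> V}"
      unfolding e using 2 V cu_ext_H2 by simp
    ultimately obtain C where C: "C > 0" "act F A ` horoball C \<subseteq> {p \<in> ext_H2 F. proj F p \<in> V}"
      using A(1) unfolding ext_open_def by blast
    define z where "z = (\<i> * of_real (C + 1), \<i>)"
    have z: "z \<in> HB C" using C(1) by (simp add: z_def HB_def H2_iff)
    then have "act F A (Interior z) \<in> {p \<in> ext_H2 F. proj F p \<in> V}" using C(2) unfolding horoball_HB by blast
    then have "qpt (act2 A z) \<in> V" unfolding act_Interior qpt_def by simp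
    moreover have "act2 A z \<in> H2" using act2_H2[OF A(1)] z HB_H2 by blast
    ultimately show ?thesis by blast
  qed (use V in auto)
qed

lemma sheaf_nonzero_open:
  assumes U: "openin X U" and f: "f \<in> Ox U"
  shows "openin X {x \<in> U. f x \<noteq> 0}"
proof -
  have top: "topspace (subtopology X U) = U" using openin_subset[OF U] by (simp add: topspace_subtopology Int_absorb1)
  have "openin (subtopology X U) {x \<in> topspace (subtopology X U). f x \<in> - {0}}"
    using sheaf_continuous[OF f] by (rule openin_continuous_map_preimage) (simp add: open_Compl)
  then show ?thesis unfolding top using U by (simp add: openin_open_subtopology)
qed

text \<open>The set where \<open>f\<close> is nonzero is open, so a point of the closure in it would
  bring a point of the image of the curve with it. Moved to a representative in \<open>W\<close>,
  that point lies on a translate of the curve, whose form is again in \<open>S\<close>.\<close>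

lemma vanish_closed_image:
  assumes U: "chart U W" and f: "f \<in> Ox U" "zero_on S W f" and S: "\<Gamma>_closed m S" and v: "v \<in> S"
    and x: "x \<in> closed_image F (curve v)" "x \<in> U"
  shows "f x = 0"
proof (rule ccontr)
  assume "f x \<noteq> 0"
  have oU: "openin X U" by (rule chartD(1)[OF U])
  have "openin X {x \<in> U. f x \<noteq> 0}" by (rule sheaf_nonzero_open[OF oU f(1)])
  moreover have "x \<in> {x \<in> U. f x \<noteq> 0}" using x \<open>f x \<noteq> 0\<close> by simp
  moreover have "\<forall>T. x \<in> T \<and> openin X T \<longrightarrow> (\<exists>y. y \<in> (\<lambda>z. proj F (Interior z)) ` curve v \<and> y \<in> T)"
    using x(1) unfolding closed_image_def in_closure_of by (rule conjunct2)
  ultimately have "\<exists>y. y \<in> (\<lambda>z. proj F (Interior z)) ` curve v \<and> y \<in> {x \<in> U. f x \<noteq> 0}" by meson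
  then obtain y where y: "y \<in> (\<lambda>z. proj F (Interior z)) ` curve v" "y \<in> U" "f y \<noteq> 0" by blast
  then obtain z where z: "z \<in> curve v" "y = qpt z" by (auto simp: qpt_def)
  have zH: "z \<in> H2" using z by (simp add: curve_def)
  have "qpt z \<in> U" using y(2) z by simp
  then obtain w where w: "w \<in> W" "w \<in> H2" "qpt z = qpt w" using chart_rep[OF U zH] by metis
  note wH = w(2)
  obtain A where A: "A \<in> \<Gamma>" "z = act2 A w" using qpt_eq_iff[OF wH zH] w(3) by auto
  have vH: "v \<in> HF m" using S v by (auto simp: \<Gamma>_closed_def)
  have "w \<in> curve (pull A v)" using curve_pull[of v A w] vH A z(1) wH by simp
  moreover have "pull A v \<in> S" using S v A by (auto simp: \<Gamma>_closed_def)
  ultimately have "f (qpt w) = 0" using f(2) w(1) unfolding zero_on_def by blast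
  then show False using y z w by simp
qed

definition orbit :: "real \<times> real \<times> real \<Rightarrow> (real \<times> real \<times> real) set" where
  "orbit v = {w. \<exists>A\<in>\<Gamma>. w = pull A v \<or> w = - pull A v}"

lemma orbit_closed:
  assumes v: "v \<in> HF m"
  shows "\<Gamma>_closed m (orbit v)" "v \<in> orbit v" "\<Gamma>_closed m (HF m - orbit v)"
proof -
  have vV: "v \<in> VF" using v by simp
  have pm: "pull B (pull A v) = pull (A ** B) v" if "A \<in> \<Gamma>" "B \<in> \<Gamma>" for A B
    using pull_mult[OF vV] that by simp
  have pV: "pull A v \<in> VF" if "A \<in> \<Gamma>" for A using pull_VF[OF vV] that by simp
  show "\<Gamma>_closed m (orbit v)"
    unfolding \<Gamma>_closed_def
  proof (intro conjI ballI)
    show "orbit v \<subseteq> HF m"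
    proof
      fix w assume "w \<in> orbit v"
      then obtain A where A: "A \<in> \<Gamma>" "w = pull A v \<or> w = - pull A v" unfolding orbit_def by blast
      show "w \<in> HF m" using A(2) pull_HF[OF v A(1)] HF_uminus[OF pull_HF[OF v A(1)]] by (elim disjE) simp_all
    qed
    fix w assume "w \<in> orbit v"
    then obtain A where A: "A \<in> \<Gamma>" "w = pull A v \<or> w = - pull A v" by (auto simp: orbit_def)
    then show "- w \<in> orbit v" by (auto simp: orbit_def)
    fix B assume B: "B \<in> \<Gamma>"
    have "pull B w = pull (A ** B) v \<or> pull B w = - pull (A ** B) v"
      using A(2) pm[OF A(1) B] pull_uminus[OF pV[OF A(1)]] by auto
    then show "pull B w \<in> orbit v" using \<Gamma>_mult[OF A(1) B] by (auto simp: orbit_def)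
  qed
  show vo: "v \<in> orbit v" using pull_one[OF vV] unfolding orbit_def by (intro CollectI bexI[of _ "mat 1"]) auto
  have pull_back: "w \<in> orbit v" if w: "w \<in> HF m" and A: "A \<in> \<Gamma>" and "pull A w \<in> orbit v" for w A
  proof -
    have "pull (inv2 A) (pull A w) \<in> orbit v"
      using that(3) \<open>\<Gamma>_closed m (orbit v)\<close> inv2_\<Gamma>[OF A] by (auto simp: \<Gamma>_closed_def)
    moreover have "pull (inv2 A) (pull A w) = w"
      using pull_mult[of w A "inv2 A"] w A inv2_G[of A] inv2_right[of A] pull_one[of w] by simp
    ultimately show ?thesis by simp
  qed
  show "\<Gamma>_closed m (HF m - orbit v)"
    unfolding \<Gamma>_closed_def
  proof (intro conjI ballI)
    fix w assume w: "w \<in> HF m - orbit v"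
    have "- (- w) \<in> orbit v" if "- w \<in> orbit v" using \<open>\<Gamma>_closed m (orbit v)\<close> that unfolding \<Gamma>_closed_def by blast
    then show "- w \<in> HF m - orbit v" using w HF_uminus by auto
    fix A assume A: "A \<in> \<Gamma>"
    show "pull A w \<in> HF m - orbit v" using w pull_back[of w A] A pull_HF by auto
  qed auto
qed

lemma closed_image_pull:
  assumes v: "v \<in> VF" and A: "A \<in> \<Gamma>"
  shows "closed_image F (curve (pull A v)) = closed_image F (curve v)"
proof -
  have AG: "A \<in> G" using A by simp
  have "qpt ` curve (pull A v) = qpt ` curve v"
  proof (intro equalityI subsetI)
    fix x assume "x \<in> qpt ` curve (pull A v)"
    then obtain z where z: "z \<in> curve (pull A v)" "x = qpt z" by blast
    have zH: "z \<in> H2" using z by (simp add: curve_def)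
    have "act2 A z \<in> curve v" using z curve_pull[OF v AG zH] by simp
    moreover have "x = qpt (act2 A z)" using qpt_act2[OF A zH] z by simp
    ultimately show "x \<in> qpt ` curve v" by blast
  next
    fix x assume "x \<in> qpt ` curve v"
    then obtain z where z: "z \<in> curve v" "x = qpt z" by blast
    have zH: "z \<in> H2" using z by (simp add: curve_def)
    have iH: "act2 (inv2 A) z \<in> H2" by (intro act2_H2 inv2_G AG zH)
    have "act2 (inv2 A) z \<in> curve (pull A v)" using z curve_pull[OF v AG iH] AG zH by simp
    moreover have "x = qpt (act2 (inv2 A) z)" using qpt_act2[OF inv2_\<Gamma>[OF A] zH] z by simp
    ultimately show "x \<in> qpt ` curve (pull A v)" by blast
  qed
  then show ?thesis unfolding closed_image_def qpt_def by simp
qed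

section \<open>Multiplicities of the Hirzebruch-Zagier divisor\<close>

definition form_vec :: "int \<times> int \<times> real \<Rightarrow> real \<times> real \<times> real" where
  "form_vec = (\<lambda>(a, b, l). (of_int a, l, of_int b))"

lemma HF_form_vec: "HF m = form_vec ` HZ_forms F m"
proof (intro equalityI subsetI)
  fix v assume v: "v \<in> HF m"
  obtain a l b where abl: "v = (a, l, b)" by (cases v) auto
  then have "a \<in> \<int>" "b \<in> \<int>" and l: "l \<in> Di" using v by (auto simp: HF_def LL_def)
  then obtain i j where ij: "a = of_int i" "b = of_int j" by (metis Ints_cases)
  have "(i, j, l) \<in> HZ_forms F m" using v l by (simp add: HZ_forms_def HF_def nrm_def abl ij)
  then show "v \<in> form_vec ` HZ_forms F m" by (rule rev_image_eqI) (simp add: form_vec_def abl ij)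
next
  fix v assume "v \<in> form_vec ` HZ_forms F m"
  then show "v \<in> HF m" by (auto simp: form_vec_def HZ_forms_def HF_def LL_def nrm_def)
qed

lemma HZ_curve_form: "HZ_curve F w = curve (form_vec w)"
  by (cases w) (auto simp: HZ_curve_def curve_def form_vec_def ell_def)

lemma form_vec_inj: "form_vec v = form_vec w \<Longrightarrow> v = w"
  by (cases v; cases w) (simp add: form_vec_def)

lemma form_vec_uminus: "form_vec (- w) = - form_vec w"
  by (cases w) (simp add: form_vec_def)

text \<open>Two forms of the same norm with the same curve share at least two points, for instance
  those over i and 2i, so they agree up to sign by \<open>curve_unique\<close>. The count runs over
  pairs {v, -v}, hence the divisor upstairs is reduced.\<close>

lemma HZ_upstairs_curve:
  assumes m: "m > 0" and v: "v \<in> HF m"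
  shows "HZ_upstairs F m (curve v) = 1"
proof -
  obtain w where w: "w \<in> HZ_forms F m" "v = form_vec w" using v unfolding HF_form_vec by blast
  have vV: "v \<in> VF" using v by simp
  have "{c \<in> (\<lambda>v. {v, - v}) ` HZ_forms F m. \<forall>u\<in>c. HZ_curve F u = curve v} = {{w, - w}}"
  proof (intro equalityI subsetI)
    fix c assume "c \<in> {c \<in> (\<lambda>v. {v, - v}) ` HZ_forms F m. \<forall>u\<in>c. HZ_curve F u = curve v}"
    then obtain u where u: "u \<in> HZ_forms F m" "c = {u, - u}" "HZ_curve F u = curve v" by blast
    have uH: "form_vec u \<in> HF m" unfolding HF_form_vec using u by blast
    have cu: "curve (form_vec u) = curve v" using u HZ_curve_form by simp
    have p: "(\<i>, graph2 v \<i>) \<in> curve v" "(2 * \<i>, graph2 v (2 * \<i>)) \<in> curve v"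
      using graph2_curve[OF vV HF_nrm_pos[OF v m]] by simp_all
    have "form_vec u = v \<or> form_vec u = - v"
      by (rule curve_unique[OF HF_VF[OF uH] vV _ HF_nrm_pos[OF uH m], of "(\<i>, graph2 v \<i>)" "(2 * \<i>, graph2 v (2 * \<i>))"])
         (use p cu HF_nrm[OF uH] HF_nrm[OF v] in auto)
    then have "u = w \<or> u = - w" using form_vec_inj form_vec_uminus w(2) by metis
    then show "c \<in> {{w, - w}}" using u(2) by auto
  next
    fix c assume "c \<in> {{w, - w}}"
    then show "c \<in> {c \<in> (\<lambda>v. {v, - v}) ` HZ_forms F m. \<forall>u\<in>c. HZ_curve F u = curve v}"
      using w curve_uminus[OF vV] by (auto simp: HZ_curve_form form_vec_uminus)
  qed
  then show ?thesis unfolding HZ_upstairs_def by simp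
qed

lemma HZ_upstairs_nonzero:
  assumes "HZ_upstairs F m C \<noteq> 0"
  obtains v where "v \<in> HF m" "C = curve v"
proof -
  have "{c \<in> (\<lambda>v. {v, - v}) ` HZ_forms F m. \<forall>u\<in>c. HZ_curve F u = C} \<noteq> {}"
    using assms unfolding HZ_upstairs_def by (metis card.empty of_nat_0)
  then obtain w where "w \<in> HZ_forms F m" "HZ_curve F w = C" by blast
  then show ?thesis using that[of "form_vec w"] HZ_curve_form HF_form_vec by auto
qed

lemma HZ_divisor_eq:
  assumes m: "m > 0"
  shows "HZ_divisor F m Z = (if \<exists>v\<in>HF m. closed_image F (curve v) = Z then 1 else 0)"
proof (cases "\<exists>v\<in>HF m. closed_image F (curve v) = Z")
  case True
  then obtain v where v: "v \<in> HF m" "closed_image F (curve v) = Z" by blast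
  then have ex: "\<exists>C. HZ_upstairs F m C \<noteq> 0 \<and> closed_image F C = Z"
    using HZ_upstairs_curve[OF m v(1)] by (intro exI[of _ "curve v"]) simp
  define C where "C = (SOME C. HZ_upstairs F m C \<noteq> 0 \<and> closed_image F C = Z)"
  have "HZ_upstairs F m C \<noteq> 0" using someI_ex[OF ex] unfolding C_def by blast
  then have "HZ_upstairs F m C = 1" using HZ_upstairs_curve[OF m] by (metis HZ_upstairs_nonzero)
  then show ?thesis using ex True unfolding HZ_divisor_def C_def by simp
next
  case False
  then have none: "\<not> (\<exists>C. HZ_upstairs F m C \<noteq> 0 \<and> closed_image F C = Z)" by (metis HZ_upstairs_nonzero)
  show ?thesis unfolding HZ_divisor_def if_not_P[OF none] if_not_P[OF False] ..
qed

end

section \<open>Generic points of prime divisors and orders along them\<close>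

context quadratic
begin

text \<open>The dimension condition is behind the last claim: at an isolated point the empty family
  of functions already cuts out the point, which would make \<open>local_dim\<close> 0 instead of
  1.\<close>

lemma unisolated:
  assumes U: "chart U W" and Y: "prime_divisor (subtopology X U) Ox Y"
  shows "Y \<subseteq> U" "Y \<noteq> {}" "closedin (subtopology X U) Y"
    and "\<And>y V. y \<in> Y \<Longrightarrow> openin X V \<Longrightarrow> y \<in> V \<Longrightarrow> \<exists>y'\<in>Y. y' \<in> V \<and> y' \<noteq> y"
proof -
  have oU: "openin X U" by (rule chartD(1)[OF U])
  have top: "topspace (subtopology X U) = U" using openin_subset[OF oU] by (simp add: topspace_subtopology Int_absorb1)
  have irr: "irreducible_analytic (subtopology X U) Ox Y" and dim: "\<forall>y\<in>Y. local_dim (subtopology X U) Ox Y y = 1"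
    using Y by (auto simp: prime_divisor_def)
  have an: "analytic_subset (subtopology X U) Ox Y" and "Y \<noteq> {}" using irr by (auto simp: irreducible_analytic_def)
  then show cl: "closedin (subtopology X U) Y" "Y \<noteq> {}" by (auto simp: analytic_subset_def)
  show YU: "Y \<subseteq> U" using closedin_subset[OF cl(1)] top by simp
  show "\<exists>y'\<in>Y. y' \<in> V \<and> y' \<noteq> y" if y: "y \<in> Y" and V: "openin X V" "y \<in> V" for y V
  proof (rule ccontr)
    assume no: "\<not> (\<exists>y'\<in>Y. y' \<in> V \<and> y' \<noteq> y)"
    have oVU: "openin (subtopology X U) (V \<inter> U)" using V(1) oU by (simp add: openin_open_subtopology openin_Int)
    have e: "Y \<inter> (V \<inter> U) = {y}"
    proof (intro equalityI subsetI)
      fix x assume "x \<in> Y \<inter> (V \<inter> U)"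
      then have "x \<in> Y" "x \<in> V" by simp_all
      then show "x \<in> {y}" using no by (metis singletonI)
    next
      fix x assume "x \<in> {y}"
      then show "x \<in> Y \<inter> (V \<inter> U)" using y V(2) subsetD[OF YU y] by simp
    qed
    define P where "P = (\<lambda>k. \<exists>V (f :: nat \<Rightarrow> ext_point set \<Rightarrow> complex). openin (subtopology X U) V \<and> y \<in> V \<and>
       (\<forall>i<k. f i \<in> Ox V) \<and> {x \<in> Y \<inter> V. \<forall>i<k. f i x = 0} = {y})"
    have "P 0" unfolding P_def
    proof (intro exI conjI)
      show "openin (subtopology X U) (V \<inter> U)" by (rule oVU)
      show "y \<in> V \<inter> U" using V(2) subsetD[OF YU y] by simp
      show "\<forall>i<(0::nat). (\<lambda>_ _. 0) i \<in> Ox (V \<inter> U)" by simp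
      show "{x \<in> Y \<inter> (V \<inter> U). \<forall>i<(0::nat). (\<lambda>_ _. 0) i x = 0} = {y}" using e by simp
    qed
    then have "(LEAST k. P k) = 0" by (rule Least_eq_0)
    then have "local_dim (subtopology X U) Ox Y y = 0" unfolding local_dim_def P_def .
    then show False using dim y by simp
  qed
qed

text \<open>As \<open>Y\<close> has no isolated points and the quotient map is open, the preimage of
  \<open>Y\<close> accumulates at each representative of a point of \<open>Y\<close>, while there
  are only finitely many nongeneric points nearby. Properties of \<open>Y\<close> can therefore be
  tested at generic points. If \<open>y\<close> is the cusp, a nearby interior point of
  \<open>Y\<close> takes its place first.\<close>

lemma prime_divisor_points:
  assumes m: "m > 0" and U: "chart U W" and Y: "prime_divisor (subtopology X U) Ox Y"
    and y: "y \<in> Y" and V: "openin X V" "y \<in> V"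
  obtains z where "z \<in> W" "qpt z \<in> Y" "qpt z \<in> V" "generic m z"
proof -
  note p = unisolated[OF U Y]
  note oU = chartD(1)[OF U] and oW = chartD(2,3)[OF U] and qW = chartD(4)[OF U]
  obtain k where k: "U - qpt ` W \<subseteq> {k}" by (rule chart_extra[OF U])
  obtain z where z: "z \<in> W" "qpt z \<in> Y" "qpt z \<in> V"
  proof (cases "y \<in> qpt ` W")
    case True
    then show ?thesis using that y V by blast
  next
    case False
    then have yk: "y = k" using k y p(1) by blast
    have "openin X (V \<inter> U)" using V oU by (simp add: openin_Int)
    then obtain y' where y': "y' \<in> Y" "y' \<in> V \<inter> U" "y' \<noteq> y" using p(4)[OF y] V y p(1) by blast
    then have "y' \<in> qpt ` W" using k yk by blast
    then show ?thesis using that y' by blast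
  qed
  have zH: "z \<in> H2" using z oW by blast
  obtain T where T: "open T" "z \<in> T" "T \<subseteq> H2" "finite {z \<in> T. \<not> generic m z}" using nongeneric_discrete[OF m zH] by metis
  let ?Y = "{w \<in> W. qpt w \<in> Y}"
  have lim: "z islimpt ?Y"
    unfolding islimpt_def
  proof (intro allI impI)
    fix S assume S: "z \<in> S" "open S"
    have o1: "openin X (qpt ` (S \<inter> W))" using S oW by (intro openin_qpt_image open_Int) auto
    have q: "qpt z \<in> qpt ` (S \<inter> W)" using S z by blast
    from p(4)[OF z(2) o1 q] obtain y' where "y' \<in> Y" "y' \<in> qpt ` (S \<inter> W)" "y' \<noteq> qpt z" by (elim bexE conjE)
    then show "\<exists>w\<in>?Y. w \<in> S \<and> w \<noteq> z" by blast
  qed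
  let ?S = "T \<inter> {w \<in> H2. qpt w \<in> V}"
  have oS: "open ?S" using T(1) open_qpt_preimage[OF V(1)] by (rule open_Int)
  have zS: "z \<in> ?S" using T(2) z(3) zH by simp
  have "infinite (?S \<inter> ?Y)" using lim[unfolded islimpt_eq_acc_point, THEN spec, of ?S] oS zS by simp
  then have "infinite (?S \<inter> ?Y - {z \<in> T. \<not> generic m z})" by (rule Diff_infinite_finite[OF T(4)])
  then obtain w where "w \<in> ?S \<inter> ?Y - {z \<in> T. \<not> generic m z}" using infinite_imp_nonempty by blast
  then show ?thesis using that by blast
qed

lemma analytic_zero:
  assumes U: "chart U W" and an: "analytic_subset (subtopology X U) Ox Y" and f: "f \<in> Ox U"
  shows "analytic_subset (subtopology X U) Ox {y \<in> Y. f y = 0}"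
proof -
  have oU: "openin X U" by (rule chartD(1)[OF U])
  have top: "topspace (subtopology X U) = U" using openin_subset[OF oU] by (simp add: topspace_subtopology Int_absorb1)
  have cl: "closedin (subtopology X U) Y" using an by (simp add: analytic_subset_def)
  have YU: "Y \<subseteq> U" using closedin_subset[OF cl] top by simp
  show ?thesis
    unfolding analytic_subset_def
  proof (intro conjI ballI)
    have "closedin (subtopology X U) {x \<in> topspace (subtopology X U). f x \<in> {0}}"
      using sheaf_continuous[OF f] by (rule closedin_continuous_map_preimage) simp
    then have "closedin (subtopology X U) (Y \<inter> {x \<in> topspace (subtopology X U). f x \<in> {0}})"
      by (rule closedin_Int[OF cl])
    moreover have "Y \<inter> {x \<in> topspace (subtopology X U). f x \<in> {0}} = {y \<in> Y. f y = 0}" using YU top by auto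
    ultimately show "closedin (subtopology X U) {y \<in> Y. f y = 0}" by simp
    fix x assume "x \<in> topspace (subtopology X U)"
    then obtain V S where V: "openin (subtopology X U) V" "x \<in> V" "finite S" "S \<subseteq> Ox V"
        "Y \<inter> V = {y \<in> V. \<forall>f\<in>S. f y = 0}" using an unfolding analytic_subset_def by meson
    have "V \<subseteq> U" using openin_subset[OF V(1)] top by simp
    then have "f \<in> Ox V" using sheaf_restrict[OF f] by blast
    moreover have "{y \<in> Y. f y = 0} \<inter> V = {y \<in> V. \<forall>g\<in>insert f S. g y = 0}" using V(5) by blast
    ultimately show "\<exists>V S. openin (subtopology X U) V \<and> x \<in> V \<and> finite S \<and> S \<subseteq> Ox V \<and>
        {y \<in> Y. f y = 0} \<inter> V = {y \<in> V. \<forall>f\<in>S. f y = 0}"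
      using V(1-4) by (intro exI[of _ V] exI[of _ "insert f S"] conjI) auto
  qed
qed

lemma order_eq:
  assumes "Y \<subseteq> X' closure_of {y \<in> Y. in_ideal_power X' O' Y n y f}"
    and "\<And>k. Y \<subseteq> X' closure_of {y \<in> Y. in_ideal_power X' O' Y k y f} \<Longrightarrow> k \<le> n"
  shows "order_along X' O' f Y = n"
  unfolding order_along_def using assms by (intro Greatest_equality)

lemma in_ideal_power_vanish:
  assumes "in_ideal_power X' O' Y k y f" "k > 0" "y \<in> Y"
  shows "f y = 0"
proof -
  obtain V N h g where V0: "openin X' V \<and> y \<in> V \<and>
      (\<forall>i<(N::nat). h i \<in> O' V \<and> (\<forall>j<k. g i j \<in> O' V \<and> (\<forall>x\<in>Y \<inter> V. g i j x = 0))) \<and>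
      (\<forall>x\<in>V. f x = (\<Sum>i<N. h i x * (\<Prod>j<k. g i j x)))"
    using assms(1) unfolding in_ideal_power_def by (elim exE)
  then have V: "y \<in> V" "\<forall>i<N. \<forall>j<k. \<forall>x\<in>Y \<inter> V. g i j x = 0"
      "\<forall>x\<in>V. f x = (\<Sum>i<N. h i x * (\<Prod>j<k. g i j x))" by simp_all
  have z: "(\<Prod>j<k. g i j y) = 0" if "i < N" for i
    using V(1,2) that assms(2,3) by (intro prod_zero) auto
  have "f y = (\<Sum>i<N. h i y * (\<Prod>j<k. g i j y))" using V(1,3) by blast
  also have "\<dots> = 0"
  proof (intro sum.neutral ballI)
    fix i assume "i \<in> {..<N}"
    then have "(\<Prod>j<k. g i j y) = 0" using z by simp
    then show "h i y * (\<Prod>j<k. g i j y) = 0" by (simp only: mult_zero_right)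
  qed
  finally show ?thesis .
qed

text \<open>A comparison of growth. Near \<open>z\<close> the preimage of \<open>Y\<close> lies on
  the curve of \<open>v\<close> and accumulates at \<open>z\<close>, so by the identity theorem
  functions vanishing on \<open>Y\<close> vanish along the whole branch. A sum of k-fold products of
  them is O(t^k) at vertical distance t from the curve, whereas \<open>f\<close> has the exact size
  t^n there.\<close>

lemma ideal_order_upper:
  assumes m: "m > 0" and U: "chart U W" and Y: "prime_divisor (subtopology X U) Ox Y"
    and z: "z \<in> W'" "qpt z \<in> Y" and W': "open W'" "W' \<subseteq> W" and h: "holomorphic2_on h W'"
    and fac: "\<And>w. w \<in> W' \<Longrightarrow> h w \<noteq> 0 \<and> f (qpt w) = h w * ell v w ^ n"
    and v: "v \<in> HF m" and van: "\<And>w. w \<in> W' \<Longrightarrow> qpt w \<in> Y \<Longrightarrow> f (qpt w) = 0" and n: "n > 0"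
    and ideal: "in_ideal_power (subtopology X U) Ox Y k (qpt z) f"
  shows "k \<le> n"
proof (rule ccontr)
  assume "\<not> k \<le> n"
  then have kn: "k > n" by simp
  note p = unisolated[OF U Y]
  note oU = chartD(1)[OF U] and oW = chartD(2,3)[OF U]
  have vV: "v \<in> VF" "nrm v > 0" using v HF_nrm_pos[OF v m] by simp_all
  obtain V N H g where id: "openin (subtopology X U) V \<and> qpt z \<in> V \<and>
     (\<forall>i<(N::nat). H i \<in> Ox V \<and> (\<forall>j<k. g i j \<in> Ox V \<and> (\<forall>x\<in>Y \<inter> V. g i j x = 0))) \<and>
     (\<forall>x\<in>V. f x = (\<Sum>i<N. H i x * (\<Prod>j<k. g i j x)))"
    using ideal unfolding in_ideal_power_def by (elim exE)
  note V0 = conjunct1[OF id] conjunct1[OF conjunct2[OF id]]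
  note Hg = conjunct1[OF conjunct2[OF conjunct2[OF id]]] and fs = conjunct2[OF conjunct2[OF conjunct2[OF id]]]
  have oV: "openin X V" using V0(1) oU by (simp add: openin_open_subtopology)
  define B where "B = W' \<inter> {w \<in> H2. qpt w \<in> V}"
  have oB: "open B" unfolding B_def using W'(1) open_qpt_preimage[OF oV] by (intro open_Int)
  have zB: "z \<in> B" using z V0 W' oW by (auto simp: B_def)
  have BH: "B \<subseteq> H2" by (auto simp: B_def)
  obtain a b where ab: "z = (a, b)" by (cases z) auto
  have ima: "Im a > 0" using zB BH by (auto simp: ab H2_iff)
  define \<phi> where "\<phi> = graph2 v"
  have onc: "w \<in> curve v" if "w \<in> B" "qpt w \<in> Y" for w
  proof -
    have "w \<in> W'" using that by (simp add: B_def)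
    then have "h w \<noteq> 0" "h w * ell v w ^ n = 0" using fac[of w] van[of w] that(2) by auto
    then have "ell v w = 0" by simp
    then show ?thesis using that BH by (auto simp: curve_def)
  qed
  have gr: "y = \<phi> x" if "(x, y) \<in> B" "qpt (x, y) \<in> Y" for x y
    using onc[OF that] curve_iff_graph2[OF vV] that BH unfolding \<phi>_def by blast
  have b: "b = \<phi> a" using gr[of a b] zB z(2) by (simp add: ab)
  have hol\<phi>: "\<phi> holomorphic_on {x. Im x > 0}" unfolding \<phi>_def by (rule graph2_holomorphic[OF vV])
  have oH: "open {x. Im x > 0}" by (rule open_halfspace_Im_gt)
  have cont\<phi>: "isCont \<phi> a"
    using holomorphic_on_imp_continuous_on[OF hol\<phi>] oH ima by (simp add: continuous_on_eq_continuous_at)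
  have cont2: "isCont (\<lambda>x. (x, \<phi> x)) a" using cont\<phi> by (intro continuous_intros)
  have pB: "(a, \<phi> a) \<in> B" using zB ab b by simp
  have "\<exists>S. open S \<and> a \<in> S \<and> (\<forall>x\<in>S. (x, \<phi> x) \<in> B)"
    using iffD1[OF continuous_at_open cont2, THEN spec, of B] oB pB by simp
  then obtain S0 where S0': "open S0" "a \<in> S0" "\<forall>x\<in>S0. (x, \<phi> x) \<in> B" by (elim exE conjE)
  have S0: "open S0" "a \<in> S0" "x \<in> S0 \<Longrightarrow> (x, \<phi> x) \<in> B" for x using S0' by simp_all
  obtain r where r: "r > 0" "ball a r \<subseteq> S0 \<inter> {x. Im x > 0}"
    using openE[OF open_Int[OF S0(1) oH], of a] S0(2) ima by blast
  let ?D = "ball a r"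
  let ?Z = "{x \<in> ?D. qpt (x, \<phi> x) \<in> Y}"
  \<comment> \<open>Points of \<open>Y\<close> accumulate at \<open>qpt z\<close>, and their
    representatives near \<open>z\<close> are on the graph of \<phi>; hence their first coordinates
    accumulate at \<open>a\<close>.\<close>
  have limZ: "a islimpt ?Z"
    unfolding islimpt_def
  proof (intro allI impI)
    fix T assume T: "a \<in> T" "open T"
    let ?S = "((T \<inter> ?D) \<times> UNIV) \<inter> B"
    have oS: "open ?S" using T oB by (intro open_Int open_Times) auto
    have o1: "openin X (qpt ` ?S)" using oS BH by (intro openin_qpt_image) auto
    have q: "qpt z \<in> qpt ` ?S" using zB T r by (intro imageI) (simp add: ab)
    from p(4)[OF z(2) o1 q] obtain y' where y': "y' \<in> Y" "y' \<in> qpt ` ?S" "y' \<noteq> qpt z" by (elim bexE conjE)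
    from y'(2) obtain p where p: "y' = qpt p" "p \<in> ?S" by (elim imageE)
    obtain x y where "p = (x, y)" by (cases p)
    then have xy: "(x, y) \<in> ?S" "y' = qpt (x, y)" using p by simp_all
    have "y = \<phi> x" using gr[of x y] xy y' by auto
    then show "\<exists>x'\<in>?Z. x' \<in> T \<and> x' \<noteq> a" using xy y' b ab by (intro bexI[of _ x]) auto
  qed
  have holg: "holomorphic2_on (\<lambda>w. G (qpt w)) B" if "G \<in> Ox V" for G
    by (rule holomorphic2_on_subset[OF sheaf_holomorphic[OF that]]) (auto simp: B_def)
  have van0: "g i j (qpt (x, \<phi> x)) = 0" if ij: "i < N" "j < k" and x: "x \<in> ?D" for i j x
  proof -
    have gO: "g i j \<in> Ox V" using Hg ij by blast
    have DB: "(t, \<phi> t) \<in> B" if "t \<in> ?D" for t using that r S0 by blast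
    have hl: "(\<lambda>t. g i j (qpt (t, \<phi> t))) holomorphic_on ?D"
    proof (rule holomorphic2_on_curve[OF holg[OF gO] oB])
      show "\<phi> holomorphic_on ?D" by (rule holomorphic_on_subset[OF hol\<phi>]) (use r in blast)
    qed (use DB in \<open>auto intro: holomorphic_intros\<close>)
    show ?thesis
    proof (rule analytic_continuation[OF hl open_ball connected_ball _ _ limZ _ x])
      show "g i j (qpt (t, \<phi> t)) = 0" if "t \<in> ?Z" for t
      proof -
        have "(t, \<phi> t) \<in> B" using DB that by blast
        then have "qpt (t, \<phi> t) \<in> Y \<inter> V" using that by (simp add: B_def)
        then show ?thesis using Hg ij by blast
      qed
    qed (use r in auto)
  qed
  have "\<exists>K V'. open V' \<and> z \<in> V' \<and> (\<forall>x y. (x, y) \<in> V' \<longrightarrow> cmod (g i j (qpt (x, y))) \<le> K * cmod (y - \<phi> x))"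
    if ij: "i < N" "j < k" for i j
  proof -
    have gO: "g i j \<in> Ox V" using Hg ij by blast
    have "(a, \<phi> a) \<in> B" using zB ab b by simp
    from vanishing_on_graph_bound[OF oB this holg[OF gO] cont\<phi> open_ball, of a r] van0[OF ij] r
    obtain K V' where "open V'" "(a, \<phi> a) \<in> V'" "\<And>x y. (x, y) \<in> V' \<Longrightarrow> cmod (g i j (qpt (x, y))) \<le> K * cmod (y - \<phi> x)"
      by (metis centre_in_ball)
    then show ?thesis using ab b by blast
  qed
  then obtain K V' where KV: "\<And>i j. i < N \<Longrightarrow> j < k \<Longrightarrow> open (V' i j) \<and> z \<in> V' i j \<and>
      (\<forall>x y. (x, y) \<in> V' i j \<longrightarrow> cmod (g i j (qpt (x, y))) \<le> K i j * cmod (y - \<phi> x))"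
    by metis
  define \<N> where "\<N> = B \<inter> (\<Inter>i<N. \<Inter>j<k. V' i j)"
  have o\<N>: "open \<N>" unfolding \<N>_def using oB KV by (intro open_Int open_INT ballI) auto
  have z\<N>: "z \<in> \<N>" unfolding \<N>_def using zB KV by auto
  define Q where "Q w = (\<Sum>i<N. cmod (H i (qpt w)) * (\<Prod>j<k. \<bar>K i j\<bar>))" for w
  have up: "cmod (f (qpt (x, y))) \<le> Q (x, y) * cmod (y - \<phi> x) ^ k" if w: "(x, y) \<in> \<N>" for x y
  proof -
    have wV: "qpt (x, y) \<in> V" using w by (simp add: \<N>_def B_def)
    have gb: "cmod (g i j (qpt (x, y))) \<le> \<bar>K i j\<bar> * cmod (y - \<phi> x)" if "i < N" "j < k" for i j
    proof -
      have "(x, y) \<in> V' i j" using w that by (auto simp: \<N>_def)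
      then have "cmod (g i j (qpt (x, y))) \<le> K i j * cmod (y - \<phi> x)" using KV[OF that] by blast
      also have "\<dots> \<le> \<bar>K i j\<bar> * cmod (y - \<phi> x)" by (intro mult_right_mono) auto
      finally show ?thesis .
    qed
    have "cmod (f (qpt (x, y))) \<le> (\<Sum>i<N. cmod (H i (qpt (x, y)) * (\<Prod>j<k. g i j (qpt (x, y)))))"
      using fs wV by (simp add: norm_sum)
    also have "\<dots> \<le> (\<Sum>i<N. cmod (H i (qpt (x, y))) * (\<Prod>j<k. \<bar>K i j\<bar> * cmod (y - \<phi> x)))"
      unfolding norm_mult prod_norm[symmetric] using gb
      by (intro sum_mono mult_left_mono prod_mono conjI norm_ge_zero) auto
    also have "\<dots> = Q (x, y) * cmod (y - \<phi> x) ^ k"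
      by (simp add: Q_def sum_distrib_right prod.distrib mult.assoc)
    finally show ?thesis .
  qed
  \<comment> \<open>Leaving the curve in the second coordinate alone makes y - \<phi> x equal to the
    parameter t.\<close>
  define c where "c t = (a, b + of_real t)" for t :: real
  have contc: "continuous_on UNIV c" unfolding c_def by (intro continuous_intros)
  have c0: "c 0 = z" by (simp add: c_def ab)
  define L where "L t = cmod (h (c t)) * cmod (den2 v a) ^ n" for t
  have oc: "open (c -` \<N>)" using contc o\<N> open_vimage by blast
  have "0 \<in> c -` \<N>" using z\<N> c0 by simp
  from openE[OF oc this] obtain d where d0: "d > 0" "ball 0 d \<subseteq> c -` \<N>" by metis
  have d: "d > 0" "c t \<in> \<N>" if "\<bar>t\<bar> < d" for t
  proof -
    have "t \<in> ball 0 d" using that by (simp add: dist_real_def)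
    then show "c t \<in> \<N>" using d0(2) by blast
  qed (rule d0(1))
  have ineq: "L t \<le> Q (c t) * t ^ (k - n)" if t: "0 < t" "t < d" for t
  proof -
    have cN: "c t \<in> \<N>" using d(2)[of t] t by simp
    then have cW: "c t \<in> W'" by (simp add: \<N>_def B_def)
    have yx: "b + of_real t - \<phi> a = of_real t" using b by simp
    have "ell v (c t) = den2 v a * of_real t"
      unfolding c_def using ell_graph2[OF vV ima, of "b + of_real t"] yx by (simp add: \<phi>_def)
    then have "cmod (f (qpt (c t))) = L t * t ^ n"
      using fac[OF cW] t by (simp add: L_def norm_mult norm_power power_mult_distrib)
    moreover have "cmod (f (qpt (c t))) \<le> Q (c t) * t ^ k"
      using up[of a "b + of_real t"] cN yx t unfolding c_def by simp
    ultimately have "L t * t ^ n \<le> (Q (c t) * t ^ (k - n)) * t ^ n"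
      using kn by (simp add: mult.assoc flip: power_add)
    then show ?thesis using t by simp
  qed
  have isz: "isCont (\<lambda>t. G (c t)) 0" if "continuous_on \<N> G" for G :: "complex \<times> complex \<Rightarrow> complex"
  proof -
    have G: "isCont G (c 0)" using that o\<N> z\<N> c0 by (simp add: continuous_on_eq_continuous_at)
    have "isCont c 0" using contc by (simp add: continuous_on_eq_continuous_at)
    from isCont_o2[OF this G] show ?thesis .
  qed
  have contL: "isCont L 0"
  proof -
    have "continuous_on \<N> h"
      by (rule continuous_on_subset[OF holomorphic2_on_imp_continuous_on[OF h]]) (auto simp: \<N>_def B_def)
    then show ?thesis unfolding L_def using isz by (intro continuous_intros) auto
  qed
  have contQ: "isCont (\<lambda>t. Q (c t) * t ^ (k - n)) 0"
  proof -
    have "isCont (\<lambda>t. H i (qpt (c t))) 0" if "i < N" for i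
    proof (rule isz)
      have "H i \<in> Ox V" using Hg that by blast
      then show "continuous_on \<N> (\<lambda>w. H i (qpt w))"
        by (intro continuous_on_subset[OF holomorphic2_on_imp_continuous_on[OF holg]]) (auto simp: \<N>_def)
    qed
    then show ?thesis unfolding Q_def by (intro continuous_intros) auto
  qed
  have "(L \<longlongrightarrow> L 0) (at_right 0)" "((\<lambda>t. Q (c t) * t ^ (k - n)) \<longlongrightarrow> Q (c 0) * 0 ^ (k - n)) (at_right 0)"
    using contL contQ unfolding isCont_def by (auto intro: filterlim_at_split[THEN iffD1, THEN conjunct2])
  moreover have "eventually (\<lambda>t. L t \<le> Q (c t) * t ^ (k - n)) (at_right 0)"
    unfolding eventually_at_right_field using d0(1) ineq by (intro exI[of _ d]) auto
  ultimately have "L 0 \<le> Q (c 0) * 0 ^ (k - n)" by (intro tendsto_le[of "at_right (0::real)"]) auto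
  moreover have "(0::real) ^ (k - n) = 0" using kn by (intro zero_power) simp
  ultimately have "L 0 \<le> 0" by (simp only: mult_zero_right)
  moreover have "L 0 > 0"
  proof -
    have "h z \<noteq> 0" using fac[of z] zB by (simp add: B_def)
    then show ?thesis unfolding L_def using den2_nz[OF vV ima] c0 by simp
  qed
  ultimately show False by simp
qed

lemma order_onE:
  assumes f: "order_on n m W f" and z: "z \<in> W" and v: "v \<in> HF m" "z \<in> curve v"
    and only: "\<forall>u\<in>HF m. z \<in> curve u \<longrightarrow> u = v \<or> u = - v"
  obtains W' h where "open W'" "z \<in> W'" "W' \<subseteq> W" "holomorphic2_on h W'"
    "\<forall>w\<in>W'. h w \<noteq> 0 \<and> f (qpt w) = h w * ell v w ^ n"
proof -
  have "\<exists>W' h. open W' \<and> z \<in> W' \<and> W' \<subseteq> W \<and> holomorphic2_on h W' \<and>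
        (\<forall>w\<in>W'. h w \<noteq> 0 \<and> f (qpt w) = h w * ell v w ^ n)"
    by (rule mp[OF mp[OF bspec[OF bspec[OF f[unfolded order_on_def] z] v(1)] v(2)] only])
  then show ?thesis using that by (elim exE conjE)
qed

text \<open>At a generic point the stabilizer consists of scalar matrices, which act trivially, so
  on a small neighbourhood every function is \<Gamma>-invariant. Hence \<open>h\<close> and the
  equation \<open>ell v\<close> themselves descend to sections, and \<open>f\<close> is one product
  with \<open>n\<close> equal factors in the ideal of \<open>Y\<close>.\<close>

lemma ideal_order_lower:
  assumes m: "m > 0" and U: "chart U W"
    and z: "z \<in> W" "generic m z" "z \<in> curve v" "v \<in> HF m" and n: "n > 0"
    and f: "order_on n m W f" and van: "\<And>w. w \<in> W \<Longrightarrow> qpt w \<in> Y \<Longrightarrow> f (qpt w) = 0"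
  shows "in_ideal_power (subtopology X U) Ox Y n (qpt z) f"
proof -
  note oU = chartD(1)[OF U] and oW = chartD(2-4)[OF U]
  have only: "\<forall>u\<in>HF m. z \<in> curve u \<longrightarrow> u = v \<or> u = - v" using z unfolding generic_def by blast
  obtain W' h where W': "open W'" "z \<in> W'" "W' \<subseteq> W" "holomorphic2_on h W'"
      "\<forall>w\<in>W'. h w \<noteq> 0 \<and> f (qpt w) = h w * ell v w ^ n"
    by (rule order_onE[OF f z(1,4,3) only])
  have zH: "z \<in> H2" using z oW by blast
  obtain W1 K where W1: "open W1" "z \<in> W1" "W1 \<subseteq> W'"
      "\<And>A w. A \<in> \<Gamma> \<Longrightarrow> w \<in> W1 \<Longrightarrow> act2 A w \<in> W1 \<Longrightarrow> A \<in> stab z"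
    using invariant_nbhd[OF zH W'(1,2)] by metis
  have W1H: "W1 \<subseteq> H2" using W1 W' oW by blast
  have triv: "act2 A w = w" if "A \<in> stab z" for A w
  proof -
    have "A = mat 1 \<or> A = - mat 1" using z(2) that unfolding generic_def by blast
    then show ?thesis
    proof
      assume A: "A = - mat 1"
      have n: "A$1$1 = -1" "A$1$2 = 0" "A$2$1 = 0" "A$2$2 = -1" by (simp_all add: A)
      show ?thesis by (simp add: act2_def mob_def aut_def n)
    qed simp
  qed
  have inv: "\<Gamma>_inv_on W1 \<psi>" for \<psi>
    unfolding \<Gamma>_inv_on_def using W1(4) triv by metis
  let ?V = "qpt ` W1"
  have oV: "openin X ?V" by (intro openin_qpt_image W1 W1H)
  have VU: "?V \<subseteq> U" using W1 W' oW by blast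
  have hol_h: "holomorphic2_on h W1" by (rule holomorphic2_on_subset[OF W'(4) W1(3)])
  note sh = push_sheaf[OF W1(1) W1H hol_h inv, of 0]
  note sl = push_sheaf[OF W1(1) W1H holomorphic2_ell inv, of v 0]
  have fz: "push W1 (ell v) 0 x = 0" if x: "x \<in> Y \<inter> ?V" for x
  proof -
    from x obtain w where w: "w \<in> W1" "x = qpt w" by blast
    then have "f (qpt w) = 0" using van[of w] x W1 W' by blast
    then have "ell v w = 0" using W'(5) w W1 n by (metis mult_eq_0_iff power_eq_0_iff subsetD)
    then show ?thesis using push_qpt[OF W1H inv w(1)] w by simp
  qed
  have fx: "f x = (\<Sum>i<(1::nat). push W1 h 0 x * (\<Prod>j<n. push W1 (ell v) 0 x))" if x: "x \<in> ?V" for x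
  proof -
    from x obtain w where w: "w \<in> W1" "x = qpt w" by blast
    have "f (qpt w) = h w * ell v w ^ n" using W'(5) w W1 by blast
    then show ?thesis using push_qpt[OF W1H inv w(1)] w by simp
  qed
  show ?thesis
    unfolding in_ideal_power_def
  proof (intro exI conjI allI impI ballI)
    show "openin (subtopology X U) ?V" using oV VU oU by (simp add: openin_open_subtopology)
    show "qpt z \<in> ?V" using W1 by blast
    show "f x = (\<Sum>i<(1::nat). (\<lambda>i. push W1 h 0) i x * (\<Prod>j<n. (\<lambda>i j. push W1 (ell v) 0) i j x))" if "x \<in> ?V" for x
      using fx[OF that] by simp
  qed (use sh sl fz in auto)
qed

text \<open>The function cutting out the orbit of \<open>v\<close> vanishes on the closed image by
  continuity, and its zeros in \<open>W\<close> are on translates of the curve. So passing to the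
  closure adds no points represented in \<open>W\<close>.\<close>

lemma HZ_orbit_zero:
  assumes U: "chart U W" and all: "\<forall>S. \<Gamma>_closed m S \<longrightarrow> (\<exists>f\<in>Ox U. zero_on S W f)"
    and v: "v \<in> HF m" and z: "z \<in> W" "qpt z \<in> closed_image F (curve v)"
  shows "\<exists>A\<in>\<Gamma>. z \<in> curve (pull A v)"
proof -
  obtain f where f: "f \<in> Ox U" "zero_on (orbit v) W f" using all orbit_closed(1)[OF v] by blast
  have "qpt z \<in> U" using chartD(4)[OF U] z by blast
  then have "f (qpt z) = 0" by (rule vanish_closed_image[OF U f orbit_closed(1,2)[OF v] z(2)])
  then obtain u where u: "u \<in> orbit v" "z \<in> curve u" using f z unfolding zero_on_def by blast
  then obtain A where A: "A \<in> \<Gamma>" "u = pull A v \<or> u = - pull A v" by (auto simp: orbit_def)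
  have "pull A v \<in> VF" using v A by (intro pull_VF) simp_all
  then have "z \<in> curve (pull A v)" using A(2) u(2) curve_uminus[of "pull A v"] by (elim disjE) simp_all
  then show ?thesis using A(1) by blast
qed

lemma local_equation_of_data:
  assumes m: "m > 0" and n: "n > 0" and U: "chart U W"
    and all: "\<forall>S. \<Gamma>_closed m S \<longrightarrow> (\<exists>f\<in>Ox U. zero_on S W f)"
    and f: "f \<in> Ox U" "zero_on (HF m) W f" "order_on n m W f"
  shows "local_equation X Ox U f n (HZ_divisor F m)"
  unfolding local_equation_def
proof (intro conjI allI impI)
  note oU = chartD(1)[OF U] and oW = chartD(2-4)[OF U]
  have top: "topspace (subtopology X U) = U" using openin_subset[OF oU] by (simp add: topspace_subtopology Int_absorb1)
  show "f \<in> Ox U" by (rule f(1))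
  show "U \<subseteq> X closure_of {x \<in> U. f x \<noteq> 0}"
  proof
    fix x assume x: "x \<in> U"
    show "x \<in> X closure_of {x \<in> U. f x \<noteq> 0}"
      unfolding in_closure_of
    proof (intro conjI allI impI)
      show "x \<in> topspace X" using x openin_subset[OF oU] by blast
      fix T assume T: "x \<in> T \<and> openin X T"
      have oT: "openin X (T \<inter> U)" using T oU by (simp add: openin_Int)
      obtain z where z: "z \<in> H2" "qpt z \<in> T \<inter> U" using interior_dense[OF oT, of x] T x by blast
      then obtain w where w: "w \<in> W" "w \<in> H2" "qpt z = qpt w" using chart_rep[OF U z(1)] by (metis IntD2)
      let ?T = "W \<inter> {w \<in> H2. qpt w \<in> T \<inter> U}"
      have oo: "open ?T" using oW(1) open_qpt_preimage[OF oT] by (rule open_Int)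
      have "w \<in> ?T" using w z by simp
      then have ne: "?T \<noteq> {}" by blast
      obtain u where u: "u \<in> ?T" "\<And>v. v \<in> HF m \<Longrightarrow> u \<notin> curve v"
        by (rule off_curves[OF m oo _ ne]) auto
      then have "f (qpt u) \<noteq> 0" using f(2) unfolding zero_on_def by blast
      then show "\<exists>y. y \<in> {x \<in> U. f x \<noteq> 0} \<and> y \<in> T" using u(1) by blast
    qed
  qed
  fix Y assume Y: "prime_divisor (subtopology X U) Ox Y"
  note p = unisolated[OF U Y]
  have HFc: "\<Gamma>_closed m (HF m)" using HF_uminus pull_HF by (auto simp: \<Gamma>_closed_def)
  have clzero: "closedin (subtopology X U) {x \<in> U. f x = 0}"
  proof -
    have "closedin (subtopology X U) {x \<in> topspace (subtopology X U). f x \<in> {0}}"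
      using sheaf_continuous[OF f(1)] by (rule closedin_continuous_map_preimage) simp
    then show ?thesis unfolding top by simp
  qed
  show "int (order_along (subtopology X U) Ox f Y) = int n * restrict_divisor (HZ_divisor F m) Y"
  proof (cases "\<forall>y\<in>Y. f y = 0")
    case False
    then obtain y where y: "y \<in> Y" "f y \<noteq> 0" by blast
    have yU: "y \<in> U" using y p(1) by blast
    \<comment> \<open>Membership in a positive power of the ideal at a dense set of points would
      make \<open>f\<close> vanish on all of \<open>Y\<close>. For the same reason no component
      contains \<open>Y\<close>: \<open>f\<close> vanishes on every component.\<close>
    have "order_along (subtopology X U) Ox f Y = 0"
    proof (rule order_eq)
      have "in_ideal_power (subtopology X U) Ox Y 0 x f" if x: "x \<in> Y" for x
        unfolding in_ideal_power_def
        by (rule exI[of _ U], rule exI[of _ 1], rule exI[of _ "\<lambda>_. f"], rule exI)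
           (use x p(1) f(1) oU top in \<open>auto simp: openin_open_subtopology\<close>)
      then have "{x \<in> Y. in_ideal_power (subtopology X U) Ox Y 0 x f} = Y" by blast
      then show "Y \<subseteq> subtopology X U closure_of {x \<in> Y. in_ideal_power (subtopology X U) Ox Y 0 x f}"
        using closure_of_subset[of Y "subtopology X U"] p(1) unfolding top by simp
    next
      fix k assume *: "Y \<subseteq> subtopology X U closure_of {x \<in> Y. in_ideal_power (subtopology X U) Ox Y k x f}"
      show "k \<le> 0"
      proof (rule ccontr)
        assume "\<not> k \<le> 0"
        then have "{x \<in> Y. in_ideal_power (subtopology X U) Ox Y k x f} \<subseteq> {x \<in> U. f x = 0}"
          using in_ideal_power_vanish[of "subtopology X U" Ox Y k] p(1) by blast
        then have "Y \<subseteq> {x \<in> U. f x = 0}" using * closure_of_minimal[OF _ clzero] by blast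
        then show False using y by blast
      qed
    qed
    moreover have "{Z. Y \<subseteq> Z \<and> HZ_divisor F m Z \<noteq> 0} = {}"
    proof (rule ccontr)
      assume "{Z. Y \<subseteq> Z \<and> HZ_divisor F m Z \<noteq> 0} \<noteq> {}"
      then obtain Z where Z: "Y \<subseteq> Z" "HZ_divisor F m Z \<noteq> 0" by blast
      then obtain v where v: "v \<in> HF m" "closed_image F (curve v) = Z" unfolding HZ_divisor_eq[OF m] by (metis)
      have "f y = 0" by (rule vanish_closed_image[OF U f(1,2) HFc v(1) _ yU]) (use v Z y in blast)
      then show False using y by simp
    qed
    ultimately show ?thesis unfolding restrict_divisor_def by simp
  next
    case True
    \<comment> \<open>A generic point of \<open>Y\<close> singles out the form \<open>v0\<close>,
      unique up to sign; its component will turn out to be the only one containing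
      \<open>Y\<close>.\<close>
    obtain y0 where y0: "y0 \<in> Y" using p(2) by blast
    obtain z0 where z0: "z0 \<in> W" "qpt z0 \<in> Y" "generic m z0"
      by (rule prime_divisor_points[OF m U Y y0 oU subsetD[OF p(1) y0]])
    have "f (qpt z0) = 0" using True z0 by blast
    then obtain v0 where v0: "v0 \<in> HF m" "z0 \<in> curve v0" using f(2) z0 unfolding zero_on_def by blast
    obtain f1 where f1: "f1 \<in> Ox U" "zero_on (orbit v0) W f1" using all orbit_closed(1)[OF v0(1)] by blast
    obtain f2 where f2: "f2 \<in> Ox U" "zero_on (HF m - orbit v0) W f2" using all orbit_closed(3)[OF v0(1)] by blast
    have irr: "irreducible_analytic (subtopology X U) Ox Y" using Y by (simp add: prime_divisor_def)
    then have an: "analytic_subset (subtopology X U) Ox Y" by (simp add: irreducible_analytic_def)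
    have int: "f1 (qpt w) = 0 \<or> f2 (qpt w) = 0" if w: "w \<in> W" "qpt w \<in> Y" for w
    proof -
      have "f (qpt w) = 0" using True w by blast
      then show ?thesis using f(2) f1(2) f2(2) w(1) unfolding zero_on_def by blast
    qed
    \<comment> \<open>The zero sets are described on \<open>W\<close> only. At the cusp, if both
      values were nonzero, they would be nonzero on a neighbourhood, and this contains a generic
      point of \<open>Y\<close> represented in \<open>W\<close>.\<close>
    have "f1 y = 0 \<or> f2 y = 0" if y: "y \<in> Y" for y
    proof (rule ccontr)
      assume ne: "\<not> ?thesis"
      let ?T = "{x \<in> U. f1 x \<noteq> 0} \<inter> {x \<in> U. f2 x \<noteq> 0}"
      have oT: "openin X ?T" using sheaf_nonzero_open[OF oU f1(1)] sheaf_nonzero_open[OF oU f2(1)] by (rule openin_Int)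
      have yT: "y \<in> ?T" using ne subsetD[OF p(1) y] by simp
      obtain w where w: "w \<in> W" "qpt w \<in> Y" "qpt w \<in> ?T" "generic m w" by (rule prime_divisor_points[OF m U Y y oT yT])
      then show False using int[OF w(1,2)] by simp
    qed
    then have "Y = {y \<in> Y. f1 y = 0} \<union> {y \<in> Y. f2 y = 0}" by blast
    moreover have "analytic_subset (subtopology X U) Ox {y \<in> Y. f1 y = 0}"
      "analytic_subset (subtopology X U) Ox {y \<in> Y. f2 y = 0}" using analytic_zero[OF U an] f1(1) f2(1) by blast+
    ultimately have "Y = {y \<in> Y. f1 y = 0} \<or> Y = {y \<in> Y. f2 y = 0}" using irr unfolding irreducible_analytic_def by blast
    moreover have "Y \<noteq> {y \<in> Y. f2 y = 0}"
    proof
      assume "Y = {y \<in> Y. f2 y = 0}"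
      then have "f2 (qpt z0) = 0" using z0 by blast
      then obtain u where u: "u \<in> HF m" "u \<notin> orbit v0" "z0 \<in> curve u" using f2(2) z0 unfolding zero_on_def by blast
      then have "u = v0 \<or> u = - v0" using z0(3) v0 unfolding generic_def by blast
      then show False using u(2) orbit_closed(1,2)[OF v0(1)] by (auto simp: \<Gamma>_closed_def)
    qed
    ultimately have f1Y: "\<forall>y\<in>Y. f1 y = 0" by blast
    define Z0 where "Z0 = closed_image F (curve v0)"
    have YZ0: "Y \<subseteq> Z0"
    proof
      fix y assume y: "y \<in> Y"
      show "y \<in> Z0"
        unfolding Z0_def closed_image_def in_closure_of
      proof (intro conjI allI impI)
        show "y \<in> topspace X" using y p(1) openin_subset[OF oU] by blast
        fix T assume T: "y \<in> T \<and> openin X T"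
        obtain w where w: "w \<in> W" "qpt w \<in> Y" "qpt w \<in> T" "generic m w"
          by (rule prime_divisor_points[OF m U Y y conjunct2[OF T] conjunct1[OF T]])
        then have "f1 (qpt w) = 0" using f1Y by blast
        then obtain u where "u \<in> orbit v0" "w \<in> curve u" using f1(2) w unfolding zero_on_def by blast
        then obtain A where A: "A \<in> \<Gamma>" "w \<in> curve (pull A v0)"
          using curve_uminus[OF pull_VF[OF HF_VF[OF v0(1)]]] unfolding orbit_def by (auto dest: \<Gamma>_G)
        have wH: "w \<in> H2" using w oW by blast
        have "act2 A w \<in> curve v0" using curve_pull[of v0 A w] A v0 wH by simp
        moreover have "qpt (act2 A w) = qpt w" using qpt_act2[OF A(1) wH] .
        ultimately have "qpt w \<in> qpt ` curve v0" by (metis imageI)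
        then show "\<exists>x. x \<in> (\<lambda>z. proj F (Interior z)) ` curve v0 \<and> x \<in> T" using w(3) unfolding qpt_def by blast
      qed
    qed
    \<comment> \<open>A component containing \<open>Y\<close> contains \<open>qpt z0\<close>, so
      some translate of its form passes through \<open>z0\<close> and equals \<open>v0\<close> up to
      sign.\<close>
    have uniq: "Z = Z0" if Z: "Y \<subseteq> Z" "HZ_divisor F m Z \<noteq> 0" for Z
    proof -
      obtain v where v: "v \<in> HF m" "closed_image F (curve v) = Z" using Z(2) unfolding HZ_divisor_eq[OF m] by metis
      have "qpt z0 \<in> closed_image F (curve v)" using v Z z0 by blast
      then obtain A where A: "A \<in> \<Gamma>" "z0 \<in> curve (pull A v)" using HZ_orbit_zero[OF U all v(1) z0(1)] by blast
      have "pull A v = v0 \<or> pull A v = - v0" using z0(3) A v0 pull_HF[OF v(1) A(1)] unfolding generic_def by blast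
      then have "curve (pull A v) = curve v0" using curve_uminus[OF HF_VF[OF v0(1)]] by (elim disjE) simp_all
      then show ?thesis using closed_image_pull[OF HF_VF[OF v(1)] A(1)] v(2) unfolding Z0_def by simp
    qed
    have ex: "\<exists>v\<in>HF m. closed_image F (curve v) = Z0" unfolding Z0_def using v0(1) by (intro bexI[of _ v0] refl)
    have HZ1: "HZ_divisor F m Z0 = 1" unfolding HZ_divisor_eq[OF m] if_P[OF ex] ..
    have "{Z. Y \<subseteq> Z \<and> HZ_divisor F m Z \<noteq> 0} = {Z0}"
    proof (intro equalityI subsetI)
      fix Z assume "Z \<in> {Z. Y \<subseteq> Z \<and> HZ_divisor F m Z \<noteq> 0}"
      then show "Z \<in> {Z0}" using uniq[of Z] by simp
    next
      fix Z assume "Z \<in> {Z0}"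
      then show "Z \<in> {Z. Y \<subseteq> Z \<and> HZ_divisor F m Z \<noteq> 0}" using YZ0 HZ1 by simp
    qed
    then have "restrict_divisor (HZ_divisor F m) Y = 1" unfolding restrict_divisor_def using HZ1 by simp
    moreover have "order_along (subtopology X U) Ox f Y = n"
    proof (rule order_eq)
      show "Y \<subseteq> subtopology X U closure_of {y \<in> Y. in_ideal_power (subtopology X U) Ox Y n y f}"
      proof
        fix y assume y: "y \<in> Y"
        show "y \<in> subtopology X U closure_of {y \<in> Y. in_ideal_power (subtopology X U) Ox Y n y f}"
          unfolding in_closure_of
        proof (intro conjI allI impI)
          show "y \<in> topspace (subtopology X U)" using y p(1) top by blast
          fix T assume T: "y \<in> T \<and> openin (subtopology X U) T"
          then have oT: "openin X T" using oU by (simp add: openin_open_subtopology)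
          obtain w where w: "w \<in> W" "qpt w \<in> Y" "qpt w \<in> T" "generic m w" by (rule prime_divisor_points[OF m U Y y oT conjunct1[OF T]])
          have "f (qpt w) = 0" using True w by blast
          then obtain v where v: "v \<in> HF m" "w \<in> curve v" using f(2) w unfolding zero_on_def by blast
          have "in_ideal_power (subtopology X U) Ox Y n (qpt w) f"
            using True by (intro ideal_order_lower[OF m U w(1,4) v(2,1) n f(3)]) blast
          then show "\<exists>x. x \<in> {y \<in> Y. in_ideal_power (subtopology X U) Ox Y n y f} \<and> x \<in> T" using w by blast
        qed
      qed
    next
      fix k assume k: "Y \<subseteq> subtopology X U closure_of {y \<in> Y. in_ideal_power (subtopology X U) Ox Y k y f}"
      have only: "\<forall>u\<in>HF m. z0 \<in> curve u \<longrightarrow> u = v0 \<or> u = - v0" using z0(3) v0 unfolding generic_def by blast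
      obtain W' h where W': "open W'" "z0 \<in> W'" "W' \<subseteq> W" "holomorphic2_on h W'"
          "\<forall>w\<in>W'. h w \<noteq> 0 \<and> f (qpt w) = h w * ell v0 w ^ n"
        by (rule order_onE[OF f(3) z0(1) v0 only])
      have oV: "openin X (qpt ` W')" using W' oW by (intro openin_qpt_image) auto
      have VU: "qpt ` W' \<subseteq> U" using W'(3) oW(3) by blast
      have "openin (subtopology X U) (qpt ` W')" using oV VU oU by (simp add: openin_open_subtopology)
      moreover have "qpt z0 \<in> qpt ` W'" using W'(2) by blast
      moreover have "qpt z0 \<in> subtopology X U closure_of {y \<in> Y. in_ideal_power (subtopology X U) Ox Y k y f}" using k z0(2) by blast
      ultimately obtain y where y: "y \<in> Y" "in_ideal_power (subtopology X U) Ox Y k y f" "y \<in> qpt ` W'"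
        unfolding in_closure_of by blast
      then obtain z where z: "z \<in> W'" "y = qpt z" by blast
      show "k \<le> n"
        by (rule ideal_order_upper[OF m U Y z(1) _ W'(1,3,4) _ v0(1) _ n]) (use y z W'(5) True in auto)
    qed
    ultimately show ?thesis by simp
  qed
qed

lemma Q_Cartier_of_local_data:
  assumes m: "m > 0" and n: "n > 0" and data: "\<And>x. x \<in> topspace X \<Longrightarrow> local_data m n x"
  shows "Q_Cartier X Ox (HZ_divisor F m)"
  unfolding Q_Cartier_def
proof (intro exI[of _ n] conjI ballI)
  show "0 < n" by (rule n)
  fix x assume "x \<in> topspace X"
  then obtain U W f where U: "chart U W" "x \<in> U" "\<forall>S. \<Gamma>_closed m S \<longrightarrow> (\<exists>f\<in>Ox U. zero_on S W f)"
     "f \<in> Ox U" "zero_on (HF m) W f" "order_on n m W f"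
    using data unfolding local_data_def by meson
  have "openin X U" by (rule chartD(1)[OF U(1)])
  then show "\<exists>U f. openin X U \<and> x \<in> U \<and> local_equation X Ox U f n (HZ_divisor F m)"
    using U(2) local_equation_of_data[OF m n U(1,3-6)] by blast
qed

end

section \<open>Interior points\<close>

context quadratic
begin

lemma continuous_nonzero_open:
  fixes h :: "complex \<times> complex \<Rightarrow> complex"
  assumes "open W" "continuous_on W h"
  shows "open {w \<in> W. h w \<noteq> 0}"
proof -
  have "open (W \<inter> h -` (- {0}))"
    by (rule continuous_open_preimage[OF assms(2,1)]) (simp add: open_Compl)
  moreover have "W \<inter> h -` (- {0}) = {w \<in> W. h w \<noteq> 0}" by auto
  ultimately show ?thesis by simp
qed

text \<open>Nonvanishing of \<open>h\<close> is asked for at the point \<open>z\<close> alone;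
  continuity provides the neighbourhood that \<open>order_on\<close> requires.\<close>

lemma order_onI:
  assumes W: "open W" and \<phi>: "\<And>w. w \<in> W \<Longrightarrow> f (qpt w) = \<phi> w"
    and loc: "\<And>z v. z \<in> W \<Longrightarrow> v \<in> HF m \<Longrightarrow> z \<in> curve v \<Longrightarrow> (\<forall>u\<in>HF m. z \<in> curve u \<longrightarrow> u = v \<or> u = - v) \<Longrightarrow>
      \<exists>W' h. open W' \<and> z \<in> W' \<and> W' \<subseteq> W \<and> holomorphic2_on h W' \<and> h z \<noteq> 0 \<and> (\<forall>w\<in>W'. \<phi> w = h w * ell v w ^ n)"
  shows "order_on n m W f"
  unfolding order_on_def
proof (intro ballI impI)
  fix z v assume z: "z \<in> W" "v \<in> HF m" "z \<in> curve v" "\<forall>u\<in>HF m. z \<in> curve u \<longrightarrow> u = v \<or> u = - v"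
  obtain W' h where W': "open W'" "z \<in> W'" "W' \<subseteq> W" "holomorphic2_on h W'" "h z \<noteq> 0" "\<forall>w\<in>W'. \<phi> w = h w * ell v w ^ n"
    using loc[OF z] by (elim exE conjE)
  have "open {w \<in> W'. h w \<noteq> 0}"
    by (intro continuous_nonzero_open W'(1) holomorphic2_on_imp_continuous_on W'(4))
  moreover have "z \<in> {w \<in> W'. h w \<noteq> 0}" using W' by simp
  moreover have "{w \<in> W'. h w \<noteq> 0} \<subseteq> W" using W'(3) by blast
  moreover have "holomorphic2_on h {w \<in> W'. h w \<noteq> 0}" by (rule holomorphic2_on_subset[OF W'(4)]) blast
  moreover have "\<forall>w\<in>{w \<in> W'. h w \<noteq> 0}. h w \<noteq> 0 \<and> f (qpt w) = h w * ell v w ^ n"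
  proof
    fix w assume w: "w \<in> {w \<in> W'. h w \<noteq> 0}"
    then have "w \<in> W" using W'(3) by blast
    then show "h w \<noteq> 0 \<and> f (qpt w) = h w * ell v w ^ n" using w W'(6) \<phi>[of w] by simp
  qed
  ultimately show "\<exists>W' h. open W' \<and> z \<in> W' \<and> W' \<subseteq> W \<and> holomorphic2_on h W' \<and> (\<forall>w\<in>W'. h w \<noteq> 0 \<and> f (qpt w) = h w * ell v w ^ n)"
    by (intro exI conjI)
qed

lemma order_on_power:
  assumes "order_on n m W f" shows "order_on (n * k) m W (\<lambda>x. f x ^ k)"
  unfolding order_on_def
proof (intro ballI impI)
  fix z v assume z: "z \<in> W" "v \<in> HF m" "z \<in> curve v" "\<forall>u\<in>HF m. z \<in> curve u \<longrightarrow> u = v \<or> u = - v"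
  have "\<exists>W' h. open W' \<and> z \<in> W' \<and> W' \<subseteq> W \<and> holomorphic2_on h W' \<and> (\<forall>w\<in>W'. h w \<noteq> 0 \<and> f (qpt w) = h w * ell v w ^ n)"
    using assms z unfolding order_on_def by simp
  then obtain W' h where W': "open W'" "z \<in> W'" "W' \<subseteq> W" "holomorphic2_on h W'"
      "\<forall>w\<in>W'. h w \<noteq> 0 \<and> f (qpt w) = h w * ell v w ^ n" by (elim exE conjE)
  have "\<forall>w\<in>W'. h w ^ k \<noteq> 0 \<and> f (qpt w) ^ k = h w ^ k * ell v w ^ (n * k)"
    using W'(5) by (simp add: power_mult_distrib power_mult)
  then show "\<exists>W' h. open W' \<and> z \<in> W' \<and> W' \<subseteq> W \<and> holomorphic2_on h W' \<and> (\<forall>w\<in>W'. h w \<noteq> 0 \<and> f (qpt w) ^ k = h w * ell v w ^ (n * k))"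
    using W'(1-3) holomorphic2_on_power[OF W'(4), of k] by (intro exI[of _ W'] exI[of _ "\<lambda>w. h w ^ k"] conjI)
qed

lemma sheaf_power:
  assumes "f \<in> Ox U" shows "(\<lambda>x. f x ^ k) \<in> Ox U"
proof -
  have "continuous_map (subtopology X U) euclidean (\<lambda>x. f x ^ k)"
    using continuous_map_compose[OF sheaf_continuous[OF assms], of euclidean "\<lambda>w. w ^ k"]
    by (simp add: o_def continuous_on_power)
  moreover have "holomorphic2_on (\<lambda>z. f (qpt z) ^ k) {z \<in> H2. qpt z \<in> U}"
    by (rule holomorphic2_on_power[OF sheaf_holomorphic[OF assms]])
  ultimately show ?thesis by (simp add: BB_sheaf_def qpt_def)
qed

lemma zero_on_power: "k > 0 \<Longrightarrow> zero_on S W f \<Longrightarrow> zero_on S W (\<lambda>x. f x ^ k)"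
  by (simp add: zero_on_def)

lemma nonzero_form: "v \<in> HF m \<Longrightarrow> m > 0 \<Longrightarrow> v \<noteq> - v"
  using HF_nrm_pos[of v m] by (cases v) (auto simp: nrm_def)

lemma stab_mult:
  assumes z: "z \<in> H2" and A: "A \<in> stab z" and B: "B \<in> stab z"
  shows "A ** B \<in> stab z" "inv2 A \<in> stab z"
  using assms act2_mult[of A B z] act2_inv2(1)[of A z] \<Gamma>_mult[of A B] inv2_\<Gamma>[of A] by (auto simp: stab_def)

lemma stab_reindex:
  assumes z: "z \<in> H2" and A: "A \<in> stab z"
  shows "bij_betw (\<lambda>B. B ** A) (stab z) (stab z)"
proof (rule bij_betw_byWitness[where f' = "\<lambda>B. B ** inv2 A"])
  have AG: "A \<in> G" using A by (simp add: stab_def)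
  show "\<forall>B\<in>stab z. (B ** A) ** inv2 A = B" using inv2_right[OF AG] by (simp flip: matrix_mul_assoc)
  show "\<forall>B\<in>stab z. (B ** inv2 A) ** A = B" using inv2_left[OF AG] by (simp flip: matrix_mul_assoc)
  show "(\<lambda>B. B ** A) ` stab z \<subseteq> stab z" using stab_mult(1)[OF z _ A] by blast
  show "(\<lambda>B. B ** inv2 A) ` stab z \<subseteq> stab z" using stab_mult(1)[OF z _ stab_mult(2)[OF z A A]] by blast
qed

text \<open>Right multiplication by a stabilizing element permutes the stabilizer, which makes the
  product over it invariant. The order is twice the size of the stabilizer because, for each A in
  it, both forms that A pulls back to v and to -v occur in \<open>Q\<close>.\<close>

lemma interior_product:
  assumes m: "m > 0" and z0: "z0 \<in> H2" and W: "open W" "W \<subseteq> K" "compact K" "K \<subseteq> H2"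
    and stabW: "\<And>A. A \<in> stab z0 \<Longrightarrow> act2 A ` W = W"
    and free: "\<And>A w. A \<in> \<Gamma> \<Longrightarrow> w \<in> W \<Longrightarrow> act2 A w \<in> W \<Longrightarrow> A \<in> stab z0"
    and S: "\<Gamma>_closed m S"
  obtains f where "f \<in> Ox (qpt ` W)" "zero_on S W f"
    "S = HF m \<longrightarrow> order_on (2 * card (stab z0)) m W f"
proof -
  have SH: "S \<subseteq> HF m" and Su: "\<And>v. v \<in> S \<Longrightarrow> - v \<in> S" and Sp: "\<And>v A. v \<in> S \<Longrightarrow> A \<in> \<Gamma> \<Longrightarrow> pull A v \<in> S"
    using S by (auto simp: \<Gamma>_closed_def)
  have WH: "W \<subseteq> H2" using W by blast
  define Q where "Q = {v \<in> S. curve v \<inter> W \<noteq> {}}"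
  have finQ: "finite Q"
  proof (rule finite_subset)
    show "Q \<subseteq> {v \<in> HF m. curve v \<inter> K \<noteq> {}}" using SH W(2) by (auto simp: Q_def)
  qed (rule curves_locally_finite[OF W(3,4)])
  define P where "P z = (\<Prod>v\<in>Q. ell v z)" for z
  define \<phi> where "\<phi> z = (\<Prod>A\<in>stab z0. P (act2 A z))" for z
  have st: "A \<in> \<Gamma>" "A \<in> G" if "A \<in> stab z0" for A using that by (auto simp: stab_def)
  have inW: "act2 A z \<in> W" if "A \<in> stab z0" "z \<in> W" for A z using stabW[OF that(1)] that(2) by blast
  have holP: "holomorphic2_on P V" for V
    unfolding P_def by (intro holomorphic2_on_prod holomorphic2_ell)
  have hol: "holomorphic2_on \<phi> W"
    unfolding \<phi>_def
    by (intro holomorphic2_on_prod holomorphic2_comp_act2[OF _ WH holP[of UNIV]]) (auto simp: st)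
  have inv: "\<Gamma>_inv_on W \<phi>"
    unfolding \<Gamma>_inv_on_def
  proof (intro ballI impI)
    fix A z assume A: "A \<in> \<Gamma>" "z \<in> W" "act2 A z \<in> W"
    then have As: "A \<in> stab z0" by (rule free)
    have zH: "z \<in> H2" using A WH by blast
    have "\<phi> (act2 A z) = (\<Prod>B\<in>stab z0. P (act2 (B ** A) z))"
      unfolding \<phi>_def using act2_mult[OF st(2) st(2)[OF As] zH] by (intro prod.cong) simp_all
    also have "\<dots> = \<phi> z" unfolding \<phi>_def
      by (rule prod.reindex_bij_betw[OF stab_reindex[OF z0 As]])
    finally show "\<phi> (act2 A z) = \<phi> z" .
  qed
  have fst: "finite (stab z0)" by (rule finite_stab[OF z0])
  have one: "mat 1 \<in> stab z0" by (simp add: stab_def)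
  define f where "f = push W \<phi> 0"
  have f\<phi>: "f (qpt w) = \<phi> w" if "w \<in> W" for w unfolding f_def by (rule push_qpt[OF WH inv that])
  have pz: "\<phi> z = 0 \<longleftrightarrow> (\<exists>A\<in>stab z0. \<exists>v\<in>Q. act2 A z \<in> curve v)" if z: "z \<in> W" for z
  proof -
    have "act2 A z \<in> H2" if "A \<in> stab z0" for A using inW[OF that z] WH by blast
    then show ?thesis unfolding \<phi>_def P_def using fst finQ by (auto simp: curve_def)
  qed
  show ?thesis
  proof (rule that)
    show "f \<in> Ox (qpt ` W)" unfolding f_def by (rule push_sheaf[OF W(1) WH hol inv])
    show "zero_on S W f"
      unfolding zero_on_def
    proof
      fix z assume z: "z \<in> W"
      have zH: "z \<in> H2" using z WH by blast
      show "f (qpt z) = 0 \<longleftrightarrow> (\<exists>v\<in>S. z \<in> curve v)"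
        unfolding f\<phi>[OF z] pz[OF z]
      proof
        assume "\<exists>A\<in>stab z0. \<exists>v\<in>Q. act2 A z \<in> curve v"
        then obtain A v where A: "A \<in> stab z0" "v \<in> S" "act2 A z \<in> curve v" by (auto simp: Q_def)
        have "z \<in> curve (pull A v)" using curve_pull[of v A z] A st[OF A(1)] SH zH by auto
        then show "\<exists>v\<in>S. z \<in> curve v" using Sp[OF A(2) st(1)[OF A(1)]] by blast
      next
        assume "\<exists>v\<in>S. z \<in> curve v"
        then obtain v where "v \<in> S" "z \<in> curve v" by blast
        then show "\<exists>A\<in>stab z0. \<exists>v\<in>Q. act2 A z \<in> curve v"
          using one z by (intro bexI[of _ "mat 1"] bexI[of _ v]) (auto simp: Q_def)
      qed
    qed
    show "S = HF m \<longrightarrow> order_on (2 * card (stab z0)) m W f"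
    proof
      assume SHF: "S = HF m"
      show "order_on (2 * card (stab z0)) m W f"
      proof (rule order_onI[where \<phi> = \<phi>, OF W(1)])
        show "f (qpt w) = \<phi> w" if "w \<in> W" for w by (rule f\<phi>[OF that])
      next
        fix z v assume z: "z \<in> W" "v \<in> HF m" "z \<in> curve v" and only: "\<forall>u\<in>HF m. z \<in> curve u \<longrightarrow> u = v \<or> u = - v"
        have zH: "z \<in> H2" using z WH by blast
        define vA where "vA A = pull (inv2 A) v" for A
        have vAS: "vA A \<in> HF m" if "A \<in> stab z0" for A
          unfolding vA_def using pull_HF[OF z(2) inv2_\<Gamma>[OF st(1)[OF that]]] .
        have pvA: "pull A (vA A) = v" if "A \<in> stab z0" for A
          unfolding vA_def using pull_mult[of v "inv2 A" A] z(2) inv2_G[OF st(2)[OF that]] st(2)[OF that]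
            inv2_left[OF st(2)[OF that]] pull_one[of v] by simp
        have vAc: "act2 A z \<in> curve (vA A)" if "A \<in> stab z0" for A
          using curve_pull[OF HF_VF[OF vAS[OF that]] st(2)[OF that] zH] pvA[OF that] z(3) by simp
        have cAu: "u = vA A \<or> u = - vA A" if A: "A \<in> stab z0" and u: "u \<in> HF m" "act2 A z \<in> curve u" for A u
        proof -
          have "z \<in> curve (pull A u)" using curve_pull[OF HF_VF[OF u(1)] st(2)[OF A] zH] u(2) by simp
          then have "pull A u = v \<or> pull A u = - v" using only pull_HF[OF u(1) st(1)[OF A]] by blast
          moreover have "u = pull (inv2 A) (pull A u)"
            using pull_mult[of u A "inv2 A"] u(1) inv2_G[OF st(2)[OF A]] st(2)[OF A] inv2_right[OF st(2)[OF A]] pull_one[of u] by simp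
          ultimately show ?thesis using pull_uminus[of v "inv2 A"] z(2) unfolding vA_def by auto
        qed
        have vAQ: "vA A \<in> Q" "- vA A \<in> Q" if "A \<in> stab z0" for A
          using vAc[OF that] vAS[OF that] inW[OF that z(1)] curve_uminus[of "vA A"] HF_uminus[OF vAS[OF that]]
          unfolding Q_def SHF by auto
        define R' where "R' A w = (\<Prod>u\<in>Q - {vA A, - vA A}. ell u w)" for A w
        \<comment> \<open>The inverse of the automorphy factor in \<open>ell_pull\<close>, so that
          \<open>ell (vA A) (act2 A w) = j A w * ell v w\<close>. The pair of forms
          \<open>vA A\<close> and \<open>- vA A\<close> produces its square and the minus sign in
          \<open>h\<close>.\<close>
        define j where "j A w = inverse (aut A (fst w) * aut (cjm A) (snd w))" for A :: "real^2^2" and w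
        define h where "h w = (\<Prod>A\<in>stab z0. - (j A w ^ 2) * R' A (act2 A w))" for w
        have eq: "P (act2 A w) = (- (j A w ^ 2) * R' A (act2 A w)) * ell v w ^ 2" if A: "A \<in> stab z0" and w: "w \<in> W" for A w
        proof -
          have wH: "w \<in> H2" using w WH by blast
          have "P x = ell (vA A) x * (ell (- vA A) x * R' A x)" for x
          proof -
            have "P x = ell (vA A) x * (\<Prod>u\<in>Q - {vA A}. ell u x)"
              unfolding P_def using finQ vAQ(1)[OF A] by (rule prod.remove)
            also have "(\<Prod>u\<in>Q - {vA A}. ell u x) = ell (- vA A) x * (\<Prod>u\<in>Q - {vA A} - {- vA A}. ell u x)"
              using finQ vAQ(2)[OF A] nonzero_form[OF vAS[OF A] m] by (intro prod.remove) auto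
            also have "Q - {vA A} - {- vA A} = Q - {vA A, - vA A}" by blast
            finally show ?thesis unfolding R'_def .
          qed
          then have 1: "P (act2 A w) = - (ell (vA A) (act2 A w) ^ 2) * R' A (act2 A w)"
            using ell_uminus[OF HF_VF[OF vAS[OF A]]] by (simp add: power2_eq_square)
          have "ell v w = ell (vA A) (act2 A w) * (aut A (fst w) * aut (cjm A) (snd w))"
            using ell_pull[OF HF_VF[OF vAS[OF A]] st(2)[OF A] wH] pvA[OF A] by simp
          then have "ell (vA A) (act2 A w) = j A w * ell v w"
            unfolding j_def using aut_nz[OF st(2)[OF A] wH] by (simp add: field_simps)
          then show ?thesis unfolding 1 by (simp add: power_mult_distrib)
        qed
        have "\<phi> w = h w * ell v w ^ (2 * card (stab z0))" if w: "w \<in> W" for w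
        proof -
          have "\<phi> w = (\<Prod>A\<in>stab z0. (- (j A w ^ 2) * R' A (act2 A w)) * ell v w ^ 2)"
            unfolding \<phi>_def using eq w by (intro prod.cong) simp_all
          also have "\<dots> = h w * (ell v w ^ 2) ^ card (stab z0)" unfolding h_def prod.distrib by simp
          finally show ?thesis by (simp add: power_mult)
        qed
        moreover have "holomorphic2_on h W"
          unfolding h_def
        proof (intro holomorphic2_on_prod holomorphic2_on_mult holomorphic2_on_uminus holomorphic2_on_power)
          fix A assume A: "A \<in> stab z0"
          show "holomorphic2_on (j A) W" unfolding j_def
            using aut_nz[OF st(2)[OF A]] WH
            by (intro holomorphic2_on_inverse holomorphic2_on_mult holomorphic2_aut) auto
          have "holomorphic2_on (R' A) UNIV" unfolding R'_def by (intro holomorphic2_on_prod holomorphic2_ell)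
          then show "holomorphic2_on (\<lambda>w. R' A (act2 A w)) W"
            by (rule holomorphic2_comp_act2[OF st(2)[OF A] WH]) simp
        qed
        moreover have "h z \<noteq> 0"
        proof -
          have "j A z \<noteq> 0" if "A \<in> stab z0" for A using aut_nz[OF st(2)[OF that] zH] by (simp add: j_def)
          moreover have "R' A (act2 A z) \<noteq> 0" if A: "A \<in> stab z0" for A
          proof
            assume "R' A (act2 A z) = 0"
            then obtain u where u: "u \<in> Q - {vA A, - vA A}" "ell u (act2 A z) = 0" unfolding R'_def using finQ by auto
            have "act2 A z \<in> curve u" using u(2) inW[OF A z(1)] WH by (auto simp: curve_def)
            moreover have "u \<in> HF m" using u(1) SH by (auto simp: Q_def)
            ultimately show False using cAu[OF A] u(1) by blast
          qed
          ultimately show ?thesis unfolding h_def using fst by simp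
        qed
        ultimately show "\<exists>W' h. open W' \<and> z \<in> W' \<and> W' \<subseteq> W \<and> holomorphic2_on h W' \<and> h z \<noteq> 0 \<and>
            (\<forall>w\<in>W'. \<phi> w = h w * ell v w ^ (2 * card (stab z0)))"
          using W(1) z(1) by (intro exI[of _ W] exI[of _ h] conjI) auto
      qed
    qed
  qed
qed

lemma local_data_interior:
  assumes m: "m > 0" and n: "n > 0" and z0: "z0 \<in> H2" and dvd: "2 * card (stab z0) dvd n"
  shows "local_data m n (qpt z0)"
proof -
  obtain W K where W: "open W" "z0 \<in> W" "W \<subseteq> K" "compact K" "K \<subseteq> H2"
    and s: "\<And>A. A \<in> stab z0 \<Longrightarrow> act2 A ` W = W" "\<And>A w. A \<in> \<Gamma> \<Longrightarrow> w \<in> W \<Longrightarrow> act2 A w \<in> W \<Longrightarrow> A \<in> stab z0"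
    using invariant_nbhd[OF z0 open_UNIV UNIV_I] by metis
  have WH: "W \<subseteq> H2" using W by blast
  have ch: "chart (qpt ` W) W"
    unfolding chart_def using openin_qpt_image[OF W(1) WH] W(1) WH by simp
  have ip: "\<exists>f\<in>Ox (qpt ` W). zero_on S W f \<and> (S = HF m \<longrightarrow> order_on (2 * card (stab z0)) m W f)"
    if S: "\<Gamma>_closed m S" for S
  proof (rule interior_product[OF m z0 W(1) W(3) W(4) W(5)])
    show "act2 A ` W = W" if "A \<in> stab z0" for A by (rule s(1)[OF that])
    show "A \<in> stab z0" if "A \<in> \<Gamma>" "w \<in> W" "act2 A w \<in> W" for A w by (rule s(2)[OF that])
    show "\<Gamma>_closed m S" by (rule S)
    fix f assume f: "f \<in> Ox (qpt ` W)" "zero_on S W f" "S = HF m \<longrightarrow> order_on (2 * card (stab z0)) m W f"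
    show ?thesis using f by (intro bexI[of _ f] conjI)
  qed
  have zero: "\<exists>f\<in>Ox (qpt ` W). zero_on S W f" if "\<Gamma>_closed m S" for S
    using ip[OF that] by (elim bexE conjE) (intro bexI)
  have HFc: "\<Gamma>_closed m (HF m)" using HF_uminus pull_HF by (simp add: \<Gamma>_closed_def)
  obtain f where f0: "f \<in> Ox (qpt ` W)" "zero_on (HF m) W f \<and> (HF m = HF m \<longrightarrow> order_on (2 * card (stab z0)) m W f)"
    using ip[OF HFc] by (elim bexE)
  then have f: "f \<in> Ox (qpt ` W)" "zero_on (HF m) W f" "order_on (2 * card (stab z0)) m W f" by simp_all
  obtain k where k: "n = 2 * card (stab z0) * k" using dvd by (elim dvdE)
  then have "k > 0" using n by (metis gr0I mult_0_right)
  then have "(\<lambda>x. f x ^ k) \<in> Ox (qpt ` W)" "zero_on (HF m) W (\<lambda>x. f x ^ k)" "order_on n m W (\<lambda>x. f x ^ k)"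
    using sheaf_power[OF f(1)] zero_on_power[OF _ f(2)] order_on_power[OF f(3), of k] k by simp_all
  then have "\<exists>f\<in>Ox (qpt ` W). zero_on (HF m) W f \<and> order_on n m W f" by (intro bexI conjI)
  moreover have "qpt z0 \<in> qpt ` W" using W by (intro imageI)
  ultimately show ?thesis unfolding local_data_def using ch zero by (intro exI[of _ "qpt ` W"] exI[of _ W] conjI) simp_all
qed

end

section \<open>Local Borcherds products\<close>

definition e2 :: "complex \<Rightarrow> complex" where "e2 x = exp (2 * of_real pi * \<i> * x)"

lemma e2_add: "e2 (x + y) = e2 x * e2 y"
  by (simp add: e2_def exp_add algebra_simps)

lemma e2_minus: "e2 (- x) = inverse (e2 x)"
  by (simp add: e2_def exp_minus)

lemma e2_nz [simp]: "e2 x \<noteq> 0"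
  by (simp add: e2_def)

lemma norm_e2: "cmod (e2 x) = exp (- 2 * pi * Im x)"
  by (simp add: e2_def norm_exp_eq_Re)

lemma e2_of_int [simp]: "e2 (of_int i) = 1"
  by (simp add: e2_def exp_eq_1 mult_ac)

lemma e2_eq_1: "e2 x = 1 \<longleftrightarrow> (\<exists>i :: int. x = of_int i)"
proof
  assume "e2 x = 1"
  then obtain n :: int where n: "Re (2 * of_real pi * \<i> * x) = 0" "Im (2 * of_real pi * \<i> * x) = of_int (2 * n) * pi"
    unfolding e2_def exp_eq_1 by blast
  then have "Im x = 0" "Re x = of_int n" by simp_all
  then show "\<exists>i :: int. x = of_int i" by (intro exI[of _ n]) (simp add: complex_eq_iff)
qed auto

lemma e2_power: "e2 x ^ n = e2 (of_nat n * x)"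
  by (simp add: e2_def exp_of_nat_mult[symmetric] mult_ac)

lemma e2_holomorphic: "e2 holomorphic_on UNIV"
  unfolding e2_def by (intro holomorphic_intros)

text \<open>The quotient (1 - e2 y)/y with its removable singularity filled in. It turns the
  vanishing of a factor 1 - e2 y into a linear factor times something nonzero at 0.\<close>

definition e2q :: "complex \<Rightarrow> complex" where
  "e2q y = (if y = 0 then - (2 * of_real pi * \<i>) else (1 - e2 y) / y)"

lemma e2q_mult: "1 - e2 y = e2q y * y"
  by (simp add: e2q_def e2_def)

lemma e2q_holomorphic: "e2q holomorphic_on UNIV"
proof -
  have d: "((\<lambda>y. 1 - e2 y) has_field_derivative - (2 * of_real pi * \<i>)) (at 0)"
    unfolding e2_def by (auto intro!: derivative_eq_intros)
  then have dd: "deriv (\<lambda>y. 1 - e2 y) 0 = - (2 * of_real pi * \<i>)" by (rule DERIV_imp_deriv)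
  have "(\<lambda>y. if y = 0 then deriv (\<lambda>y. 1 - e2 y) 0 else (1 - e2 y) / y - (1 - e2 0) / (y - 0)) holomorphic_on UNIV"
  proof (rule pole_theorem)
    show "(\<lambda>y. 1 - e2 y) holomorphic_on UNIV" by (intro holomorphic_intros e2_holomorphic)
  qed auto
  moreover have "(\<lambda>y. if y = 0 then deriv (\<lambda>y. 1 - e2 y) 0 else (1 - e2 y) / y - (1 - e2 0) / (y - 0)) = e2q"
    unfolding dd by (auto simp: e2q_def fun_eq_iff e2_def)
  ultimately show ?thesis by simp
qed

lemma e2q_0: "e2q 0 \<noteq> 0"
  by (simp add: e2q_def)

text \<open>The j-th factor is split off and, as e2 has period 1, equals its linear term times a
  value of \<open>e2q\<close>. The rest of the product is nonzero at \<open>z\<close> since no other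
  factor vanishes there.\<close>

lemma product_simple_zero:
  assumes W: "open W" "z \<in> W" and x: "\<And>k. holomorphic2_on (x k) W"
    and ls: "loc_summable (\<lambda>k w. e2 (x k w)) W"
    and zero: "x j z = of_int i" and only: "\<And>k. e2 (x k z) = 1 \<Longrightarrow> k = j"
  shows "\<exists>h. holomorphic2_on h W \<and> h z \<noteq> 0 \<and>
    (\<forall>w\<in>W. prodinf (\<lambda>k. 1 - e2 (x k w)) = h w * (x j w - of_int i))"
proof -
  let ?q = "\<lambda>k w. e2 (x k w)"
  let ?q' = "?q(j := (\<lambda>_. 0))"
  have ls': "loc_summable ?q' W" by (rule loc_summable_remove[OF ls])
  have hq: "holomorphic2_on (?q k) W" for k
    by (rule holomorphic2_on_comp[OF x e2_holomorphic]) auto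
  have hq': "holomorphic2_on (?q' k) W" for k
    using hq[of k] holomorphic2_on_const[of 0 W] by simp
  define h where "h w = e2q (x j w - of_int i) * prodinf (\<lambda>k. 1 - ?q' k w)" for w
  show ?thesis
  proof (intro exI[of _ h] conjI ballI)
    have "holomorphic2_on (\<lambda>w. e2q (x j w - of_int i)) W"
      by (rule holomorphic2_on_comp[OF holomorphic2_on_diff[OF x holomorphic2_on_const] e2q_holomorphic]) auto
    then show "holomorphic2_on h W" unfolding h_def
      by (intro holomorphic2_on_mult holomorphic2_on_prodinf[OF W(1) hq' ls'])
    have "prodinf (\<lambda>k. 1 - ?q' k z) \<noteq> 0"
    proof
      assume "prodinf (\<lambda>k. 1 - ?q' k z) = 0"
      then obtain k where k: "?q' k z = 1" using loc_summableD(3)[OF ls' W(2)] by blast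
      then have "k \<noteq> j" by auto
      then have "e2 (x k z) = 1" using k by simp
      from only[OF this] \<open>k \<noteq> j\<close> show False by simp
    qed
    then show "h z \<noteq> 0" unfolding h_def zero using e2q_0 by simp
    fix w assume w: "w \<in> W"
    have "e2 (x j w) = e2 (x j w - of_int i)"
      using e2_add[of "x j w - of_int i" "of_int i"] by simp
    then have "1 - ?q j w = e2q (x j w - of_int i) * (x j w - of_int i)" using e2q_mult by metis
    then show "prodinf (\<lambda>k. 1 - e2 (x k w)) = h w * (x j w - of_int i)"
      using prodinf_extract[OF ls w, of j] unfolding h_def by simp
  qed
qed

lemma exp_neg_le: "(x::real) > 0 \<Longrightarrow> exp (- x) \<le> 1 / x"
proof -
  assume x: "x > 0"
  have "x \<le> exp x" using exp_ge_add_one_self[of x] by linarith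
  then show ?thesis using x by (simp add: exp_minus field_simps)
qed

lemma summable_exp_bound:
  assumes "e > (1::real)" shows "summable (\<lambda>k. c * (1 / e) ^ k)"
  using assms by (intro summable_mult summable_geometric) auto

text \<open>The exponents grow like e^k, so the terms decay doubly exponentially; exp(-x) <= 1/x
  gives up most of this for a geometric majorant.\<close>

lemma exp_bound:
  fixes d e c y :: real
  assumes "d > 0" "e > 1" "y \<ge> d * e ^ k - c"
  shows "exp (- y) \<le> exp c / d * (1 / e) ^ k"
proof -
  have p: "d * e ^ k > 0" using assms by simp
  have "exp (- y) \<le> exp (c - d * e ^ k)" using assms(3) by simp
  also have "\<dots> = exp c * exp (- (d * e ^ k))" by (simp flip: exp_add)
  also have "\<dots> \<le> exp c * (1 / (d * e ^ k))" by (intro mult_left_mono exp_neg_le p) simp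
  finally show ?thesis by (simp add: power_divide)
qed

text \<open>One class of forms at a cusp. The norm of such a form is -l l', so positive norm means
  opposite signs of l and l'. The number \<open>e\<close> stands for \<epsilon>^2, whose conjugate
  is 1/e, and \<open>s\<close> is the period of the offsets b.\<close>

locale cusp_factor =
  fixes l l' e s b :: real
  assumes l: "l > 0" and l': "l' < 0" and e: "e > 1" and s: "s > 0"
begin

definition lin :: "int \<Rightarrow> complex \<times> complex \<Rightarrow> complex" where
  "lin k z = of_real (l * e powi k) * fst z + of_real (l' * e powi (- k)) * snd z"

definition xp :: "nat \<Rightarrow> complex \<times> complex \<Rightarrow> complex" where
  "xp k z = (lin (int k) z + of_real b) / of_real s"

text \<open>The index k stands for -k - 1, so \<open>xp\<close> and \<open>xm\<close> together use
  every integer once. The sign is reversed since in this direction the imaginary part of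
  \<open>lin\<close> tends to minus infinity.\<close>

definition xm :: "nat \<Rightarrow> complex \<times> complex \<Rightarrow> complex" where
  "xm k z = - (lin (- int k - 1) z + of_real b) / of_real s"

definition pp :: "complex \<times> complex \<Rightarrow> complex" where "pp z = prodinf (\<lambda>k. 1 - e2 (xp k z))"
definition pm :: "complex \<times> complex \<Rightarrow> complex" where "pm z = prodinf (\<lambda>k. 1 - e2 (xm k z))"

text \<open>The Weyl vector, as the linear solution of
  \<open>wv (eta z) = wv z + lin 0 z / s\<close>: the coefficients are l and l' divided by e - 1 and
  1/e - 1. This increment offsets the one factor that changes sides under \<open>eta\<close>. Both
  coefficients are positive, which makes the product decay at the cusp.\<close>

definition wv :: "complex \<times> complex \<Rightarrow> complex" where
  "wv z = (of_real (l / (e - 1)) * fst z + of_real (l' / (1 / e - 1)) * snd z) / of_real s"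

definition ff :: "complex \<times> complex \<Rightarrow> complex" where
  "ff z = e2 (wv z) * (pp z * pm z)"

definition eta :: "complex \<times> complex \<Rightarrow> complex \<times> complex" where
  "eta z = (of_real e * fst z, of_real (1 / e) * snd z)"

lemma holomorphic2_lin: "holomorphic2_on (lin k) W"
  unfolding lin_def
  by (intro holomorphic2_on_add holomorphic2_on_mult holomorphic2_on_const holomorphic2_on_fst holomorphic2_on_snd)

lemma holomorphic2_x: "holomorphic2_on (xp k) W" "holomorphic2_on (xm k) W"
proof -
  show "holomorphic2_on (xp k) W" unfolding xp_def divide_inverse
    by (intro holomorphic2_on_mult holomorphic2_on_add holomorphic2_lin holomorphic2_on_const)
  show "holomorphic2_on (xm k) W" unfolding xm_def divide_inverse
    by (intro holomorphic2_on_mult holomorphic2_on_add holomorphic2_on_uminus holomorphic2_lin holomorphic2_on_const)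
qed

lemma Im_lin: "Im (lin k z) = l * e powi k * Im (fst z) + l' * e powi (- k) * Im (snd z)"
proof -
  have "Im (of_real p * u + of_real q * v) = p * Im u + q * Im v" for p q u v by simp
  then show ?thesis unfolding lin_def by (simp only:)
qed

lemma Im_xp: "Im (xp k z) = (l * e ^ k * Im (fst z) + l' * (1 / e) ^ k * Im (snd z)) / s"
proof -
  have "e powi (- int k) = (1 / e) ^ k" by (simp add: power_int_minus power_one_over inverse_eq_divide)
  then show ?thesis by (simp add: xp_def Im_lin)
qed

lemma Im_xm: "Im (xm k z) = (- l' * e ^ Suc k * Im (snd z) - l * (1 / e) ^ Suc k * Im (fst z)) / s"
proof -
  have "e powi (- int k - 1) = (1 / e) ^ Suc k"
  proof -
    have "e powi (- int (Suc k)) = inverse (e ^ Suc k)" by (simp only: power_int_minus power_int_of_nat)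
    moreover have "- int k - 1 = - int (Suc k)" by simp
    ultimately show ?thesis by (simp only: power_divide inverse_eq_divide power_one)
  qed
  moreover have "e powi (- (- int k - 1)) = e ^ Suc k"
  proof -
    have "- (- int k - 1) = int (Suc k)" by simp
    then show ?thesis by (simp only: power_int_of_nat)
  qed
  moreover have "Im (xm k z) = - Im (lin (- int k - 1) z) / s" by (simp add: xm_def)
  ultimately show ?thesis unfolding Im_lin by (simp add: algebra_simps)
qed

lemma e_pow_le: "(1 / e) ^ k \<le> 1"
  using e by (intro power_le_one) auto

text \<open>The term of the imaginary part with factor e^k is at least a constant times e^k, and the
  other one stays bounded; \<open>exp_bound\<close> turns this into a geometric majorant.\<close>

lemma ls_bounds:
  assumes B: "B \<ge> 1" "cmod (fst w) \<le> B" "cmod (snd w) \<le> B" "Im (fst w) \<ge> 1 / B" "Im (snd w) \<ge> 1 / B"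
  shows "cmod (e2 (xp k w)) \<le> exp (2 * pi * (- l' * B / s)) / (2 * pi * (l / B / s)) * (1 / e) ^ k"
    "cmod (e2 (xm k w)) \<le> exp (2 * pi * (l * B / s)) / (2 * pi * (- l' / B / s)) * (1 / e) ^ k"
proof -
  have B0: "B > 0" using B by simp
  have im: "Im (fst w) \<le> B" "Im (snd w) \<le> B"
    using abs_Im_le_cmod[of "fst w"] abs_Im_le_cmod[of "snd w"] B by linarith+
  have i0: "0 \<le> Im (fst w)" "0 \<le> Im (snd w)" using B B0 by (meson order_trans zero_le_divide_1_iff less_imp_le)+
  have ek: "e ^ k \<ge> 1" "e ^ k > 0" using e by auto
  have "l * e ^ k * Im (fst w) \<ge> l * e ^ k * (1 / B)" using l ek B by (intro mult_left_mono) auto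
  moreover have "(- l') * ((1 / e) ^ k * Im (snd w)) \<le> (- l') * (1 * B)"
    using l' im i0 e_pow_le[of k] e by (intro mult_left_mono mult_mono) auto
  ultimately have "l * e ^ k * Im (fst w) + l' * (1 / e) ^ k * Im (snd w) \<ge> l / B * e ^ k - (- l' * B)"
    by (simp add: algebra_simps)
  then have "(l / B * e ^ k - (- l' * B)) / s \<le> Im (xp k w)"
    unfolding Im_xp using s by (intro divide_right_mono) auto
  then have "2 * pi * ((l / B * e ^ k - (- l' * B)) / s) \<le> 2 * pi * Im (xp k w)"
    by (intro mult_left_mono) auto
  then have "2 * pi * Im (xp k w) \<ge> 2 * pi * (l / B / s) * e ^ k - 2 * pi * (- l' * B / s)"
    by (simp add: diff_divide_distrib add_divide_distrib algebra_simps)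
  from exp_bound[OF _ e this]
  show "cmod (e2 (xp k w)) \<le> exp (2 * pi * (- l' * B / s)) / (2 * pi * (l / B / s)) * (1 / e) ^ k"
    unfolding norm_e2 using l B0 s by simp
  have "(- l') * e ^ Suc k * Im (snd w) \<ge> (- l') * e ^ k * (1 / B)"
    using l' ek B e i0 by (intro mult_mono) (auto simp: mult_nonpos_nonneg)
  moreover have "l * ((1 / e) ^ Suc k * Im (fst w)) \<le> l * (1 * B)"
    using l im i0 e_pow_le[of "Suc k"] e by (intro mult_left_mono mult_mono) auto
  ultimately have "- l' * e ^ Suc k * Im (snd w) - l * (1 / e) ^ Suc k * Im (fst w) \<ge> - l' / B * e ^ k - l * B"
    by (simp add: algebra_simps)
  then have "(- l' / B * e ^ k - l * B) / s \<le> Im (xm k w)"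
    unfolding Im_xm using s by (intro divide_right_mono) auto
  then have "2 * pi * ((- l' / B * e ^ k - l * B) / s) \<le> 2 * pi * Im (xm k w)"
    by (intro mult_left_mono) auto
  then have "2 * pi * Im (xm k w) \<ge> 2 * pi * (- l' / B / s) * e ^ k - 2 * pi * (l * B / s)"
    by (simp add: diff_divide_distrib add_divide_distrib algebra_simps)
  moreover have "2 * pi * (- l' / B / s) > 0"
    using l' B0 s by (intro mult_pos_pos divide_pos_pos) auto
  ultimately have "exp (- (2 * pi * Im (xm k w))) \<le> exp (2 * pi * (l * B / s)) / (2 * pi * (- l' / B / s)) * (1 / e) ^ k"
    by (intro exp_bound e)
  then show "cmod (e2 (xm k w)) \<le> exp (2 * pi * (l * B / s)) / (2 * pi * (- l' / B / s)) * (1 / e) ^ k"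
    unfolding norm_e2 by (simp only: mult_minus_left)
qed

lemma loc_summable_x:
  "loc_summable (\<lambda>k w. e2 (xp k w)) H2" "loc_summable (\<lambda>k w. e2 (xm k w)) H2"
proof -
  have *: "\<exists>r>0. \<exists>B\<ge>1. cball z r \<subseteq> H2 \<and> (\<forall>w\<in>cball z r. cmod (fst w) \<le> B \<and> cmod (snd w) \<le> B \<and> Im (fst w) \<ge> 1 / B \<and> Im (snd w) \<ge> 1 / B)"
    if z: "z \<in> H2" for z
  proof -
    obtain r where r: "r > 0" "cball z r \<subseteq> H2" using z open_H2 open_contains_cball by metis
    obtain B where "B \<ge> 1" "\<And>w. w \<in> cball z r \<Longrightarrow> cmod (fst w) \<le> B \<and> cmod (snd w) \<le> B \<and> Im (fst w) \<ge> 1 / B \<and> Im (snd w) \<ge> 1 / B"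
      using compact_H2_bound[OF compact_cball r(2)] by metis
    then show ?thesis using r by (intro exI[of _ r] exI[of _ B] conjI ballI) auto
  qed
  show "loc_summable (\<lambda>k w. e2 (xp k w)) H2"
    unfolding loc_summable_def
  proof
    fix z :: "complex \<times> complex" assume "z \<in> H2"
    from *[OF this] obtain r B where r: "r > 0" "B \<ge> 1" "cball z r \<subseteq> H2"
      "\<forall>w\<in>cball z r. cmod (fst w) \<le> B \<and> cmod (snd w) \<le> B \<and> Im (fst w) \<ge> 1 / B \<and> Im (snd w) \<ge> 1 / B" by (elim exE conjE)
    show "\<exists>r>0. \<exists>M. cball z r \<subseteq> H2 \<and> summable M \<and> (\<forall>k. \<forall>w\<in>cball z r. cmod (e2 (xp k w)) \<le> M k)"
      using r ls_bounds(1)[OF r(2)] summable_exp_bound[OF e]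
      by (intro exI[of _ r] conjI exI[of _ "\<lambda>k. exp (2 * pi * (- l' * B / s)) / (2 * pi * (l / B / s)) * (1 / e) ^ k"] allI ballI)
         (blast+)
  qed
  show "loc_summable (\<lambda>k w. e2 (xm k w)) H2"
    unfolding loc_summable_def
  proof
    fix z :: "complex \<times> complex" assume "z \<in> H2"
    from *[OF this] obtain r B where r: "r > 0" "B \<ge> 1" "cball z r \<subseteq> H2"
      "\<forall>w\<in>cball z r. cmod (fst w) \<le> B \<and> cmod (snd w) \<le> B \<and> Im (fst w) \<ge> 1 / B \<and> Im (snd w) \<ge> 1 / B" by (elim exE conjE)
    show "\<exists>r>0. \<exists>M. cball z r \<subseteq> H2 \<and> summable M \<and> (\<forall>k. \<forall>w\<in>cball z r. cmod (e2 (xm k w)) \<le> M k)"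
      using r ls_bounds(2)[OF r(2)] summable_exp_bound[OF e]
      by (intro exI[of _ r] conjI exI[of _ "\<lambda>k. exp (2 * pi * (l * B / s)) / (2 * pi * (- l' / B / s)) * (1 / e) ^ k"] allI ballI)
         (blast+)
  qed
qed

lemma holomorphic2_e2: "holomorphic2_on f W \<Longrightarrow> holomorphic2_on (\<lambda>z. e2 (f z)) W"
  by (rule holomorphic2_on_comp[OF _ e2_holomorphic]) auto

lemma holomorphic2_wv: "holomorphic2_on wv W"
  unfolding wv_def divide_inverse
  by (intro holomorphic2_on_add holomorphic2_on_mult holomorphic2_on_const holomorphic2_on_fst holomorphic2_on_snd)

lemma holomorphic2_ff: "holomorphic2_on ff H2"
  unfolding ff_def pp_def pm_def
  by (intro holomorphic2_on_mult holomorphic2_e2 holomorphic2_wv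
      holomorphic2_on_prodinf[OF open_H2 _ loc_summable_x(1)] holomorphic2_on_prodinf[OF open_H2 _ loc_summable_x(2)] holomorphic2_x)

lemma ff_LIMSEQ:
  assumes "z \<in> H2"
  shows "(\<lambda>n. \<Prod>k<n. (1 - e2 (xp k z)) * (1 - e2 (xm k z))) \<longlonglongrightarrow> pp z * pm z"
  unfolding prod.distrib pp_def pm_def
  by (intro tendsto_mult loc_summableD(2)[OF loc_summable_x(1) assms] loc_summableD(2)[OF loc_summable_x(2) assms])

lemma xm_eq: "xm k z = of_int i \<longleftrightarrow> lin (- int k - 1) z + of_real b = of_real s * of_int (- i)"
proof -
  have s0: "(of_real s :: complex) \<noteq> 0" using s by simp
  define A where "A = lin (- int k - 1) z + of_real b"
  have "xm k z = of_int i \<longleftrightarrow> - A = of_int i * of_real s" unfolding xm_def A_def using s0 by (simp only: divide_eq_eq if_False if_True not_False_eq_True)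
  also have "\<dots> \<longleftrightarrow> A = of_real s * of_int (- i)"
  proof
    assume "- A = of_int i * of_real s"
    then have "- (- A) = - (of_int i * of_real s)" by (simp only:)
    then show "A = of_real s * of_int (- i)" by (simp add: mult.commute)
  qed (simp add: mult.commute)
  finally show ?thesis by (simp add: A_def)
qed

lemma ff_zero:
  assumes "z \<in> H2"
  shows "ff z = 0 \<longleftrightarrow> (\<exists>k i :: int. lin k z + of_real b = of_real s * of_int i)"
proof -
  have s0: "(of_real s :: complex) \<noteq> 0" using s by simp
  have "ff z = 0 \<longleftrightarrow> (\<exists>k. e2 (xp k z) = 1) \<or> (\<exists>k. e2 (xm k z) = 1)"
    unfolding ff_def pp_def pm_def using loc_summableD(3)[OF loc_summable_x(1) assms] loc_summableD(3)[OF loc_summable_x(2) assms] by simp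
  also have "(\<exists>k. e2 (xp k z) = 1) \<longleftrightarrow> (\<exists>k\<ge>0. \<exists>i :: int. lin k z + of_real b = of_real s * of_int i)"
  proof -
    have "xp k z = of_int i \<longleftrightarrow> lin (int k) z + of_real b = of_real s * of_int i" for k i
      using s0 by (simp add: xp_def field_simps)
    then show ?thesis unfolding e2_eq_1 by (metis nonneg_int_cases of_nat_0_le_iff)
  qed
  also have "(\<exists>k. e2 (xm k z) = 1) \<longleftrightarrow> (\<exists>k<0. \<exists>i :: int. lin k z + of_real b = of_real s * of_int i)"
  proof -
    have x: "xm k z = of_int i \<longleftrightarrow> lin (- int k - 1) z + of_real b = of_real s * of_int (- i)" for k i
      by (rule xm_eq)
    show ?thesis
    proof
      assume "\<exists>k. e2 (xm k z) = 1"
      then obtain k i where "xm k z = of_int i" unfolding e2_eq_1 by blast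
      then show "\<exists>k<0. \<exists>i :: int. lin k z + of_real b = of_real s * of_int i"
        unfolding x by (intro exI[of _ "- int k - 1"] conjI exI[of _ "- i"]) auto
    next
      assume "\<exists>k<0. \<exists>i :: int. lin k z + of_real b = of_real s * of_int i"
      then obtain k i where k: "k < 0" "lin k z + of_real b = of_real s * of_int i" by blast
      have "- int (nat (- k - 1)) - 1 = k" using k(1) by simp
      then have "xm (nat (- k - 1)) z = of_int (- i)" unfolding x using k(2) by simp
      then show "\<exists>k. e2 (xm k z) = 1" unfolding e2_eq_1 by blast
    qed
  qed
  finally show ?thesis by (metis linorder_not_less)
qed

text \<open>The sign of k decides whether the zero belongs to \<open>pp\<close> or to
  \<open>pm\<close>; a zero of the other product would come from an index of the opposite kind,
  which \<open>only\<close> excludes.\<close>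

lemma ff_simple_zero:
  assumes z: "z \<in> H2" and zero: "lin k z + of_real b = of_real s * of_int i"
    and only: "\<And>k' (i' :: int). lin k' z + of_real b = of_real s * of_int i' \<Longrightarrow> k' = k"
  obtains h where "holomorphic2_on h H2" "h z \<noteq> 0"
    "\<And>w. w \<in> H2 \<Longrightarrow> ff w = h w * (lin k w + of_real b - of_real s * of_int i)"
proof -
  have s0: "(of_real s :: complex) \<noteq> 0" using s by simp
  have xp: "xp k z = of_int i \<longleftrightarrow> lin (int k) z + of_real b = of_real s * of_int i" for k i
    using s0 by (simp add: xp_def field_simps)
  have xm: "xm k z = of_int i \<longleftrightarrow> lin (- int k - 1) z + of_real b = of_real s * of_int (- i)" for k i
    by (rule xm_eq)
  show ?thesis
  proof (cases "k \<ge> 0")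
    case True
    define j where "j = nat k"
    have kj: "k = int j" using True by (simp add: j_def)
    have x0: "xp j z = of_int i" unfolding xp using zero kj by simp
    have o: "k' = j" if 1: "e2 (xp k' z) = 1" for k'
    proof -
      obtain i' where "xp k' z = of_int i'" using 1 unfolding e2_eq_1 by (elim exE)
      then show ?thesis using only[of "int k'" i'] unfolding xp kj by simp
    qed
    have "\<exists>h. holomorphic2_on h H2 \<and> h z \<noteq> 0 \<and> (\<forall>w\<in>H2. pp w = h w * (xp j w - of_int i))"
      unfolding pp_def by (rule product_simple_zero[OF open_H2 z holomorphic2_x(1) loc_summable_x(1) x0]) (rule o)
    then obtain h where h: "holomorphic2_on h H2" "h z \<noteq> 0" "\<forall>w\<in>H2. pp w = h w * (xp j w - of_int i)"
      by (elim exE conjE)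
    have pm: "pm z \<noteq> 0"
    proof
      assume "pm z = 0"
      then obtain k' i' where "xm k' z = of_int i'"
        unfolding pm_def loc_summableD(3)[OF loc_summable_x(2) z] e2_eq_1 by blast
      then have "- int k' - 1 = k" using only unfolding xm by blast
      then show False using True by simp
    qed
    have hpm: "holomorphic2_on pm H2" unfolding pm_def
      by (intro holomorphic2_on_prodinf[OF open_H2 _ loc_summable_x(2)] holomorphic2_e2 holomorphic2_x)
    show ?thesis
    proof (rule that[of "\<lambda>w. e2 (wv w) * (h w * inverse (of_real s) * pm w)"])
      show "holomorphic2_on (\<lambda>w. e2 (wv w) * (h w * inverse (of_real s) * pm w)) H2"
        by (intro holomorphic2_on_mult holomorphic2_e2 holomorphic2_wv h hpm holomorphic2_on_const)
      show "e2 (wv z) * (h z * inverse (of_real s) * pm z) \<noteq> 0" using h pm s0 by simp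
      fix w :: "complex \<times> complex" assume w: "w \<in> H2"
      have "xp j w - of_int i = inverse (of_real s) * (lin k w + of_real b - of_real s * of_int i)"
        using s0 by (simp add: xp_def kj field_simps)
      then show "ff w = e2 (wv w) * (h w * inverse (of_real s) * pm w) * (lin k w + of_real b - of_real s * of_int i)"
        unfolding ff_def bspec[OF h(3) w] by simp
    qed
  next
    case False
    define j where "j = nat (- k - 1)"
    have kj: "k = - int j - 1" using False by (simp add: j_def)
    have x0: "xm j z = of_int (- i)" unfolding xm using zero kj by simp
    have o: "k' = j" if 1: "e2 (xm k' z) = 1" for k'
    proof -
      obtain i' where "xm k' z = of_int i'" using 1 unfolding e2_eq_1 by (elim exE)
      then show ?thesis using only[of "- int k' - 1" "- i'"] unfolding xm kj by simp
    qed
    have "\<exists>h. holomorphic2_on h H2 \<and> h z \<noteq> 0 \<and> (\<forall>w\<in>H2. pm w = h w * (xm j w - of_int (- i)))"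
      unfolding pm_def by (rule product_simple_zero[OF open_H2 z holomorphic2_x(2) loc_summable_x(2) x0]) (rule o)
    then obtain h where h: "holomorphic2_on h H2" "h z \<noteq> 0" "\<forall>w\<in>H2. pm w = h w * (xm j w - of_int (- i))"
      by (elim exE conjE)
    have pm: "pp z \<noteq> 0"
    proof
      assume "pp z = 0"
      then obtain k' i' where "xp k' z = of_int i'"
        unfolding pp_def loc_summableD(3)[OF loc_summable_x(1) z] e2_eq_1 by blast
      then have "int k' = k" using only unfolding xp by blast
      then show False using False by simp
    qed
    have hpm: "holomorphic2_on pp H2" unfolding pp_def
      by (intro holomorphic2_on_prodinf[OF open_H2 _ loc_summable_x(1)] holomorphic2_e2 holomorphic2_x)
    show ?thesis
    proof (rule that[of "\<lambda>w. e2 (wv w) * (h w * (- inverse (of_real s)) * pp w)"])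
      show "holomorphic2_on (\<lambda>w. e2 (wv w) * (h w * (- inverse (of_real s)) * pp w)) H2"
        by (intro holomorphic2_on_mult holomorphic2_e2 holomorphic2_wv h hpm holomorphic2_on_const)
      show "e2 (wv z) * (h z * (- inverse (of_real s)) * pp z) \<noteq> 0" using h pm s0 by simp
      fix w :: "complex \<times> complex" assume w: "w \<in> H2"
      have "xm j w - of_int (- i) = - inverse (of_real s) * (lin k w + of_real b - of_real s * of_int i)"
        using s0 by (simp add: xm_def kj field_simps)
      then show "ff w = e2 (wv w) * (h w * (- inverse (of_real s)) * pp w) * (lin k w + of_real b - of_real s * of_int i)"
        unfolding ff_def bspec[OF h(3) w] by simp
    qed
  qed
qed

lemma eta_H2: "z \<in> H2 \<Longrightarrow> eta z \<in> H2"
  using e by (simp add: eta_def H2_iff)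

lemma lin_eta: "lin k (eta z) = lin (k + 1) z"
proof -
  have "e powi (k + 1) = e powi k * e" using e by (simp add: power_int_add_1)
  moreover have "e powi (- (k + 1)) = e powi (- k) * (1 / e)"
    using e power_int_add[of e "- k" "- 1"] by (simp add: inverse_eq_divide)
  ultimately show ?thesis by (simp only: lin_def eta_def fst_conv snd_conv of_real_mult mult.assoc)
qed

lemma prodinf_shift:
  assumes "loc_summable q H2" "z \<in> H2" "w \<in> H2" "\<And>k. q (Suc k) z = q k w"
  shows "prodinf (\<lambda>k. 1 - q k z) = (1 - q 0 z) * prodinf (\<lambda>k. 1 - q k w)"
proof (rule LIMSEQ_unique)
  show "(\<lambda>n. \<Prod>k<Suc n. 1 - q k z) \<longlonglongrightarrow> prodinf (\<lambda>k. 1 - q k z)"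
    using loc_summableD(2)[OF assms(1,2)] by (rule LIMSEQ_Suc)
  have "(\<Prod>k<Suc n. 1 - q k z) = (1 - q 0 z) * (\<Prod>k<n. 1 - q k w)" for n
    unfolding prod.lessThan_Suc_shift assms(4) ..
  then show "(\<lambda>n. \<Prod>k<Suc n. 1 - q k z) \<longlonglongrightarrow> (1 - q 0 z) * prodinf (\<lambda>k. 1 - q k w)"
    using tendsto_mult_left[OF loc_summableD(2)[OF assms(1,3)]] by simp
qed

text \<open>Replacing z by \<open>eta z\<close> takes the factor 1 - e2 x out of \<open>pp\<close>
  and puts 1 - e2 (-x) into \<open>pm\<close>, where x = \<open>xp 0 z\<close>. The quotient of the
  two is -e2 (-x), and the Weyl vector contributes e2 (x - b/s), so only a phase is left.\<close>

lemma ff_eta: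
  assumes z: "z \<in> H2"
  shows "ff (eta z) = - e2 (- of_real (b / s)) * ff z"
proof -
  have s0: "(of_real s :: complex) \<noteq> 0" using s by simp
  have e1: "e \<noteq> 1" "e \<noteq> 0" using e by auto
  define x where "x = xp 0 z"
  have p: "pp z = (1 - e2 x) * pp (eta z)"
    unfolding pp_def x_def
  proof (rule prodinf_shift[OF loc_summable_x(1) z eta_H2[OF z]])
    show "e2 (xp (Suc k) z) = e2 (xp k (eta z))" for k by (simp add: xp_def lin_eta add.commute)
  qed
  have x0: "xm 0 (eta z) = - x" by (simp add: xm_def xp_def x_def lin_eta diff_divide_distrib add_divide_distrib)
  have m: "pm (eta z) = (1 - e2 (- x)) * pm z"
    unfolding pm_def x0[symmetric]
  proof (rule prodinf_shift[OF loc_summable_x(2) eta_H2[OF z] z])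
    show "e2 (xm (Suc k) (eta z)) = e2 (xm k z)" for k
    proof -
      have "- 1 - int k = - int k - 1" by simp
      with lin_eta[of "- int (Suc k) - 1" z] show ?thesis by (simp add: xm_def)
    qed
  qed
  have "wv (eta z) = wv z + lin 0 z / of_real s"
  proof -
    have "l / (e - 1) * e = l / (e - 1) + l" "l' / (1 / e - 1) * (1 / e) = l' / (1 / e - 1) + l'"
      using e1 by (simp_all add: field_simps)
    then have "of_real (l / (e - 1)) * (of_real e * fst z) = (of_real (l / (e - 1)) + of_real l) * fst z"
      "of_real (l' / (1 / e - 1)) * (of_real (1 / e) * snd z) = (of_real (l' / (1 / e - 1)) + of_real l') * snd z"
      by (metis mult.assoc of_real_add of_real_mult)+
    then show ?thesis unfolding wv_def eta_def lin_def fst_conv snd_conv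
      by (simp only:) (simp add: add_divide_distrib algebra_simps)
  qed
  moreover have "lin 0 z / of_real s = x - of_real (b / s)"
    using s0 by (simp add: x_def xp_def field_simps)
  ultimately have w: "e2 (wv (eta z)) = e2 (wv z) * e2 x * e2 (- of_real (b / s))"
      by (simp only: e2_add[symmetric] diff_conv_add_uminus add.assoc of_real_minus of_real_divide)
  have "e2 x * (1 - e2 (- x)) = - (1 - e2 x)" by (simp add: e2_minus algebra_simps)
  then have "e2 (wv (eta z)) * (pp (eta z) * pm (eta z)) = e2 (wv z) * e2 (- of_real (b / s)) * (- (1 - e2 x)) * pp (eta z) * pm z"
    unfolding w m by (simp add: algebra_simps)
  then show ?thesis unfolding ff_def p by (simp add: algebra_simps)
qed

lemma norm_ff_eta: "z \<in> H2 \<Longrightarrow> cmod (ff (eta z)) = cmod (ff z)"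
  by (simp add: ff_eta norm_mult norm_e2)

lemma norm_ff_scale:
  assumes z: "z \<in> H2"
  shows "cmod (ff (of_real (e powi j) * fst z, of_real (e powi (- j)) * snd z)) = cmod (ff z)"
proof -
  have e0: "e > 0" using e by simp
  define T where "T j z = (of_real (e powi j) * fst z, of_real (e powi (- j)) * snd z)" for j :: int and z :: "complex \<times> complex"
  have TH: "T j z \<in> H2" if "z \<in> H2" for j z using that e0 by (simp add: T_def H2_iff del: of_real_power_int)
  have step: "T (j + 1) z = eta (T j z)" for j z
  proof -
    have "e powi (j + 1) = e * e powi j" using e by (simp add: power_int_add_1)
    moreover have "e powi (- (j + 1)) = (1 / e) * e powi (- j)"
    proof -
      have "e powi (- (j + 1)) = e powi (- 1 + - j)" by (rule arg_cong[where f = "\<lambda>i. e powi i"]) simp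
      also have "\<dots> = e powi (- 1) * e powi (- j)" using e by (intro power_int_add) auto
      also have "e powi (- 1) = 1 / e" by (simp add: power_int_minus inverse_eq_divide)
      finally show ?thesis .
    qed
    ultimately show ?thesis by (simp only: T_def eta_def fst_conv snd_conv of_real_mult mult.assoc)
  qed
  have "cmod (ff (T j z)) = cmod (ff z)"
  proof (induction j rule: int_induct[where k = 0])
    case base
    then show ?case by (simp add: T_def)
  next
    case (step1 i)
    then show ?case using step[of i z] norm_ff_eta[OF TH[OF z], of i] by simp
  next
    case (step2 i)
    then show ?case using step[of "i - 1" z] norm_ff_eta[OF TH[OF z], of "i - 1"] by simp
  qed
  then show ?thesis by (simp add: T_def)
qed

text \<open>The two inequalities describe the Weyl chamber where \<open>xp 0\<close> and
  \<open>xm 0\<close>, and with them all exponents, have nonnegative imaginary part. There both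
  imaginary parts of z are at least a multiple of the square root of their product, so the two
  infinite products are bounded by constants and the Weyl vector gives the exponential
  decay.\<close>

lemma ff_bound_chamber:
  assumes C: "C > 0"
  obtains A \<kappa> where "A > 0" "\<kappa> > 0"
    "\<And>z. z \<in> H2 \<Longrightarrow> C \<le> Im (fst z) * Im (snd z) \<Longrightarrow> - l' * Im (snd z) \<le> l * Im (fst z) \<Longrightarrow>
       l * Im (fst z) \<le> - l' * e\<^sup>2 * Im (snd z) \<Longrightarrow> cmod (ff z) \<le> A * exp (- \<kappa> * sqrt (Im (fst z) * Im (snd z)))"
proof -
  \<comment> \<open>In the chamber y1 >= \<delta>1 sqrt(y1 y2) and y2 >= \<delta>2 sqrt(y1
    y2).\<close>
  define \<delta>1 where "\<delta>1 = sqrt (- l' / l)"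
  define \<delta>2 where "\<delta>2 = sqrt (l / (- l' * e\<^sup>2))"
  have "- l' / l > 0" "l / (- l' * e\<^sup>2) > 0" using l l' e by (intro divide_pos_pos mult_pos_pos; simp)+
  then have d: "\<delta>1 > 0" "\<delta>2 > 0" unfolding \<delta>1_def \<delta>2_def by (simp_all only: real_sqrt_gt_0_iff)
  define d1 where "d1 = 2 * pi * (l * (\<delta>1 * sqrt C)) / s"
  define d2 where "d2 = 2 * pi * (- l' * e * (\<delta>2 * sqrt C)) / s"
  have dp: "d1 > 0" "d2 > 0" unfolding d1_def d2_def using d C l l' e s
    by (intro divide_pos_pos mult_pos_pos; simp)+
  define M1 where "M1 k = exp d1 / d1 * (1 / e) ^ k" for k :: nat
  define M2 where "M2 k = exp d2 / d2 * (1 / e) ^ k" for k :: nat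
  have sM: "summable M1" "summable M2" unfolding M1_def M2_def by (rule summable_exp_bound[OF e])+
  define \<kappa> where "\<kappa> = 2 * pi * (l / (e - 1) * \<delta>1) / s"
  have \<kappa>: "\<kappa> > 0" using d l e s by (simp add: \<kappa>_def)
  define A where "A = exp (suminf M1) * exp (suminf M2)"
  have "cmod (ff z) \<le> A * exp (- \<kappa> * sqrt (Im (fst z) * Im (snd z)))"
    if z: "z \<in> H2" and zC: "C \<le> Im (fst z) * Im (snd z)" and c1: "- l' * Im (snd z) \<le> l * Im (fst z)"
      and c2: "l * Im (fst z) \<le> - l' * e\<^sup>2 * Im (snd z)" for z
  proof -
    define y1 y2 where "y1 = Im (fst z)" and "y2 = Im (snd z)"
    have y: "y1 > 0" "y2 > 0" using z by (simp_all add: y1_def y2_def H2_iff)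
    have yC: "C \<le> y1 * y2" and c1: "- l' * y2 \<le> l * y1" and c2: "l * y1 \<le> - l' * e\<^sup>2 * y2"
      using zC c1 c2 by (simp_all add: y1_def y2_def)
    have r1: "\<delta>1\<^sup>2 * (y1 * y2) \<le> y1\<^sup>2"
    proof -
      have "- l' / l * y2 \<le> y1" using c1 l by (simp add: field_simps)
      then have "- l' / l * y2 * y1 \<le> y1 * y1" using y by (intro mult_right_mono) auto
      then show ?thesis using l l' by (simp add: \<delta>1_def power2_eq_square mult_ac divide_nonpos_pos)
    qed
    have s1: "\<delta>1 * sqrt (y1 * y2) \<le> y1"
    proof (rule power2_le_imp_le)
      show "(\<delta>1 * sqrt (y1 * y2))\<^sup>2 \<le> y1\<^sup>2" using r1 y by (simp add: power_mult_distrib)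
      show "0 \<le> y1" using y by simp
    qed
    have r2: "\<delta>2\<^sup>2 * (y1 * y2) \<le> y2\<^sup>2"
    proof -
      have p: "- l' * e\<^sup>2 > 0" using l' e by (simp add: mult_neg_pos)
      have "l / (- l' * e\<^sup>2) * y1 \<le> y2" using c2 pos_divide_le_eq[OF p, of "l * y1" y2] by (simp add: mult_ac)
      then have "l / (- l' * e\<^sup>2) * y1 * y2 \<le> y2 * y2" using y by (intro mult_right_mono) auto
      moreover have "\<delta>2\<^sup>2 = l / (- l' * e\<^sup>2)" unfolding \<delta>2_def
      proof (rule real_sqrt_pow2)
        show "0 \<le> l / (- l' * e\<^sup>2)" using divide_pos_pos[OF l p] by simp
      qed
      ultimately show ?thesis by (simp only: power2_eq_square[of y2] mult.assoc)
    qed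
    have s2: "\<delta>2 * sqrt (y1 * y2) \<le> y2"
    proof (rule power2_le_imp_le)
      show "(\<delta>2 * sqrt (y1 * y2))\<^sup>2 \<le> y2\<^sup>2" using r2 y by (simp add: power_mult_distrib)
      show "0 \<le> y2" using y by simp
    qed
    have sC: "sqrt C \<le> sqrt (y1 * y2)" using yC by simp
    have t1: "\<delta>1 * sqrt C \<le> y1" using s1 mult_left_mono[OF sC, of \<delta>1] d by linarith
    have t2: "\<delta>2 * sqrt C \<le> y2" using s2 mult_left_mono[OF sC, of \<delta>2] d by linarith
    have ek: "e ^ k \<ge> 1" for k using e by simp
    have b1: "cmod (e2 (xp k z)) \<le> M1 k" for k
    proof -
      have "(- l') * ((1 / e) ^ k * y2) \<le> (- l') * (1 * y2)"
      proof (rule mult_left_mono)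
        show "(1 / e) ^ k * y2 \<le> 1 * y2" by (rule mult_right_mono[OF e_pow_le]) (use y in simp)
      qed (use l' in simp)
      then have "l * e ^ k * y1 + l' * (1 / e) ^ k * y2 \<ge> l * e ^ k * y1 - l * y1" using c1 by (simp add: mult.assoc)
      also have "l * e ^ k * y1 - l * y1 = (e ^ k - 1) * (l * y1)" by (simp add: algebra_simps)
      finally have "l * e ^ k * y1 + l' * (1 / e) ^ k * y2 \<ge> (e ^ k - 1) * (l * y1)" .
      moreover have "(e ^ k - 1) * (l * y1) \<ge> (e ^ k - 1) * (l * (\<delta>1 * sqrt C))"
        using ek[of k] l t1 by (intro mult_left_mono) auto
      ultimately have "(e ^ k - 1) * (l * (\<delta>1 * sqrt C)) / s \<le> Im (xp k z)"
        unfolding Im_xp y1_def[symmetric] y2_def[symmetric] using s by (intro divide_right_mono) auto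
      then have "2 * pi * ((e ^ k - 1) * (l * (\<delta>1 * sqrt C)) / s) \<le> 2 * pi * Im (xp k z)" by (intro mult_left_mono) auto
      moreover have "2 * pi * ((e ^ k - 1) * (l * (\<delta>1 * sqrt C)) / s) = d1 * e ^ k - d1"
        using s by (simp add: d1_def field_simps)
      ultimately have "d1 * e ^ k - d1 \<le> 2 * pi * Im (xp k z)" by (simp only:)
      from exp_bound[OF dp(1) e this] show ?thesis unfolding norm_e2 M1_def by (simp only: mult_minus_left)
    qed
    have b2: "cmod (e2 (xm k z)) \<le> M2 k" for k
    proof -
      have "l * y1 * (1 / e) ^ Suc k \<le> - l' * e\<^sup>2 * y2 * (1 / e)"
      proof (rule mult_mono)
        have "(1 / e) ^ Suc k \<le> (1 / e) * 1" using e e_pow_le[of k] by (simp add: mult_left_mono divide_right_mono)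
        then show "(1 / e) ^ Suc k \<le> 1 / e" by simp
      qed (use c2 y l l' e in \<open>auto simp: mult_nonpos_nonneg\<close>)
      also have "- l' * e\<^sup>2 * y2 * (1 / e) = - l' * e * y2" using e by (simp add: power2_eq_square)
      finally have "- l' * e ^ Suc k * y2 - l * (1 / e) ^ Suc k * y1 \<ge> - l' * e ^ Suc k * y2 - (- l' * e * y2)" by (simp add: mult_ac)
      also have "- l' * e ^ Suc k * y2 - (- l' * e * y2) = (e ^ k - 1) * (- l' * e * y2)" by (simp add: algebra_simps)
      finally have "- l' * e ^ Suc k * y2 - l * (1 / e) ^ Suc k * y1 \<ge> (e ^ k - 1) * (- l' * e * y2)" .
      moreover have "(e ^ k - 1) * (- l' * e * y2) \<ge> (e ^ k - 1) * (- l' * e * (\<delta>2 * sqrt C))"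
      proof (intro mult_left_mono)
        show "0 \<le> - l' * e" using l' e by (intro mult_nonneg_nonneg) auto
      qed (use ek[of k] t2 in auto)
      ultimately have "(e ^ k - 1) * (- l' * e * (\<delta>2 * sqrt C)) / s \<le> Im (xm k z)"
        unfolding Im_xm y1_def[symmetric] y2_def[symmetric] using s by (intro divide_right_mono) auto
      then have "2 * pi * ((e ^ k - 1) * (- l' * e * (\<delta>2 * sqrt C)) / s) \<le> 2 * pi * Im (xm k z)" by (intro mult_left_mono) auto
      moreover have "2 * pi * ((e ^ k - 1) * (- l' * e * (\<delta>2 * sqrt C)) / s) = d2 * e ^ k - d2"
        using s by (simp add: d2_def field_simps)
      ultimately have "d2 * e ^ k - d2 \<le> 2 * pi * Im (xm k z)" by (simp only:)
      from exp_bound[OF dp(2) e this] show ?thesis unfolding norm_e2 M2_def by (simp only: mult_minus_left)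
    qed
    have n1: "cmod (pp z) \<le> exp (suminf M1)" unfolding pp_def by (rule norm_prodinf_le[OF sM(1) b1])
    have n2: "cmod (pm z) \<le> exp (suminf M2)" unfolding pm_def by (rule norm_prodinf_le[OF sM(2) b2])
    have "cmod (e2 (wv z)) \<le> exp (- \<kappa> * sqrt (y1 * y2))"
    proof -
      have "l' / (1 / e - 1) \<ge> 0" using l' e by (simp add: divide_nonpos_nonpos)
      then have "l' / (1 / e - 1) * y2 \<ge> 0" using y by (intro mult_nonneg_nonneg) auto
      then have "(l / (e - 1) * y1 + l' / (1 / e - 1) * y2) / s \<ge> l / (e - 1) * y1 / s"
        using s by (intro divide_right_mono) auto
      moreover have "Im (wv z) = (l / (e - 1) * y1 + l' / (1 / e - 1) * y2) / s"
        unfolding wv_def y1_def y2_def by (simp del: of_real_divide of_real_diff)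
      ultimately have "Im (wv z) \<ge> l / (e - 1) * y1 / s" by (simp only:)
      moreover have "l / (e - 1) * y1 / s \<ge> l / (e - 1) * (\<delta>1 * sqrt (y1 * y2)) / s"
        using s1 l e s by (intro divide_right_mono mult_left_mono) auto
      ultimately have "2 * pi * (l / (e - 1) * (\<delta>1 * sqrt (y1 * y2)) / s) \<le> 2 * pi * Im (wv z)"
        by (intro mult_left_mono) auto
      then show ?thesis unfolding norm_e2 by (simp add: \<kappa>_def mult_ac)
    qed
    then have "cmod (ff z) \<le> exp (- \<kappa> * sqrt (y1 * y2)) * (exp (suminf M1) * exp (suminf M2))"
      unfolding ff_def norm_mult using n1 n2 by (intro mult_mono) auto
    then show ?thesis by (simp add: A_def y1_def y2_def mult_ac)
  qed
  then show ?thesis using that[of A \<kappa>] \<kappa> by (simp add: A_def)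
qed

text \<open>The modulus of \<open>ff\<close> is invariant under \<open>eta\<close>, which multiplies
  Im z1 / Im z2 by e^2. Some power of \<open>eta\<close> therefore moves any point into the chamber,
  without changing the product of the imaginary parts.\<close>

lemma ff_bound:
  assumes C: "C > 0"
  obtains A \<kappa> where "A > 0" "\<kappa> > 0"
    "\<And>z. z \<in> H2 \<Longrightarrow> C \<le> Im (fst z) * Im (snd z) \<Longrightarrow> cmod (ff z) \<le> A * exp (- \<kappa> * sqrt (Im (fst z) * Im (snd z)))"
proof -
  obtain A \<kappa> where A: "A > 0" "\<kappa> > 0" and
    ch: "\<And>z. z \<in> H2 \<Longrightarrow> C \<le> Im (fst z) * Im (snd z) \<Longrightarrow> - l' * Im (snd z) \<le> l * Im (fst z) \<Longrightarrow>
       l * Im (fst z) \<le> - l' * e\<^sup>2 * Im (snd z) \<Longrightarrow> cmod (ff z) \<le> A * exp (- \<kappa> * sqrt (Im (fst z) * Im (snd z)))"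
    using ff_bound_chamber[OF C] by metis
  have "cmod (ff z) \<le> A * exp (- \<kappa> * sqrt (Im (fst z) * Im (snd z)))" if z: "z \<in> H2" and zC: "C \<le> Im (fst z) * Im (snd z)" for z
  proof -
    define y1 y2 where "y1 = Im (fst z)" and "y2 = Im (snd z)"
    have y: "y1 > 0" "y2 > 0" using z by (simp_all add: y1_def y2_def H2_iff)
    define x where "x = - l' * y2 / (l * y1)"
    have x: "x > 0" unfolding x_def using l l' y by (intro divide_pos_pos mult_pos_pos) auto
    have ee: "e\<^sup>2 > 1" using e by (simp add: one_less_power)
    \<comment> \<open>The least j with -l' y2 <= e^(2j) l y1. The inequality fails for j - 1, and
      this is the upper boundary of the chamber.\<close>
    define j where "j = \<lceil>log (e\<^sup>2) x\<rceil>"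
    have pw: "(e\<^sup>2) powr of_int i = (e powi i)\<^sup>2" for i
    proof -
      have "(e\<^sup>2) powr of_int i = (e\<^sup>2) powi i" using e by (intro powr_real_of_int') auto
      then show ?thesis by (simp only: power2_eq_square power_int_mult_distrib)
    qed
    have "log (e\<^sup>2) x \<le> of_int j" "of_int (j - 1) < log (e\<^sup>2) x" unfolding j_def by linarith+
    then have "x \<le> (e\<^sup>2) powr of_int j" "(e\<^sup>2) powr of_int (j - 1) < x"
      using ee x by (simp_all add: log_le_iff less_log_iff)
    then have xj: "x \<le> (e powi j)\<^sup>2" "(e powi (j - 1))\<^sup>2 < x" unfolding pw by auto
    define E where "E = e powi j"
    have E: "E > 0" using e by (simp add: E_def)
    have Em: "e powi (- j) = 1 / E" by (simp add: E_def power_int_minus divide_inverse)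
    have E1: "e powi (j - 1) = E / e" using e by (simp add: E_def power_int_diff)
    define w where "w = (of_real (e powi j) * fst z, of_real (e powi (- j)) * snd z)"
    have imw: "Im (fst w) = E * y1" "Im (snd w) = y2 / E" by (simp_all add: w_def y1_def y2_def E_def[symmetric] Em)
    have wH: "w \<in> H2" using imw y E by (simp add: H2_iff)
    have prod: "Im (fst w) * Im (snd w) = y1 * y2" unfolding imw using E by simp
    have c1: "- l' * Im (snd w) \<le> l * Im (fst w)"
    proof -
      have "- l' * y2 \<le> E\<^sup>2 * (l * y1)" using xj(1) l y unfolding x_def E_def[symmetric] by (simp only: pos_divide_le_eq mult_pos_pos)
      then have "- l' * y2 / E \<le> E\<^sup>2 * (l * y1) / E" using E by (intro divide_right_mono) auto
      then show ?thesis unfolding imw using E by (simp add: power2_eq_square mult_ac)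
    qed
    have c2: "l * Im (fst w) \<le> - l' * e\<^sup>2 * Im (snd w)"
    proof -
      have "(E / e)\<^sup>2 * (l * y1) \<le> - l' * y2" using xj(2) l y unfolding x_def E1 by (simp only: pos_less_divide_eq mult_pos_pos less_imp_le)
      then have "(E / e)\<^sup>2 * (l * y1) * (e\<^sup>2 / E) \<le> - l' * y2 * (e\<^sup>2 / E)" using E by (intro mult_right_mono) auto
      moreover have "(E / e)\<^sup>2 * (l * y1) * (e\<^sup>2 / E) = l * (E * y1)" using E e by (simp add: power2_eq_square)
      ultimately show ?thesis unfolding imw by (simp add: mult_ac)
    qed
    have "cmod (ff w) \<le> A * exp (- \<kappa> * sqrt (y1 * y2))"
      using ch[OF wH _ c1 c2] zC unfolding prod y1_def[symmetric] y2_def[symmetric] by simp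
    moreover have "cmod (ff w) = cmod (ff z)" unfolding w_def by (rule norm_ff_scale[OF z])
    ultimately show ?thesis by (simp add: y1_def y2_def)
  qed
  then show ?thesis using that[OF A] by blast
qed

end

section \<open>Cusps\<close>

context quadratic
begin

text \<open>The first column generates an ideal of norm g, and the second lies in its inverse. The
  conditions are grouped by use: the products of entries make conjugates of unit matrices integral;
  the multiples by g bound the denominators of pulled back lattice forms; the quotients by g put the
  vector (0, 0, 1/g) into the pulled back lattice.\<close>

definition cusp_frame :: "real^2^2 \<Rightarrow> int \<Rightarrow> bool" where
  "cusp_frame \<alpha> g \<longleftrightarrow> \<alpha> \<in> G \<and> g > 0 \<and> \<alpha>$1$1 \<in> R \<and> \<alpha>$2$1 \<in> R \<and>
     (\<alpha>$1$1 * \<alpha>$2$2 \<in> R \<and> \<alpha>$1$2 * \<alpha>$2$1 \<in> R \<and> \<alpha>$1$1 * \<alpha>$1$2 \<in> R \<and> \<alpha>$2$1 * \<alpha>$2$2 \<in> R) \<and>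
     (of_int g * \<alpha>$1$2 \<in> R \<and> of_int g * \<alpha>$2$2 \<in> R) \<and>
     (of_int g * (\<alpha>$1$2 * cj (\<alpha>$1$2)) \<in> \<int> \<and> of_int g * (\<alpha>$2$2 * cj (\<alpha>$2$2)) \<in> \<int> \<and>
      of_int g * (\<alpha>$1$2 * cj (\<alpha>$2$2)) \<in> R) \<and>
     (\<alpha>$1$1 * cj (\<alpha>$1$1) / of_int g \<in> \<int> \<and> \<alpha>$2$1 * cj (\<alpha>$2$1) / of_int g \<in> \<int> \<and>
      \<alpha>$2$1 * cj (\<alpha>$1$1) / of_int g \<in> R)"

lemma bezout3:
  fixes p q r :: int
  assumes "p \<noteq> 0 \<or> q \<noteq> 0"
  obtains x y z g where "x * p + y * q + z * r = g" "g > 0" "g dvd p" "g dvd q" "g dvd r"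
proof -
  obtain u v where uv: "u * p + v * q = gcd p q" using bezout_int by blast
  obtain u' v' where uv': "u' * gcd p q + v' * r = gcd (gcd p q) r" using bezout_int by blast
  have "gcd (gcd p q) r > 0" using assms by (simp add: gcd_pos_int)
  moreover have "(u' * u) * p + (u' * v) * q + v' * r = gcd (gcd p q) r"
  proof -
    have "(u' * u) * p + (u' * v) * q + v' * r = u' * (u * p + v * q) + v' * r" by (simp add: algebra_simps)
    then show ?thesis by (simp only: uv uv')
  qed
  ultimately show ?thesis by (intro that[of "u' * u" "u' * v" v' "gcd (gcd p q) r"]) (auto intro: dvd_trans[OF gcd_dvd1])
qed

text \<open>The second column of the frame has entries in the inverse of the ideal generated by \<open>a\<close> and
  \<open>c\<close>. That ideal is invertible since \<open>g\<close> generates its norm, and \<open>a c'/g\<close> is an integer because its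
  trace and its norm are.\<close>

lemma ex_cusp_frame:
  assumes "a0 \<in> F" "c0 \<in> F" "a0 \<noteq> 0 \<or> c0 \<noteq> 0"
  obtains \<alpha> g where "cusp_frame \<alpha> g" "act F \<alpha> CuspInf = cu a0 c0"
proof -
  obtain k1 :: int where k1: "k1 > 0" "of_int k1 * a0 \<in> R" using R_denominator[OF assms(1)] by metis
  obtain k2 :: int where k2: "k2 > 0" "of_int k2 * c0 \<in> R" using R_denominator[OF assms(2)] by metis
  define a where "a = of_int (k1 * k2) * a0"
  define c where "c = of_int (k1 * k2) * c0"
  have "a = of_int k2 * (of_int k1 * a0)" "c = of_int k1 * (of_int k2 * c0)" by (simp_all add: a_def c_def)
  then have aR: "a \<in> R" and cR: "c \<in> R" using R_mult[OF of_int_R k1(2)] R_mult[OF of_int_R k2(2)] by simp_all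
  have ac0: "a \<noteq> 0 \<or> c \<noteq> 0" using assms(3) k1(1) k2(1) by (auto simp: a_def c_def)
  have cuac: "cu a c = cu a0 c0" using k1(1) k2(1) by (simp add: cu_def a_def c_def)
  define a' c' where "a' = cj a" and "c' = cj c"
  have F: "a \<in> F" "c \<in> F" using aR cR by simp_all
  have R': "a' \<in> R" "c' \<in> R" using aR cR by (simp_all add: a'_def c'_def)
  obtain p where p: "a * a' = of_int p" using R_norm[OF aR] unfolding a'_def by (elim Ints_cases)
  obtain q where q: "c * c' = of_int q" using R_norm[OF cR] unfolding c'_def by (elim Ints_cases)
  obtain r where r: "a * c' + a' * c = of_int r"
    using R_trace_mult[OF aR R'(2)] F unfolding a'_def c'_def by (auto elim: Ints_cases)
  have pq: "p \<noteq> 0 \<or> q \<noteq> 0"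
  proof (rule ccontr)
    assume "\<not> ?thesis"
    then have "a * a' = 0" "c * c' = 0" using p q by simp_all
    then show False using ac0 F by (auto simp: a'_def c'_def)
  qed
  obtain x y z g where bz: "x * p + y * q + z * r = g" "g > 0" "g dvd p" "g dvd q" "g dvd r" by (rule bezout3[OF pq])
  obtain p1 where p1: "p = g * p1" using bz(3) by (elim dvdE)
  obtain q1 where q1: "q = g * q1" using bz(4) by (elim dvdE)
  obtain r1 where r1: "r = g * r1" using bz(5) by (elim dvdE)
  define G' :: real where "G' = of_int g"
  have G0: "G' > 0" "G' \<noteq> 0" using bz(2) by (simp_all add: G'_def)
  have GF: "G' \<in> F" "cj G' = G'" by (simp_all add: G'_def)
  have pG: "a * a' = G' * of_int p1" "c * c' = G' * of_int q1" "a * c' + a' * c = G' * of_int r1"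
    using p q r by (simp_all add: p1 q1 r1 G'_def)
  define t where "t = a * c' / G'"
  define t' where "t' = a' * c / G'"
  have tF: "t \<in> F" using F GF by (simp add: t_def c'_def)
  have tc: "cj t = t'" using F GF by (simp add: t_def t'_def a'_def c'_def)
  have "t + t' = of_int r1" using pG(3) G0 by (simp add: t_def t'_def add_divide_distrib[symmetric])
  moreover have "t * t' = of_int (p1 * q1)"
  proof -
    have "t * t' = (a * a') * (c * c') / (G' * G')" by (simp add: t_def t'_def)
    then show ?thesis unfolding pG using G0 by simp
  qed
  ultimately have tR: "t \<in> R" unfolding R_iff using tF tc by simp
  then have tR': "t' \<in> R" using tc by (metis R_cj)
  have ac: "a * c' = G' * t" "a' * c = G' * t'" using G0 by (simp_all add: t_def t'_def)
  \<comment> \<open>The numbers p, r, q are the coefficients of N(a X + c Y). The relation x p + y q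
    + z r = g for their greatest common divisor is a d - b c = 1, multiplied by g, for this choice
    of b and d.\<close>
  define d where "d = (of_int x * a' + of_int z * c') / G'"
  define b where "b = - (of_int y * c' + of_int z * a') / G'"
  have gb: "G' * b = - (of_int y * c' + of_int z * a')" "G' * d = of_int x * a' + of_int z * c'"
    using G0 by (simp_all add: b_def d_def)
  have bdF: "b \<in> F" "d \<in> F" using F GF by (simp_all add: b_def d_def a'_def c'_def)
  have cancel: "u = v" if "G' * u = G' * v" for u v using that G0 by simp
  have ad: "a * d = of_int x * of_int p1 + of_int z * t"
    by (rule cancel) (use gb pG ac in algebra)
  have bc: "b * c = - (of_int y * of_int q1 + of_int z * t')"
    by (rule cancel) (use gb pG ac in algebra)
  have ab: "a * b = - (of_int y * t + of_int z * of_int p1)"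
    by (rule cancel) (use gb pG ac in algebra)
  have cd: "c * d = of_int x * t' + of_int z * of_int q1"
    by (rule cancel) (use gb pG ac in algebra)
  have tt: "t + t' = of_int r1" by fact
  have one: "of_int x * of_int p1 + of_int y * of_int q1 + of_int z * of_int r1 = (1::real)"
  proof -
    have "G' * (of_int x * of_int p1 + of_int y * of_int q1 + of_int z * of_int r1) = of_int (x * p + y * q + z * r)"
      by (simp add: p1 q1 r1 G'_def algebra_simps)
    also have "\<dots> = G' * 1" by (simp add: bz G'_def)
    finally show ?thesis by (rule cancel)
  qed
  have det: "a * d - b * c = 1" using ad bc tt one by algebra
  define \<alpha> where "\<alpha> = mk2 a b c d"
  have al: "\<alpha>$1$1 = a" "\<alpha>$1$2 = b" "\<alpha>$2$1 = c" "\<alpha>$2$2 = d" by (simp_all add: \<alpha>_def)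
  have \<alpha>G: "\<alpha> \<in> G" unfolding SL2_iff al using F bdF det by simp
  have cb: "G' * cj b = - (of_int y * c + of_int z * a)"
    using arg_cong[OF gb(1), of cj] bdF GF F by (simp add: a'_def c'_def)
  have cd': "G' * cj d = of_int x * a + of_int z * c"
    using arg_cong[OF gb(2), of cj] bdF GF F by (simp add: a'_def c'_def)
  have nb: "G' * (b * cj b) = of_int (y * y * q1 + y * z * r1 + z * z * p1)"
  proof (rule cancel)
    have "G' * (G' * (b * cj b)) = (G' * b) * (G' * cj b)" by (simp add: mult_ac)
    also have "\<dots> = G' * of_int (y * y * q1 + y * z * r1 + z * z * p1)"
      unfolding gb(1) cb using pG by (simp add: algebra_simps) algebra
    finally show "G' * (G' * (b * cj b)) = G' * of_int (y * y * q1 + y * z * r1 + z * z * p1)" .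
  qed
  have nd: "G' * (d * cj d) = of_int (x * x * p1 + x * z * r1 + z * z * q1)"
  proof (rule cancel)
    have "G' * (G' * (d * cj d)) = (G' * d) * (G' * cj d)" by (simp add: mult_ac)
    also have "\<dots> = G' * of_int (x * x * p1 + x * z * r1 + z * z * q1)"
      unfolding gb(2) cd' using pG by (simp add: algebra_simps) algebra
    finally show "G' * (G' * (d * cj d)) = G' * of_int (x * x * p1 + x * z * r1 + z * z * q1)" .
  qed
  have nbd: "G' * (b * cj d) = - (of_int (x * y) * t + of_int (y * z) * of_int q1 + of_int (x * z) * of_int p1 + of_int (z * z) * t')"
  proof (rule cancel)
    have "G' * (G' * (b * cj d)) = (G' * b) * (G' * cj d)" by (simp add: mult_ac)
    also have "\<dots> = G' * (- (of_int (x * y) * t + of_int (y * z) * of_int q1 + of_int (x * z) * of_int p1 + of_int (z * z) * t'))"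
      unfolding gb(1) cd' using pG ac by (simp add: algebra_simps) algebra
    finally show "G' * (G' * (b * cj d)) = G' * (- (of_int (x * y) * t + of_int (y * z) * of_int q1 + of_int (x * z) * of_int p1 + of_int (z * z) * t'))" .
  qed
  have "cusp_frame \<alpha> g"
    unfolding cusp_frame_def al G'_def[symmetric]
  proof (intro conjI)
    show "\<alpha> \<in> G" "0 < g" "a \<in> R" "c \<in> R" by (fact \<alpha>G bz(2) aR cR)+
    show "a * d \<in> R" "b * c \<in> R" "a * b \<in> R" "c * d \<in> R" unfolding ad bc ab cd using tR tR' by simp_all
    show "G' * b \<in> R" "G' * d \<in> R" unfolding gb using R' by simp_all
    show "G' * (b * cj b) \<in> \<int>" "G' * (d * cj d) \<in> \<int>" unfolding nb nd by simp_all
    show "G' * (b * cj d) \<in> R" unfolding nbd using tR tR' by simp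
    show "a * cj a / G' \<in> \<int>" "c * cj c / G' \<in> \<int>"
      using pG(1,2) G0 unfolding a'_def c'_def by simp_all
    show "c * cj a / G' \<in> R" using tR' unfolding t'_def a'_def by (simp add: mult.commute)
  qed
  moreover have "act F \<alpha> CuspInf = cu a0 c0" using G_CuspInf(1)[OF \<alpha>G] al cuac by simp
  ultimately show ?thesis by (rule that)
qed

lemma frame_pull_LL:
  assumes fr: "cusp_frame \<alpha> g" and v: "v \<in> LL" and p: "pull \<alpha> v = (A, x, B)"
  shows "A \<in> \<int>" "of_int g * B \<in> \<int>" "(of_int g * rD) * x \<in> R"
proof -
  define a b c d where "a = \<alpha>$1$1" and "b = \<alpha>$1$2" and "c = \<alpha>$2$1" and "d = \<alpha>$2$2"
  define G' :: real where "G' = of_int g"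
  note fr' = fr[unfolded cusp_frame_def, folded a_def b_def c_def d_def G'_def]
  have GF: "G' \<in> F" "cj G' = G'" by (simp_all add: G'_def)
  have R: "a \<in> R" "c \<in> R" "G' * b \<in> R" "G' * d \<in> R" "G' * (b * cj d) \<in> R"
    and Z: "G' * (b * cj b) \<in> \<int>" "G' * (d * cj d) \<in> \<int>" and \<alpha>: "\<alpha> \<in> G" using fr' by simp_all
  have bd: "b \<in> F" "d \<in> F" using \<alpha> by (simp_all add: b_def d_def)
  obtain a0 l b0 where v': "v = (a0, l, b0)" "a0 \<in> \<int>" "b0 \<in> \<int>" "l \<in> Di" using v by (auto simp: LL_def)
  have A: "A = a0 * (a * cj a) + (l * a * cj c + cj l * cj a * c) + b0 * (c * cj c)"
    and L: "x = a0 * a * cj b + l * a * cj d + cj l * c * cj b + b0 * c * cj d"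
    and B: "B = a0 * b * cj b + l * b * cj d + cj l * d * cj b + b0 * d * cj d"
    using p by (simp_all add: pull_def v'(1) a_def b_def c_def d_def mult_ac)
  show "A \<in> \<int>" unfolding A
    by (intro Ints_add Ints_mult[OF v'(2) R_norm[OF R(1)]] Ints_mult[OF v'(3) R_norm[OF R(2)]] Di_tr[OF v'(4) R(1,2)])
  have "cj (G' * (b * cj d)) = G' * (cj b * d)" using bd GF by simp
  then have "l * (G' * (b * cj d)) + cj l * (G' * (cj b * d)) \<in> \<int>" using Di_trace[OF v'(4) R(5)] by simp
  from Ints_add[OF Ints_add[OF Ints_mult[OF v'(2) Z(1)] this] Ints_mult[OF v'(3) Z(2)]]
  show "of_int g * B \<in> \<int>" unfolding B G'_def by (simp add: algebra_simps)
  have lR: "rD * l \<in> R" "rD * cj l \<in> R"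
    using v'(4) Di_cj[OF v'(4)] by (simp_all add: Di_iff)
  have cb: "G' * cj b \<in> R" "G' * cj d \<in> R" using R_cj[OF R(3)] R_cj[OF R(4)] bd GF by simp_all
  have ab: "a0 \<in> R" "b0 \<in> R" using v' by (simp_all add: Ints_R)
  have "rD * a0 * a * (G' * cj b) + (rD * l) * a * (G' * cj d) + (rD * cj l) * c * (G' * cj b) + rD * b0 * c * (G' * cj d) \<in> R"
    by (intro R_add R_mult lR cb ab R(1,2) rD_R)
  then show "(of_int g * rD) * x \<in> R" unfolding L G'_def by (simp add: algebra_simps)
qed

lemma frame_unit:
  assumes fr: "cusp_frame \<alpha> g" and \<epsilon>: "unitR \<epsilon>"
  shows "\<alpha> ** mk2 \<epsilon> 0 0 (inverse \<epsilon>) ** inv2 \<alpha> \<in> \<Gamma>"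
proof -
  define a b c d where "a = \<alpha>$1$1" and "b = \<alpha>$1$2" and "c = \<alpha>$2$1" and "d = \<alpha>$2$2"
  note fr' = fr[unfolded cusp_frame_def, folded a_def b_def c_def d_def]
  have \<alpha>: "\<alpha> \<in> G" and R: "a * d \<in> R" "b * c \<in> R" "a * b \<in> R" "c * d \<in> R" using fr' by simp_all
  have u: "\<epsilon> \<in> R" "inverse \<epsilon> \<in> R" "\<epsilon> \<noteq> 0" using \<epsilon> by (simp_all add: unitR_def)
  let ?E = "mk2 \<epsilon> 0 0 (inverse \<epsilon>)"
  have E: "?E \<in> G" unfolding SL2_iff using u by simp
  have M: "\<alpha> ** ?E ** inv2 \<alpha> \<in> G" by (intro SL2_mult \<alpha> E inv2_G)
  have e: "(\<alpha> ** ?E ** inv2 \<alpha>)$1$1 = a * d * \<epsilon> - b * c * inverse \<epsilon>"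
    "(\<alpha> ** ?E ** inv2 \<alpha>)$1$2 = a * b * (inverse \<epsilon> - \<epsilon>)"
    "(\<alpha> ** ?E ** inv2 \<alpha>)$2$1 = c * d * (\<epsilon> - inverse \<epsilon>)"
    "(\<alpha> ** ?E ** inv2 \<alpha>)$2$2 = a * d * inverse \<epsilon> - b * c * \<epsilon>"
    by (simp_all add: mat2_mult_nth inv2_def a_def b_def c_def d_def algebra_simps)
  show ?thesis
    unfolding SL2_iff
  proof (intro conjI)
    show "(\<alpha> ** ?E ** inv2 \<alpha>)$1$1 \<in> R" "(\<alpha> ** ?E ** inv2 \<alpha>)$1$2 \<in> R" "(\<alpha> ** ?E ** inv2 \<alpha>)$2$1 \<in> R"
      "(\<alpha> ** ?E ** inv2 \<alpha>)$2$2 \<in> R" unfolding e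
      using R_diff[OF R_mult[OF R(1) u(1)] R_mult[OF R(2) u(2)]] R_mult[OF R(3) R_diff[OF u(2,1)]]
        R_mult[OF R(4) R_diff[OF u(1,2)]] R_diff[OF R_mult[OF R(1) u(2)] R_mult[OF R(2) u(1)]] by simp_all
  qed (rule G_det[OF M])
qed

lemma frame_translation:
  assumes fr: "cusp_frame \<alpha> g" and \<mu>: "\<mu> \<in> R"
  shows "\<alpha> ** mk2 1 \<mu> 0 1 ** inv2 \<alpha> \<in> \<Gamma>"
proof -
  define a b c d where "a = \<alpha>$1$1" and "b = \<alpha>$1$2" and "c = \<alpha>$2$1" and "d = \<alpha>$2$2"
  note fr' = fr[unfolded cusp_frame_def, folded a_def b_def c_def d_def]
  have \<alpha>: "\<alpha> \<in> G" and R: "a \<in> R" "c \<in> R" using fr' by simp_all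
  let ?E = "mk2 1 \<mu> 0 1"
  have E: "?E \<in> G" unfolding SL2_iff using \<mu> by simp
  have M: "\<alpha> ** ?E ** inv2 \<alpha> \<in> G" by (intro SL2_mult \<alpha> E inv2_G)
  have det: "a * d - b * c = 1" using G_det[OF \<alpha>] by (simp add: a_def b_def c_def d_def)
  have e: "(\<alpha> ** ?E ** inv2 \<alpha>)$1$1 = a * d - b * c - \<mu> * a * c" "(\<alpha> ** ?E ** inv2 \<alpha>)$1$2 = \<mu> * a * a"
    "(\<alpha> ** ?E ** inv2 \<alpha>)$2$1 = - (\<mu> * c * c)" "(\<alpha> ** ?E ** inv2 \<alpha>)$2$2 = a * d - b * c + \<mu> * a * c"
    by (simp_all add: mat2_mult_nth inv2_def a_def b_def c_def d_def algebra_simps)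
  show ?thesis
    unfolding SL2_iff
  proof (intro conjI)
    show "(\<alpha> ** ?E ** inv2 \<alpha>)$1$1 \<in> R" "(\<alpha> ** ?E ** inv2 \<alpha>)$1$2 \<in> R" "(\<alpha> ** ?E ** inv2 \<alpha>)$2$1 \<in> R"
      "(\<alpha> ** ?E ** inv2 \<alpha>)$2$2 \<in> R" unfolding e det using R \<mu> by simp_all
  qed (rule G_det[OF M])
qed

text \<open>The conjugated group may have denominators in the upper right entry, but the other
  entries are integral. The lower left one is needed to separate horoballs, the diagonal ones to
  recognise units.\<close>

lemma frame_conj:
  assumes fr: "cusp_frame \<alpha> g" and \<gamma>: "\<gamma> \<in> \<Gamma>"
  defines "M \<equiv> inv2 \<alpha> ** \<gamma> ** \<alpha>"
  shows "M \<in> G" "M$2$1 \<in> R" "M$1$1 \<in> R" "M$2$2 \<in> R"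
proof -
  define a b c d where "a = \<alpha>$1$1" and "b = \<alpha>$1$2" and "c = \<alpha>$2$1" and "d = \<alpha>$2$2"
  note fr' = fr[unfolded cusp_frame_def, folded a_def b_def c_def d_def]
  have \<alpha>: "\<alpha> \<in> G" and R: "a \<in> R" "c \<in> R" "a * d \<in> R" "b * c \<in> R" "a * b \<in> R" "c * d \<in> R" using fr' by simp_all
  have \<gamma>R: "\<gamma>$1$1 \<in> R" "\<gamma>$1$2 \<in> R" "\<gamma>$2$1 \<in> R" "\<gamma>$2$2 \<in> R" using \<gamma> unfolding SL2_iff by simp_all
  have \<gamma>G: "\<gamma> \<in> G" using \<gamma> by simp
  show "M \<in> G" unfolding M_def by (intro SL2_mult inv2_G \<alpha> \<gamma>G)
  have e: "M$2$1 = a * (\<gamma>$2$1 * a + \<gamma>$2$2 * c) - c * (\<gamma>$1$1 * a + \<gamma>$1$2 * c)"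
    "M$1$1 = \<gamma>$1$1 * (a * d) + \<gamma>$1$2 * (c * d) - \<gamma>$2$1 * (a * b) - \<gamma>$2$2 * (b * c)"
    "M$2$2 = \<gamma>$2$1 * (a * b) + \<gamma>$2$2 * (a * d) - \<gamma>$1$1 * (b * c) - \<gamma>$1$2 * (c * d)"
    by (simp_all add: M_def mat2_mult_nth inv2_def a_def b_def c_def d_def algebra_simps)
  show "M$2$1 \<in> R" unfolding e by (intro R_diff R_mult R_add R(1,2) \<gamma>R)
  show "M$1$1 \<in> R" unfolding e by (intro R_diff R_add R_mult[OF \<gamma>R(1) R(3)] R_mult[OF \<gamma>R(2) R(6)] R_mult[OF \<gamma>R(3) R(5)] R_mult[OF \<gamma>R(4) R(4)])
  show "M$2$2 \<in> R" unfolding e by (intro R_diff R_add R_mult[OF \<gamma>R(3) R(5)] R_mult[OF \<gamma>R(4) R(3)] R_mult[OF \<gamma>R(1) R(4)] R_mult[OF \<gamma>R(2) R(6)])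
qed

lemma pull_add: "u \<in> VF \<Longrightarrow> v \<in> VF \<Longrightarrow> pull A (u + v) = pull A u + pull A v"
  by (cases u; cases v) (simp add: pull_def VF_def algebra_simps)

text \<open>By the last group of conditions in \<open>cusp_frame\<close>, the vector (0, 0, 1/g)
  comes from a lattice vector. Adding it does not affect the norm of a form whose first coefficient
  is 0 at the cusp.\<close>

lemma frame_full:
  assumes fr: "cusp_frame \<alpha> g" and v: "v \<in> HF m" and p: "pull \<alpha> v = (0, x, \<beta>)"
  shows "\<exists>w\<in>HF m. pull \<alpha> w = (0, x, \<beta> + 1 / of_int g)"
proof -
  define a b c d where "a = \<alpha>$1$1" and "b = \<alpha>$1$2" and "c = \<alpha>$2$1" and "d = \<alpha>$2$2"
  define G' :: real where "G' = of_int g"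
  note fr' = fr[unfolded cusp_frame_def, folded a_def b_def c_def d_def G'_def]
  have \<alpha>: "\<alpha> \<in> G" and Z: "a * cj a / G' \<in> \<int>" "c * cj c / G' \<in> \<int>" "c * cj a / G' \<in> R" using fr' by simp_all
  have iG: "inv2 \<alpha> \<in> G" by (rule inv2_G[OF \<alpha>])
  define e where "e = (0::real, 0::real, 1 / G')"
  have eV: "e \<in> VF" by (simp add: e_def VF_def G'_def)
  define u where "u = pull (inv2 \<alpha>) e"
  have cF: "c \<in> F" "a \<in> F" using \<alpha> by (simp_all add: a_def c_def)
  have "u = (c * cj c / G', - (c * cj a / G'), a * cj a / G')"
    using \<alpha> by (simp add: u_def e_def pull_def inv2_def a_def c_def)
  then have uL: "u \<in> LL" using Z by (simp add: LL_def R_Di)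
  have pu: "pull \<alpha> u = e"
    unfolding u_def using pull_mult[OF eV iG \<alpha>] inv2_left[OF \<alpha>] pull_one[OF eV] by simp
  have vL: "v \<in> LL" using v by (simp add: HF_def)
  note vV = LL_VF[OF vL] vL
  have pw: "pull \<alpha> (v + u) = (0, x, \<beta> + 1 / of_int g)"
    using pull_add[OF vV(1) LL_VF[OF uL]] p pu by (simp add: e_def G'_def)
  have "v + u \<in> LL" using vV(2) uL by (cases v; cases u) (simp add: LL_def)
  then have wV: "v + u \<in> VF" by (rule LL_VF)
  have "nrm (v + u) = nrm (pull \<alpha> (v + u))" using nrm_pull[OF wV \<alpha>] by simp
  also have "\<dots> = nrm (pull \<alpha> v)" unfolding pw p by (simp add: nrm_def)
  also have "\<dots> = nrm v" by (rule nrm_pull[OF vV(1) \<alpha>])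
  finally have "v + u \<in> HF m" using v \<open>v + u \<in> LL\<close> by (simp add: HF_def)
  then show ?thesis using pw by blast
qed

end

section \<open>Classes of forms at a cusp under units and shifts\<close>

lemma scale_into_interval:
  fixes e x :: real
  assumes e: "e > 1" and x: "x > 0"
  obtains k :: int where "1 \<le> x * e powi k" "x * e powi k < e"
proof -
  define j where "j = \<lfloor>log e x\<rfloor>"
  have pw: "e powr of_int i = e powi i" for i using e by (intro powr_real_of_int') auto
  have "of_int j \<le> log e x" "log e x < of_int (j + 1)" unfolding j_def by linarith+
  then have "e powr of_int j \<le> x" "x < e powr of_int (j + 1)"
    using e x by (simp_all add: le_log_iff log_less_iff)
  then have j: "e powi j \<le> x" "x < e powi (j + 1)" unfolding pw by auto
  have p: "e powi j > 0" using e by simp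
  have j1: "e powi (j + 1) = e * e powi j" using e by (simp add: power_int_add_1 mult.commute)
  have xj: "x * e powi (- j) = x / e powi j" by (simp add: power_int_minus divide_inverse)
  show ?thesis
  proof (rule that[of "- j"])
    show "1 \<le> x * e powi (- j)" unfolding xj using j(1) p by simp
    show "x * e powi (- j) < e" unfolding xj pos_divide_less_eq[OF p] using j(2) j1 by simp
  qed
qed

lemma scale_unique:
  fixes e a b :: real and k l :: int
  assumes e: "e > 1" and a: "1 \<le> a" "a < e" and b: "1 \<le> b" "b < e" and eq: "a * e powi k = b * e powi l"
  shows "k = l"
proof -
  have *: "\<not> k < l" if "a < e" "1 \<le> b" "a * e powi k = b * e powi l" for a b and k l :: int
  proof
    assume "k < l"
    then have "e powi (k + 1) \<le> e powi l" using e by (intro power_int_increasing) auto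
    moreover have "e powi (k + 1) = e * e powi k" using e by (simp add: power_int_add_1 mult.commute)
    moreover have "a * e powi k < e * e powi k" using that e by (intro mult_strict_right_mono) auto
    moreover have "1 * e powi l \<le> b * e powi l" using that e by (intro mult_right_mono) auto
    ultimately show False using that(3) by linarith
  qed
  have "\<not> k < l" by (rule *[OF a(2) b(1) eq])
  moreover have "\<not> l < k" by (rule *[OF b(2) a(1) eq[symmetric]])
  ultimately show ?thesis by simp
qed

text \<open>The number q/g is a period of the offsets of the forms in \<open>S\<close> at the cusp;
  q depends on \<open>S\<close>. The number nn = (\<epsilon> - 1/\<epsilon>)^2 = -(\<epsilon>^2 -
  1)(1/\<epsilon>^2 - 1) clears the denominators of the Weyl vector, and it is an integer because
  \<epsilon>^2 is a unit of norm 1.\<close>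

locale cusp_data = quadratic F for F +
  fixes m :: nat and \<alpha> :: "real^2^2" and g :: int and S :: "(real \<times> real \<times> real) set"
    and \<epsilon> :: real and q nn :: nat
  assumes m: "m > 0" and fr: "cusp_frame \<alpha> g" and S: "\<Gamma>_closed m S"
    and \<epsilon>: "unitR \<epsilon>" "\<epsilon> > 1" "\<forall>u. unitR u \<longrightarrow> (\<exists>k. u = \<epsilon> powi k \<or> u = - (\<epsilon> powi k))"
    and q: "q > 0"
    and per: "\<And>v x b. v \<in> S \<Longrightarrow> pull \<alpha> v = (0, x, b) \<Longrightarrow> \<exists>w\<in>S. pull \<alpha> w = (0, x, b + real q / of_int g)"
    and nn: "real nn = \<epsilon>\<^sup>2 + 1 / \<epsilon>\<^sup>2 - 2"
begin

definition ss :: real where "ss = real q / of_int g"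

lemma aG: "\<alpha> \<in> G" and g0: "g > 0"
  using fr by (simp_all add: cusp_frame_def)

lemma ss0: "ss > 0"
  using q g0 by (simp add: ss_def)

lemma \<epsilon>F: "\<epsilon> \<in> F" and \<epsilon>0: "\<epsilon> > 0" "\<epsilon> \<noteq> 0"
  using \<epsilon> by (simp_all add: unitR_def)

lemma ee1: "\<epsilon>\<^sup>2 > 1" and ee0: "\<epsilon>\<^sup>2 > 0" and ee_ne: "\<epsilon>\<^sup>2 \<noteq> 0" "\<epsilon>\<^sup>2 \<noteq> 1" and eeF: "\<epsilon>\<^sup>2 \<in> F"
proof -
  show 1: "\<epsilon>\<^sup>2 > 1" using \<epsilon>(2) by (simp add: one_less_power)
  then show "\<epsilon>\<^sup>2 > 0" "\<epsilon>\<^sup>2 \<noteq> 0" "\<epsilon>\<^sup>2 \<noteq> 1" by linarith+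
  show "\<epsilon>\<^sup>2 \<in> F" using \<epsilon>F by (simp add: power2_eq_square)
qed

lemma unit_norm_sq: "unitR u \<Longrightarrow> (u * cj u) * (u * cj u) = 1"
  using unitR_norm[of u] by (metis abs_mult_self_eq mult_1)

lemma cj_ee: "cj (\<epsilon>\<^sup>2) = 1 / \<epsilon>\<^sup>2"
proof -
  have "\<epsilon>\<^sup>2 * cj (\<epsilon>\<^sup>2) = 1" using unit_norm_sq[OF \<epsilon>(1)] \<epsilon>F by (simp add: power2_eq_square mult_ac)
  then show ?thesis using ee_ne by (simp add: field_simps)
qed

lemma powi_F: "x \<in> F \<Longrightarrow> x powi k \<in> F"
  and cj_powi: "x \<in> F \<Longrightarrow> cj (x powi k) = cj x powi k"
proof -
  have p: "y ^ n \<in> F" if "y \<in> F" for y n using that by (induction n) simp_all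
  show "x \<in> F \<Longrightarrow> x powi k \<in> F" "x \<in> F \<Longrightarrow> cj (x powi k) = cj x powi k" using p by (simp_all add: power_int_def)
qed

lemma cj_ee_powi: "cj (\<epsilon>\<^sup>2 powi k) = \<epsilon>\<^sup>2 powi (- k)"
  unfolding cj_powi[OF eeF] cj_ee by (simp add: power_int_minus power_int_divide_distrib divide_inverse power_int_inverse)

lemma ee_powi_inv: "\<epsilon>\<^sup>2 powi k * \<epsilon>\<^sup>2 powi (- k) = 1" "\<epsilon>\<^sup>2 powi (- k) * \<epsilon>\<^sup>2 powi k = 1"
  using ee0 by (simp_all add: power_int_minus)

lemma nn0: "nn > 0"
proof -
  have "\<epsilon>\<^sup>2 + 1 / \<epsilon>\<^sup>2 - 2 = (\<epsilon> - 1 / \<epsilon>)\<^sup>2" using \<epsilon>0 by (simp add: power2_diff power_divide)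
  moreover have "\<epsilon> - 1 / \<epsilon> > 0" using \<epsilon>(2) \<epsilon>0 by (simp add: field_simps power2_eq_square[symmetric])
  ultimately have "real nn > 0" unfolding nn by simp
  then show ?thesis by simp
qed

text \<open>Slope and offset of the forms that become linear at the cusp. Requiring a positive slope
  selects one form from each pair v, -v.\<close>

definition P0 :: "(real \<times> real) set" where
  "P0 = {p. fst p > 0 \<and> (\<exists>v\<in>S. pull \<alpha> v = (0, fst p, snd p))}"

definition Lf :: "real \<times> real \<Rightarrow> complex \<times> complex \<Rightarrow> complex" where
  "Lf p z = of_real (fst p) * fst z + of_real (cj (fst p)) * snd z + of_real (snd p)"

lemma SD: "v \<in> S \<Longrightarrow> v \<in> HF m" "v \<in> S \<Longrightarrow> - v \<in> S" "v \<in> S \<Longrightarrow> A \<in> \<Gamma> \<Longrightarrow> pull A v \<in> S"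
  using S unfolding \<Gamma>_closed_def by blast+

lemma SV: "v \<in> S \<Longrightarrow> v \<in> VF"
  by (rule HF_VF[OF SD(1)])

lemma form_at_cusp:
  assumes v: "v \<in> S" and p: "pull \<alpha> v = (0, x, b)"
  shows "x \<in> F" "x * cj x = - (real m / of_int D)" "x \<noteq> 0" "of_int g * b \<in> \<int>" "(of_int g * rD) * x \<in> R"
proof -
  have vL: "v \<in> LL" using SD(1)[OF v] by (simp add: HF_def)
  show "of_int g * b \<in> \<int>" "(of_int g * rD) * x \<in> R" by (rule frame_pull_LL(2,3)[OF fr vL p])+
  have "pull \<alpha> v \<in> VF" by (rule pull_VF[OF SV[OF v] aG])
  then show "x \<in> F" unfolding p by (simp add: VF_def)
  have "nrm (pull \<alpha> v) = real m / of_int D" using nrm_pull[OF SV[OF v] aG] HF_nrm[OF SD(1)[OF v]] by simp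
  then show n: "x * cj x = - (real m / of_int D)" unfolding p nrm_def by simp
  have "nrm v > 0" by (rule HF_nrm_pos[OF SD(1)[OF v] m])
  then have "real m / of_int D > 0" using HF_nrm[OF SD(1)[OF v]] by simp
  then show "x \<noteq> 0" using n by auto
qed

lemma P0_form:
  assumes "p \<in> P0"
  obtains v where "v \<in> S" "pull \<alpha> v = (0, fst p, snd p)"
  using assms unfolding P0_def by (elim CollectE conjE bexE)

lemma P0D:
  assumes p: "p \<in> P0"
  shows "fst p > 0" "fst p \<in> F" "fst p * cj (fst p) = - (real m / of_int D)" "cj (fst p) < 0"
    "of_int g * snd p \<in> \<int>" "(of_int g * rD) * fst p \<in> R"
proof -
  obtain v where v: "v \<in> S" "pull \<alpha> v = (0, fst p, snd p)" by (rule P0_form[OF p])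
  note f = form_at_cusp[OF v]
  show x: "fst p > 0" using p by (simp add: P0_def)
  show "fst p \<in> F" "fst p * cj (fst p) = - (real m / of_int D)" "of_int g * snd p \<in> \<int>" "(of_int g * rD) * fst p \<in> R"
    by (fact f)+
  have "real m / of_int D > 0" using m D_ge_1 by (intro divide_pos_pos) auto
  then have "fst p * cj (fst p) < 0" using f(2) by linarith
  then show "cj (fst p) < 0" using x by (simp add: mult_less_0_iff)
qed

lemma P0I:
  assumes v: "v \<in> S" and p: "pull \<alpha> v = (0, x, b)"
  shows "x > 0 \<Longrightarrow> (x, b) \<in> P0" "x < 0 \<Longrightarrow> (- x, - b) \<in> P0"
proof -
  show "(x, b) \<in> P0" if "x > 0" using that v p by (auto simp: P0_def)
  have "pull \<alpha> (- v) = (0, - x, - b)" using pull_uminus[OF SV[OF v], of \<alpha>] p by simp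
  then show "(- x, - b) \<in> P0" if "x < 0" using that SD(2)[OF v] by (auto simp: P0_def)
qed

text \<open>\<open>M\<close> has diagonal entries u and 1/u = n u', where n is the norm of u, so 1
  or -1. Pulling back yields n times the expected form; for n = -1 its negative, again in
  \<open>S\<close>, restores the positive slope.\<close>

lemma P0_pull:
  assumes p: "p \<in> P0" and \<gamma>: "\<gamma> \<in> \<Gamma>" and M: "M \<in> G" "\<alpha> ** M = \<gamma> ** \<alpha>" "M$2$1 = 0" "M$1$1 = u" "M$1$2 = u * \<nu>"
    and u: "unitR u" and \<nu>: "\<nu> \<in> F"
  shows "(fst p * u\<^sup>2, snd p + (fst p * u\<^sup>2 * \<nu> + cj (fst p * u\<^sup>2) * cj \<nu>)) \<in> P0"
proof -
  obtain v where v: "v \<in> S" "pull \<alpha> v = (0, fst p, snd p)" by (rule P0_form[OF p])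
  define x b where "x = fst p" and "b = snd p"
  have x: "x > 0" "x \<in> F" using P0D[OF p] by (simp_all add: x_def)
  have uF: "u \<in> F" "u \<noteq> 0" "cj u \<noteq> 0" using u by (auto simp: unitR_def)
  define n where "n = u * cj u"
  have n1: "n * n = 1" unfolding n_def by (rule unit_norm_sq[OF u])
  have d: "u * M$2$2 = 1" using G_det[OF M(1)] M by simp
  have "u * M$2$2 = u * (n * cj u)" using d n1 by (simp add: n_def mult_ac)
  then have M22: "M$2$2 = n * cj u" using uF by simp
  have nF: "n \<in> F" "cj n = n" using uF by (simp_all add: n_def mult.commute)
  have cM22: "cj (M$2$2) = n * u" unfolding M22 using nF uF by simp
  have v': "pull \<gamma> v \<in> S" by (rule SD(3)[OF v(1) \<gamma>])
  have "pull \<alpha> (pull \<gamma> v) = pull M (pull \<alpha> v)"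
    using pull_mult[OF SV[OF v(1)] \<Gamma>_G[OF \<gamma>] aG] pull_mult[OF SV[OF v(1)] aG M(1)] M(2) by simp
  also have "\<dots> = (0, n * (x * u\<^sup>2), n * (b + (x * u\<^sup>2 * \<nu> + cj (x * u\<^sup>2) * cj \<nu>)))"
  proof -
    have 1: "x * u * (n * u) = n * (x * u\<^sup>2)" by (simp add: power2_eq_square)
    have "x * (u * \<nu>) * (n * u) + cj x * (n * cj u) * (cj u * cj \<nu>) + b * (n * cj u) * (n * u)
        = n * (b * n * (u * cj u) + (x * u\<^sup>2 * \<nu> + cj x * (cj u)\<^sup>2 * cj \<nu>))" by (simp add: power2_eq_square algebra_simps)
    also have "b * n * (u * cj u) = b" using n1 by (simp add: n_def[symmetric] mult.assoc)
    also have "cj x * (cj u)\<^sup>2 = cj (x * u\<^sup>2)" using x uF by (simp add: power2_eq_square)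
    finally have 2: "x * (u * \<nu>) * (n * u) + cj x * (n * cj u) * (cj u * cj \<nu>) + b * (n * cj u) * (n * u)
        = n * (b + (x * u\<^sup>2 * \<nu> + cj (x * u\<^sup>2) * cj \<nu>))" .
    have c: "cj (u * \<nu>) = cj u * cj \<nu>" using uF \<nu> by simp
    have "pull M (0, x, b) = (x * u * (n * u) * 0 + x * u * (n * u) * 0, x * u * (n * u),
        x * (u * \<nu>) * (n * u) + cj x * (n * cj u) * (cj u * cj \<nu>) + b * (n * cj u) * (n * u))"
      unfolding pull_def prod.case M(3-5) cM22 c cj_0 M22 by (simp add: cM22[unfolded M22])
    then show ?thesis unfolding v(2) x_def[symmetric] b_def[symmetric] 1 2 by simp
  qed
  finally have P: "pull \<alpha> (pull \<gamma> v) = (0, n * (x * u\<^sup>2), n * (b + (x * u\<^sup>2 * \<nu> + cj (x * u\<^sup>2) * cj \<nu>)))" .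
  have xu: "x * u\<^sup>2 > 0" using x uF by simp
  have "n = 1 \<or> n = - 1" using n1 by (simp add: square_eq_1_iff)
  then show ?thesis
  proof
    assume n: "n = 1"
    show ?thesis using P0I(1)[OF v' P] xu unfolding n x_def b_def by simp
  next
    assume n: "n = - 1"
    have neg: "- (n * y) = y" for y using n by simp
    have "n * (x * u\<^sup>2) < 0" using n xu by simp
    from P0I(2)[OF v' P this] show ?thesis unfolding neg x_def b_def .
  qed
qed

lemma powi_sq: "(\<epsilon> powi k)\<^sup>2 = \<epsilon>\<^sup>2 powi k"
  by (simp only: power2_eq_square power_int_mult_distrib)

lemma P0_scale:
  assumes p: "p \<in> P0" shows "(fst p * \<epsilon>\<^sup>2 powi k, snd p) \<in> P0"
proof -
  define u where "u = \<epsilon> powi k"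
  have u: "unitR u" unfolding u_def by (rule unitR_powi[OF \<epsilon>(1)])
  have uF: "u \<in> F" "u \<noteq> 0" using u by (auto simp: unitR_def)
  define M where "M = mk2 u 0 0 (inverse u)"
  have M: "M \<in> G" unfolding SL2_iff M_def using uF by simp
  have "\<alpha> ** M ** inv2 \<alpha> ** \<alpha> = \<alpha> ** M" using inv2_left[OF aG] by (simp add: matrix_mul_assoc[symmetric])
  then have aM: "\<alpha> ** M = \<alpha> ** M ** inv2 \<alpha> ** \<alpha>" by (rule sym)
  have e: "M$2$1 = 0" "M$1$1 = u" "M$1$2 = u * 0" unfolding M_def mk2_nth by simp_all
  have "(fst p * u\<^sup>2, snd p + (fst p * u\<^sup>2 * 0 + cj (fst p * u\<^sup>2) * cj 0)) \<in> P0"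
    by (rule P0_pull[OF p frame_unit[OF fr u, folded M_def] M aM e u zero_F])
  then show ?thesis by (simp add: u_def powi_sq)
qed

lemma P0_shift: "p \<in> P0 \<Longrightarrow> (fst p, snd p + of_int i * ss) \<in> P0"
proof -
  assume p: "p \<in> P0"
  have up: "(fst p, snd p + ss) \<in> P0" if p: "p \<in> P0" for p
  proof -
    obtain v where v: "v \<in> S" "pull \<alpha> v = (0, fst p, snd p)" by (rule P0_form[OF p])
    obtain w where w: "w \<in> S" "pull \<alpha> w = (0, fst p, snd p + real q / of_int g)" using per[OF v] by (elim bexE)
    show ?thesis using P0I(1)[OF w] P0D(1)[OF p] by (simp add: ss_def)
  qed
  have down: "(fst p, snd p - ss) \<in> P0" if p: "p \<in> P0" for p
  proof -
    obtain v where v: "v \<in> S" "pull \<alpha> v = (0, fst p, snd p)" by (rule P0_form[OF p])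
    have "pull \<alpha> (- v) = (0, - fst p, - snd p)"
      using pull_uminus[OF SV[OF v(1)], of \<alpha>] v(2) by (simp add: prod_eq_iff)
    then obtain w where w: "w \<in> S" "pull \<alpha> w = (0, - fst p, - snd p + real q / of_int g)"
      using per[OF SD(2)[OF v(1)]] by (metis)
    show ?thesis using P0I(2)[OF w] P0D(1)[OF p] by (simp add: ss_def)
  qed
  show ?thesis
  proof (induction i rule: int_induct[where k = 0])
    case base
    then show ?case using p by simp
  next
    case (step1 i)
    then show ?case using up[OF step1(2)] by (simp add: algebra_simps)
  next
    case (step2 i)
    then show ?case using down[OF step2(2)] by (simp add: algebra_simps)
  qed
qed

text \<open>A fundamental domain in \<open>P0\<close> for scaling by powers of \<epsilon>^2 and
  shifting by \<open>ss\<close>. Each of its points contributes one product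
  \<open>fp\<close>.\<close>

definition Rp :: "(real \<times> real) set" where
  "Rp = {p \<in> P0. 1 \<le> fst p \<and> fst p < \<epsilon>\<^sup>2 \<and> 0 \<le> snd p \<and> snd p < ss}"

lemma Rp_P0: "p \<in> Rp \<Longrightarrow> p \<in> P0"
  by (simp add: Rp_def)

lemma finite_Rp: "finite Rp"
proof -
  define B where "B = max (\<epsilon>\<^sup>2) (real m / of_int D)"
  let ?A = "{x \<in> F. (of_int g * rD) * x \<in> R \<and> \<bar>x\<bar> \<le> B \<and> \<bar>cj x\<bar> \<le> B}"
  let ?J = "(\<lambda>j. of_int j / of_int g :: real) ` {0..<int q}"
  have "of_int g * rD \<in> R" by simp
  then have "of_int g * rD \<in> F" unfolding R_iff by blast
  then have "finite ?A" using g0 by (intro scaled_R_bounded_finite) auto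
  moreover have "Rp \<subseteq> ?A \<times> ?J"
  proof
    fix p assume p: "p \<in> Rp"
    note d = P0D[OF Rp_P0[OF p]]
    have r: "1 \<le> fst p" "fst p < \<epsilon>\<^sup>2" "0 \<le> snd p" "snd p < ss" using p by (simp_all add: Rp_def)
    have "\<bar>fst p\<bar> \<le> B" using r by (simp add: B_def)
    \<comment> \<open>Slope times conjugate slope is fixed at -m/D, so a slope of at least 1 bounds
      its conjugate.\<close>
    moreover have "1 * (- cj (fst p)) \<le> fst p * (- cj (fst p))" using r d(4) by (intro mult_right_mono) auto
    then have "\<bar>cj (fst p)\<bar> \<le> B" using d(3,4) by (simp add: B_def)
    ultimately have 1: "fst p \<in> ?A" using d by simp
    obtain j where j: "of_int g * snd p = of_int j" using d(5) by (elim Ints_cases)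
    have gp: "(0::real) < of_int g" using g0 by simp
    have b: "snd p = of_int j / of_int g" using j gp by (simp add: field_simps)
    have "0 \<le> of_int g * snd p" using gp r by simp
    moreover have "of_int g * snd p < of_int g * ss" using gp r by (intro mult_strict_left_mono)
    moreover have "of_int g * ss = real q" using gp by (simp add: ss_def)
    ultimately have "0 \<le> (of_int j :: real)" "(of_int j :: real) < of_int (int q)" unfolding j by simp_all
    then have "j \<in> {0..<int q}" unfolding of_int_0_le_iff of_int_less_iff by simp
    then have "snd p \<in> ?J" unfolding b by (rule imageI)
    then show "p \<in> ?A \<times> ?J" using 1 by (simp only: mem_Times_iff conj_absorb simp_thms)
  qed
  ultimately show ?thesis by (meson finite_SigmaI finite_atLeastLessThan_int finite_imageI finite_subset)
qed

lemma P0_rep: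
  assumes p: "p \<in> P0"
  obtains p0 k i where "p0 \<in> Rp" "fst p = fst p0 * \<epsilon>\<^sup>2 powi k" "snd p = snd p0 + of_int i * ss"
proof -
  obtain k where k: "1 \<le> fst p * \<epsilon>\<^sup>2 powi k" "fst p * \<epsilon>\<^sup>2 powi k < \<epsilon>\<^sup>2"
    by (rule scale_into_interval[OF ee1 P0D(1)[OF p]])
  define i where "i = \<lfloor>snd p / ss\<rfloor>"
  define p0 where "p0 = (fst p * \<epsilon>\<^sup>2 powi k, snd p + of_int (- i) * ss)"
  have "p0 \<in> P0" using P0_shift[OF P0_scale[OF p, of k], of "- i"] by (simp add: p0_def)
  moreover have "of_int i * ss \<le> snd p" "snd p < (of_int i + 1) * ss"
    unfolding i_def using ss0 by (rule floor_divide_lower, rule floor_divide_upper)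
  ultimately have "p0 \<in> Rp" using k by (simp add: Rp_def p0_def algebra_simps)
  moreover have "fst p = fst p0 * \<epsilon>\<^sup>2 powi (- k)" by (simp only: p0_def fst_conv mult.assoc ee_powi_inv mult_1_right)
  moreover have "snd p = snd p0 + of_int i * ss" by (simp add: p0_def)
  ultimately show ?thesis by (rule that)
qed

definition fp :: "real \<times> real \<Rightarrow> complex \<times> complex \<Rightarrow> complex" where
  "fp p z = cusp_factor.ff (fst p) (cj (fst p)) (\<epsilon>\<^sup>2) ss (snd p) z"

lemma cf: "p \<in> P0 \<Longrightarrow> cusp_factor (fst p) (cj (fst p)) (\<epsilon>\<^sup>2) ss"
  using P0D[of p] ee1 ss0 by unfold_locales

lemma lin_eq:
  assumes p: "p \<in> P0"
  shows "cusp_factor.lin (fst p) (cj (fst p)) (\<epsilon>\<^sup>2) k z + of_real (snd p) - of_real ss * of_int i =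
    Lf (fst p * \<epsilon>\<^sup>2 powi k, snd p + of_int (- i) * ss) z"
proof -
  have "cj (fst p * \<epsilon>\<^sup>2 powi k) = cj (fst p) * \<epsilon>\<^sup>2 powi (- k)"
    using P0D(2)[OF p] powi_F[OF eeF, of k] cj_ee_powi[of k] by simp
  then show ?thesis unfolding cusp_factor.lin_def[OF cf[OF p]] Lf_def by simp
qed

lemma fp_zero:
  assumes p: "p \<in> P0" and z: "z \<in> H2"
  shows "fp p z = 0 \<longleftrightarrow> (\<exists>k i. Lf (fst p * \<epsilon>\<^sup>2 powi k, snd p + of_int (- i) * ss) z = 0)"
  unfolding fp_def cusp_factor.ff_zero[OF cf[OF p] z] lin_eq[OF p, symmetric] by simp

definition Ps :: "complex \<times> complex \<Rightarrow> complex" where "Ps z = (\<Prod>p\<in>Rp. fp p z)"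

lemma Ps_zero:
  assumes z: "z \<in> H2"
  shows "Ps z = 0 \<longleftrightarrow> (\<exists>p\<in>P0. Lf p z = 0)"
proof
  assume "Ps z = 0"
  then obtain p where p: "p \<in> Rp" "fp p z = 0" unfolding Ps_def prod_zero_iff[OF finite_Rp] by (elim bexE)
  obtain k i where "Lf (fst p * \<epsilon>\<^sup>2 powi k, snd p + of_int (- i) * ss) z = 0"
    using p(2) unfolding fp_zero[OF Rp_P0[OF p(1)] z] by (elim exE)
  moreover have "(fst p * \<epsilon>\<^sup>2 powi k, snd p + of_int (- i) * ss) \<in> P0"
    using P0_shift[OF P0_scale[OF Rp_P0[OF p(1)], of k], of "- i"] by simp
  ultimately show "\<exists>p\<in>P0. Lf p z = 0" by (rule bexI)
next
  assume "\<exists>p\<in>P0. Lf p z = 0"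
  then obtain p where p: "p \<in> P0" "Lf p z = 0" by (elim bexE)
  obtain p0 k i where p0: "p0 \<in> Rp" "fst p = fst p0 * \<epsilon>\<^sup>2 powi k" "snd p = snd p0 + of_int i * ss" by (rule P0_rep[OF p(1)])
  have "p = (fst p0 * \<epsilon>\<^sup>2 powi k, snd p0 + of_int (- (- i)) * ss)" using p0(2,3) by (simp add: prod_eq_iff)
  then have "\<exists>k i. Lf (fst p0 * \<epsilon>\<^sup>2 powi k, snd p0 + of_int (- i) * ss) z = 0"
    using p(2) by (intro exI[of _ k] exI[of _ "- i"]) simp
  then have "fp p0 z = 0" unfolding fp_zero[OF Rp_P0[OF p0(1)] z] .
  then show "Ps z = 0" unfolding Ps_def prod_zero_iff[OF finite_Rp] using p0(1) by (rule bexI)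
qed

lemma holomorphic2_fp: "p \<in> P0 \<Longrightarrow> holomorphic2_on (fp p) H2"
  using cusp_factor.holomorphic2_ff[OF cf, of p "snd p"] unfolding fp_def[abs_def] by simp

lemma holomorphic2_Ps: "holomorphic2_on Ps H2"
  unfolding Ps_def[abs_def] by (intro holomorphic2_on_prod holomorphic2_fp Rp_P0)

lemma e2_power_int_multiple:
  assumes "real n * x \<in> \<int>" shows "e2 (of_real x) ^ n = 1"
proof -
  obtain i where i: "real n * x = of_int i" using assms by (elim Ints_cases)
  have "of_nat n * of_real x = (of_real (real n * x) :: complex)" by simp
  also have "\<dots> = of_int i" unfolding i by simp
  finally show ?thesis unfolding e2_power by simp
qed

text \<open>Each factor picks up the phase -e2 (-b/ss), with b in (1/g)Z and ss = q/g. The even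
  exponent removes the sign, and its factor q the root of unity.\<close>

lemma Ps_eta:
  assumes z: "z \<in> H2"
  shows "Ps (of_real (\<epsilon>\<^sup>2) * fst z, of_real (1 / \<epsilon>\<^sup>2) * snd z) ^ (2 * nn * q) = Ps z ^ (2 * nn * q)"
proof -
  let ?e = "(of_real (\<epsilon>\<^sup>2) * fst z, of_real (1 / \<epsilon>\<^sup>2) * snd z)"
  have fe: "fp p ?e ^ (2 * nn * q) = fp p z ^ (2 * nn * q)" if p: "p \<in> Rp" for p
  proof -
    note c = cf[OF Rp_P0[OF p]]
    have "fp p ?e = - e2 (- of_real (snd p / ss)) * fp p z"
      using cusp_factor.ff_eta[OF c z, of "snd p"] unfolding fp_def cusp_factor.eta_def[OF c] .
    then have "fp p ?e ^ (2 * nn * q) = (- e2 (of_real (- (snd p / ss)))) ^ (2 * nn * q) * fp p z ^ (2 * nn * q)"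
      by (simp add: power_mult_distrib)
    also have "(- e2 (of_real (- (snd p / ss)))) ^ (2 * nn * q) = e2 (of_real (- (snd p / ss))) ^ (2 * nn * q)"
      by (simp add: mult.assoc power_minus_even power_mult)
    also have "\<dots> = 1"
    proof (rule e2_power_int_multiple)
      have gp: "(of_int g :: real) > 0" using g0 by simp
      have qp: "real q > 0" using q by simp
      have "real (2 * nn * q) * (- (snd p / ss)) = - (of_int (int (2 * nn)) * (of_int g * snd p))"
        using gp qp by (simp add: ss_def field_simps)
      also have "\<dots> \<in> \<int>" by (intro Ints_minus Ints_mult Ints_of_int P0D(5)[OF Rp_P0[OF p]])
      finally show "real (2 * nn * q) * (- (snd p / ss)) \<in> \<int>" .
    qed
    finally show ?thesis by simp
  qed
  show ?thesis unfolding Ps_def prod_power_distrib by (intro prod.cong refl fe)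
qed

lemma Ps_scale:
  assumes z: "z \<in> H2"
  shows "Ps (of_real (\<epsilon>\<^sup>2 powi j) * fst z, of_real (\<epsilon>\<^sup>2 powi (- j)) * snd z) ^ (2 * nn * q) = Ps z ^ (2 * nn * q)"
proof -
  define T where "T j z = (of_real (\<epsilon>\<^sup>2 powi j) * fst z, of_real (\<epsilon>\<^sup>2 powi (- j)) * snd z)" for j :: int and z :: "complex \<times> complex"
  have ep: "\<epsilon>\<^sup>2 powi j > 0" for j using ee0 by (rule zero_less_power_int)
  have TH: "T j z \<in> H2" for j using z ep[of j] ep[of "- j"] unfolding T_def H2_iff fst_conv snd_conv
    by (simp only: Im_complex_of_real Re_complex_of_real times_complex.sel mult_zero_left add_0_right mult_pos_pos simp_thms)
  have step: "T (j + 1) z = (of_real (\<epsilon>\<^sup>2) * fst (T j z), of_real (1 / \<epsilon>\<^sup>2) * snd (T j z))" for j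
  proof -
    have "\<epsilon>\<^sup>2 powi (j + 1) = \<epsilon>\<^sup>2 * \<epsilon>\<^sup>2 powi j" using ee_ne by (simp add: power_int_add_1 mult.commute)
    moreover have "\<epsilon>\<^sup>2 powi (- (j + 1)) = (1 / \<epsilon>\<^sup>2) * \<epsilon>\<^sup>2 powi (- j)"
    proof -
      have "\<epsilon>\<^sup>2 powi (- (j + 1)) = \<epsilon>\<^sup>2 powi (- 1 + - j)" by (rule arg_cong[where f = "\<lambda>i. \<epsilon>\<^sup>2 powi i"]) simp
      also have "\<dots> = \<epsilon>\<^sup>2 powi (- 1) * \<epsilon>\<^sup>2 powi (- j)" using ee_ne by (intro power_int_add) auto
      also have "\<epsilon>\<^sup>2 powi (- 1) = 1 / \<epsilon>\<^sup>2" by (simp add: power_int_minus inverse_eq_divide)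
      finally show ?thesis .
    qed
    ultimately show ?thesis by (simp only: T_def fst_conv snd_conv of_real_mult mult.assoc)
  qed
  have "Ps (T j z) ^ (2 * nn * q) = Ps z ^ (2 * nn * q)"
  proof (induction j rule: int_induct[where k = 0])
    case base
    then show ?case by (simp add: T_def)
  next
    case (step1 i)
    then show ?case using step[of i] Ps_eta[OF TH[of i]] by (simp only:)
  next
    case (step2 i)
    then show ?case using step[of "i - 1"] Ps_eta[OF TH[of "i - 1"]] by (simp only: diff_add_cancel)
  qed
  then show ?thesis by (simp only: T_def)
qed

text \<open>Scaling the slope by \<epsilon>^(2k), translating and scaling back keeps the slope x and
  changes the offset by the trace that the k-th factor sees.\<close>

lemma translated_form:
  assumes \<nu>: "\<nu> \<in> F" and T: "\<And>p. p \<in> P0 \<Longrightarrow> (fst p, snd p + (fst p * \<nu> + cj (fst p) * cj \<nu>)) \<in> P0"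
    and p: "(x, b) \<in> P0"
  shows "(x, b + (x * \<epsilon>\<^sup>2 powi k * \<nu> + cj (x * \<epsilon>\<^sup>2 powi k) * cj \<nu>)) \<in> P0"
proof -
  have "(x * \<epsilon>\<^sup>2 powi k, b) \<in> P0" using P0_scale[OF p, of k] by simp
  from P0_scale[OF T[OF this], of "- k"]
  show ?thesis by (simp only: fst_conv snd_conv mult.assoc ee_powi_inv mult_1_right)
qed

text \<open>The map b |-> b + \<theta>, reduced into [0, ss), sends the finite set of offsets with
  slope x to itself and is injective, hence permutes it; periodicity of \<open>f\<close> makes the
  reduction invisible.\<close>

lemma prod_residues:
  fixes f :: "complex \<Rightarrow> complex"
  assumes \<theta>: "\<And>b. (x, b) \<in> P0 \<Longrightarrow> (x, b + \<theta>) \<in> P0" and f: "\<And>y i. f (y + of_real (of_int i * ss)) = f y"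
  shows "(\<Prod>b | (x, b) \<in> Rp. f (w + of_real \<theta> + of_real b)) = (\<Prod>b | (x, b) \<in> Rp. f (w + of_real b))"
proof -
  define B where "B = {b. (x, b) \<in> Rp}"
  define r where "r b = b + \<theta> + of_int (- \<lfloor>(b + \<theta>) / ss\<rfloor>) * ss" for b
  have fin: "finite B" unfolding B_def
    by (rule finite_subset[OF _ finite_imageI[OF finite_Rp, of snd]]) force
  have bd: "0 \<le> b" "b < ss" if "b \<in> B" for b using that by (simp_all add: B_def Rp_def)
  have rB: "r b \<in> B" if b: "b \<in> B" for b
  proof -
    have bR: "(x, b) \<in> Rp" using b by (simp add: B_def)
    have "(x, r b) \<in> P0" using P0_shift[OF \<theta>[OF Rp_P0[OF bR]], of "- \<lfloor>(b + \<theta>) / ss\<rfloor>"] by (simp add: r_def)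
    moreover have "of_int \<lfloor>(b + \<theta>) / ss\<rfloor> * ss \<le> b + \<theta>" "b + \<theta> < (of_int \<lfloor>(b + \<theta>) / ss\<rfloor> + 1) * ss"
      using ss0 by (rule floor_divide_lower, rule floor_divide_upper)
    then have "0 \<le> r b" "r b < ss" by (simp_all add: r_def algebra_simps)
    ultimately show ?thesis using bR by (simp add: B_def Rp_def)
  qed
  have inj: "inj_on r B"
  proof (rule inj_onI)
    fix b b' assume b: "b \<in> B" "b' \<in> B" "r b = r b'"
    define i where "i = \<lfloor>(b + \<theta>) / ss\<rfloor> - \<lfloor>(b' + \<theta>) / ss\<rfloor>"
    have e: "b - b' = of_int i * ss" using b(3) by (simp add: r_def i_def algebra_simps)
    have "\<bar>b - b'\<bar> < ss" using bd[OF b(1)] bd[OF b(2)] by linarith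
    then have "\<bar>of_int i\<bar> * ss < 1 * ss" unfolding e abs_mult using ss0 by simp
    then have "\<bar>of_int i :: real\<bar> < 1" using ss0 by simp
    then have "i = 0" by linarith
    then show "b = b'" using e by simp
  qed
  have "r ` B = B" using endo_inj_surj[OF fin _ inj] rB by blast
  then have bij: "bij_betw r B B" using inj by (simp add: bij_betw_def)
  have "f (w + of_real \<theta> + of_real b) = f (w + of_real (r b))" for b
    using f[of "w + of_real \<theta> + of_real b" "- \<lfloor>(b + \<theta>) / ss\<rfloor>"] by (simp add: r_def algebra_simps)
  then have "(\<Prod>b\<in>B. f (w + of_real \<theta> + of_real b)) = (\<Prod>b\<in>B. f (w + of_real (r b)))" by simp
  also have "\<dots> = (\<Prod>b\<in>B. f (w + of_real b))" by (rule prod.reindex_bij_betw[OF bij])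
  finally show ?thesis unfolding B_def .
qed

end

section \<open>Invariance under the stabilizer of the cusp\<close>

context cusp_data
begin

text \<open>A translation adds the constant \<kappa> to the Weyl vector. Multiplication by nn = -(e
  - 1)(1/e - 1), with e = \<epsilon>^2, cancels the denominators e - 1 and 1/e - 1, and what remains
  is a difference of two changes of offsets, each in (1/g)Z.\<close>

lemma translation_multiplier:
  assumes \<nu>: "\<nu> \<in> F" and T: "\<And>p. p \<in> P0 \<Longrightarrow> (fst p, snd p + (fst p * \<nu> + cj (fst p) * cj \<nu>)) \<in> P0"
    and p: "p \<in> P0"
  shows "e2 (cusp_factor.wv (fst p) (cj (fst p)) (\<epsilon>\<^sup>2) ss (fst z + of_real \<nu>, snd z + of_real (cj \<nu>))) ^ (2 * nn * q)
    = e2 (cusp_factor.wv (fst p) (cj (fst p)) (\<epsilon>\<^sup>2) ss z) ^ (2 * nn * q)"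
proof -
  define x b where "x = fst p" and "b = snd p"
  have xb: "(x, b) \<in> P0" using p by (simp add: x_def b_def)
  have xF: "x \<in> F" using P0D(2)[OF p] by (simp add: x_def)
  have gp: "(of_int g :: real) > 0" using g0 by simp
  define t t' where "t = x * \<nu>" and "t' = cj x * cj \<nu>"
  define e where "e = \<epsilon>\<^sup>2"
  have e: "e \<noteq> 0" "e \<noteq> 1" "e > 0" "e > 1" using ee0 ee_ne ee1 by (simp_all add: e_def)
  \<comment> \<open>These are the changes that the translation makes to the offsets for the slopes x
    and x/e. Old and new offsets belong to forms in \<open>P0\<close>, so they are in
    (1/g)Z.\<close>
  have Z: "of_int g * (t + t') \<in> \<int>" "of_int g * (t / e + t' * e) \<in> \<int>"
  proof -
    have gb: "of_int g * b \<in> \<int>" using P0D(5)[OF xb] by simp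
    have *: "of_int g * (x * e powi k * \<nu> + cj (x * e powi k) * cj \<nu>) \<in> \<int>" for k
    proof -
      have "of_int g * (b + (x * e powi k * \<nu> + cj (x * e powi k) * cj \<nu>)) \<in> \<int>"
        using P0D(5)[OF translated_form[OF \<nu> T xb, of k]] by (simp add: e_def)
      from Ints_diff[OF this gb] show ?thesis by (simp add: algebra_simps)
    qed
    show "of_int g * (t + t') \<in> \<int>" using *[of 0] by (simp add: t_def t'_def)
    have "cj (x * e powi (- 1)) = cj x * e"
      using xF powi_F[OF eeF, of "- 1"] cj_ee_powi[of "- 1"] by (simp add: e_def)
    moreover have "e powi (- 1) = 1 / e" by (simp add: power_int_minus inverse_eq_divide)
    ultimately show "of_int g * (t / e + t' * e) \<in> \<int>" using *[of "- 1"] by (simp add: t_def t'_def mult_ac)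
  qed
  define \<kappa> where "\<kappa> = (x / (e - 1) * \<nu> + cj x / (1 / e - 1) * cj \<nu>) / ss"
  have "real (2 * nn * q) * \<kappa> = of_int 2 * (of_int g * (t + t') - of_int g * (t / e + t' * e))"
  proof -
    have n: "real nn = - ((e - 1) * (1 / e - 1))" unfolding nn e_def using ee_ne by (simp add: field_simps)
    have e': "e - 1 \<noteq> 0" "1 / e - 1 \<noteq> 0" using e by (simp_all add: field_simps)
    have "real nn * (x / (e - 1) * \<nu> + cj x / (1 / e - 1) * cj \<nu>) = - ((1 / e - 1) * t + (e - 1) * t')"
    proof -
      have "- (a * c) * (x / a * \<nu> + y / c * \<mu>) = - (c * (x * \<nu>) + a * (y * \<mu>))" if "a \<noteq> 0" "c \<noteq> 0" for a c y \<mu>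
        using that by (simp add: field_simps)
      from this[OF e'] show ?thesis unfolding n t_def t'_def .
    qed
    then have *: "real nn * (x / (e - 1) * \<nu> + cj x / (1 / e - 1) * cj \<nu>) = (t + t') - (t / e + t' * e)"
      by (simp add: algebra_simps)
    have "real (2 * nn * q) * \<kappa> = 2 * (real q / ss) * (real nn * (x / (e - 1) * \<nu> + cj x / (1 / e - 1) * cj \<nu>))"
      by (simp add: \<kappa>_def)
    also have "real q / ss = of_int g" using q gp by (simp add: ss_def)
    finally show ?thesis unfolding * by (simp add: algebra_simps)
  qed
  also have "\<dots> \<in> \<int>" by (intro Ints_mult Ints_diff Z Ints_of_int)
  finally have 1: "e2 (of_real \<kappa>) ^ (2 * nn * q) = 1" by (rule e2_power_int_multiple)
  have "cusp_factor.wv x (cj x) e ss (fst z + of_real \<nu>, snd z + of_real (cj \<nu>)) = cusp_factor.wv x (cj x) e ss z + of_real \<kappa>"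
  proof -
    define P1 P2 where "P1 = x / (e - 1)" and "P2 = cj x / (1 / e - 1)"
    have wv: "cusp_factor.wv x (cj x) e ss w = (of_real P1 * fst w + of_real P2 * snd w) / of_real ss" for w
      using cusp_factor.wv_def[OF cf[OF p], of w] unfolding x_def[symmetric] e_def[symmetric] P1_def[symmetric] P2_def[symmetric] .
    have "of_real \<kappa> = (of_real P1 * of_real \<nu> + of_real P2 * of_real (cj \<nu>)) / (of_real ss :: complex)"
      unfolding \<kappa>_def P1_def[symmetric] P2_def[symmetric] by simp
    then show ?thesis unfolding wv fst_conv snd_conv by (simp only: add_divide_distrib distrib_left add_ac)
  qed
  then show ?thesis unfolding x_def[symmetric] e_def[symmetric] by (simp add: e2_add power_mult_distrib 1)
qed

text \<open>The translation changes the offset in the k-th factor by a trace that depends on k, so a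
  single infinite product is not preserved. For fixed k, however, it permutes the offsets of slope x
  modulo \<open>ss\<close>; hence the products over b agree for each k, and interchanging the finite
  products and passing to the limit gives the claim.\<close>

lemma translation_product:
  assumes \<nu>: "\<nu> \<in> F" and T: "\<And>p. p \<in> P0 \<Longrightarrow> (fst p, snd p + (fst p * \<nu> + cj (fst p) * cj \<nu>)) \<in> P0"
    and z: "z \<in> H2" and x: "x \<in> fst ` Rp"
  defines "z' \<equiv> (fst z + of_real \<nu>, snd z + of_real (cj \<nu>))"
  shows "(\<Prod>b | (x, b) \<in> Rp. cusp_factor.pp x (cj x) (\<epsilon>\<^sup>2) ss b z' * cusp_factor.pm x (cj x) (\<epsilon>\<^sup>2) ss b z')
    = (\<Prod>b | (x, b) \<in> Rp. cusp_factor.pp x (cj x) (\<epsilon>\<^sup>2) ss b z * cusp_factor.pm x (cj x) (\<epsilon>\<^sup>2) ss b z)"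
proof -
  obtain b0 where b0: "(x, b0) \<in> Rp" using x by auto
  have c: "cusp_factor x (cj x) (\<epsilon>\<^sup>2) ss" using cf[OF Rp_P0[OF b0]] by simp
  interpret cusp_factor x "cj x" "\<epsilon>\<^sup>2" ss b for b by (rule c)
  have zH: "z' \<in> H2" using z by (simp add: z'_def H2_iff)
  have xF: "x \<in> F" using P0D(2)[OF Rp_P0[OF b0]] by simp
  define \<theta> where "\<theta> k = x * \<epsilon>\<^sup>2 powi k * \<nu> + cj (x * \<epsilon>\<^sup>2 powi k) * cj \<nu>" for k :: int
  have \<theta>: "(x, b + \<theta> k) \<in> P0" if "(x, b) \<in> P0" for b k
    unfolding \<theta>_def by (rule translated_form[OF \<nu> T that])
  have "cj (x * \<epsilon>\<^sup>2 powi k) = cj x * \<epsilon>\<^sup>2 powi (- k)" for k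
    using xF powi_F[OF eeF, of k] cj_ee_powi[of k] by simp
  then have lin: "lin k z' = lin k z + of_real (\<theta> k)" for k
    unfolding lin_def z'_def \<theta>_def fst_conv snd_conv by (simp add: algebra_simps del: of_real_power_int)
  have s0: "(of_real ss :: complex) \<noteq> 0" using ss0 by simp
  have e2s: "e2 ((y + of_real (of_int i * ss)) / of_real ss) = e2 (y / of_real ss)" for y i
  proof -
    have "(y + of_real (of_int i * ss)) / of_real ss = y / of_real ss + of_int i" using s0 by (simp add: add_divide_distrib)
    then show ?thesis by (simp add: e2_add)
  qed
  have e2m: "e2 (- (y + of_real (of_int i * ss)) / of_real ss) = e2 (- y / of_real ss)" for y i
    using e2s[of y i] by (simp only: minus_divide_left[symmetric] e2_minus)
  have P: "(\<Prod>b | (x, b) \<in> Rp. 1 - e2 (xp b k z')) = (\<Prod>b | (x, b) \<in> Rp. 1 - e2 (xp b k z))" for k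
    unfolding xp_def lin by (rule prod_residues[of x "\<theta> (int k)" "\<lambda>y. 1 - e2 (y / of_real ss)" "lin (int k) z", OF \<theta>]) (simp_all only: e2s)
  have M: "(\<Prod>b | (x, b) \<in> Rp. 1 - e2 (xm b k z')) = (\<Prod>b | (x, b) \<in> Rp. 1 - e2 (xm b k z))" for k
    unfolding xm_def lin by (rule prod_residues[of x "\<theta> (- int k - 1)" "\<lambda>y. 1 - e2 (- y / of_real ss)" "lin (- int k - 1) z", OF \<theta>]) (simp_all only: e2m)
  have lim: "(\<lambda>n. \<Prod>b | (x, b) \<in> Rp. \<Prod>k<n. (1 - e2 (xp b k w)) * (1 - e2 (xm b k w))) \<longlonglongrightarrow> (\<Prod>b | (x, b) \<in> Rp. pp b w * pm b w)"
    if "w \<in> H2" for w by (intro tendsto_prod ff_LIMSEQ that)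
  have "(\<Prod>b | (x, b) \<in> Rp. \<Prod>k<n. (1 - e2 (xp b k z')) * (1 - e2 (xm b k z')))
      = (\<Prod>b | (x, b) \<in> Rp. \<Prod>k<n. (1 - e2 (xp b k z)) * (1 - e2 (xm b k z)))" for n
    by (subst (1 2) prod.swap) (simp only: prod.distrib P M)
  then show ?thesis using LIMSEQ_unique[OF lim[OF zH]] lim[OF z] by simp
qed

lemma Ps_translation:
  assumes \<nu>: "\<nu> \<in> F" and T: "\<And>p. p \<in> P0 \<Longrightarrow> (fst p, snd p + (fst p * \<nu> + cj (fst p) * cj \<nu>)) \<in> P0" and z: "z \<in> H2"
  shows "Ps (fst z + of_real \<nu>, snd z + of_real (cj \<nu>)) ^ (2 * nn * q) = Ps z ^ (2 * nn * q)"
proof -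
  let ?z = "(fst z + of_real \<nu>, snd z + of_real (cj \<nu>))"
  let ?n = "2 * nn * q"
  have split: "Ps w = (\<Prod>x\<in>fst ` Rp. \<Prod>b | (x, b) \<in> Rp. fp (x, b) w)" for w
  proof -
    have "Rp = Sigma (fst ` Rp) (\<lambda>x. {b. (x, b) \<in> Rp})" by force
    moreover have "finite {b. (x, b) \<in> Rp}" for x
      by (rule finite_subset[OF _ finite_imageI[OF finite_Rp, of snd]]) force
    ultimately show ?thesis unfolding Ps_def
      using prod.Sigma[of "fst ` Rp" "\<lambda>x. {b. (x, b) \<in> Rp}" "\<lambda>x b. fp (x, b) w"] finite_Rp by simp
  qed
  have *: "(\<Prod>b | (x, b) \<in> Rp. fp (x, b) ?z) ^ ?n = (\<Prod>b | (x, b) \<in> Rp. fp (x, b) z) ^ ?n" if x: "x \<in> fst ` Rp" for x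
  proof -
    have c: "cusp_factor x (cj x) (\<epsilon>\<^sup>2) ss" using x cf[OF Rp_P0] by force
    let ?w = "\<lambda>z. e2 (cusp_factor.wv x (cj x) (\<epsilon>\<^sup>2) ss z)"
    define B where "B w = (\<Prod>b | (x, b) \<in> Rp. cusp_factor.pp x (cj x) (\<epsilon>\<^sup>2) ss b w * cusp_factor.pm x (cj x) (\<epsilon>\<^sup>2) ss b w)" for w
    have B: "B ?z = B z" unfolding B_def by (rule translation_product[OF \<nu> T z x])
    have f: "(\<Prod>b | (x, b) \<in> Rp. fp (x, b) w) ^ ?n = (\<Prod>b | (x, b) \<in> Rp. ?w w ^ ?n) * B w ^ ?n" for w
      unfolding B_def fp_def fst_conv snd_conv cusp_factor.ff_def[OF c] prod.distrib power_mult_distrib prod_power_distrib ..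
    have "?w ?z ^ ?n = ?w z ^ ?n" using translation_multiplier[OF \<nu> T] x Rp_P0 by fastforce
    then show ?thesis unfolding f B by simp
  qed
  have "Ps ?z ^ ?n = (\<Prod>x\<in>fst ` Rp. (\<Prod>b | (x, b) \<in> Rp. fp (x, b) ?z) ^ ?n)" unfolding split by (rule prod_power_distrib)
  also have "\<dots> = (\<Prod>x\<in>fst ` Rp. (\<Prod>b | (x, b) \<in> Rp. fp (x, b) z) ^ ?n)" by (rule prod.cong[OF refl *])
  also have "\<dots> = Ps z ^ ?n" unfolding split by (rule prod_power_distrib[symmetric])
  finally show ?thesis .
qed

text \<open>A nonzero lower left entry c in \<open>R\<close> has norm at least 1 in absolute value.
  As |c z + d| >= |c| Im z in both coordinates, the new product of imaginary parts is at most the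
  reciprocal of the old one and so less than 1.\<close>

lemma horoball_separation:
  assumes M: "M \<in> G" "M$2$1 \<in> R" and z: "z \<in> HB C" "act2 M z \<in> HB C" and C: "C \<ge> 1"
  shows "M$2$1 = 0"
proof (rule ccontr)
  assume c0: "M$2$1 \<noteq> 0"
  have zH: "z \<in> H2" using z HB_H2 by blast
  define y1 y2 c c' where "y1 = Im (fst z)" and "y2 = Im (snd z)" and "c = M$2$1" and "c' = cj (M$2$1)"
  have y: "y1 > 0" "y2 > 0" using zH by (simp_all add: H2_iff y1_def y2_def)
  have cF: "c \<in> F" using M(1) by (simp add: c_def)
  obtain i where i: "c * c' = of_int i" using R_norm[OF M(2)] unfolding c_def c'_def by (elim Ints_cases)
  have "c * c' \<noteq> 0" using c0 cF by (simp add: c_def c'_def)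
  then have "1 \<le> \<bar>c * c'\<bar>" unfolding i by (simp add: of_int_abs[symmetric] del: of_int_abs)
  then have N: "1 \<le> (c * c')\<^sup>2" using one_le_power[of "\<bar>c * c'\<bar>" 2] by simp
  have "\<bar>c * y1\<bar> \<le> cmod (aut M (fst z))" using abs_Im_le_cmod[of "aut M (fst z)"] by (simp add: aut_def c_def y1_def)
  then have a1: "(c * y1)\<^sup>2 \<le> (cmod (aut M (fst z)))\<^sup>2" by (metis abs_ge_zero power2_abs power_mono)
  have "\<bar>c' * y2\<bar> \<le> cmod (aut (cjm M) (snd z))" using abs_Im_le_cmod[of "aut (cjm M) (snd z)"] by (simp add: aut_def c'_def y2_def)
  then have a2: "(c' * y2)\<^sup>2 \<le> (cmod (aut (cjm M) (snd z)))\<^sup>2" by (metis abs_ge_zero power2_abs power_mono)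
  have cc: "c \<noteq> 0" "c' \<noteq> 0" using \<open>c * c' \<noteq> 0\<close> by auto
  have Q: "y1 * y2 > C" using z(1) by (simp add: HB_def y1_def y2_def)
  have "Im (fst (act2 M z)) * Im (snd (act2 M z)) =
      y1 * y2 / ((cmod (aut M (fst z)))\<^sup>2 * (cmod (aut (cjm M) (snd z)))\<^sup>2)"
    using Im_mob[OF G_det[OF M(1)], of "fst z"] Im_mob[OF G_det_cjm[OF M(1)], of "snd z"]
    by (simp add: act2_def y1_def y2_def)
  also have "\<dots> \<le> y1 * y2 / ((c * y1)\<^sup>2 * (c' * y2)\<^sup>2)"
    using y cc a1 a2 by (intro divide_left_mono mult_mono mult_pos_pos zero_less_power2[THEN iffD2]) (auto intro!: mult_pos_pos zero_less_power2[THEN iffD2] simp: aut_nz[OF M(1) zH])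
  also have "(c * y1)\<^sup>2 * (c' * y2)\<^sup>2 = (c * c')\<^sup>2 * (y1 * y2)\<^sup>2" by (simp add: power_mult_distrib mult_ac)
  also have "y1 * y2 / ((c * c')\<^sup>2 * (y1 * y2)\<^sup>2) \<le> y1 * y2 / (1 * (y1 * y2)\<^sup>2)"
    using N y cc by (intro divide_left_mono mult_right_mono mult_pos_pos) auto
  also have "\<dots> = 1 / (y1 * y2)" using y by (simp add: power2_eq_square)
  also have "\<dots> < 1" using Q C y by simp
  finally show False using z(2) C by (simp add: HB_def)
qed

text \<open>By \<open>horoball_separation\<close> the conjugated element fixes infinity, so it is a
  translation followed by scaling with the square of a unit. All units are powers of \<epsilon> up
  to sign, so \<open>Ps_scale\<close> covers the scaling and \<open>Ps_translation\<close> the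
  rest.\<close>

lemma Ps_\<Gamma>_invariant:
  assumes \<gamma>: "\<gamma> \<in> \<Gamma>" and z: "z \<in> HB C" "act2 (inv2 \<alpha> ** \<gamma> ** \<alpha>) z \<in> HB C" and C: "C \<ge> 1"
  shows "Ps (act2 (inv2 \<alpha> ** \<gamma> ** \<alpha>) z) ^ (2 * nn * q) = Ps z ^ (2 * nn * q)"
proof -
  define M where "M = inv2 \<alpha> ** \<gamma> ** \<alpha>"
  note fc = frame_conj[OF fr \<gamma>, folded M_def]
  have zH: "z \<in> H2" using z HB_H2 by blast
  have M21: "M$2$1 = 0" by (rule horoball_separation[OF fc(1,2) z[folded M_def] C])
  define u where "u = M$1$1"
  have d: "u * M$2$2 = 1" using G_det[OF fc(1)] M21 by (simp add: u_def)
  have u0: "u \<noteq> 0" using d by auto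
  have M22: "M$2$2 = inverse u" using d by (simp add: inverse_unique)
  have u: "unitR u" using fc(3,4) u0 M22 by (simp add: unitR_def u_def)
  have uF: "u \<in> F" using fc(1) by (simp add: u_def)
  define \<nu> where "\<nu> = M$1$2 / u"
  have \<nu>F: "\<nu> \<in> F" using fc(1) uF by (simp add: \<nu>_def divide_inverse)
  have M12: "M$1$2 = u * \<nu>" using u0 by (simp add: \<nu>_def)
  obtain k where "u = \<epsilon> powi k \<or> u = - (\<epsilon> powi k)" using \<epsilon>(3) u by blast
  then have uk: "u\<^sup>2 = \<epsilon>\<^sup>2 powi k" using powi_sq[of k] by auto
  have aM: "\<alpha> ** M = \<gamma> ** \<alpha>"
    unfolding M_def using inv2_right[OF aG] by (simp add: matrix_mul_assoc)
  \<comment> \<open>Scaling the slope by the inverse power first cancels the factor u^2 of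
    \<open>P0_pull\<close> and leaves a pure translation.\<close>
  have T: "(fst p, snd p + (fst p * \<nu> + cj (fst p) * cj \<nu>)) \<in> P0" if p: "p \<in> P0" for p
  proof -
    have e: "fst p * \<epsilon>\<^sup>2 powi (- k) * u\<^sup>2 = fst p" unfolding uk by (simp only: mult.assoc ee_powi_inv mult_1_right)
    show ?thesis
      using P0_pull[OF P0_scale[OF p, of "- k"] \<gamma> fc(1) aM M21 u_def[symmetric] M12 u \<nu>F] unfolding fst_conv snd_conv e .
  qed
  let ?t = "(fst z + of_real \<nu>, snd z + of_real (cj \<nu>))"
  have tH: "?t \<in> H2" using zH by (simp add: H2_iff)
  have cu0: "cj u \<noteq> 0" using uF u0 by simp
  have "fst (act2 M z) = of_real (u\<^sup>2) * (fst z + of_real \<nu>)"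
    using u0 by (simp add: act2_def mob_def aut_def M21 M22 M12 u_def[symmetric] power2_eq_square field_simps)
  moreover have "snd (act2 M z) = of_real ((cj u)\<^sup>2) * (snd z + of_real (cj \<nu>))"
    using cu0 uF \<nu>F by (simp add: act2_def mob_def aut_def M21 M22 M12 u_def[symmetric] power2_eq_square field_simps)
  moreover have "(cj u)\<^sup>2 = \<epsilon>\<^sup>2 powi (- k)"
    using arg_cong[OF uk, of cj] cj_ee_powi[of k] uF by simp
  ultimately have "act2 M z = (of_real (\<epsilon>\<^sup>2 powi k) * fst ?t, of_real (\<epsilon>\<^sup>2 powi (- k)) * snd ?t)"
    unfolding uk by (simp only: prod_eq_iff fst_conv snd_conv simp_thms)
  then have "Ps (act2 M z) ^ (2 * nn * q) = Ps ?t ^ (2 * nn * q)" using Ps_scale[OF tH, of k] by (simp only:)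
  also have "\<dots> = Ps z ^ (2 * nn * q)" by (rule Ps_translation[OF \<nu>F T zH])
  finally show ?thesis unfolding M_def .
qed

section \<open>Limit at the cusp and curves near it\<close>

lemma fp_small:
  assumes p: "p \<in> P0" and d: "d > 0"
  obtains Y where "\<And>z. z \<in> H2 \<Longrightarrow> Y < Im (fst z) * Im (snd z) \<Longrightarrow> cmod (fp p z) < d"
proof -
  obtain A k where A: "A > 0" "k > 0"
    "\<And>z. z \<in> H2 \<Longrightarrow> 1 \<le> Im (fst z) * Im (snd z) \<Longrightarrow> cmod (fp p z) \<le> A * exp (- k * sqrt (Im (fst z) * Im (snd z)))"
    by (rule cusp_factor.ff_bound[OF cf[OF p] zero_less_one, of "snd p"]) (use that in \<open>simp add: fp_def\<close>)
  show ?thesis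
  \<comment> \<open>For larger Y one has A / (k sqrt Y) < d, which suffices by exp(-x) <= 1/x; the
    summand 1 keeps the point in the range of \<open>ff_bound\<close>.\<close>
  proof (rule that[of "1 + (A / (k * d))\<^sup>2"])
    fix z assume z: "z \<in> H2" and Y: "1 + (A / (k * d))\<^sup>2 < Im (fst z) * Im (snd z)"
    let ?Y = "Im (fst z) * Im (snd z)"
    have Y1: "1 \<le> ?Y" "(A / (k * d))\<^sup>2 < ?Y" using Y zero_le_power2[of "A / (k * d)"] by linarith+
    have Ad: "A / (k * d) > 0" using A d by (intro divide_pos_pos mult_pos_pos) auto
    have "A / (k * d) < sqrt ?Y" using Y1(2) by (rule real_less_rsqrt)
    then have "A < sqrt ?Y * (k * d)" using A d by (simp add: pos_divide_less_eq)
    then have ks: "A < k * sqrt ?Y * d" by (simp add: mult_ac)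
    have s0: "k * sqrt ?Y > 0" using A Y1(1) by (intro mult_pos_pos) auto
    have "cmod (fp p z) \<le> A * exp (- (k * sqrt ?Y))" using A(3)[OF z Y1(1)] by simp
    also have "\<dots> \<le> A * (1 / (k * sqrt ?Y))" using A by (intro mult_left_mono exp_neg_le s0) auto
    also have "\<dots> = A / (k * sqrt ?Y)" by simp
    also have "\<dots> < d" unfolding pos_divide_less_eq[OF s0] using ks by (simp add: mult_ac)
    finally show "cmod (fp p z) < d" .
  qed
qed

text \<open>Without classes in \<open>Rp\<close> the product is empty and equals 1; otherwise every
  factor tends to 0 at the cusp.\<close>

definition cv :: complex where "cv = (if Rp = {} then 1 else 0)"

lemma Ps_limit:
  assumes d: "d > 0"
  shows "\<exists>C'\<ge>real m. \<forall>z\<in>HB C'. cmod (Ps z ^ (2 * nn * q) - cv) < d"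
proof (cases "Rp = {}")
  case True
  then show ?thesis using d by (intro exI[of _ "real m"]) (simp add: Ps_def cv_def)
next
  case False
  \<comment> \<open>A single factor has to be below d; the cap at 1 keeps the others, and the
    passage to a power, from enlarging it.\<close>
  define d' where "d' = min d 1"
  have d': "d' > 0" using d by (simp add: d'_def)
  have "\<exists>Y. \<forall>z\<in>H2. Y < Im (fst z) * Im (snd z) \<longrightarrow> cmod (fp p z) < d'" if "p \<in> Rp" for p
    by (rule fp_small[OF Rp_P0[OF that] d']) (intro exI ballI impI; assumption)
  then have "\<forall>p\<in>Rp. \<exists>Y. \<forall>z\<in>H2. Y < Im (fst z) * Im (snd z) \<longrightarrow> cmod (fp p z) < d'" by (intro ballI)
  then obtain Y where Y: "\<forall>p\<in>Rp. \<forall>z\<in>H2. Y p < Im (fst z) * Im (snd z) \<longrightarrow> cmod (fp p z) < d'" unfolding bchoice_iff by (elim exE)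
  define C' where "C' = real m + (\<Sum>p\<in>Rp. \<bar>Y p\<bar>)"
  have "cmod (Ps z ^ (2 * nn * q) - cv) < d" if z: "z \<in> HB C'" for z
  proof -
    have zH: "z \<in> H2" and zC: "C' < Im (fst z) * Im (snd z)" using z by (simp_all add: HB_def)
    have sm: "cmod (fp p z) < d'" if p: "p \<in> Rp" for p
    proof -
      have "\<bar>Y p\<bar> \<le> (\<Sum>p\<in>Rp. \<bar>Y p\<bar>)" using finite_Rp p by (intro member_le_sum) auto
      then have "Y p < Im (fst z) * Im (snd z)" using zC unfolding C'_def by linarith
      then show ?thesis using bspec[OF bspec[OF Y p] zH] by simp
    qed
    obtain p where p: "p \<in> Rp" using False by blast
    have P: "Ps z = fp p z * (\<Prod>p\<in>Rp - {p}. fp p z)" unfolding Ps_def by (rule prod.remove[OF finite_Rp p])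
    have "cmod (\<Prod>p\<in>Rp - {p}. fp p z) \<le> 1" unfolding prod_norm[symmetric]
    proof (rule prod_le_1)
      fix x assume "x \<in> Rp - {p}"
      then have "cmod (fp x z) < d'" by (intro sm) simp
      then show "0 \<le> cmod (fp x z) \<and> cmod (fp x z) \<le> 1" by (simp add: d'_def)
    qed
    then have "cmod (Ps z) \<le> cmod (fp p z) * 1" unfolding P norm_mult by (intro mult_left_mono) auto
    then have Pd: "cmod (Ps z) < d'" using sm[OF p] by simp
    have n: "2 * nn * q \<ge> 1" using nn0 q by simp
    have "cmod (Ps z) ^ (2 * nn * q) \<le> cmod (Ps z) ^ 1"
      using Pd n by (intro power_decreasing) (auto simp: d'_def)
    then have "cmod (Ps z ^ (2 * nn * q)) < d'" using Pd by (simp add: norm_power)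
    then show ?thesis using False by (simp add: cv_def d'_def)
  qed
  moreover have "real m \<le> C'" unfolding C'_def by (simp add: sum_nonneg)
  ultimately show ?thesis by (intro exI[of _ C'] conjI ballI)
qed

text \<open>If the integer a in the pulled back form were nonzero, \<open>ell_zero_Im\<close> would
  give a^2 Im z1 Im z2 <= m/D <= m on the curve. This is the reason for height m of the horoball at
  every cusp.\<close>

lemma vertical_forms:
  assumes v: "v \<in> S" and z: "z \<in> HB (real m)" "act2 \<alpha> z \<in> curve v"
  obtains x b where "pull \<alpha> v = (0, x, b)" "z \<in> curve (0, x, b)"
proof -
  have zH: "z \<in> H2" using z HB_H2 by blast
  obtain a x b where p: "pull \<alpha> v = (a, x, b)" by (cases "pull \<alpha> v")
  have zc: "z \<in> curve (a, x, b)" using curve_pull[OF SV[OF v] aG zH] z(2) unfolding p by simp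
  have vL: "v \<in> LL" using SD(1)[OF v] by (simp add: HF_def)
  have aZ: "a \<in> \<int>" by (rule frame_pull_LL(1)[OF fr vL p])
  have n: "nrm (a, x, b) = real m / of_int D" using nrm_pull[OF SV[OF v] aG] HF_nrm[OF SD(1)[OF v]] p by simp
  have "a = 0"
  proof (rule ccontr)
    assume a0: "a \<noteq> 0"
    obtain i where i: "a = of_int i" using aZ by (elim Ints_cases)
    have "1 \<le> \<bar>a\<bar>" using a0 unfolding i by (simp add: of_int_abs[symmetric] del: of_int_abs)
    then have a1: "1 \<le> a\<^sup>2" using one_le_power[of "\<bar>a\<bar>" 2] by simp
    define y1 y2 where "y1 = Im (fst z)" and "y2 = Im (snd z)"
    have y: "y1 > 0" "y2 > 0" using zH by (simp_all add: H2_iff y1_def y2_def)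
    have "ell (a, x, b) (fst z, snd z) = 0" using zc by (simp add: curve_def)
    from ell_zero_Im(2)[OF refl this]
    have e: "y1 * (cmod (of_real a * snd z + of_real x))\<^sup>2 = real m / of_int D * y2" by (simp only: n y1_def y2_def)
    have "\<bar>a * y2\<bar> \<le> cmod (of_real a * snd z + of_real x)"
      using abs_Im_le_cmod[of "of_real a * snd z + of_real x"] by (simp add: y2_def)
    then have "(a * y2)\<^sup>2 \<le> (cmod (of_real a * snd z + of_real x))\<^sup>2" by (metis abs_ge_zero power2_abs power_mono)
    then have "y1 * (a * y2)\<^sup>2 \<le> real m / of_int D * y2" unfolding e[symmetric] using y by (intro mult_left_mono) auto
    then have "(y1 * y2 * a\<^sup>2) * y2 \<le> real m / of_int D * y2" by (simp add: power2_eq_square mult_ac)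
    then have "y1 * y2 * a\<^sup>2 \<le> real m / of_int D" by (rule mult_right_le_imp_le[OF _ y(2)])
    moreover have "y1 * y2 * 1 \<le> y1 * y2 * a\<^sup>2" using y a1 by (intro mult_left_mono) auto
    moreover have "real m / of_int D \<le> real m / 1" using D_ge_1 by (intro divide_left_mono) auto
    moreover have "real m < y1 * y2" using z(1) by (simp add: HB_def y1_def y2_def)
    ultimately show False by simp
  qed
  then show ?thesis using that[of x b] p zc by simp
qed

lemma ell_vertical: "ell (0, x, b) z = Lf (x, b) z"
  by (simp add: ell_def Lf_def)

lemma P0_of_curve:
  assumes v: "v \<in> S" and z: "z \<in> HB (real m)" "act2 \<alpha> z \<in> curve v"
  obtains p where "p \<in> P0" "Lf p z = 0" "pull \<alpha> v = (0, fst p, snd p) \<or> pull \<alpha> (- v) = (0, fst p, snd p)"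
proof -
  obtain x b where p: "pull \<alpha> v = (0, x, b)" "z \<in> curve (0, x, b)" by (rule vertical_forms[OF v z])
  have L: "Lf (x, b) z = 0" using p(2) unfolding curve_def ell_vertical by simp
  note f = form_at_cusp[OF v p(1)]
  show ?thesis
  proof (cases "x > 0")
    case True
    show ?thesis by (rule that[of "(x, b)"]) (use P0I(1)[OF v p(1) True] L p in simp_all)
  next
    case False
    then have x: "x < 0" using f(3) by simp
    have "Lf (- x, - b) z = - Lf (x, b) z" using f(1) by (simp add: Lf_def)
    then have "Lf (- x, - b) z = 0" using L by simp
    moreover have "pull \<alpha> (- v) = (0, - x, - b)" using pull_uminus[OF SV[OF v], of \<alpha>] p(1) by simp
    ultimately show ?thesis by (intro that[of "(- x, - b)"]) (use P0I(2)[OF v p(1) x] in simp_all)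
  qed
qed

lemma curve_of_P0:
  assumes p: "p \<in> P0" and z: "z \<in> H2" "Lf p z = 0"
  obtains v where "v \<in> S" "pull \<alpha> v = (0, fst p, snd p)" "act2 \<alpha> z \<in> curve v"
proof -
  obtain v where v: "v \<in> S" "pull \<alpha> v = (0, fst p, snd p)" by (rule P0_form[OF p])
  have "z \<in> curve (pull \<alpha> v)" unfolding v(2) curve_def ell_vertical using z by simp
  then have "act2 \<alpha> z \<in> curve v" using curve_pull[OF SV[OF v(1)] aG z(1)] by simp
  then show ?thesis by (rule that[OF v])
qed

end

section \<open>The equation at a cusp and its order\<close>

context cusp_data
begin

text \<open>Up to sign, \<open>v\<close> is the only form through the point, so a single class in
  \<open>Rp\<close> and a single index k are responsible for the zero. That factor is a unit times
  \<open>Lf p\<close> near the point, the other factors do not vanish, and the even exponent hides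
  whether \<open>v\<close> or \<open>- v\<close> has the positive slope.\<close>

lemma cusp_order:
  assumes SHF: "S = HF m" and z: "z \<in> HB (real m)" and v: "v \<in> HF m" "act2 \<alpha> z \<in> curve v"
    and only: "\<forall>u\<in>HF m. act2 \<alpha> z \<in> curve u \<longrightarrow> u = v \<or> u = - v"
  shows "\<exists>K. holomorphic2_on K H2 \<and> K z \<noteq> 0 \<and>
    (\<forall>y\<in>H2. Ps y ^ (2 * nn * q) = K y ^ (2 * nn * q) * ell v (act2 \<alpha> y) ^ (2 * nn * q))"
proof -
  let ?n = "2 * nn * q"
  have zH: "z \<in> H2" using z HB_H2 by blast
  have vS: "v \<in> S" using v SHF by simp
  obtain p where p: "p \<in> P0" "Lf p z = 0" and pv: "pull \<alpha> v = (0, fst p, snd p) \<or> pull \<alpha> (- v) = (0, fst p, snd p)"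
    by (rule P0_of_curve[OF vS z v(2)])
  obtain v' where v': "v' = v \<or> v' = - v" "pull \<alpha> v' = (0, fst p, snd p)" using pv by blast
  have v'S: "v' \<in> S" using v'(1) vS SD(2)[OF vS] by auto
  have pow: "ell v' y ^ ?n = ell v y ^ ?n" for y
    using v'(1)
  proof
    assume "v' = - v"
    then have "ell v' y = - ell v y" using ell_uminus[OF SV[OF vS]] by simp
    then show ?thesis by (simp add: mult.assoc power_minus_even power_mult)
  qed simp
  have uniq: "p' = p" if p': "p' \<in> P0" "Lf p' z = 0" for p'
  proof -
    obtain v'' where v'': "v'' \<in> S" "pull \<alpha> v'' = (0, fst p', snd p')" "act2 \<alpha> z \<in> curve v''"
      by (rule curve_of_P0[OF p'(1) zH p'(2)])
    have "v'' \<in> HF m" using v''(1) SHF by simp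
    from mp[OF bspec[OF only this] v''(3)] have "v'' = v' \<or> v'' = - v'" using v'(1) by auto
    then show ?thesis
    proof
      assume "v'' = v'"
      then have "(0, fst p', snd p') = (0::real, fst p, snd p)" using v''(2) v'(2) by (simp only:)
      then show ?thesis by (simp add: prod_eq_iff)
    next
      assume "v'' = - v'"
      then have "(0, fst p', snd p') = - (0::real, fst p, snd p)"
        using v''(2) pull_uminus[OF SV[OF v'S], of \<alpha>] v'(2) by (simp only:)
      then have "fst (snd (0::real, fst p', snd p')) = fst (snd (- (0::real, fst p, snd p)))" by (rule arg_cong)
      then have "fst p' = - fst p" by (simp only: fst_conv snd_conv uminus_Pair)
      then show ?thesis using P0D(1)[OF p(1)] P0D(1)[OF p'(1)] by simp
    qed
  qed
  obtain p0 k i where p0: "p0 \<in> Rp" "fst p = fst p0 * \<epsilon>\<^sup>2 powi k" "snd p = snd p0 + of_int i * ss" by (rule P0_rep[OF p(1)])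
  have r0: "1 \<le> fst p0" "fst p0 < \<epsilon>\<^sup>2" "0 \<le> snd p0" "snd p0 < ss" using p0(1) by (simp_all add: Rp_def)
  note P = Rp_P0[OF p0(1)]
  have pe: "(fst p0 * \<epsilon>\<^sup>2 powi k, snd p0 + of_int (- (- i)) * ss) = p" using p0(2,3) by (simp add: prod_eq_iff)
  have inP: "(fst p1 * \<epsilon>\<^sup>2 powi k, snd p1 + of_int j * ss) \<in> P0" if "p1 \<in> P0" for p1 k j
    using P0_shift[OF P0_scale[OF that, of k], of j] by (simp only: fst_conv snd_conv)
  note c = cf[OF P]
  let ?lin = "cusp_factor.lin (fst p0) (cj (fst p0)) (\<epsilon>\<^sup>2)"
  have L0: "?lin k y + of_real (snd p0) - of_real ss * of_int (- i) = Lf p y" for y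
    using lin_eq[OF P, of k y "- i"] unfolding pe .
  have zero: "?lin k z + of_real (snd p0) = of_real ss * of_int (- i)" using L0[of z] unfolding p(2) by (simp only: right_minus_eq)
  have only': "k' = k" if l: "?lin k' z + of_real (snd p0) = of_real ss * of_int i'" for k' i'
  proof -
    have "Lf (fst p0 * \<epsilon>\<^sup>2 powi k', snd p0 + of_int (- i') * ss) z = 0" using lin_eq[OF P, of k' z i'] unfolding l by simp
    from arg_cong[OF uniq[OF inP[OF P] this], of fst] have "fst p0 * \<epsilon>\<^sup>2 powi k' = fst p0 * \<epsilon>\<^sup>2 powi k"
      unfolding p0(2) by (simp only: fst_conv)
    then show ?thesis by (rule scale_unique[OF ee1 r0(1,2) r0(1,2)])
  qed
  have "\<exists>h. holomorphic2_on h H2 \<and> h z \<noteq> 0 \<and> (\<forall>y\<in>H2. fp p0 y = h y * Lf p y)"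
  proof (rule cusp_factor.ff_simple_zero[OF c zH zero])
    fix k' i' assume "?lin k' z + of_real (snd p0) = of_real ss * of_int i'"
    then show "k' = k" by (rule only')
  next
    fix h assume h: "holomorphic2_on h H2" "h z \<noteq> 0"
      "\<And>w. w \<in> H2 \<Longrightarrow> cusp_factor.ff (fst p0) (cj (fst p0)) (\<epsilon>\<^sup>2) ss (snd p0) w =
         h w * (?lin k w + of_real (snd p0) - of_real ss * of_int (- i))"
    show ?thesis
    proof (intro exI[of _ h] conjI ballI h(1,2))
      fix y :: "complex \<times> complex" assume y: "y \<in> H2"
      show "fp p0 y = h y * Lf p y" unfolding fp_def h(3)[OF y] L0 ..
    qed
  qed
  then obtain h where h: "holomorphic2_on h H2" "h z \<noteq> 0" "\<forall>y\<in>H2. fp p0 y = h y * Lf p y" by (elim exE conjE)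
  \<comment> \<open>A zero of another factor would lead to the same pair \<open>p\<close>, and two
    points of the fundamental domain \<open>Rp\<close> in one class coincide.\<close>
  have other: "fp p1 z \<noteq> 0" if p1: "p1 \<in> Rp" "p1 \<noteq> p0" for p1
  proof
    assume "fp p1 z = 0"
    then obtain k' i' where L: "Lf (fst p1 * \<epsilon>\<^sup>2 powi k', snd p1 + of_int (- i') * ss) z = 0"
      unfolding fp_zero[OF Rp_P0[OF p1(1)] zH] by (elim exE)
    have r1: "1 \<le> fst p1" "fst p1 < \<epsilon>\<^sup>2" "0 \<le> snd p1" "snd p1 < ss" using p1(1) by (simp_all add: Rp_def)
    have e: "(fst p1 * \<epsilon>\<^sup>2 powi k', snd p1 + of_int (- i') * ss) = p" by (rule uniq[OF inP[OF Rp_P0[OF p1(1)]] L])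
    have e1: "fst p1 * \<epsilon>\<^sup>2 powi k' = fst p0 * \<epsilon>\<^sup>2 powi k" using arg_cong[OF e, of fst] unfolding p0(2) by (simp only: fst_conv)
    have e2: "snd p1 + of_int (- i') * ss = snd p0 + of_int i * ss" using arg_cong[OF e, of snd] unfolding p0(3) by (simp only: snd_conv)
    have "k' = k" by (rule scale_unique[OF ee1 r1(1,2) r0(1,2) e1])
    then have f: "fst p1 = fst p0" using e1 ee0 by simp
    have d: "snd p1 - snd p0 = of_int (i + i') * ss" using e2 by (simp add: algebra_simps)
    have "\<bar>snd p1 - snd p0\<bar> < ss" using r0 r1 by linarith
    then have "\<bar>of_int (i + i')\<bar> * ss < 1 * ss" unfolding d abs_mult using ss0 by simp
    then have "\<bar>of_int (i + i') :: real\<bar> < 1" using ss0 by (simp only: mult_less_cancel_right_pos)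
    then have "i + i' = 0" by linarith
    then have "snd p1 = snd p0" using d by simp
    then show False using f p1(2) by (simp add: prod_eq_iff)
  qed
  define K where "K y = h y * (\<Prod>p\<in>Rp - {p0}. fp p y) * (aut \<alpha> (fst y) * aut (cjm \<alpha>) (snd y))" for y
  show ?thesis
  proof (intro exI[of _ K] conjI ballI)
    show "holomorphic2_on K H2" unfolding K_def
      by (intro holomorphic2_on_mult holomorphic2_on_prod h(1) holomorphic2_fp Rp_P0 holomorphic2_aut) simp
    have "(\<Prod>p\<in>Rp - {p0}. fp p z) \<noteq> 0" using other finite_Rp by simp
    then show "K z \<noteq> 0" unfolding K_def using h(2) aut_nz[OF aG zH] by simp
    fix y :: "complex \<times> complex" assume y: "y \<in> H2"
    have "ell (pull \<alpha> v') y = Lf p y" unfolding v'(2) ell_vertical by simp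
    then have L: "Lf p y = ell v' (act2 \<alpha> y) * aut \<alpha> (fst y) * aut (cjm \<alpha>) (snd y)"
      using ell_pull[OF SV[OF v'S] aG y] by simp
    have "Ps y = fp p0 y * (\<Prod>p\<in>Rp - {p0}. fp p y)" unfolding Ps_def by (rule prod.remove[OF finite_Rp p0(1)])
    also have "\<dots> = K y * ell v' (act2 \<alpha> y)" unfolding K_def bspec[OF h(3) y] L by (simp only: mult_ac)
    finally show "Ps y ^ ?n = K y ^ ?n * ell v (act2 \<alpha> y) ^ ?n" by (simp only: power_mult_distrib pow)
  qed
qed

lemma cusp_section:
  "\<exists>f\<in>Ox (cusp_nbhd \<alpha> (real m)). zero_on S (act2 \<alpha> ` HB (real m)) f \<and>
     (S = HF m \<longrightarrow> order_on (2 * nn * q) m (act2 \<alpha> ` HB (real m)) f)"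
proof -
  let ?n = "2 * nn * q"
  define W where "W = act2 \<alpha> ` HB (real m)"
  define \<phi> where "\<phi> w = Ps (act2 (inv2 \<alpha>) w) ^ ?n" for w
  define f where "f = push W \<phi> cv"
  have C: "real m \<ge> 1" "real m > 0" using m by simp_all
  have iG: "inv2 \<alpha> \<in> G" by (rule inv2_G[OF aG])
  have oW: "open W" unfolding W_def by (intro open_act2_image aG open_HB HB_H2)
  have WH: "W \<subseteq> H2" unfolding W_def by (intro act2_image_H2 aG HB_H2)
  have \<phi>\<alpha>: "\<phi> (act2 \<alpha> z) = Ps z ^ ?n" if "z \<in> H2" for z
    unfolding \<phi>_def act2_inv2(1)[OF aG that] ..
  have iH: "act2 (inv2 \<alpha>) w \<in> H2" if "w \<in> W" for w by (rule act2_H2[OF iG subsetD[OF WH that]])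
  have Wz: "\<exists>z. z \<in> HB (real m) \<and> z \<in> H2 \<and> w = act2 \<alpha> z" if "w \<in> W" for w
    using that HB_H2 unfolding W_def by blast
  have hol: "holomorphic2_on \<phi> W" unfolding \<phi>_def
    by (intro holomorphic2_on_power holomorphic2_comp_act2[OF iG WH holomorphic2_Ps] iH)
  have inv: "\<Gamma>_inv_on W \<phi>" unfolding \<Gamma>_inv_on_def
  proof (intro ballI impI)
    fix A w assume A: "A \<in> \<Gamma>" and w: "w \<in> W" "act2 A w \<in> W"
    obtain z where z: "z \<in> HB (real m)" "z \<in> H2" "w = act2 \<alpha> z" using Wz[OF w(1)] by (elim exE conjE)
    obtain z' where z': "z' \<in> HB (real m)" "z' \<in> H2" "act2 A w = act2 \<alpha> z'" using Wz[OF w(2)] by (elim exE conjE)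
    have "act2 (inv2 \<alpha> ** A ** \<alpha>) z = act2 (inv2 \<alpha> ** A) (act2 \<alpha> z)"
      by (rule act2_mult[OF SL2_mult[OF iG \<Gamma>_G[OF A]] aG z(2)])
    also have "\<dots> = act2 (inv2 \<alpha>) (act2 A (act2 \<alpha> z))" by (rule act2_mult[OF iG \<Gamma>_G[OF A] act2_H2[OF aG z(2)]])
    also have "act2 A (act2 \<alpha> z) = act2 \<alpha> z'" using z'(3) unfolding z(3) .
    also have "act2 (inv2 \<alpha>) (act2 \<alpha> z') = z'" by (rule act2_inv2(1)[OF aG z'(2)])
    finally have e: "act2 (inv2 \<alpha> ** A ** \<alpha>) z = z'" .
    have "Ps z' ^ ?n = Ps z ^ ?n" using Ps_\<Gamma>_invariant[OF A z(1) _ C(1)] z'(1) unfolding e by simp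
    moreover have "\<phi> (act2 A w) = Ps z' ^ ?n" unfolding z'(3) by (rule \<phi>\<alpha>[OF z'(2)])
    moreover have "\<phi> w = Ps z ^ ?n" unfolding z(3) by (rule \<phi>\<alpha>[OF z(2)])
    ultimately show "\<phi> (act2 A w) = \<phi> w" by (simp only:)
  qed
  have sh: "f \<in> Ox (cusp_nbhd \<alpha> (real m))" unfolding f_def
  proof (rule push_sheaf_cusp[OF aG C(2) W_def hol inv])
    fix d :: real assume d: "d > 0"
    obtain C' where C': "real m \<le> C'" "\<forall>z\<in>HB C'. cmod (Ps z ^ ?n - cv) < d" using Ps_limit[OF d] by (elim exE conjE)
    have "cmod (\<phi> (act2 \<alpha> z) - cv) < d" if "z \<in> HB C'" for z
      unfolding \<phi>\<alpha>[OF subsetD[OF HB_H2 that]] by (rule bspec[OF C'(2) that])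
    then show "\<exists>C'\<ge>real m. \<forall>z\<in>HB C'. cmod (\<phi> (act2 \<alpha> z) - cv) < d" using C'(1) by (intro exI[of _ C'] conjI ballI)
  qed
  have f\<phi>: "f (qpt w) = \<phi> w" if "w \<in> W" for w unfolding f_def by (rule push_qpt[OF WH inv that])
  have n0: "?n > 0" using nn0 q by simp
  have zero: "zero_on S W f" unfolding zero_on_def
  proof
    fix w assume w: "w \<in> W"
    obtain z where z: "z \<in> HB (real m)" "z \<in> H2" "w = act2 \<alpha> z" using Wz[OF w] by (elim exE conjE)
    have "f (qpt w) = Ps z ^ ?n" unfolding f\<phi>[OF w] unfolding z(3) by (rule \<phi>\<alpha>[OF z(2)])
    then have "f (qpt w) = 0 \<longleftrightarrow> Ps z = 0" using n0 by (simp only: power_eq_0_iff simp_thms)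
    also have "\<dots> \<longleftrightarrow> (\<exists>p\<in>P0. Lf p z = 0)" by (rule Ps_zero[OF z(2)])
    also have "\<dots> \<longleftrightarrow> (\<exists>v\<in>S. w \<in> curve v)"
    proof
      assume "\<exists>p\<in>P0. Lf p z = 0"
      then obtain p where p: "p \<in> P0" "Lf p z = 0" by (elim bexE)
      obtain v where v: "v \<in> S" "act2 \<alpha> z \<in> curve v" by (rule curve_of_P0[OF p(1) z(2) p(2)])
      show "\<exists>v\<in>S. w \<in> curve v" unfolding z(3) using v(2,1) by (rule bexI)
    next
      assume "\<exists>v\<in>S. w \<in> curve v"
      then obtain v where v: "v \<in> S" "w \<in> curve v" by (elim bexE)
      obtain p where p: "p \<in> P0" "Lf p z = 0" by (rule P0_of_curve[OF v(1) z(1) v(2)[unfolded z(3)]])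
      show "\<exists>p\<in>P0. Lf p z = 0" using p(2,1) by (rule bexI)
    qed
    finally show "f (qpt w) = 0 \<longleftrightarrow> (\<exists>v\<in>S. w \<in> curve v)" .
  qed
  have order: "order_on ?n m W f" if SHF: "S = HF m"
  proof (rule order_onI[where \<phi> = \<phi>, OF oW])
    show "f (qpt w) = \<phi> w" if "w \<in> W" for w by (rule f\<phi>[OF that])
  next
    fix w v assume w: "w \<in> W" and v: "v \<in> HF m" "w \<in> curve v" and only: "\<forall>u\<in>HF m. w \<in> curve u \<longrightarrow> u = v \<or> u = - v"
    obtain z where z: "z \<in> HB (real m)" "z \<in> H2" "w = act2 \<alpha> z" using Wz[OF w] by (elim exE conjE)
    obtain K where K: "holomorphic2_on K H2" "K z \<noteq> 0"
      "\<forall>y\<in>H2. Ps y ^ ?n = K y ^ ?n * ell v (act2 \<alpha> y) ^ ?n"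
      using cusp_order[OF SHF z(1) v(1) v(2)[unfolded z(3)] only[unfolded z(3)]] by (elim exE conjE)
    show "\<exists>W' h. open W' \<and> w \<in> W' \<and> W' \<subseteq> W \<and> holomorphic2_on h W' \<and> h w \<noteq> 0 \<and> (\<forall>w\<in>W'. \<phi> w = h w * ell v w ^ ?n)"
    proof (intro exI[of _ W] exI[of _ "\<lambda>w. K (act2 (inv2 \<alpha>) w) ^ ?n"] conjI ballI oW w order_refl)
      show "holomorphic2_on (\<lambda>w. K (act2 (inv2 \<alpha>) w) ^ ?n) W"
        by (intro holomorphic2_on_power holomorphic2_comp_act2[OF iG WH K(1)] iH)
      have "act2 (inv2 \<alpha>) w = z" unfolding z(3) by (rule act2_inv2(1)[OF aG z(2)])
      then show "K (act2 (inv2 \<alpha>) w) ^ ?n \<noteq> 0" using K(2) by (simp only: power_eq_0_iff simp_thms not_False_eq_True)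
      fix y assume y: "y \<in> W"
      show "\<phi> y = K (act2 (inv2 \<alpha>) y) ^ ?n * ell v y ^ ?n"
        using bspec[OF K(3) iH[OF y]] unfolding \<phi>_def act2_inv2(2)[OF aG subsetD[OF WH y]] .
    qed
  qed
  show ?thesis using sh zero order unfolding W_def by (intro bexI[of _ f] conjI impI)
qed

end

section \<open>Local data at every point with a common exponent\<close>

context quadratic
begin

text \<open>Translation by \<mu> = -g D x' is integral because g rD x is, and it shifts the offset
  by the trace of x \<mu>, which is -2 g D N(x) = 2 g m. As this comes from an element of \<Gamma>,
  every \<Gamma>-closed set of forms is periodic at the cusp, whichever orbits it contains.\<close>

lemma frame_translate:
  assumes fr: "cusp_frame \<alpha> g" and v: "v \<in> HF m" and p: "pull \<alpha> v = (0, x, b)"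
  shows "\<exists>\<gamma>\<in>\<Gamma>. pull \<alpha> (pull \<gamma> v) = (0, x, b + 2 * of_int g * real m)"
proof -
  have \<alpha>: "\<alpha> \<in> G" using fr by (simp add: cusp_frame_def)
  have vL: "v \<in> LL" using v by (simp add: HF_def)
  note vV = LL_VF[OF vL]
  have "pull \<alpha> v \<in> VF" by (rule pull_VF[OF vV \<alpha>])
  then have xF: "x \<in> F" unfolding p by (simp add: VF_def)
  have "nrm (pull \<alpha> v) = real m / of_int D" using nrm_pull[OF vV \<alpha>] HF_nrm[OF v] by simp
  then have n: "x * cj x = - (real m / of_int D)" unfolding p nrm_def by simp
  have rF: "rD \<in> F" using rD_R unfolding R_iff by blast
  have "cj ((of_int g * rD) * x) \<in> R" by (rule R_cj[OF frame_pull_LL(3)[OF fr vL p]])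
  then have "rD * cj ((of_int g * rD) * x) \<in> R" by (rule R_mult[OF rD_R])
  moreover have "rD * cj ((of_int g * rD) * x) = - (of_int g * of_int D * cj x)"
    using xF rF by (simp add: rD_sq[symmetric])
  ultimately have \<mu>R: "- (of_int g * of_int D * cj x) \<in> R" by simp
  define \<mu> where "\<mu> = - (of_int g * of_int D * cj x)"
  have D0: "(of_int D :: real) \<noteq> 0" using D_ge_1 by linarith
  have \<mu>F: "\<mu> \<in> F" "cj \<mu> = - (of_int g * of_int D * x)" using xF by (simp_all add: \<mu>_def)
  have t: "x * \<mu> = of_int g * real m" "cj x * cj \<mu> = of_int g * real m"
  proof -
    have "x * \<mu> = - (of_int g * of_int D * (x * cj x))" "cj x * cj \<mu> = - (of_int g * of_int D * (x * cj x))"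
      unfolding \<mu>F(2) by (simp_all add: \<mu>_def)
    then show "x * \<mu> = of_int g * real m" "cj x * cj \<mu> = of_int g * real m" unfolding n using D0 by simp_all
  qed
  define T where "T = mk2 1 \<mu> 0 1"
  have T: "T \<in> G" unfolding SL2_iff T_def using \<mu>F by simp
  define \<gamma> where "\<gamma> = \<alpha> ** T ** inv2 \<alpha>"
  have \<gamma>: "\<gamma> \<in> \<Gamma>" unfolding \<gamma>_def T_def by (rule frame_translation[OF fr \<mu>R[folded \<mu>_def]])
  have "\<gamma> ** \<alpha> = \<alpha> ** T" unfolding \<gamma>_def using inv2_left[OF \<alpha>] by (simp add: matrix_mul_assoc[symmetric])
  then have "pull \<alpha> (pull \<gamma> v) = pull T (pull \<alpha> v)"
    using pull_mult[OF vV \<Gamma>_G[OF \<gamma>] \<alpha>] pull_mult[OF vV \<alpha> T] by simp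
  also have "\<dots> = (0, x, b + (x * \<mu> + cj x * cj \<mu>))" unfolding p unfolding pull_def T_def mk2_nth prod.case cj_0 cj_1 by simp
  also have "\<dots> = (0, x, b + 2 * of_int g * real m)" unfolding t by simp
  finally show ?thesis using \<gamma> by (rule_tac bexI)
qed

lemma local_data_cusp:
  assumes m: "m > 0" and n: "n > 0" "2 * nn dvd n" and ac: "a \<in> F" "c \<in> F" "a \<noteq> 0 \<or> c \<noteq> 0"
    and \<epsilon>: "unitR \<epsilon>" "\<epsilon> > 1" "\<forall>u. unitR u \<longrightarrow> (\<exists>k. u = \<epsilon> powi k \<or> u = - (\<epsilon> powi k))"
    and nn: "real nn = \<epsilon>\<^sup>2 + 1 / \<epsilon>\<^sup>2 - 2"
  shows "local_data m n (proj F (cu a c))"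
proof -
  obtain \<alpha> g where fr: "cusp_frame \<alpha> g" and act: "act F \<alpha> CuspInf = cu a c" by (rule ex_cusp_frame[OF ac])
  have aG: "\<alpha> \<in> G" and g0: "g > 0" using fr by (simp_all add: cusp_frame_def)
  define U where "U = cusp_nbhd \<alpha> (real m)"
  define W where "W = act2 \<alpha> ` HB (real m)"
  have U: "U = insert (proj F (cu a c)) (qpt ` W)" unfolding U_def W_def cusp_nbhd_def act ..
  have WH: "W \<subseteq> H2" unfolding W_def by (intro act2_image_H2 aG HB_H2)
  have ch: "chart U W" unfolding chart_def
  proof (intro conjI ballI impI)
    show "openin X U" unfolding U_def using m by (intro openin_cusp_nbhd aG) simp
    show "open W" unfolding W_def by (intro open_act2_image aG open_HB HB_H2)
    show "qpt ` W \<subseteq> U" "\<exists>k. U - qpt ` W \<subseteq> {k}" unfolding U by blast+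
    show "qpt z \<in> qpt ` W" if "z \<in> H2" "qpt z \<in> U" for z
      using that(2) qpt_ne_cusp[OF ac that(1)] unfolding U by (simp only: insert_iff simp_thms)
  qed (rule WH)
  have zero: "\<exists>f\<in>Ox U. zero_on S W f" if S: "\<Gamma>_closed m S" for S
  proof -
    have SHF: "S \<subseteq> HF m" and Sp: "\<forall>v\<in>S. \<forall>A\<in>\<Gamma>. pull A v \<in> S" using S unfolding \<Gamma>_closed_def by blast+
    \<comment> \<open>The period 2 g m from \<open>frame_translate\<close> is q/g with q = 2 g^2 m.
      This q depends on the cusp, which does no harm as only the zero set is wanted here.\<close>
    have "cusp_data F m \<alpha> g S \<epsilon> (2 * nat g * nat g * m) nn"
    proof (unfold_locales)
      show "0 < m" "cusp_frame \<alpha> g" "\<Gamma>_closed m S" "unitR \<epsilon>" "1 < \<epsilon>"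
        "\<forall>u. unitR u \<longrightarrow> (\<exists>k. u = \<epsilon> powi k \<or> u = - (\<epsilon> powi k))" "real nn = \<epsilon>\<^sup>2 + 1 / \<epsilon>\<^sup>2 - 2"
        by (fact m fr S \<epsilon> nn)+
      show "0 < 2 * nat g * nat g * m" using g0 m by simp
      fix v x b assume v: "v \<in> S" and p: "pull \<alpha> v = (0, x, b)"
      obtain \<gamma> where \<gamma>: "\<gamma> \<in> \<Gamma>" "pull \<alpha> (pull \<gamma> v) = (0, x, b + 2 * of_int g * real m)"
        using frame_translate[OF fr subsetD[OF SHF v] p] by (elim bexE)
      have "real (2 * nat g * nat g * m) / of_int g = 2 * of_int g * real m" using g0 by simp
      with \<gamma>(2) have "pull \<alpha> (pull \<gamma> v) = (0, x, b + real (2 * nat g * nat g * m) / of_int g)" by (simp only:)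
      then show "\<exists>w\<in>S. pull \<alpha> w = (0, x, b + real (2 * nat g * nat g * m) / of_int g)"
        using bspec[OF bspec[OF Sp v] \<gamma>(1)] by (rule bexI)
    qed
    from cusp_data.cusp_section[OF this] show ?thesis unfolding U_def[symmetric] W_def[symmetric] by blast
  qed
  have HFc: "\<Gamma>_closed m (HF m)" using HF_uminus pull_HF by (simp add: \<Gamma>_closed_def)
  \<comment> \<open>All forms together have the finer period 1/g by \<open>frame_full\<close>. So q
    = 1 is possible, and the exponent 2 nn is the same at every cusp.\<close>
  have cd: "cusp_data F m \<alpha> g (HF m) \<epsilon> 1 nn"
  proof (unfold_locales)
    show "0 < m" "cusp_frame \<alpha> g" "\<Gamma>_closed m (HF m)" "unitR \<epsilon>" "1 < \<epsilon>"
      "\<forall>u. unitR u \<longrightarrow> (\<exists>k. u = \<epsilon> powi k \<or> u = - (\<epsilon> powi k))" "real nn = \<epsilon>\<^sup>2 + 1 / \<epsilon>\<^sup>2 - 2" "0 < (1::nat)"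
      by (fact m fr HFc \<epsilon> nn zero_less_one)+
    fix v x b assume "v \<in> HF m" "pull \<alpha> v = (0, x, b)"
    from frame_full[OF fr this] show "\<exists>w\<in>HF m. pull \<alpha> w = (0, x, b + real 1 / of_int g)" by simp
  qed
  obtain f where f0: "f \<in> Ox U" "zero_on (HF m) W f \<and> (HF m = HF m \<longrightarrow> order_on (2 * nn * 1) m W f)"
    using cusp_data.cusp_section[OF cd] unfolding U_def[symmetric] W_def[symmetric] by (elim bexE)
  then have f: "f \<in> Ox U" "zero_on (HF m) W f" "order_on (2 * nn) m W f" by simp_all
  obtain k where k: "n = 2 * nn * k" using n(2) by (elim dvdE)
  then have "k > 0" using n(1) by (metis gr0I mult_0_right)
  then have "(\<lambda>x. f x ^ k) \<in> Ox U" "zero_on (HF m) W (\<lambda>x. f x ^ k)" "order_on n m W (\<lambda>x. f x ^ k)"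
    using sheaf_power[OF f(1)] zero_on_power[OF _ f(2)] order_on_power[OF f(3), of k] k by simp_all
  then have "\<exists>f\<in>Ox U. zero_on (HF m) W f \<and> order_on n m W f" by (intro bexI conjI)
  moreover have "proj F (cu a c) \<in> U" unfolding U by (rule insertI1)
  ultimately show ?thesis unfolding local_data_def using ch zero by (intro exI[of _ U] exI[of _ W] conjI) simp_all
qed

lemma ex_local_data:
  assumes m: "m > 0"
  shows "\<exists>n>0. \<forall>x\<in>topspace X. local_data m n x"
proof -
  obtain \<epsilon> where \<epsilon>: "unitR \<epsilon>" "\<epsilon> > 1" "\<forall>u. unitR u \<longrightarrow> (\<exists>k. u = \<epsilon> powi k \<or> u = - (\<epsilon> powi k))" by (rule fundamental_unit)
  have eR: "\<epsilon> \<in> R" "\<epsilon> \<in> F" using \<epsilon>(1) by (simp_all add: unitR_def)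
  have "(\<epsilon> * cj \<epsilon>) * (\<epsilon> * cj \<epsilon>) = 1" using unitR_norm[OF \<epsilon>(1)] by (metis abs_mult_self_eq mult_1)
  then have "cj (\<epsilon>\<^sup>2) * \<epsilon>\<^sup>2 = 1" using eR by (simp add: power2_eq_square mult_ac)
  then have "cj (\<epsilon>\<^sup>2) = 1 / \<epsilon>\<^sup>2" using \<epsilon>(2) by (simp add: field_simps)
  moreover have "\<epsilon> * \<epsilon> \<in> R" by (rule R_mult[OF eR(1) eR(1)])
  then have "\<epsilon>\<^sup>2 + cj (\<epsilon>\<^sup>2) \<in> \<int>" unfolding R_iff by (simp only: power2_eq_square simp_thms)
  ultimately obtain t where t: "\<epsilon>\<^sup>2 + 1 / \<epsilon>\<^sup>2 = of_int t" by (metis Ints_cases)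
  have "\<epsilon>\<^sup>2 + 1 / \<epsilon>\<^sup>2 - 2 = (\<epsilon> - 1 / \<epsilon>)\<^sup>2" using \<epsilon>(2) by (simp add: power2_diff power_divide)
  moreover have "\<epsilon> - 1 / \<epsilon> > 0"
  proof -
    have "1 / \<epsilon> < 1" using \<epsilon>(2) by simp
    then show ?thesis using \<epsilon>(2) by linarith
  qed
  ultimately have "of_int t - 2 > (0::real)" unfolding t by simp
  then have t0: "t - 2 > 0" by linarith
  define nn where "nn = nat (t - 2)"
  have nn0: "nn > 0" using t0 by (simp add: nn_def)
  have nn: "real nn = \<epsilon>\<^sup>2 + 1 / \<epsilon>\<^sup>2 - 2" unfolding t nn_def using t0 by simp
  \<comment> \<open>Divisible by 2 nn for the cusps and, through the factorial, by twice the order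
    of every stabilizer, since these orders are at most \<open>stab_bound\<close>.\<close>
  define n where "n = 2 * nn * fact stab_bound"
  have n0: "n > 0" unfolding n_def using nn0 by simp
  show ?thesis
  proof (intro exI[of _ n] conjI ballI n0)
    fix x assume "x \<in> topspace X"
    then show "local_data m n x"
    proof (cases rule: X_cases)
      case (1 z)
      have "card (stab z) dvd fact stab_bound" using card_stab[OF 1(1)] by (intro dvd_fact) auto
      then have "2 * card (stab z) dvd 2 * fact stab_bound" by (rule mult_dvd_mono[OF dvd_refl])
      moreover have "2 * fact stab_bound dvd n" unfolding n_def by simp
      ultimately have "2 * card (stab z) dvd n" by (rule dvd_trans)
      then show ?thesis unfolding 1(2) by (rule local_data_interior[OF m n0 1(1)])
    next
      case (2 a c)
      have "2 * nn dvd n" unfolding n_def by simp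
      then show ?thesis unfolding 2(4) by (rule local_data_cusp[OF m n0 _ 2(1-3) \<epsilon> nn])
    qed
  qed
qed

end

theorem theorem3p9:
  fixes F :: "real set" and m :: nat
  assumes "real_quadratic_field F" and "m > 0"
  shows "Q_Cartier (BB_topology F) (BB_sheaf F) (HZ_divisor F m)"
proof -
  interpret quadratic F by unfold_locales (rule assms(1))
  obtain n where n: "n > 0" "\<forall>x\<in>topspace X. local_data m n x"
    using ex_local_data[OF assms(2)] by (elim exE conjE)
  show ?thesis by (rule Q_Cartier_of_local_data[OF assms(2) n(1)]) (rule bspec[OF n(2)])
qed

end
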